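(* Let $\lambda$ be a regular cardinal. (1) ($3^{rd}$ invariance theorem) Let $A,B$ be two cofibrant objects of a weak model category $\mathcal{M}$ and $f:A\to B$ a weak equivalence. Then the map $f^*:\mathbb{L}^{\mathcal{M}}_\lambda(A)\to\mathbb{L}^{\mathcal{M}}_\lambda(B)$ induces a bijection $h\mathbb{L}^{\mathcal{M}}_\lambda(A)\simeq h\mathbb{L}^{\mathcal{M}}_\lambda(B)$. (2) ($4^{th}$ invariance theorem) Let $F:\mathcal{M}\to\mathcal{N}$ be a left Quillen equivalence between two weak model categories. Then for every cofibrant object $A\in\mathcal{M}$ the induced map $h\mathbb{L}F_A:h\mathbb{L}^{\mathcal{M}}_\lambda(A)\to h\mathbb{L}^{\mathcal{N}}_\lambda(FA)$ is an isomorphism.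
   Context: **Weak model categories.** A weak model category is a category $\mathcal{M}$ with three classes of maps, cofibrations, fibrations and weak equivalences, such that (an object $X$ is cofibrant if $0\to X$ is a cofibration, fibrant if $X\to1$ is a fibration; a trivial (co)fibration is a (co)fibration that is a weak equivalence): (i) there are an initial object $0$ and a terminal object $1$, $\mathrm{id}_0$ is a cofibration and $\mathrm{id}_1$ a fibration; (ii) composites of cofibrations with cofibrant domain are cofibrations, composites of fibrations with fibrant codomain are fibrations; (iii) weak equivalences satisfy 2-out-of-3 for composable pairs between objects each of which is fibrant or cofibrant; (iv) isomorphisms between objects that are fibrant or cofibrant are weak equivalences; (v) the pushout of a cofibration $A\to C$ along a map $A\to B$ with $A,B$ cofibrant exists and $B\to B\sqcup_A C$ is a cofibration; (vi) dually for pullbacks of fibrations along maps between fibrant objects; (vii) the three classes are closed under isomorphism of arrows; (viii) every map from a cofibrant to a fibrant object factors as a cofibration followed by a trivial fibration, and also as a trivial cofibration followed by a fibration; (ix) a cofibration between cofibrant objects has the left lifting property against a fibration between fibrant objects as soon as one of the two is a weak equivalence. The homotopy category $\mathrm{Ho}(\mathcal{M})$ is the localization at weak equivalences of the full subcategory of objects that are fibrant or cofibrant; it is equivalent to the localizations of the full subcategories of cofibrant, of fibrant, and of bifibrant objects. A Quillen adjunction between weak model categories is an adjunction $F\dashv G$ with $F$ preserving cofibrations and $G$ preserving fibrations; $F$ is a left Quillen equivalence if the induced adjunction of homotopy categories is an equivalence. **The language.** Let $\mathcal{M}^{cof}$ be the full subcategory of cofibrant objects. A $\lambda$-boolean algebra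 is a boolean algebra with joins of $\lambda$-small families; $\mathbf{Bool}_\lambda$ is the category of these, with boolean algebra morphisms preserving $\lambda$-small joins. A $\lambda$-boolean algebra over $\mathcal{M}^{cof}$ is a functor $\mathcal{B}:\mathcal{M}^{cof}\to\mathbf{Bool}_\lambda$ (write $f^*:\mathcal{B}(A)\to\mathcal{B}(B)$ for the action of $f:A\to B$) such that for every cofibration $i:A\to B$ between cofibrant objects $i^*$ has a left adjoint $\exists_i:\mathcal{B}(B)\to\mathcal{B}(A)$, and for every pushout of $i$ along $f:A\to A'$, with resulting maps $i':A'\to B'$ and $f':B\to B'$, one has $f^*\exists_i=\exists_{i'}f'^*$. Morphisms are natural transformations commuting with all $\exists_i$. $\mathbb{L}^{\mathcal{M}}_\lambda$ denotes the initial $\lambda$-boolean algebra over $\mathcal{M}^{cof}$ (formed in a larger universe if $\mathcal{M}^{cof}$ is large). **Validity.** For $X\in\mathcal{M}$, $c\mapsto\mathcal{P}(\mathrm{Hom}(c,X))$, with $g^*(S)=\{v:d\to X\mid vg\in S\}$ for $g:c\to d$ and $\exists_i(S)=\{vi\mid v\in S\}$, is a $\lambda$-boolean algebra over $\mathcal{M}^{cof}$. Let $|\cdot|_X:\mathbb{L}^{\mathcal{M}}_\lambda\to\mathcal{P}(\mathrm{Hom}(-,X))$ be the unique morphism. **Semantic equivalence.** For $A$ cofibrant, $\phi,\psi\in\mathbb{L}^{\mathcal{M}}_\lambda(A)$ are semantically equivalent, $\phi\approx\psi$, if $|\phi|_X=|\psi|_X$ for all fibrant $X\in\mathcal{M}$.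 $h\mathbb{L}^{\mathcal{M}}_\lambda(A)$ is the quotient of $\mathbb{L}^{\mathcal{M}}_\lambda(A)$ by $\approx$; it is again a boolean algebra. **Action of left Quillen functors.** A left Quillen functor $F:\mathcal{M}\to\mathcal{N}$ restricts to $\mathcal{M}^{cof}\to\mathcal{N}^{cof}$, preserving cofibrations, the initial object and pushouts of cofibrations, so $A\mapsto\mathbb{L}^{\mathcal{N}}_\lambda(FA)$ is a $\lambda$-boolean algebra over $\mathcal{M}^{cof}$. The unique morphism $\mathbb{L}^{\mathcal{M}}_\lambda\to\mathbb{L}^{\mathcal{N}}_\lambda(F-)$ is compatible with $\approx$, and $h\mathbb{L}F_A$ is the map it induces on quotients at $A$. *)

theory Defs
  imports "HOL-Algebra.Lattice" "HOL-Library.FuncSet"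
begin

unbundle cardinal_syntax

section \<open>Categories, functors and adjunctions\<close>

record ('o, 'm) cat =
  Obj :: "'o set"
  Arr :: "'m set"
  Dom :: "'m \<Rightarrow> 'o"
  Cod :: "'m \<Rightarrow> 'o"
  ident :: "'o \<Rightarrow> 'm"
  compo :: "'m \<Rightarrow> 'm \<Rightarrow> 'm" (infixl \<open>\<cdot>\<index>\<close> 70)

definition Hom :: "('o, 'm, 'z) cat_scheme \<Rightarrow> 'o \<Rightarrow> 'o \<Rightarrow> 'm set"
  where "Hom C A B = {f \<in> Arr C. Dom C f = A \<and> Cod C f = B}"

locale category =
  fixes C :: "('o, 'm, 'z) cat_scheme" (structure)
  assumes Dom_Obj: "f \<in> Arr C \<Longrightarrow> Dom C f \<in> Obj C"
    and Cod_Obj: "f \<in> Arr C \<Longrightarrow> Cod C f \<in> Obj C"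
    and ident_Hom: "A \<in> Obj C \<Longrightarrow> ident C A \<in> Hom C A A"
    and compo_Hom: "\<lbrakk>f \<in> Hom C A B; g \<in> Hom C B D\<rbrakk> \<Longrightarrow> g \<cdot> f \<in> Hom C A D"
    and ident_right: "f \<in> Hom C A B \<Longrightarrow> f \<cdot> ident C A = f"
    and ident_left: "f \<in> Hom C A B \<Longrightarrow> ident C B \<cdot> f = f"
    and compo_assoc: "\<lbrakk>f \<in> Hom C A B; g \<in> Hom C B D; h \<in> Hom C D E\<rbrakk>
      \<Longrightarrow> h \<cdot> g \<cdot> f = h \<cdot> (g \<cdot> f)"

definition full_subcat :: "('o, 'm, 'z) cat_scheme \<Rightarrow> 'o set \<Rightarrow> ('o, 'm) cat"
  where "full_subcat C S = \<lparr>Obj = Obj C \<inter> S, Arr = {f \<in> Arr C. Dom C f \<in> S \<and> Cod C f \<in> S},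
    Dom = Dom C, Cod = Cod C, ident = ident C, compo = compo C\<rparr>"

definition initial :: "('o, 'm, 'z) cat_scheme \<Rightarrow> 'o \<Rightarrow> bool"
  where "initial C Z \<longleftrightarrow> Z \<in> Obj C \<and> (\<forall>X\<in>Obj C. \<exists>!f. f \<in> Hom C Z X)"

definition terminal :: "('o, 'm, 'z) cat_scheme \<Rightarrow> 'o \<Rightarrow> bool"
  where "terminal C T \<longleftrightarrow> T \<in> Obj C \<and> (\<forall>X\<in>Obj C. \<exists>!f. f \<in> Hom C X T)"

definition is_iso :: "('o, 'm, 'z) cat_scheme \<Rightarrow> 'm \<Rightarrow> bool"
  where "is_iso C f \<longleftrightarrow> f \<in> Arr C \<and> (\<exists>g\<in>Hom C (Cod C f) (Dom C f).
    g \<cdot>\<^bsub>C\<^esub> f = ident C (Dom C f) \<and> f \<cdot>\<^bsub>C\<^esub> g = ident C (Cod C f))"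

definition iso_closed :: "('o, 'm, 'z) cat_scheme \<Rightarrow> 'm set \<Rightarrow> bool"
  where "iso_closed C K \<longleftrightarrow> (\<forall>f\<in>K. \<forall>f'\<in>Arr C. \<forall>u v.
    is_iso C u \<and> is_iso C v \<and> u \<in> Hom C (Dom C f) (Dom C f') \<and> v \<in> Hom C (Cod C f) (Cod C f')
    \<and> f' \<cdot>\<^bsub>C\<^esub> u = v \<cdot>\<^bsub>C\<^esub> f \<longrightarrow> f' \<in> K)"

text \<open>\<open>pushout C f g p q\<close> says that the square with span \<open>B \<leftarrow>f\<midarrow> A \<midarrow>g\<rightarrow> B'\<close>
  and cospan \<open>B \<midarrow>p\<rightarrow> D \<leftarrow>q\<midarrow> B'\<close> is a pushout; \<open>pullback C f g p q\<close> says that the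
  square with cospan \<open>B \<midarrow>f\<rightarrow> A \<leftarrow>g\<midarrow> B'\<close> and span \<open>B \<leftarrow>p\<midarrow> D \<midarrow>q\<rightarrow> B'\<close> is a pullback.\<close>

definition pushout :: "('o, 'm, 'z) cat_scheme \<Rightarrow> 'm \<Rightarrow> 'm \<Rightarrow> 'm \<Rightarrow> 'm \<Rightarrow> bool"
  where "pushout C f g p q \<longleftrightarrow> (\<exists>A B B' D.
    f \<in> Hom C A B \<and> g \<in> Hom C A B' \<and> p \<in> Hom C B D \<and> q \<in> Hom C B' D \<and>
    p \<cdot>\<^bsub>C\<^esub> f = q \<cdot>\<^bsub>C\<^esub> g \<and>
    (\<forall>X u v. u \<in> Hom C B X \<and> v \<in> Hom C B' X \<and> u \<cdot>\<^bsub>C\<^esub> f = v \<cdot>\<^bsub>C\<^esub> g \<longrightarrow>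
      (\<exists>!h. h \<in> Hom C D X \<and> h \<cdot>\<^bsub>C\<^esub> p = u \<and> h \<cdot>\<^bsub>C\<^esub> q = v)))"

definition pullback :: "('o, 'm, 'z) cat_scheme \<Rightarrow> 'm \<Rightarrow> 'm \<Rightarrow> 'm \<Rightarrow> 'm \<Rightarrow> bool"
  where "pullback C f g p q \<longleftrightarrow> (\<exists>A B B' D.
    f \<in> Hom C B A \<and> g \<in> Hom C B' A \<and> p \<in> Hom C D B \<and> q \<in> Hom C D B' \<and>
    f \<cdot>\<^bsub>C\<^esub> p = g \<cdot>\<^bsub>C\<^esub> q \<and>
    (\<forall>X u v. u \<in> Hom C X B \<and> v \<in> Hom C X B' \<and> f \<cdot>\<^bsub>C\<^esub> u = g \<cdot>\<^bsub>C\<^esub> v \<longrightarrow>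
      (\<exists>!h. h \<in> Hom C X D \<and> p \<cdot>\<^bsub>C\<^esub> h = u \<and> q \<cdot>\<^bsub>C\<^esub> h = v)))"

definition lifts :: "('o, 'm, 'z) cat_scheme \<Rightarrow> 'm \<Rightarrow> 'm \<Rightarrow> bool"
  where "lifts C i p \<longleftrightarrow> (\<forall>u\<in>Hom C (Dom C i) (Dom C p). \<forall>v\<in>Hom C (Cod C i) (Cod C p).
    p \<cdot>\<^bsub>C\<^esub> u = v \<cdot>\<^bsub>C\<^esub> i \<longrightarrow>
    (\<exists>h\<in>Hom C (Cod C i) (Dom C p). h \<cdot>\<^bsub>C\<^esub> i = u \<and> p \<cdot>\<^bsub>C\<^esub> h = v))"

record ('o, 'm, 'p, 'n) ftor =
  fobj :: "'o \<Rightarrow> 'p"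
  farr :: "'m \<Rightarrow> 'n"

definition id_ftor :: "('o, 'm, 'o, 'm) ftor"
  where "id_ftor = \<lparr>fobj = (\<lambda>A. A), farr = (\<lambda>f. f)\<rparr>"

definition comp_ftor :: "('p, 'n, 'q, 'l) ftor \<Rightarrow> ('o, 'm, 'p, 'n) ftor \<Rightarrow> ('o, 'm, 'q, 'l) ftor"
    (infixl \<open>\<circ>\<^sub>F\<close> 70)
  where "G \<circ>\<^sub>F F = \<lparr>fobj = fobj G \<circ> fobj F, farr = farr G \<circ> farr F\<rparr>"

definition is_functor ::
    "('o, 'm, 'y) cat_scheme \<Rightarrow> ('p, 'n, 'z) cat_scheme \<Rightarrow> ('o, 'm, 'p, 'n) ftor \<Rightarrow> bool"
  where "is_functor C D F \<longleftrightarrow>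
    (\<forall>A\<in>Obj C. fobj F A \<in> Obj D \<and> farr F (ident C A) = ident D (fobj F A)) \<and>
    (\<forall>A B. \<forall>f\<in>Hom C A B. farr F f \<in> Hom D (fobj F A) (fobj F B)) \<and>
    (\<forall>A B E. \<forall>f\<in>Hom C A B. \<forall>g\<in>Hom C B E. farr F (g \<cdot>\<^bsub>C\<^esub> f) = farr F g \<cdot>\<^bsub>D\<^esub> farr F f)"

definition nat_trans :: "('o, 'm, 'y) cat_scheme \<Rightarrow> ('p, 'n, 'z) cat_scheme \<Rightarrow>
    ('o, 'm, 'p, 'n) ftor \<Rightarrow> ('o, 'm, 'p, 'n) ftor \<Rightarrow> ('o \<Rightarrow> 'n) \<Rightarrow> bool"
  where "nat_trans C D F G \<tau> \<longleftrightarrow> is_functor C D F \<and> is_functor C D G \<and>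
    (\<forall>A\<in>Obj C. \<tau> A \<in> Hom D (fobj F A) (fobj G A)) \<and>
    (\<forall>A B. \<forall>f\<in>Hom C A B. \<tau> B \<cdot>\<^bsub>D\<^esub> farr F f = farr G f \<cdot>\<^bsub>D\<^esub> \<tau> A)"

definition nat_iso :: "('o, 'm, 'y) cat_scheme \<Rightarrow> ('p, 'n, 'z) cat_scheme \<Rightarrow>
    ('o, 'm, 'p, 'n) ftor \<Rightarrow> ('o, 'm, 'p, 'n) ftor \<Rightarrow> ('o \<Rightarrow> 'n) \<Rightarrow> bool"
  where "nat_iso C D F G \<tau> \<longleftrightarrow> nat_trans C D F G \<tau> \<and> (\<forall>A\<in>Obj C. is_iso D (\<tau> A))"

definition adjunction :: "('o, 'm, 'y) cat_scheme \<Rightarrow> ('p, 'n, 'z) cat_scheme \<Rightarrow>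
    ('o, 'm, 'p, 'n) ftor \<Rightarrow> ('p, 'n, 'o, 'm) ftor \<Rightarrow> ('o \<Rightarrow> 'm) \<Rightarrow> ('p \<Rightarrow> 'n) \<Rightarrow> bool"
  where "adjunction C D F G \<eta> \<epsilon> \<longleftrightarrow> is_functor C D F \<and> is_functor D C G \<and>
    nat_trans C C id_ftor (G \<circ>\<^sub>F F) \<eta> \<and> nat_trans D D (F \<circ>\<^sub>F G) id_ftor \<epsilon> \<and>
    (\<forall>X\<in>Obj C. \<epsilon> (fobj F X) \<cdot>\<^bsub>D\<^esub> farr F (\<eta> X) = ident D (fobj F X)) \<and>
    (\<forall>Y\<in>Obj D. farr G (\<epsilon> Y) \<cdot>\<^bsub>C\<^esub> \<eta> (fobj G Y) = ident C (fobj G Y))"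

definition adjoint_equivalence :: "('o, 'm, 'y) cat_scheme \<Rightarrow> ('p, 'n, 'z) cat_scheme \<Rightarrow>
    ('o, 'm, 'p, 'n) ftor \<Rightarrow> ('p, 'n, 'o, 'm) ftor \<Rightarrow> ('o \<Rightarrow> 'm) \<Rightarrow> ('p \<Rightarrow> 'n) \<Rightarrow> bool"
  where "adjoint_equivalence C D F G \<eta> \<epsilon> \<longleftrightarrow> adjunction C D F G \<eta> \<epsilon> \<and>
    (\<forall>X\<in>Obj C. is_iso C (\<eta> X)) \<and> (\<forall>Y\<in>Obj D. is_iso D (\<epsilon> Y))"


section \<open>Localization of a category\<close>

text \<open>The localization of \<open>C\<close> at \<open>W\<close>, whose arrows are zigzags up to the relations that make
  \<open>C\<close> functorial and \<open>W\<close> invertible (see \<open>localization_universal\<close> below). A zigzag is read from its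
  source to its target; \<open>Bwd w\<close> traverses \<open>w\<close> from its codomain to its domain and becomes
  the formal inverse of \<open>w\<close>.\<close>

datatype 'm step = Fwd 'm | Bwd 'm

inductive zigzag :: "('o, 'm, 'z) cat_scheme \<Rightarrow> 'm set \<Rightarrow> 'o \<Rightarrow> 'o \<Rightarrow> 'm step list \<Rightarrow> bool"
  for C W
  where
    zz_nil: "A \<in> Obj C \<Longrightarrow> zigzag C W A A []"
  | zz_fwd: "\<lbrakk>f \<in> Hom C A B; zigzag C W B D p\<rbrakk> \<Longrightarrow> zigzag C W A D (Fwd f # p)"
  | zz_bwd: "\<lbrakk>w \<in> W; w \<in> Hom C B A; zigzag C W B D p\<rbrakk> \<Longrightarrow> zigzag C W A D (Bwd w # p)"

inductive zzeq ::
    "('o, 'm, 'z) cat_scheme \<Rightarrow> 'm set \<Rightarrow> 'o \<Rightarrow> 'o \<Rightarrow> 'm step list \<Rightarrow> 'm step list \<Rightarrow> bool"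
  for C W
  where
    zzeq_refl: "zigzag C W A B p \<Longrightarrow> zzeq C W A B p p"
  | zzeq_sym: "zzeq C W A B p q \<Longrightarrow> zzeq C W A B q p"
  | zzeq_trans: "\<lbrakk>zzeq C W A B p q; zzeq C W A B q r\<rbrakk> \<Longrightarrow> zzeq C W A B p r"
  | zzeq_append: "\<lbrakk>zzeq C W A B p p'; zzeq C W B D q q'\<rbrakk> \<Longrightarrow> zzeq C W A D (p @ q) (p' @ q')"
  | zzeq_ident: "A \<in> Obj C \<Longrightarrow> zzeq C W A A [Fwd (ident C A)] []"
  | zzeq_comp: "\<lbrakk>f \<in> Hom C A B; g \<in> Hom C B D\<rbrakk>
      \<Longrightarrow> zzeq C W A D [Fwd f, Fwd g] [Fwd (g \<cdot>\<^bsub>C\<^esub> f)]"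
  | zzeq_inv1: "\<lbrakk>w \<in> W; w \<in> Hom C A B\<rbrakk> \<Longrightarrow> zzeq C W A A [Fwd w, Bwd w] []"
  | zzeq_inv2: "\<lbrakk>w \<in> W; w \<in> Hom C A B\<rbrakk> \<Longrightarrow> zzeq C W B B [Bwd w, Fwd w] []"

type_synonym ('o, 'm) zarr = "'o \<times> 'o \<times> 'm step list set"

definition zcls :: "('o, 'm, 'z) cat_scheme \<Rightarrow> 'm set \<Rightarrow> 'o \<Rightarrow> 'o \<Rightarrow> 'm step list \<Rightarrow> ('o, 'm) zarr"
  where "zcls C W A B p = (A, B, {q. zzeq C W A B p q})"

definition localization ::
    "('o, 'm, 'z) cat_scheme \<Rightarrow> 'm set \<Rightarrow> ('o, ('o, 'm) zarr) cat"
  where "localization C W = \<lparr>Obj = Obj C,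
    Arr = {zcls C W A B p | A B p. zigzag C W A B p},
    Dom = fst, Cod = fst \<circ> snd,
    ident = (\<lambda>A. zcls C W A A []),
    compo = (\<lambda>b a. (fst a, fst (snd b),
      {r. \<exists>p\<in>snd (snd a). \<exists>q\<in>snd (snd b). zzeq C W (fst a) (fst (snd b)) (p @ q) r}))\<rparr>"

definition loc_ftor ::
    "('o, 'm, 'z) cat_scheme \<Rightarrow> 'm set \<Rightarrow> ('o, 'm, 'o, ('o, 'm) zarr) ftor"
  where "loc_ftor C W = \<lparr>fobj = (\<lambda>A. A), farr = (\<lambda>f. zcls C W (Dom C f) (Cod C f) [Fwd f])\<rparr>"


section \<open>Weak model categories\<close>

record ('o, 'm) wmcat = "('o, 'm) cat" +
  Cof :: "'m set"
  Fib :: "'m set"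
  Weq :: "'m set"

definition cofibrant :: "('o, 'm, 'z) wmcat_scheme \<Rightarrow> 'o \<Rightarrow> bool"
  where "cofibrant M X \<longleftrightarrow> (\<exists>Z. initial M Z \<and> (\<exists>f\<in>Hom M Z X. f \<in> Cof M))"

definition fibrant :: "('o, 'm, 'z) wmcat_scheme \<Rightarrow> 'o \<Rightarrow> bool"
  where "fibrant M X \<longleftrightarrow> (\<exists>T. terminal M T \<and> (\<exists>f\<in>Hom M X T. f \<in> Fib M))"

locale weak_model_category = category M
  for M :: "('o, 'm, 'z) wmcat_scheme" (structure) +
  assumes Cof_Arr: "Cof M \<subseteq> Arr M" and Fib_Arr: "Fib M \<subseteq> Arr M" and Weq_Arr: "Weq M \<subseteq> Arr M"
    and initial_Cof: "\<exists>Z. initial M Z \<and> ident M Z \<in> Cof M"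
    and terminal_Fib: "\<exists>T. terminal M T \<and> ident M T \<in> Fib M"
    and Cof_comp: "\<lbrakk>cofibrant M A; f \<in> Cof M; f \<in> Hom M A B; g \<in> Cof M; g \<in> Hom M B D\<rbrakk>
      \<Longrightarrow> g \<cdot> f \<in> Cof M"
    and Fib_comp: "\<lbrakk>fibrant M D; f \<in> Fib M; f \<in> Hom M A B; g \<in> Fib M; g \<in> Hom M B D\<rbrakk>
      \<Longrightarrow> g \<cdot> f \<in> Fib M"
    and two_of_three: "\<lbrakk>f \<in> Hom M A B; g \<in> Hom M B D; cofibrant M A \<or> fibrant M A;
        cofibrant M B \<or> fibrant M B; cofibrant M D \<or> fibrant M D\<rbrakk>
      \<Longrightarrow> (f \<in> Weq M \<and> g \<in> Weq M \<longrightarrow> g \<cdot> f \<in> Weq M) \<and>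
          (f \<in> Weq M \<and> g \<cdot> f \<in> Weq M \<longrightarrow> g \<in> Weq M) \<and>
          (g \<in> Weq M \<and> g \<cdot> f \<in> Weq M \<longrightarrow> f \<in> Weq M)"
    and iso_Weq: "\<lbrakk>is_iso M f; f \<in> Hom M A B; cofibrant M A \<or> fibrant M A;
        cofibrant M B \<or> fibrant M B\<rbrakk> \<Longrightarrow> f \<in> Weq M"
    and Cof_pushout: "\<lbrakk>i \<in> Cof M; i \<in> Hom M A B; f \<in> Hom M A A'; cofibrant M A; cofibrant M A'\<rbrakk>
      \<Longrightarrow> \<exists>f' i'. pushout M i f f' i' \<and> i' \<in> Cof M"
    and Fib_pullback: "\<lbrakk>p \<in> Fib M; p \<in> Hom M X Y; f \<in> Hom M Y' Y; fibrant M Y; fibrant M Y'\<rbrakk>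
      \<Longrightarrow> \<exists>f' p'. pullback M p f f' p' \<and> p' \<in> Fib M"
    and Cof_iso_closed: "iso_closed M (Cof M)"
    and Fib_iso_closed: "iso_closed M (Fib M)"
    and Weq_iso_closed: "iso_closed M (Weq M)"
    and factor_trivial_Fib: "\<lbrakk>f \<in> Hom M A X; cofibrant M A; fibrant M X\<rbrakk>
      \<Longrightarrow> \<exists>E. \<exists>i\<in>Hom M A E. \<exists>p\<in>Hom M E X. f = p \<cdot> i \<and> i \<in> Cof M \<and> p \<in> Fib M \<inter> Weq M"
    and factor_trivial_Cof: "\<lbrakk>f \<in> Hom M A X; cofibrant M A; fibrant M X\<rbrakk>
      \<Longrightarrow> \<exists>E. \<exists>i\<in>Hom M A E. \<exists>p\<in>Hom M E X. f = p \<cdot> i \<and> i \<in> Cof M \<inter> Weq M \<and> p \<in> Fib M"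
    and lifting: "\<lbrakk>i \<in> Cof M; i \<in> Hom M A B; cofibrant M A; cofibrant M B;
        p \<in> Fib M; p \<in> Hom M X Y; fibrant M X; fibrant M Y; i \<in> Weq M \<or> p \<in> Weq M\<rbrakk>
      \<Longrightarrow> lifts M i p"

definition cof_cat :: "('o, 'm, 'z) wmcat_scheme \<Rightarrow> ('o, 'm) cat"
  where "cof_cat M = full_subcat M {X. cofibrant M X}"

definition fib_cat :: "('o, 'm, 'z) wmcat_scheme \<Rightarrow> ('o, 'm) cat"
  where "fib_cat M = full_subcat M {X. fibrant M X}"

definition core_cat :: "('o, 'm, 'z) wmcat_scheme \<Rightarrow> ('o, 'm) cat"
  where "core_cat M = full_subcat M {X. cofibrant M X \<or> fibrant M X}"

definition Ho :: "('o, 'm, 'z) wmcat_scheme \<Rightarrow> ('o, ('o, 'm) zarr) cat"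
  where "Ho M = localization (core_cat M) (Weq M \<inter> Arr (core_cat M))"

definition Ho_ftor :: "('o, 'm, 'z) wmcat_scheme \<Rightarrow> ('o, 'm, 'o, ('o, 'm) zarr) ftor"
  where "Ho_ftor M = loc_ftor (core_cat M) (Weq M \<inter> Arr (core_cat M))"

definition quillen_adjunction :: "('o, 'm, 'y) wmcat_scheme \<Rightarrow> ('p, 'n, 'z) wmcat_scheme \<Rightarrow>
    ('o, 'm, 'p, 'n) ftor \<Rightarrow> ('p, 'n, 'o, 'm) ftor \<Rightarrow> ('o \<Rightarrow> 'm) \<Rightarrow> ('p \<Rightarrow> 'n) \<Rightarrow> bool"
  where "quillen_adjunction M N F G \<eta> \<epsilon> \<longleftrightarrow> adjunction M N F G \<eta> \<epsilon> \<and>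
    farr F ` Cof M \<subseteq> Cof N \<and> farr G ` Fib N \<subseteq> Fib M"

text \<open>The adjunction of homotopy categories induced by a Quillen adjunction. \<open>LF\<close> is the functor
  that \<open>F\<close> induces on homotopy categories via the localization of the cofibrant objects, and \<open>RG\<close>
  the one that \<open>G\<close> induces via the fibrant objects; they are determined up to unique isomorphism by
  \<open>\<alpha>\<close> and \<open>\<beta>\<close>. The last clause says that, for \<open>X\<close> cofibrant and \<open>Y\<close> fibrant, the transpose of
  \<open>[h] : LF X \<cong> F X \<rightarrow> Y\<close> is the class of the transpose \<open>X \<rightarrow> G Y\<close> of \<open>h\<close>, so that the derived
  adjunction is the one coming from \<open>\<eta>\<close> and \<open>\<epsilon>\<close>.\<close>

definition induced_adjunction :: "('o, 'm, 'y) wmcat_scheme \<Rightarrow> ('p, 'n, 'z) wmcat_scheme \<Rightarrow>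
    ('o, 'm, 'p, 'n) ftor \<Rightarrow> ('p, 'n, 'o, 'm) ftor \<Rightarrow> ('o \<Rightarrow> 'm) \<Rightarrow>
    ('o, ('o, 'm) zarr, 'p, ('p, 'n) zarr) ftor \<Rightarrow> ('p, ('p, 'n) zarr, 'o, ('o, 'm) zarr) ftor \<Rightarrow>
    ('o \<Rightarrow> ('o, 'm) zarr) \<Rightarrow> ('p \<Rightarrow> ('p, 'n) zarr) \<Rightarrow> bool"
  where "induced_adjunction M N F G \<eta> LF RG \<eta>h \<epsilon>h \<longleftrightarrow>
    adjunction (Ho M) (Ho N) LF RG \<eta>h \<epsilon>h \<and>
    (\<exists>\<alpha> \<beta>. nat_iso (cof_cat M) (Ho N) (LF \<circ>\<^sub>F Ho_ftor M) (Ho_ftor N \<circ>\<^sub>F F) \<alpha> \<and>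
      nat_iso (fib_cat N) (Ho M) (RG \<circ>\<^sub>F Ho_ftor N) (Ho_ftor M \<circ>\<^sub>F G) \<beta> \<and>
      (\<forall>X Y h. cofibrant M X \<and> fibrant N Y \<and> h \<in> Hom N (fobj F X) Y \<longrightarrow>
        \<beta> Y \<cdot>\<^bsub>Ho M\<^esub> farr RG (farr (Ho_ftor N) h \<cdot>\<^bsub>Ho N\<^esub> \<alpha> X) \<cdot>\<^bsub>Ho M\<^esub> \<eta>h X
          = farr (Ho_ftor M) (farr G h \<cdot>\<^bsub>M\<^esub> \<eta> X)))"

definition left_quillen_equivalence ::
    "('o, 'm, 'y) wmcat_scheme \<Rightarrow> ('p, 'n, 'z) wmcat_scheme \<Rightarrow> ('o, 'm, 'p, 'n) ftor \<Rightarrow> bool"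
  where "left_quillen_equivalence M N F \<longleftrightarrow> (\<exists>G \<eta> \<epsilon> LF RG \<eta>h \<epsilon>h.
    quillen_adjunction M N F G \<eta> \<epsilon> \<and> induced_adjunction M N F G \<eta> LF RG \<eta>h \<epsilon>h \<and>
    adjoint_equivalence (Ho M) (Ho N) LF RG \<eta>h \<epsilon>h)"


section \<open>Boolean algebras\<close>

locale boolean_lattice = bounded_lattice L for L (structure) +
  assumes meet_distrib: "\<lbrakk>x \<in> carrier L; y \<in> carrier L; z \<in> carrier L\<rbrakk>
      \<Longrightarrow> x \<sqinter> (y \<squnion> z) = (x \<sqinter> y) \<squnion> (x \<sqinter> z)"
    and complement: "x \<in> carrier L \<Longrightarrow> \<exists>y\<in>carrier L. x \<sqinter> y = \<bottom> \<and> x \<squnion> y = \<top>"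

definition bool_hom :: "('a, 'y) gorder_scheme \<Rightarrow> ('b, 'z) gorder_scheme \<Rightarrow> ('a \<Rightarrow> 'b) \<Rightarrow> bool"
  where "bool_hom L L' h \<longleftrightarrow> h \<in> carrier L \<rightarrow> carrier L' \<and>
    h \<bottom>\<^bsub>L\<^esub> = \<bottom>\<^bsub>L'\<^esub> \<and> h \<top>\<^bsub>L\<^esub> = \<top>\<^bsub>L'\<^esub> \<and>
    (\<forall>x\<in>carrier L. \<forall>y\<in>carrier L. h (x \<sqinter>\<^bsub>L\<^esub> y) = h x \<sqinter>\<^bsub>L'\<^esub> h y \<and> h (x \<squnion>\<^bsub>L\<^esub> y) = h x \<squnion>\<^bsub>L'\<^esub> h y)"

definition bool_iso :: "('a, 'y) gorder_scheme \<Rightarrow> ('b, 'z) gorder_scheme \<Rightarrow> ('a \<Rightarrow> 'b) \<Rightarrow> bool"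
  where "bool_iso L L' h \<longleftrightarrow> bool_hom L L' h \<and> bij_betw h (carrier L) (carrier L')"

text \<open>A cardinal \<open>\<lambda>\<close> is represented, as in the library of cardinals, by a well-order \<open>r\<close>.\<close>

locale lambda_boolean = boolean_lattice L for r :: "'k rel" and L (structure) +
  assumes small_joins: "\<lbrakk>S \<subseteq> carrier L; |S| <o r\<rbrakk> \<Longrightarrow> \<exists>s. least L s (Upper L S)"

definition lambda_hom ::
    "'k rel \<Rightarrow> ('a, 'y) gorder_scheme \<Rightarrow> ('b, 'z) gorder_scheme \<Rightarrow> ('a \<Rightarrow> 'b) \<Rightarrow> bool"
  where "lambda_hom r L L' h \<longleftrightarrow> bool_hom L L' h \<and>
    (\<forall>S. S \<subseteq> carrier L \<and> |S| <o r \<longrightarrow> h (\<Squnion>\<^bsub>L\<^esub>S) = \<Squnion>\<^bsub>L'\<^esub>(h ` S))"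

text \<open>The quotient of a preorder; if \<open>L\<close> is a boolean algebra and \<open>R\<close> a congruence on it, this is
  the usual order on the quotient.\<close>

definition quot_order :: "('a, 'z) gorder_scheme \<Rightarrow> 'a rel \<Rightarrow> 'a set gorder"
  where "quot_order L R =
    \<lparr>carrier = carrier L // R, eq = (=), le = (\<lambda>X Y. \<exists>x\<in>X. \<exists>y\<in>Y. x \<sqsubseteq>\<^bsub>L\<^esub> y)\<rparr>"

definition quot_map :: "'b rel \<Rightarrow> ('a \<Rightarrow> 'b) \<Rightarrow> 'a set \<Rightarrow> 'b set"
  where "quot_map R' h X = (\<Union>x\<in>X. R' `` {h x})"


section \<open>Boolean algebras over a category with cofibrations\<close>

record ('o, 'm, 'b) bafun =
  alg :: "'o \<Rightarrow> 'b gorder"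
  act :: "'m \<Rightarrow> 'b \<Rightarrow> 'b"
  exq :: "'m \<Rightarrow> 'b \<Rightarrow> 'b"

text \<open>Here \<open>K\<close> is the class of cofibrations of \<open>C\<close>. The condition \<open>i' \<in> K\<close> below is automatic when
  \<open>C\<close> is the category of cofibrant objects of a weak model category.\<close>

locale lambda_boolean_over = category C
  for r :: "'k rel" and C :: "('o, 'm, 'z) cat_scheme" and K :: "'m set"
    and P :: "('o, 'm, 'b) bafun" +
  assumes alg_lambda: "A \<in> Obj C \<Longrightarrow> lambda_boolean r (alg P A)"
    and act_hom: "f \<in> Hom C A B \<Longrightarrow> lambda_hom r (alg P A) (alg P B) (act P f)"
    and act_ident: "\<lbrakk>A \<in> Obj C; x \<in> carrier (alg P A)\<rbrakk> \<Longrightarrow> act P (ident C A) x = x"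
    and act_comp: "\<lbrakk>f \<in> Hom C A B; g \<in> Hom C B D; x \<in> carrier (alg P A)\<rbrakk>
      \<Longrightarrow> act P (g \<cdot>\<^bsub>C\<^esub> f) x = act P g (act P f x)"
    and exq_closed: "\<lbrakk>i \<in> K; i \<in> Hom C A B; y \<in> carrier (alg P B)\<rbrakk> \<Longrightarrow> exq P i y \<in> carrier (alg P A)"
    and exq_adjoint: "\<lbrakk>i \<in> K; i \<in> Hom C A B; x \<in> carrier (alg P A); y \<in> carrier (alg P B)\<rbrakk>
      \<Longrightarrow> exq P i y \<sqsubseteq>\<^bsub>alg P A\<^esub> x \<longleftrightarrow> y \<sqsubseteq>\<^bsub>alg P B\<^esub> act P i x"
    and beck_chevalley: "\<lbrakk>i \<in> K; i' \<in> K; pushout C i f f' i'; y \<in> carrier (alg P (Cod C i))\<rbrakk>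
      \<Longrightarrow> act P f (exq P i y) = exq P i' (act P f' y)"

definition bafun_hom :: "'k rel \<Rightarrow> ('o, 'm, 'z) cat_scheme \<Rightarrow> 'm set \<Rightarrow>
    ('o, 'm, 'a) bafun \<Rightarrow> ('o, 'm, 'b) bafun \<Rightarrow> ('o \<Rightarrow> 'a \<Rightarrow> 'b) \<Rightarrow> bool"
  where "bafun_hom r C K P Q h \<longleftrightarrow>
    (\<forall>A\<in>Obj C. lambda_hom r (alg P A) (alg Q A) (h A)) \<and>
    (\<forall>A B. \<forall>f\<in>Hom C A B. \<forall>x\<in>carrier (alg P A). h B (act P f x) = act Q f (h A x)) \<and>
    (\<forall>A B. \<forall>i\<in>K \<inter> Hom C A B. \<forall>y\<in>carrier (alg P B). h A (exq P i y) = exq Q i (h B y))"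


section \<open>The initial boolean algebra over a category with cofibrations\<close>

text \<open>The initial \<open>\<lambda>\<close>-boolean algebra is the algebra of formulas modulo provable equivalence; its
  universal property, for algebras over an arbitrary type, is lemma \<open>initial_over_hom\<close> below. The family of a
  formula \<open>Join I s\<close> is \<open>(s k)\<^sub>k\<close> for \<open>k \<in> I\<close>, the values outside \<open>I\<close> being irrelevant; every
  \<open>\<lambda>\<close>-small family can be indexed by a subset of the field of \<open>\<lambda>\<close>.\<close>

datatype ('m, 'k) fm =
    Fls
  | Neg "('m, 'k) fm"
  | And "('m, 'k) fm" "('m, 'k) fm"
  | Join "'k set" "'k \<Rightarrow> ('m, 'k) fm"
  | Sub 'm "('m, 'k) fm"
  | Ex 'm "('m, 'k) fm"

inductive is_fm :: "'k rel \<Rightarrow> ('o, 'm, 'z) cat_scheme \<Rightarrow> 'm set \<Rightarrow> 'o \<Rightarrow> ('m, 'k) fm \<Rightarrow> bool"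
  for r C K
  where
    fm_Fls: "A \<in> Obj C \<Longrightarrow> is_fm r C K A Fls"
  | fm_Neg: "is_fm r C K A s \<Longrightarrow> is_fm r C K A (Neg s)"
  | fm_And: "\<lbrakk>is_fm r C K A s; is_fm r C K A t\<rbrakk> \<Longrightarrow> is_fm r C K A (And s t)"
  | fm_Join: "\<lbrakk>A \<in> Obj C; |I| <o r; \<And>k. k \<in> I \<Longrightarrow> is_fm r C K A (s k)\<rbrakk>
      \<Longrightarrow> is_fm r C K A (Join I s)"
  | fm_Sub: "\<lbrakk>f \<in> Hom C A B; is_fm r C K A s\<rbrakk> \<Longrightarrow> is_fm r C K B (Sub f s)"
  | fm_Ex: "\<lbrakk>i \<in> K; i \<in> Hom C A B; is_fm r C K B s\<rbrakk> \<Longrightarrow> is_fm r C K A (Ex i s)"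

text \<open>\<open>entails r C K A s t\<close> is the least relation \<open>s \<le> t\<close> between formulas at \<open>A\<close> closed under
  the laws of \<open>\<lambda>\<close>-boolean algebras over \<open>C\<close>. The rules \<open>en_contr\<close>, \<open>en_cases\<close> and \<open>en_JoinE\<close>
  account for complements and distributivity.\<close>

inductive entails ::
    "'k rel \<Rightarrow> ('o, 'm, 'z) cat_scheme \<Rightarrow> 'm set \<Rightarrow> 'o \<Rightarrow> ('m, 'k) fm \<Rightarrow> ('m, 'k) fm \<Rightarrow> bool"
  for r C K
  where
    en_refl: "is_fm r C K A s \<Longrightarrow> entails r C K A s s"
  | en_trans: "\<lbrakk>entails r C K A s t; entails r C K A t u\<rbrakk> \<Longrightarrow> entails r C K A s u"
  | en_Fls: "is_fm r C K A s \<Longrightarrow> entails r C K A Fls s"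
  | en_And1: "\<lbrakk>is_fm r C K A s; is_fm r C K A t\<rbrakk> \<Longrightarrow> entails r C K A (And s t) s"
  | en_And2: "\<lbrakk>is_fm r C K A s; is_fm r C K A t\<rbrakk> \<Longrightarrow> entails r C K A (And s t) t"
  | en_And: "\<lbrakk>entails r C K A u s; entails r C K A u t\<rbrakk> \<Longrightarrow> entails r C K A u (And s t)"
  | en_contr: "is_fm r C K A s \<Longrightarrow> entails r C K A (And s (Neg s)) Fls"
  | en_cases: "\<lbrakk>is_fm r C K A s; is_fm r C K A u; entails r C K A (And u s) t;
        entails r C K A (And u (Neg s)) t\<rbrakk> \<Longrightarrow> entails r C K A u t"
  | en_JoinI: "\<lbrakk>is_fm r C K A (Join I s); k \<in> I\<rbrakk> \<Longrightarrow> entails r C K A (s k) (Join I s)"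
  | en_JoinE: "\<lbrakk>is_fm r C K A (Join I s); is_fm r C K A u; is_fm r C K A t;
        \<And>k. k \<in> I \<Longrightarrow> entails r C K A (And u (s k)) t\<rbrakk> \<Longrightarrow> entails r C K A (And u (Join I s)) t"
  | en_Sub: "\<lbrakk>f \<in> Hom C A B; entails r C K A s t\<rbrakk> \<Longrightarrow> entails r C K B (Sub f s) (Sub f t)"
  | en_ident1: "is_fm r C K A s \<Longrightarrow> entails r C K A (Sub (ident C A) s) s"
  | en_ident2: "is_fm r C K A s \<Longrightarrow> entails r C K A s (Sub (ident C A) s)"
  | en_comp1: "\<lbrakk>f \<in> Hom C A B; g \<in> Hom C B D; is_fm r C K A s\<rbrakk>
      \<Longrightarrow> entails r C K D (Sub (g \<cdot>\<^bsub>C\<^esub> f) s) (Sub g (Sub f s))"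
  | en_comp2: "\<lbrakk>f \<in> Hom C A B; g \<in> Hom C B D; is_fm r C K A s\<rbrakk>
      \<Longrightarrow> entails r C K D (Sub g (Sub f s)) (Sub (g \<cdot>\<^bsub>C\<^esub> f) s)"
  | en_Sub_Fls: "f \<in> Hom C A B \<Longrightarrow> entails r C K B (Sub f Fls) Fls"
  | en_Sub_Neg: "\<lbrakk>f \<in> Hom C A B; is_fm r C K A s\<rbrakk>
      \<Longrightarrow> entails r C K B (Neg (Sub f s)) (Sub f (Neg s))"
  | en_Sub_And: "\<lbrakk>f \<in> Hom C A B; is_fm r C K A s; is_fm r C K A t\<rbrakk>
      \<Longrightarrow> entails r C K B (And (Sub f s) (Sub f t)) (Sub f (And s t))"
  | en_Sub_Join: "\<lbrakk>f \<in> Hom C A B; is_fm r C K A (Join I s)\<rbrakk>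
      \<Longrightarrow> entails r C K B (Sub f (Join I s)) (Join I (\<lambda>k. Sub f (s k)))"
  | en_ExE: "\<lbrakk>i \<in> K; i \<in> Hom C A B; is_fm r C K A t; entails r C K B s (Sub i t)\<rbrakk>
      \<Longrightarrow> entails r C K A (Ex i s) t"
  | en_ExI: "\<lbrakk>i \<in> K; i \<in> Hom C A B; is_fm r C K B s; entails r C K A (Ex i s) t\<rbrakk>
      \<Longrightarrow> entails r C K B s (Sub i t)"
  | en_BC: "\<lbrakk>i \<in> K; i' \<in> K; pushout C i f f' i'; is_fm r C K (Cod C i) s\<rbrakk>
      \<Longrightarrow> entails r C K (Cod C f) (Sub f (Ex i s)) (Ex i' (Sub f' s))"

definition fm_order :: "'k rel \<Rightarrow> ('o, 'm, 'z) cat_scheme \<Rightarrow> 'm set \<Rightarrow> 'o \<Rightarrow> ('m, 'k) fm gorder"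
  where "fm_order r C K A = \<lparr>carrier = {s. is_fm r C K A s},
    eq = (\<lambda>s t. entails r C K A s t \<and> entails r C K A t s), le = entails r C K A\<rparr>"

definition fm_rel :: "'k rel \<Rightarrow> ('o, 'm, 'z) cat_scheme \<Rightarrow> 'm set \<Rightarrow> 'o \<Rightarrow> ('m, 'k) fm rel"
  where "fm_rel r C K A = {(s, t). entails r C K A s t \<and> entails r C K A t s}"

definition initial_over ::
    "'k rel \<Rightarrow> ('o, 'm, 'z) cat_scheme \<Rightarrow> 'm set \<Rightarrow> ('o, 'm, ('m, 'k) fm set) bafun"
  where "initial_over r C K = \<lparr>
    alg = (\<lambda>A. quot_order (fm_order r C K A) (fm_rel r C K A)),
    act = (\<lambda>f. quot_map (fm_rel r C K (Cod C f)) (Sub f)),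
    exq = (\<lambda>i. quot_map (fm_rel r C K (Dom C i)) (Ex i))\<rparr>"

definition initial_hom :: "'k rel \<Rightarrow> ('o, 'm, 'z) cat_scheme \<Rightarrow> 'm set \<Rightarrow>
    ('o, 'm, 'b) bafun \<Rightarrow> 'o \<Rightarrow> ('m, 'k) fm set \<Rightarrow> 'b"
  where "initial_hom r C K P A x =
    (THE y. \<exists>h. bafun_hom r C K (initial_over r C K) P h \<and> h A x = y)"

section \<open>The language of a weak model category\<close>

definition cof_cofs :: "('o, 'm, 'z) wmcat_scheme \<Rightarrow> 'm set"
  where "cof_cofs M = Cof M \<inter> Arr (cof_cat M)"

definition language :: "'k rel \<Rightarrow> ('o, 'm, 'z) wmcat_scheme \<Rightarrow> ('o, 'm, ('m, 'k) fm set) bafun"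
  where "language r M = initial_over r (cof_cat M) (cof_cofs M)"

text \<open>The algebra \<open>c \<mapsto> Pow(Hom(c, X))\<close>; \<open>X\<close> is any object of \<open>M\<close>.\<close>

definition hom_algebra :: "('o, 'm, 'z) wmcat_scheme \<Rightarrow> 'o \<Rightarrow> ('o, 'm, 'm set) bafun"
  where "hom_algebra M X = \<lparr>
    alg = (\<lambda>c. \<lparr>carrier = Pow (Hom M c X), eq = (=), le = (\<subseteq>)\<rparr>),
    act = (\<lambda>g S. {v \<in> Hom M (Cod M g) X. v \<cdot>\<^bsub>M\<^esub> g \<in> S}),
    exq = (\<lambda>i S. (\<lambda>v. v \<cdot>\<^bsub>M\<^esub> i) ` S)\<rparr>"

definition interp :: "'k rel \<Rightarrow> ('o, 'm, 'z) wmcat_scheme \<Rightarrow> 'o \<Rightarrow> 'o \<Rightarrow> ('m, 'k) fm set \<Rightarrow> 'm set"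
  where "interp r M X = initial_hom r (cof_cat M) (cof_cofs M) (hom_algebra M X)"

text \<open>\<open>interp r M X A \<phi>\<close> is \<open>|\<phi>|\<^sub>X\<close> for \<open>\<phi>\<close> in the language at \<open>A\<close>.\<close>

definition sem_equiv :: "'k rel \<Rightarrow> ('o, 'm, 'z) wmcat_scheme \<Rightarrow> 'o \<Rightarrow> ('m, 'k) fm set rel"
  where "sem_equiv r M A = {(\<phi>, \<psi>). \<phi> \<in> carrier (alg (language r M) A) \<and>
    \<psi> \<in> carrier (alg (language r M) A) \<and>
    (\<forall>X\<in>Obj M. fibrant M X \<longrightarrow> interp r M X A \<phi> = interp r M X A \<psi>)}"

definition h_language :: "'k rel \<Rightarrow> ('o, 'm, 'z) wmcat_scheme \<Rightarrow> 'o \<Rightarrow> ('m, 'k) fm set set gorder"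
  where "h_language r M A = quot_order (alg (language r M) A) (sem_equiv r M A)"

text \<open>For a left Quillen functor \<open>F : M \<rightarrow> N\<close>, \<open>language_map\<close> is the unique morphism from the language
  of \<open>M\<close> to \<open>A \<mapsto> language r N\<close> at \<open>F A\<close>.\<close>

definition pull_bafun :: "('o, 'm, 'p, 'n) ftor \<Rightarrow> ('p, 'n, 'b) bafun \<Rightarrow> ('o, 'm, 'b) bafun"
  where "pull_bafun F P = \<lparr>alg = (\<lambda>A. alg P (fobj F A)), act = (\<lambda>f. act P (farr F f)),
    exq = (\<lambda>i. exq P (farr F i))\<rparr>"

definition language_map :: "'k rel \<Rightarrow> ('o, 'm, 'y) wmcat_scheme \<Rightarrow> ('p, 'n, 'z) wmcat_scheme \<Rightarrow>
    ('o, 'm, 'p, 'n) ftor \<Rightarrow> 'o \<Rightarrow> ('m, 'k) fm set \<Rightarrow> ('n, 'k) fm set"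
  where "language_map r M N F =
    initial_hom r (cof_cat M) (cof_cofs M) (pull_bafun F (language r N))"

section \<open>Well-definedness and universal properties\<close>

lemma boolI:
  fixes L :: "('a, 'z) gorder_scheme" (structure)
  assumes po: "partial_order L"
    and cl: "\<And>x y. x \<in> carrier L \<Longrightarrow> y \<in> carrier L \<Longrightarrow> m x y \<in> carrier L"
      "\<And>x y. x \<in> carrier L \<Longrightarrow> y \<in> carrier L \<Longrightarrow> j x y \<in> carrier L"
      "b \<in> carrier L" "t \<in> carrier L" "\<And>x. x \<in> carrier L \<Longrightarrow> n x \<in> carrier L"
    and m: "\<And>x y z. \<lbrakk>x \<in> carrier L; y \<in> carrier L; z \<in> carrier L\<rbrakk> \<Longrightarrow>
      z \<sqsubseteq> m x y \<longleftrightarrow> z \<sqsubseteq> x \<and> z \<sqsubseteq> y"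
    and j: "\<And>x y z. \<lbrakk>x \<in> carrier L; y \<in> carrier L; z \<in> carrier L\<rbrakk> \<Longrightarrow>
      j x y \<sqsubseteq> z \<longleftrightarrow> x \<sqsubseteq> z \<and> y \<sqsubseteq> z"
    and bt: "\<And>x. x \<in> carrier L \<Longrightarrow> b \<sqsubseteq> x" "\<And>x. x \<in> carrier L \<Longrightarrow> x \<sqsubseteq> t"
    and d: "\<And>x y z. \<lbrakk>x \<in> carrier L; y \<in> carrier L; z \<in> carrier L\<rbrakk> \<Longrightarrow>
      m x (j y z) \<sqsubseteq> j (m x y) (m x z)"
    and n: "\<And>x. x \<in> carrier L \<Longrightarrow> m x (n x) \<sqsubseteq> b" "\<And>x. x \<in> carrier L \<Longrightarrow> t \<sqsubseteq> j x (n x)"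
  shows "boolean_lattice L"
    and "\<And>x y. \<lbrakk>x \<in> carrier L; y \<in> carrier L\<rbrakk> \<Longrightarrow> x \<sqinter> y = m x y"
    and "\<And>x y. \<lbrakk>x \<in> carrier L; y \<in> carrier L\<rbrakk> \<Longrightarrow> x \<squnion> y = j x y"
    and "\<bottom> = b" and "\<top> = t"
proof -
  interpret partial_order L by fact
  have gl: "greatest L (m x y) (Lower L {x, y})" if "x \<in> carrier L" "y \<in> carrier L" for x y
    using that m cl m[of x y "m x y"] by (auto simp: greatest_def Lower_def)
  have lb: "least L (j x y) (Upper L {x, y})" if "x \<in> carrier L" "y \<in> carrier L" for x y
    using that j cl j[of x y "j x y"] by (auto simp: least_def Upper_def)
  interpret bounded_lattice L
  proof unfold_locales
    show "\<exists>s. least L s (Upper L {x, y})" if "x \<in> carrier L" "y \<in> carrier L" for x y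
      using lb that by blast
    show "\<exists>s. greatest L s (Lower L {x, y})" if "x \<in> carrier L" "y \<in> carrier L" for x y
      using gl that by blast
    show "\<exists>x. least L x (carrier L)" using bt cl by (auto simp: least_def)
    show "\<exists>x. greatest L x (carrier L)" using bt cl by (auto simp: greatest_def)
  qed
  show me: "x \<sqinter> y = m x y" if "x \<in> carrier L" "y \<in> carrier L" for x y
    using gl[OF that] greatest_unique unfolding meet_def inf_def by (metis someI_ex)
  show je: "x \<squnion> y = j x y" if "x \<in> carrier L" "y \<in> carrier L" for x y
    using lb[OF that] least_unique unfolding join_def sup_def by (metis someI_ex)
  show be: "\<bottom> = b" using bt cl by (intro le_antisym) auto
  show te: "\<top> = t" using bt cl by (intro le_antisym) auto
  show "boolean_lattice L"
  proof unfold_locales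
    fix x y z assume x: "x \<in> carrier L" "y \<in> carrier L" "z \<in> carrier L"
    have "m x (j y z) \<sqsubseteq> j (m x y) (m x z)" using d x .
    moreover have "j (m x y) (m x z) \<sqsubseteq> m x (j y z)"
    proof -
      have *: "m x y \<sqsubseteq> x" "m x z \<sqsubseteq> x" "m x y \<sqsubseteq> y" "m x z \<sqsubseteq> z" using x m[of x y "m x y"] m[of x z "m x z"] cl by auto
      have "y \<sqsubseteq> j y z" "z \<sqsubseteq> j y z" using x j[of y z "j y z"] cl by auto
      then have "m x y \<sqsubseteq> j y z" "m x z \<sqsubseteq> j y z" using * x cl by (meson le_trans)+
      then show ?thesis using * x cl by (simp add: m j)
    qed
    ultimately show "x \<sqinter> (y \<squnion> z) = (x \<sqinter> y) \<squnion> (x \<sqinter> z)"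
      using x cl by (simp add: me je le_antisym)
  next
    fix x assume x: "x \<in> carrier L"
    have "m x (n x) = b" using n bt cl x by (intro le_antisym) auto
    moreover have "j x (n x) = t" using n bt cl x by (intro le_antisym) auto
    ultimately show "\<exists>y\<in>carrier L. x \<sqinter> y = \<bottom> \<and> x \<squnion> y = \<top>" 
      using x cl by (intro bexI[of _ "n x"]) (auto simp: be te me je)
  qed
qed

definition bcompl :: "('a, 'z) gorder_scheme \<Rightarrow> 'a \<Rightarrow> 'a"
  where "bcompl L x = (THE y. y \<in> carrier L \<and> x \<sqinter>\<^bsub>L\<^esub> y = \<bottom>\<^bsub>L\<^esub> \<and> x \<squnion>\<^bsub>L\<^esub> y = \<top>\<^bsub>L\<^esub>)"

context boolean_lattice begin

lemma meet_iff: "\<lbrakk>x \<in> carrier L; y \<in> carrier L; z \<in> carrier L\<rbrakk> \<Longrightarrow> z \<sqsubseteq> x \<sqinter> y \<longleftrightarrow> z \<sqsubseteq> x \<and> z \<sqsubseteq> y"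
  by (meson meet_le meet_left meet_right le_trans meet_closed)

lemma join_iff: "\<lbrakk>x \<in> carrier L; y \<in> carrier L; z \<in> carrier L\<rbrakk> \<Longrightarrow> x \<squnion> y \<sqsubseteq> z \<longleftrightarrow> x \<sqsubseteq> z \<and> y \<sqsubseteq> z"
  by (meson join_le join_left join_right le_trans join_closed)

lemma meet_eq: "\<lbrakk>x \<in> carrier L; y \<in> carrier L\<rbrakk> \<Longrightarrow> x \<sqsubseteq> y \<Longrightarrow> x \<sqinter> y = x"
  by (rule le_antisym) (auto simp: meet_iff meet_left)

lemma compl_unique:
  assumes "x \<in> carrier L" "y \<in> carrier L" "y' \<in> carrier L"
    "x \<sqinter> y = \<bottom>" "x \<squnion> y = \<top>" "x \<sqinter> y' = \<bottom>" "x \<squnion> y' = \<top>"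
  shows "y = y'"
proof -
  have *: "u \<sqsubseteq> v" if "u \<in> carrier L" "v \<in> carrier L" "x \<sqinter> u = \<bottom>" "x \<squnion> v = \<top>" for u v
  proof -
    have "u = u \<sqinter> (x \<squnion> v)" using that assms(1) by (simp add: meet_eq)
    also have "\<dots> = (u \<sqinter> x) \<squnion> (u \<sqinter> v)" using that(1,2) assms(1) by (intro meet_distrib)
    also have "u \<sqinter> x = \<bottom>" using that meet_comm by metis
    also have "\<bottom> \<squnion> (u \<sqinter> v) \<sqsubseteq> v" using that by (simp add: join_iff meet_right)
    finally show ?thesis .
  qed
  show ?thesis using assms * by (intro le_antisym) auto
qed

lemma compl_facts:
  assumes "x \<in> carrier L"
  shows "bcompl L x \<in> carrier L" "x \<sqinter> bcompl L x = \<bottom>" "x \<squnion> bcompl L x = \<top>"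
proof -
  have "\<exists>!y. y \<in> carrier L \<and> x \<sqinter> y = \<bottom> \<and> x \<squnion> y = \<top>"
    using complement[OF assms] compl_unique[OF assms] by blast
  from theI'[OF this] show "bcompl L x \<in> carrier L" "x \<sqinter> bcompl L x = \<bottom>" "x \<squnion> bcompl L x = \<top>"
    unfolding bcompl_def by auto
qed

lemma cases_le:
  assumes "s \<in> carrier L" "u \<in> carrier L" "t \<in> carrier L"
    "u \<sqinter> s \<sqsubseteq> t" "u \<sqinter> bcompl L s \<sqsubseteq> t"
  shows "u \<sqsubseteq> t"
proof -
  have "u = u \<sqinter> (s \<squnion> bcompl L s)" using assms by (simp add: compl_facts meet_eq)
  also have "\<dots> = (u \<sqinter> s) \<squnion> (u \<sqinter> bcompl L s)" using assms by (intro meet_distrib compl_facts)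
  also have "\<dots> \<sqsubseteq> t" using assms by (simp add: join_iff compl_facts)
  finally show ?thesis .
qed

lemma residual:
  assumes "u \<in> carrier L" "c \<in> carrier L" "t \<in> carrier L"
  shows "u \<sqinter> c \<sqsubseteq> t \<longleftrightarrow> c \<sqsubseteq> bcompl L u \<squnion> t"
proof
  assume *: "u \<sqinter> c \<sqsubseteq> t"
  note cl = compl_facts[OF assms(1)]
  show "c \<sqsubseteq> bcompl L u \<squnion> t"
  proof (rule cases_le[of u])
    show "c \<sqinter> u \<sqsubseteq> bcompl L u \<squnion> t"
      using * assms cl by (metis join_right le_trans meet_comm join_closed meet_closed)
    show "c \<sqinter> bcompl L u \<sqsubseteq> bcompl L u \<squnion> t"
      using assms cl by (meson join_left le_trans meet_right join_closed meet_closed)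
  qed (use assms cl in auto)
next
  assume *: "c \<sqsubseteq> bcompl L u \<squnion> t"
  note cl = compl_facts[OF assms(1)]
  have "u \<sqinter> c \<sqsubseteq> u \<sqinter> (bcompl L u \<squnion> t)"
    using assms cl le_trans[OF meet_right[OF assms(1,2)] *] meet_left[OF assms(1,2)]
    by (simp add: meet_iff)
  also have "u \<sqinter> (bcompl L u \<squnion> t) = \<bottom> \<squnion> (u \<sqinter> t)" using assms cl by (simp add: meet_distrib)
  also have "\<dots> \<sqsubseteq> t" using assms by (simp add: join_iff meet_right)
  finally show "u \<sqinter> c \<sqsubseteq> t" using assms cl by auto
qed

end

lemma bool_hom_compl:
  assumes "boolean_lattice L" "boolean_lattice L'" "bool_hom L L' h" "x \<in> carrier L"
  shows "h (bcompl L x) = bcompl L' (h x)"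
proof -
  interpret L: boolean_lattice L by fact
  interpret L': boolean_lattice L' by fact
  note c = L.compl_facts[OF assms(4)]
  have hx: "h x \<in> carrier L'" "h (bcompl L x) \<in> carrier L'" using assms c by (auto simp: bool_hom_def)
  have e: "h x \<sqinter>\<^bsub>L'\<^esub> h (bcompl L x) = h (x \<sqinter>\<^bsub>L\<^esub> bcompl L x)" "h x \<squnion>\<^bsub>L'\<^esub> h (bcompl L x) = h (x \<squnion>\<^bsub>L\<^esub> bcompl L x)"
    using assms c(1) by (auto simp: bool_hom_def)
  have "h \<bottom>\<^bsub>L\<^esub> = \<bottom>\<^bsub>L'\<^esub>" "h \<top>\<^bsub>L\<^esub> = \<top>\<^bsub>L'\<^esub>" using assms by (auto simp: bool_hom_def)
  then have "h x \<sqinter>\<^bsub>L'\<^esub> h (bcompl L x) = \<bottom>\<^bsub>L'\<^esub>" "h x \<squnion>\<^bsub>L'\<^esub> h (bcompl L x) = \<top>\<^bsub>L'\<^esub>"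
    unfolding e c by auto
  then show ?thesis
    using L'.compl_unique[OF hx(1,2) L'.compl_facts(1)[OF hx(1)]] L'.compl_facts[OF hx(1)] by metis
qed

context lambda_boolean begin

lemma sup_least:
  assumes "S \<subseteq> carrier L" "|S| <o r"
  shows "least L (\<Squnion> S) (Upper L S)"
  using small_joins[OF assms] unfolding sup_def by (rule someI_ex)

lemma sup_closed: "\<lbrakk>S \<subseteq> carrier L; |S| <o r\<rbrakk> \<Longrightarrow> \<Squnion> S \<in> carrier L"
  using sup_least least_closed by (metis Upper_closed)

lemma sup_iff:
  assumes "S \<subseteq> carrier L" "|S| <o r" "t \<in> carrier L"
  shows "\<Squnion> S \<sqsubseteq> t \<longleftrightarrow> (\<forall>x\<in>S. x \<sqsubseteq> t)"
proof
  assume *: "\<Squnion> S \<sqsubseteq> t"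
  show "\<forall>x\<in>S. x \<sqsubseteq> t"
  proof
    fix x assume x: "x \<in> S"
    have "x \<sqsubseteq> \<Squnion> S" using least_Upper_above[OF sup_least[OF assms(1,2)] x assms(1)] .
    then show "x \<sqsubseteq> t" using * x assms sup_closed[OF assms(1,2)] le_trans by blast
  qed
next
  assume "\<forall>x\<in>S. x \<sqsubseteq> t"
  then show "\<Squnion> S \<sqsubseteq> t"
    using sup_least[OF assms(1,2)] assms by (auto simp: least_def Upper_def)
qed

end

lemma (in partial_order) sup_eqI:
  assumes "S \<subseteq> carrier L" "x \<in> carrier L" "\<And>t. t \<in> carrier L \<Longrightarrow> x \<sqsubseteq> t \<longleftrightarrow> (\<forall>y\<in>S. y \<sqsubseteq> t)"
  shows "least L x (Upper L S)" "\<Squnion> S = x"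
proof -
  show l: "least L x (Upper L S)" using assms assms(3)[of x] by (auto simp: least_def Upper_def)
  then show "\<Squnion> S = x" unfolding sup_def using least_unique by (metis someI_ex)
qed

lemma small_image: "|I| <o r \<Longrightarrow> |f ` I| <o r"
  using card_of_image ordLeq_ordLess_trans by blast

lemma (in category) Hom_Obj: "f \<in> Hom C A B \<Longrightarrow> A \<in> Obj C \<and> B \<in> Obj C"
  using Dom_Obj Cod_Obj by (auto simp: Hom_def)

lemma pushout_Hom:
  assumes "pushout C i f f' i'"
  shows "i \<in> Hom C (Dom C i) (Cod C i)" "f \<in> Hom C (Dom C i) (Cod C f)"
    "f' \<in> Hom C (Cod C i) (Cod C i')" "i' \<in> Hom C (Cod C f) (Cod C i')"
  using assms unfolding pushout_def Hom_def by auto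

definition Disj where "Disj s t = Neg (And (Neg s) (Neg t))"

definition cls_rep where "cls_rep x = (SOME s. s \<in> x)"

context
  fixes r :: "'k rel" and C :: "('o, 'm, 'z) cat_scheme" and K :: "'m set"
  assumes cat: "category C" and card: "Card_order r"
begin

interpretation category C by (rule cat)

private abbreviation (input) "FM \<equiv> is_fm r C K"
private abbreviation (input) "EN \<equiv> entails r C K"
private abbreviation (input) "cl \<equiv> \<lambda>A s. fm_rel r C K A `` {s}"
private abbreviation (input) "IA \<equiv> initial_over r C K"

lemma FM_Obj: "FM A s \<Longrightarrow> A \<in> Obj C"
  by (induction rule: is_fm.induct) (auto dest: Hom_Obj)

lemma FM_JoinD: "FM A (Join I s) \<Longrightarrow> k \<in> I \<Longrightarrow> FM A (s k)"
  and FM_JoinD2: "FM A (Join I s) \<Longrightarrow> |I| <o r"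
  by (auto elim: is_fm.cases)

lemma EN_FM: "EN A s t \<Longrightarrow> FM A s \<and> FM A t"
proof (induction rule: entails.induct)
  case (en_Sub_Join f A B I s)
  then show ?case
    by (auto intro!: is_fm.intros dest: Hom_Obj FM_JoinD FM_JoinD2 intro: fm_Sub)
next
  case (en_BC i i' f f' s)
  note p = pushout_Hom[OF en_BC(3)]
  show ?case using p en_BC by (auto intro!: fm_Sub[OF p(2)] fm_Ex[OF _ p(1)] fm_Ex[OF _ p(4)] fm_Sub[OF p(3)])
next
  case (en_comp1 f A B g D s) then show ?case by (metis compo_Hom fm_Sub)
next
  case (en_comp2 f A B g D s) then show ?case by (metis compo_Hom fm_Sub)
next
  case (en_ident1 A s) then show ?case by (metis ident_Hom fm_Sub FM_Obj)
next
  case (en_ident2 A s) then show ?case by (metis ident_Hom fm_Sub FM_Obj)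
next
  case (en_Sub_Fls f A B) then show ?case by (auto intro: is_fm.intros dest: Hom_Obj)
next
  case (en_JoinI A I s k) then show ?case using FM_JoinD by blast
qed (auto intro: is_fm.intros FM_Obj)

lemma en_top: assumes "FM A s" shows "EN A s (Neg Fls)"
proof -
  have f: "FM A Fls" "FM A (Neg Fls)" using FM_Obj[OF assms] by (auto intro: is_fm.intros)
  show ?thesis
    by (rule en_cases[OF f(1) assms en_trans[OF en_And2[OF assms f(1)] en_Fls[OF f(2)]]
      en_And2[OF assms f(2)]])
qed

lemma en_NegI: assumes "FM A s" "FM A u" "EN A (And u s) Fls" shows "EN A u (Neg s)"
  by (rule en_cases[OF assms(1,2) en_trans[OF assms(3) en_Fls[OF fm_Neg[OF assms(1)]]]
    en_And2[OF assms(2) fm_Neg[OF assms(1)]]])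

lemma en_contrI:
  assumes "EN A u s" "EN A u (Neg s)" "FM A t" shows "EN A u t"
  by (rule en_trans[OF en_trans[OF en_And[OF assms(1,2)] en_contr] en_Fls[OF assms(3)]])
    (use EN_FM[OF assms(1)] in blast)

lemma FM_Or: "FM A s \<Longrightarrow> FM A t \<Longrightarrow> FM A (Disj s t)"
  unfolding Disj_def by (intro is_fm.intros)

lemma en_Or1: assumes "FM A s" "FM A t" shows "EN A s (Disj s t)"
  unfolding Disj_def
proof (rule en_NegI)
  have f: "FM A (Neg s)" "FM A (Neg t)" "FM A (And (Neg s) (Neg t))" "FM A Fls"
    using assms FM_Obj by (auto intro: is_fm.intros)
  show "EN A (And s (And (Neg s) (Neg t))) Fls"
    by (rule en_contrI[OF en_And1 en_trans[OF en_And2 en_And1]]) (use assms f in auto)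
qed (use assms in \<open>auto intro: is_fm.intros\<close>)

lemma en_Or2: assumes "FM A s" "FM A t" shows "EN A t (Disj s t)"
  unfolding Disj_def
proof (rule en_NegI)
  have f: "FM A (Neg s)" "FM A (Neg t)" "FM A (And (Neg s) (Neg t))" "FM A Fls"
    using assms FM_Obj by (auto intro: is_fm.intros)
  show "EN A (And t (And (Neg s) (Neg t))) Fls"
    by (rule en_contrI[OF en_And1 en_trans[OF en_And2 en_And2]]) (use assms f in auto)
qed (use assms in \<open>auto intro: is_fm.intros\<close>)

lemma en_contrapos: assumes "EN A s u" shows "EN A (Neg u) (Neg s)"
proof -
  have f: "FM A s" "FM A u" "FM A (Neg u)" using EN_FM[OF assms] by (auto intro: is_fm.intros)
  have "EN A (And (Neg u) s) Fls"
    by (rule en_contrI[OF en_trans[OF en_And2 assms] en_And1])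
      (use f FM_Obj in \<open>auto intro: is_fm.intros\<close>)
  then show ?thesis by (rule en_NegI[OF f(1,3)])
qed

lemma en_OrE: assumes "EN A s u" "EN A t u" shows "EN A (Disj s t) u"
proof (rule en_cases[of _ _ _ _ u])
  have f: "FM A s" "FM A t" "FM A u" using EN_FM assms by auto
  then have g: "FM A (Disj s t)" "FM A (Neg u)" by (auto intro: FM_Or is_fm.intros)
  show "EN A (And (Disj s t) u) u" by (rule en_And2[OF g(1) f(3)])
  have n: "EN A (And (Disj s t) (Neg u)) (And (Neg s) (Neg t))"
    by (rule en_trans[OF en_And2[OF g] en_And[OF en_contrapos[OF assms(1)] en_contrapos[OF assms(2)]]])
  then show "EN A (And (Disj s t) (Neg u)) u"
    using en_contrI[OF n[unfolded Disj_def] en_And1[OF g, unfolded Disj_def] f(3)] by (simp only: Disj_def)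
  show "FM A u" "FM A (Disj s t)" using f g by auto
qed

lemma en_split: assumes "FM A s" "FM A t" "FM A u" "EN A u (Disj s t)"
    "EN A (And u s) v" "EN A (And u t) v"
  shows "EN A u v"
proof (rule en_cases[of _ _ _ _ s])
  have v: "FM A v" using EN_FM[OF assms(5)] by simp
  have f: "FM A (Neg s)" "FM A (Neg t)" "FM A (And u (Neg s))"
     "FM A (And (And u (Neg s)) t)" "FM A (And (And u (Neg s)) (Neg t))"
    using assms(1-3) by (auto intro: is_fm.intros)
  show "EN A (And u (Neg s)) v"
  proof (rule en_cases[of _ _ _ _ t])
    have "EN A (And (And u (Neg s)) t) (And u t)"
      by (rule en_And[OF en_trans[OF en_And1[OF f(3) assms(2)] en_And1[OF assms(3) f(1)]]
        en_And2[OF f(3) assms(2)]])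
    then show "EN A (And (And u (Neg s)) t) v" by (rule en_trans[OF _ assms(6)])
    have u: "EN A (And (And u (Neg s)) (Neg t)) u"
      by (rule en_trans[OF en_And1[OF f(3,2)] en_And1[OF assms(3) f(1)]])
    have 1: "EN A (And (And u (Neg s)) (Neg t)) (And (Neg s) (Neg t))"
      by (rule en_And[OF en_trans[OF en_And1[OF f(3,2)] en_And2[OF assms(3) f(1)]]
        en_And2[OF f(3,2)]])
    show "EN A (And (And u (Neg s)) (Neg t)) v"
      by (rule en_contrI[OF 1 _ v]) (rule en_trans[OF u assms(4)[unfolded Disj_def]])
  qed (use f assms in auto)
qed (use assms in auto)

lemma en_distrib: assumes "FM A x" "FM A y" "FM A z"
  shows "EN A (And x (Disj y z)) (Disj (And x y) (And x z))"
proof (rule en_split[of _ y z])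
  have f: "FM A (Disj y z)" "FM A (And x (Disj y z))" "FM A (And x y)" "FM A (And x z)"
    using assms by (auto intro: is_fm.intros FM_Or)
  show "EN A (And x (Disj y z)) (Disj y z)" by (rule en_And2[OF assms(1) f(1)])
  have x: "EN A (And x (Disj y z)) x" by (rule en_And1[OF assms(1) f(1)])
  have "EN A (And (And x (Disj y z)) y) (And x y)" "EN A (And (And x (Disj y z)) z) (And x z)"
    by (intro en_And[OF en_trans[OF en_And1 x] en_And2] f assms)+
  then show "EN A (And (And x (Disj y z)) y) (Disj (And x y) (And x z))"
    "EN A (And (And x (Disj y z)) z) (Disj (And x y) (And x z))"
    using en_trans[OF _ en_Or1[OF f(3,4)]] en_trans[OF _ en_Or2[OF f(3,4)]] by auto
  show "FM A (And x (Disj y z))" using f by auto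
qed (use assms in auto)

lemma en_lem: assumes "FM A s" shows "EN A (Neg Fls) (Disj s (Neg s))"
proof (rule en_cases[of _ _ _ _ s])
  have f: "FM A (Neg s)" "FM A (Neg Fls)" using assms FM_Obj by (auto intro: is_fm.intros)
  show "EN A (And (Neg Fls) s) (Disj s (Neg s))" "EN A (And (Neg Fls) (Neg s)) (Disj s (Neg s))"
    by (rule en_trans[OF en_And2 en_Or1] en_trans[OF en_And2 en_Or2]; use f assms in simp)+
  show "FM A s" "FM A (Neg Fls)" using assms f by auto
qed

lemma en_JoinE': assumes "FM A (Join I s)" "FM A t" "\<And>k. k \<in> I \<Longrightarrow> EN A (s k) t"
  shows "EN A (Join I s) t"
proof -
  have t: "FM A (Neg Fls)" using FM_Obj[OF assms(2)] by (auto intro: is_fm.intros)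
  have "EN A (And (Neg Fls) (Join I s)) t"
  proof (rule en_JoinE[OF assms(1) t assms(2)])
    fix k assume "k \<in> I"
    then show "EN A (And (Neg Fls) (s k)) t"
      by (intro en_trans[OF en_And2[OF t] assms(3)] FM_JoinD[OF assms(1)])
  qed
  moreover have "EN A (Join I s) (And (Neg Fls) (Join I s))"
    by (rule en_And[OF en_top[OF assms(1)] en_refl[OF assms(1)]])
  ultimately show ?thesis by (rule en_trans[rotated])
qed

lemma rel_equiv: "A \<in> Obj C \<Longrightarrow> equiv {s. FM A s} (fm_rel r C K A)"
  unfolding fm_rel_def
  by (intro equivI refl_onI symI transI) (auto intro: en_refl en_trans dest: EN_FM)

lemma initial_carrier: "carrier (alg IA A) = cl A ` {s. FM A s}"
  by (auto simp: initial_over_def quot_order_def fm_order_def quotient_def)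

lemma cl_self: "FM A s \<Longrightarrow> s \<in> cl A s"
  by (auto simp: fm_rel_def intro: en_refl)

lemma cl_eq: "FM A s \<Longrightarrow> FM A t \<Longrightarrow> cl A s = cl A t \<longleftrightarrow> EN A s t \<and> EN A t s"
  unfolding fm_rel_def by (auto intro: en_refl en_trans) 

lemma le_cl: "FM A s \<Longrightarrow> FM A t \<Longrightarrow> cl A s \<sqsubseteq>\<^bsub>alg IA A\<^esub> cl A t \<longleftrightarrow> EN A s t"
  unfolding fm_rel_def
  by (auto simp: initial_over_def quot_order_def fm_order_def intro: en_trans en_refl)

lemma eq_alg: "eq (alg IA A) = (=)"
  by (simp add: initial_over_def quot_order_def)

lemma po: "A \<in> Obj C \<Longrightarrow> partial_order (alg IA A)"
  unfolding partial_order_def partial_order_axioms_def weak_partial_order_def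
    weak_partial_order_axioms_def equivalence_def
  by (auto simp: eq_alg initial_carrier le_cl intro: en_refl en_trans simp: cl_eq simp del: Image_singleton_iff
      cong del: image_cong_simp) (auto simp: fm_rel_def intro: en_trans)

lemma cls_rep: assumes "x \<in> carrier (alg IA A)" shows "FM A (cls_rep x)" "cl A (cls_rep x) = x"
proof -
  obtain s where s: "FM A s" "x = cl A s" using assms by (auto simp: initial_carrier)
  have "cls_rep x \<in> x" unfolding cls_rep_def using s cl_self by (metis someI_ex)
  then have e: "EN A s (cls_rep x)" "EN A (cls_rep x) s" using s by (auto simp: fm_rel_def)
  then show f: "FM A (cls_rep x)" using EN_FM by blast
  show "cl A (cls_rep x) = x" using s e cl_eq f by metis
qed

lemma rep_cl: "FM A s \<Longrightarrow> FM A (cls_rep (cl A s)) \<and> EN A s (cls_rep (cl A s)) \<and> EN A (cls_rep (cl A s)) s"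
proof -
  assume s: "FM A s"
  then have c: "cl A s \<in> carrier (alg IA A)" by (auto simp: initial_carrier)
  show ?thesis using cls_rep(1)[OF c] cl_eq[OF cls_rep(1)[OF c] s] cls_rep(2)[OF c] by blast
qed

lemma bool_IA:
  assumes A: "A \<in> Obj C"
  shows "boolean_lattice (alg IA A)"
    and meet_cl: "FM A s \<Longrightarrow> FM A t \<Longrightarrow> cl A s \<sqinter>\<^bsub>alg IA A\<^esub> cl A t = cl A (And s t)"
    and join_cl: "FM A s \<Longrightarrow> FM A t \<Longrightarrow> cl A s \<squnion>\<^bsub>alg IA A\<^esub> cl A t = cl A (Disj s t)"
    and bot_cl: "\<bottom>\<^bsub>alg IA A\<^esub> = cl A Fls" and top_cl: "\<top>\<^bsub>alg IA A\<^esub> = cl A (Neg Fls)"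
proof -
  let ?L = "alg IA A"
  let ?m = "\<lambda>x y. cl A (And (cls_rep x) (cls_rep y))" and ?j = "\<lambda>x y. cl A (Disj (cls_rep x) (cls_rep y))"
    and ?n = "\<lambda>x. cl A (Neg (cls_rep x))"
  have F: "FM A Fls" "FM A (Neg Fls)" using A by (auto intro: is_fm.intros)
  have cls_closed: "FM A s \<Longrightarrow> cl A s \<in> carrier ?L" for s by (simp add: initial_carrier)
  note intr = fm_And fm_Neg FM_Or rep_cl
  have leL: "x \<in> carrier ?L \<Longrightarrow> FM A t \<Longrightarrow> x \<sqsubseteq>\<^bsub>?L\<^esub> cl A t \<longleftrightarrow> EN A (cls_rep x) t" 
    and leR: "x \<in> carrier ?L \<Longrightarrow> FM A t \<Longrightarrow> cl A t \<sqsubseteq>\<^bsub>?L\<^esub> x \<longleftrightarrow> EN A t (cls_rep x)"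
    and leLR: "x \<in> carrier ?L \<Longrightarrow> y \<in> carrier ?L \<Longrightarrow> x \<sqsubseteq>\<^bsub>?L\<^esub> y \<longleftrightarrow> EN A (cls_rep x) (cls_rep y)" for x y t
    by (metis cls_rep le_cl)+
  note B = boolI[where L = ?L and m = ?m and j = ?j and n = ?n and b = "cl A Fls" and t = "cl A (Neg Fls)"]
  have 1: "partial_order ?L" by (rule po[OF A])
  have 2: "?m x y \<in> carrier ?L" "?j x y \<in> carrier ?L"
    if "x \<in> carrier ?L" "y \<in> carrier ?L" for x y
    using that by (auto intro!: cls_closed intr dest: cls_rep)
  have n2: "?n x \<in> carrier ?L" if "x \<in> carrier ?L" for x
    using that by (auto intro!: cls_closed intr dest: cls_rep)
  have 3: "z \<sqsubseteq>\<^bsub>?L\<^esub> ?m x y \<longleftrightarrow> z \<sqsubseteq>\<^bsub>?L\<^esub> x \<and> z \<sqsubseteq>\<^bsub>?L\<^esub> y"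
    if "x \<in> carrier ?L" "y \<in> carrier ?L" "z \<in> carrier ?L" for x y z
    using that cls_rep(1)[OF that(1)] cls_rep(1)[OF that(2)] 
    by (auto simp: leL leLR fm_And intro: en_And en_trans[OF _ en_And1] en_trans[OF _ en_And2])
  have 4: "?j x y \<sqsubseteq>\<^bsub>?L\<^esub> z \<longleftrightarrow> x \<sqsubseteq>\<^bsub>?L\<^esub> z \<and> y \<sqsubseteq>\<^bsub>?L\<^esub> z"
    if "x \<in> carrier ?L" "y \<in> carrier ?L" "z \<in> carrier ?L" for x y z
    using that cls_rep(1)[OF that(1)] cls_rep(1)[OF that(2)] 
    by (auto simp: leR leLR FM_Or intro: en_OrE en_trans[OF en_Or1] en_trans[OF en_Or2])
  have 5: "cl A Fls \<sqsubseteq>\<^bsub>?L\<^esub> x" "x \<sqsubseteq>\<^bsub>?L\<^esub> cl A (Neg Fls)" if "x \<in> carrier ?L" for x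
    using that cls_rep(1)[OF that] by (auto simp: leL leR F intro: en_Fls en_top)
  have AndM: "EN A (And s t) (And s' t')" if "EN A s s'" "EN A t t'" for s t s' t'
    using that EN_FM[OF that(1)] EN_FM[OF that(2)] by (meson en_And en_And1 en_And2 en_trans)
  have OrM: "EN A (Disj s t) (Disj s' t')" if "EN A s s'" "EN A t t'" for s t s' t'
    using that EN_FM[OF that(1)] EN_FM[OF that(2)] by (meson en_OrE en_Or1 en_Or2 en_trans)
  have 6: "?m x (?j y z) \<sqsubseteq>\<^bsub>?L\<^esub> ?j (?m x y) (?m x z)"
    if x: "x \<in> carrier ?L" "y \<in> carrier ?L" "z \<in> carrier ?L" for x y z
  proof -
    note f = cls_rep(1)[OF x(1)] cls_rep(1)[OF x(2)] cls_rep(1)[OF x(3)]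
    note g = fm_And[OF f(1,2)] fm_And[OF f(1,3)] FM_Or[OF f(2,3)]
    show ?thesis
      unfolding le_cl[OF fm_And[OF f(1) rep_cl[OF g(3), THEN conjunct1]]
          FM_Or[OF rep_cl[OF g(1), THEN conjunct1] rep_cl[OF g(2), THEN conjunct1]]]
      using en_trans[OF AndM[OF en_refl[OF f(1)] rep_cl[OF g(3), THEN conjunct2, THEN conjunct2]]
          en_trans[OF en_distrib[OF f]
          OrM[OF rep_cl[OF g(1), THEN conjunct2, THEN conjunct1]
            rep_cl[OF g(2), THEN conjunct2, THEN conjunct1]]]] .
  qed
  have 7: "?m x (?n x) \<sqsubseteq>\<^bsub>?L\<^esub> cl A Fls" if x: "x \<in> carrier ?L" for x
  proof -
    note f = cls_rep(1)[OF x] note g = fm_Neg[OF f]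
    show ?thesis
      unfolding le_cl[OF fm_And[OF f rep_cl[OF g, THEN conjunct1]] F(1)]
      using en_trans[OF AndM[OF en_refl[OF f] rep_cl[OF g, THEN conjunct2, THEN conjunct2]]
          en_contr[OF f]] .
  qed
  have 8: "cl A (Neg Fls) \<sqsubseteq>\<^bsub>?L\<^esub> ?j x (?n x)" if x: "x \<in> carrier ?L" for x
  proof -
    note f = cls_rep(1)[OF x] note g = fm_Neg[OF f]
    show ?thesis
      unfolding le_cl[OF F(2) FM_Or[OF f rep_cl[OF g, THEN conjunct1]]]
      using en_trans[OF en_lem[OF f]
          OrM[OF en_refl[OF f] rep_cl[OF g, THEN conjunct2, THEN conjunct1]]] .
  qed
  note F' = cls_closed[OF F(1)] cls_closed[OF F(2)]
  have B2: "x \<sqinter>\<^bsub>?L\<^esub> y = ?m x y" if "x \<in> carrier ?L" "y \<in> carrier ?L" for x y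
    by (rule B(2); fact 1 2 n2 3 4 5 6 7 8 F' that)
  have B3: "x \<squnion>\<^bsub>?L\<^esub> y = ?j x y" if "x \<in> carrier ?L" "y \<in> carrier ?L" for x y
    by (rule B(3); fact 1 2 n2 3 4 5 6 7 8 F' that)
  show "boolean_lattice ?L" by (rule B(1); fact 1 2 n2 3 4 5 6 7 8 F')
  show "\<bottom>\<^bsub>?L\<^esub> = cl A Fls" by (rule B(4); fact 1 2 n2 3 4 5 6 7 8 F')
  show "\<top>\<^bsub>?L\<^esub> = cl A (Neg Fls)" by (rule B(5); fact 1 2 n2 3 4 5 6 7 8 F')
  show "cl A s \<sqinter>\<^bsub>?L\<^esub> cl A t = cl A (And s t)" if "FM A s" "FM A t"
  proof -
    have "cl A s \<sqinter>\<^bsub>?L\<^esub> cl A t = ?m (cl A s) (cl A t)"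
      by (rule B2) (use that cls_closed in auto)
    also have "\<dots> = cl A (And s t)"
      using that by (subst cl_eq) (auto intro!: intr AndM simp: rep_cl)
    finally show ?thesis .
  qed
  show "cl A s \<squnion>\<^bsub>?L\<^esub> cl A t = cl A (Disj s t)" if "FM A s" "FM A t"
  proof -
    have "cl A s \<squnion>\<^bsub>?L\<^esub> cl A t = ?j (cl A s) (cl A t)"
      by (rule B3) (use that cls_closed in auto)
    also have "\<dots> = cl A (Disj s t)"
      using that by (subst cl_eq) (auto intro!: intr OrM simp: rep_cl)
    finally show ?thesis .
  qed
qed


lemma EN_Or: assumes "EN A s s'" "EN A t t'" shows "EN A (Disj s t) (Disj s' t')"
proof -
  have f: "FM A s'" "FM A t'" using assms EN_FM by auto
  show ?thesis by (rule en_OrE[OF en_trans[OF assms(1) en_Or1[OF f]] en_trans[OF assms(2) en_Or2[OF f]]])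
qed

lemma EN_And: assumes "EN A s s'" "EN A t t'" shows "EN A (And s t) (And s' t')"
proof -
  have f: "FM A s" "FM A t" using assms EN_FM by auto
  show ?thesis by (rule en_And[OF en_trans[OF en_And1[OF f] assms(1)] en_trans[OF en_And2[OF f] assms(2)]])
qed

lemma cls_closed: "FM A s \<Longrightarrow> cl A s \<in> carrier (alg IA A)" by (simp add: initial_carrier)

lemma small_family:
  assumes "S \<subseteq> carrier (alg IA A)" "|S| <o r"
  obtains I :: "'k set" and s :: "'k \<Rightarrow> ('m, 'k) fm" where "|I| <o r" "\<And>k. k \<in> I \<Longrightarrow> FM A (s k)" "S = (\<lambda>k. cl A (s k)) ` I"
proof -
  have "|S| \<le>o |Field r|"
    using assms(2) card card_of_Field_ordIso ordIso_symmetric ordLeq_ordIso_trans ordLess_imp_ordLeq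
    by blast
  then obtain e where e: "inj_on e S" "e ` S \<subseteq> Field r" using card_of_ordLeq[of S "Field r"] by blast
  show thesis
  proof (rule that[of "e ` S" "\<lambda>k. cls_rep (inv_into S e k)"])
    show "|e ` S| <o r" using assms(2) by (rule small_image)
    show "FM A (cls_rep (inv_into S e k))" if "k \<in> e ` S" for k
      using that e assms(1) cls_rep(1) by (auto simp: inv_into_f_f)
    show "S = (\<lambda>k. cl A (cls_rep (inv_into S e k))) ` e ` S"
    proof -
      have "cl A (cls_rep (inv_into S e (e x))) = x" if "x \<in> S" for x
        unfolding inv_into_f_f[OF e(1) that] by (rule cls_rep(2)) (use that assms(1) in blast)
      then show ?thesis by (simp add: image_image)
    qed
  qed
qed

lemma sup_cl:
  assumes "A \<in> Obj C" "|I| <o r" "\<And>k. k \<in> I \<Longrightarrow> FM A (s k)"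
  shows "least (alg IA A) (cl A (Join I s)) (Upper (alg IA A) ((\<lambda>k. cl A (s k)) ` I))"
    "\<Squnion>\<^bsub>alg IA A\<^esub> ((\<lambda>k. cl A (s k)) ` I) = cl A (Join I s)"
proof -
  interpret partial_order "alg IA A" by (rule po[OF assms(1)])
  have J: "FM A (Join I s)" using assms by (rule fm_Join)
  have 1: "(\<lambda>k. cl A (s k)) ` I \<subseteq> carrier (alg IA A)" using assms cls_closed by auto
  have 2: "cl A (Join I s) \<sqsubseteq>\<^bsub>alg IA A\<^esub> t \<longleftrightarrow> (\<forall>y\<in>(\<lambda>k. cl A (s k)) ` I. y \<sqsubseteq>\<^bsub>alg IA A\<^esub> t)"
    if t: "t \<in> carrier (alg IA A)" for t
  proof -
    obtain u where u: "FM A u" "t = cl A u" using t by (auto simp: initial_carrier)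
    show ?thesis unfolding u(2) using u(1) J assms(3)
      by (auto simp: le_cl intro: en_JoinE' en_trans[OF en_JoinI[OF J]])
  qed
  show "least (alg IA A) (cl A (Join I s)) (Upper (alg IA A) ((\<lambda>k. cl A (s k)) ` I))"
    "\<Squnion>\<^bsub>alg IA A\<^esub> ((\<lambda>k. cl A (s k)) ` I) = cl A (Join I s)"
    using sup_eqI[OF 1 cls_closed[OF J] 2] by auto
qed

lemma lambda_IA: assumes "A \<in> Obj C" shows "lambda_boolean r (alg IA A)"
proof -
  interpret boolean_lattice "alg IA A" by (rule bool_IA(1)[OF assms])
  show ?thesis
  proof unfold_locales
    fix S assume S: "S \<subseteq> carrier (alg IA A)" "|S| <o r"
    obtain I :: "'k set" and s :: "'k \<Rightarrow> ('m, 'k) fm" where I: "|I| <o r" "\<And>k. k \<in> I \<Longrightarrow> FM A (s k)" "S = (\<lambda>k. cl A (s k)) ` I"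
      using small_family[OF S] by blast
    show "\<exists>s. least (alg IA A) s (Upper (alg IA A) S)"
      unfolding I(3) by (rule exI) (rule sup_cl(1)[OF assms I(1)], erule I(2))
  qed
qed

lemma act_cl: assumes "f \<in> Hom C A B" "FM A s" shows "act IA f (cl A s) = cl B (Sub f s)"
proof -
  have B: "Cod C f = B" using assms by (auto simp: Hom_def)
  have "cl B (Sub f x) = cl B (Sub f s)" if "x \<in> cl A s" for x
  proof -
    have x: "EN A s x" "EN A x s" using that by (auto simp: fm_rel_def)
    then have "FM A x" using EN_FM by blast
    then show ?thesis
      using cl_eq[OF fm_Sub[OF assms(1)] fm_Sub[OF assms]] en_Sub[OF assms(1)] x by blast
  qed
  then show ?thesis using cl_self[OF assms(2)]
    unfolding initial_over_def quot_map_def bafun.simps B by blast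
qed

lemma en_Ex:
  assumes "i \<in> K" "i \<in> Hom C A B" "EN B s t" shows "EN A (Ex i s) (Ex i t)"
proof -
  have t: "FM B t" "FM A (Ex i t)" using EN_FM[OF assms(3)] assms by (auto intro: fm_Ex)
  show ?thesis
    by (rule en_ExE[OF assms(1,2) t(2) en_trans[OF assms(3) en_ExI[OF assms(1,2) t(1) en_refl[OF t(2)]]]])
qed

lemma exq_cl:
  assumes "i \<in> K" "i \<in> Hom C A B" "FM B s" shows "exq IA i (cl B s) = cl A (Ex i s)"
proof -
  have A: "Dom C i = A" using assms by (auto simp: Hom_def)
  have "cl A (Ex i x) = cl A (Ex i s)" if "x \<in> cl B s" for x
  proof -
    have x: "EN B s x" "EN B x s" using that by (auto simp: fm_rel_def)
    then have "FM B x" using EN_FM by blast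
    then show ?thesis
      using cl_eq[OF fm_Ex[OF assms(1,2)] fm_Ex[OF assms]] en_Ex[OF assms(1,2)] x by blast
  qed
  then show ?thesis using cl_self[OF assms(3)]
    unfolding initial_over_def quot_map_def bafun.simps A by blast
qed

lemma en_Sub_Neg':
  assumes "f \<in> Hom C A B" "FM A s" shows "EN B (Sub f (Neg s)) (Neg (Sub f s))"
proof (rule en_NegI)
  note n = fm_Neg[OF assms(2)]
  have "EN A (And (Neg s) s) Fls"
    by (rule en_contrI[OF en_And2[OF n assms(2)] en_And1[OF n assms(2)]])
      (use FM_Obj[OF n] in \<open>auto intro: is_fm.intros\<close>)
  from en_trans[OF en_trans[OF en_Sub_And[OF assms(1) n assms(2)] en_Sub[OF assms(1) this]] en_Sub_Fls[OF assms(1)]]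
  show "EN B (And (Sub f (Neg s)) (Sub f s)) Fls" .
qed (use assms in \<open>auto intro: is_fm.intros\<close>)

lemma act_hom_IA: assumes f: "f \<in> Hom C A B" shows "lambda_hom r (alg IA A) (alg IA B) (act IA f)"
proof -
  have O: "A \<in> Obj C" "B \<in> Obj C" using Hom_Obj[OF f] by auto
  have F: "FM A Fls" "FM B Fls" "FM A (Neg Fls)" "FM B (Neg Fls)" using O by (auto intro: is_fm.intros)
  have el: "(\<And>s. FM A s \<Longrightarrow> P (cl A s)) \<Longrightarrow> x \<in> carrier (alg IA A) \<Longrightarrow> P x" for P x by (auto simp: initial_carrier)
  have Sb: "FM A s \<Longrightarrow> FM B (Sub f s)" for s using fm_Sub[OF f] .
  have c: "act IA f \<in> carrier (alg IA A) \<rightarrow> carrier (alg IA B)"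
    by (auto simp: initial_carrier act_cl[OF f] intro: Sb)
  have b: "act IA f \<bottom>\<^bsub>alg IA A\<^esub> = \<bottom>\<^bsub>alg IA B\<^esub>"
    unfolding bot_cl[OF O(1)] bot_cl[OF O(2)] act_cl[OF f F(1)]
    unfolding cl_eq[OF Sb[OF F(1)] F(2)] using en_Sub_Fls[OF f] en_Fls[OF Sb[OF F(1)]] by blast
  have t: "act IA f \<top>\<^bsub>alg IA A\<^esub> = \<top>\<^bsub>alg IA B\<^esub>"
    unfolding top_cl[OF O(1)] top_cl[OF O(2)] act_cl[OF f F(3)]
    unfolding cl_eq[OF Sb[OF F(3)] F(4)] using en_top[OF Sb[OF F(3)]]
      en_trans[OF en_contrapos[OF en_Sub_Fls[OF f]] en_Sub_Neg[OF f F(1)]] by blast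
  have mt: "act IA f (x \<sqinter>\<^bsub>alg IA A\<^esub> y) = act IA f x \<sqinter>\<^bsub>alg IA B\<^esub> act IA f y"
    if x: "x \<in> carrier (alg IA A)" and y: "y \<in> carrier (alg IA A)" for x y
  proof (rule el[OF _ x], rule el[OF _ y])
    fix s t assume s: "FM A s" and t: "FM A t"
    note st = fm_And[OF s t]
    show "act IA f (cl A s \<sqinter>\<^bsub>alg IA A\<^esub> cl A t) = act IA f (cl A s) \<sqinter>\<^bsub>alg IA B\<^esub> act IA f (cl A t)"
      unfolding meet_cl[OF O(1) s t] act_cl[OF f s] act_cl[OF f t] act_cl[OF f st] meet_cl[OF O(2) Sb[OF s] Sb[OF t]]
      unfolding cl_eq[OF Sb[OF st] fm_And[OF Sb[OF s] Sb[OF t]]]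
      using en_Sub_And[OF f s t] en_And[OF en_Sub[OF f en_And1[OF s t]] en_Sub[OF f en_And2[OF s t]]] by blast
  qed
  have jn: "act IA f (x \<squnion>\<^bsub>alg IA A\<^esub> y) = act IA f x \<squnion>\<^bsub>alg IA B\<^esub> act IA f y"
    if x: "x \<in> carrier (alg IA A)" and y: "y \<in> carrier (alg IA A)" for x y
  proof (rule el[OF _ x], rule el[OF _ y])
    fix s t assume s: "FM A s" and t: "FM A t"
    note st = FM_Or[OF s t] and n = fm_Neg[OF s] fm_Neg[OF t]
    have "EN B (Sub f (Disj s t)) (Disj (Sub f s) (Sub f t))"
      unfolding Disj_def
      by (rule en_trans[OF en_Sub_Neg'[OF f fm_And[OF n]] en_contrapos[OF
        en_trans[OF EN_And[OF en_Sub_Neg[OF f s] en_Sub_Neg[OF f t]] en_Sub_And[OF f n]]]])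
    moreover have "EN B (Disj (Sub f s) (Sub f t)) (Sub f (Disj s t))"
      by (rule en_OrE[OF en_Sub[OF f en_Or1[OF s t]] en_Sub[OF f en_Or2[OF s t]]])
    ultimately show "act IA f (cl A s \<squnion>\<^bsub>alg IA A\<^esub> cl A t) = act IA f (cl A s) \<squnion>\<^bsub>alg IA B\<^esub> act IA f (cl A t)"
      unfolding join_cl[OF O(1) s t] act_cl[OF f s] act_cl[OF f t] act_cl[OF f st] join_cl[OF O(2) Sb[OF s] Sb[OF t]]
      unfolding cl_eq[OF Sb[OF st] FM_Or[OF Sb[OF s] Sb[OF t]]] by blast
  qed
  have sp: "act IA f (\<Squnion>\<^bsub>alg IA A\<^esub> S) = \<Squnion>\<^bsub>alg IA B\<^esub> (act IA f ` S)"
    if S: "S \<subseteq> carrier (alg IA A)" "|S| <o r" for S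
  proof -
    obtain I :: "'k set" and s :: "'k \<Rightarrow> ('m, 'k) fm" where I: "|I| <o r" "\<And>k. k \<in> I \<Longrightarrow> FM A (s k)" "S = (\<lambda>k. cl A (s k)) ` I"
      using small_family[OF S] by blast
    have J: "FM A (Join I s)" by (rule fm_Join[OF O(1) I(1)]) (rule I(2))
    have J2: "FM B (Join I (\<lambda>k. Sub f (s k)))" by (rule fm_Join[OF O(2) I(1)]) (intro Sb I(2))
    have S1: "\<Squnion>\<^bsub>alg IA A\<^esub> S = cl A (Join I s)"
      unfolding I(3) by (rule sup_cl(2)[OF O(1) I(1)]) (rule I(2))
    have "act IA f ` S = (\<lambda>k. cl B (Sub f (s k))) ` I"
      unfolding I(3) image_image using act_cl[OF f] I(2) by simp
    then have "\<Squnion>\<^bsub>alg IA B\<^esub> (act IA f ` S) = cl B (Join I (\<lambda>k. Sub f (s k)))"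
      by (simp only:) (rule sup_cl(2)[OF O(2) I(1)], intro Sb I(2))
    moreover have "act IA f (\<Squnion>\<^bsub>alg IA A\<^esub> S) = cl B (Sub f (Join I s))"
      unfolding S1 act_cl[OF f J] ..
    moreover have "EN B (Join I (\<lambda>k. Sub f (s k))) (Sub f (Join I s))"
      by (rule en_JoinE'[OF J2 Sb[OF J]]) (rule en_Sub[OF f en_JoinI[OF J]])
    ultimately show ?thesis using cl_eq[OF Sb[OF J] J2] en_Sub_Join[OF f J] by simp
  qed
  show ?thesis unfolding lambda_hom_def bool_hom_def using c b t mt jn sp by blast
qed

lemma initial_over_lambda: "lambda_boolean_over r C K IA"
proof (intro lambda_boolean_over.intro lambda_boolean_over_axioms.intro)
  show "category C" by (rule cat)
  show "lambda_boolean r (alg IA A)" if "A \<in> Obj C" for A using that by (rule lambda_IA)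
  show "lambda_hom r (alg IA A) (alg IA B) (act IA f)" if "f \<in> Hom C A B" for f A B
    using that by (rule act_hom_IA)
next
  fix A x assume A: "A \<in> Obj C" and "x \<in> carrier (alg IA A)"
  then obtain s where s: "FM A s" "x = cl A s" by (auto simp: initial_carrier)
  note i = ident_Hom[OF A]
  show "act IA (ident C A) x = x"
    unfolding s(2) act_cl[OF i s(1)] cl_eq[OF fm_Sub[OF i s(1)] s(1)]
    using en_ident1[OF s(1)] en_ident2[OF s(1)] by blast
next
  fix f A B g D x assume f: "f \<in> Hom C A B" and g: "g \<in> Hom C B D" and "x \<in> carrier (alg IA A)"
  then obtain s where s: "FM A s" "x = cl A s" by (auto simp: initial_carrier)
  note h = compo_Hom[OF f g]
  show "act IA (g \<cdot>\<^bsub>C\<^esub> f) x = act IA g (act IA f x)"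
    unfolding s(2) act_cl[OF f s(1)] act_cl[OF g fm_Sub[OF f s(1)]] act_cl[OF h s(1)]
      cl_eq[OF fm_Sub[OF h s(1)] fm_Sub[OF g fm_Sub[OF f s(1)]]]
    using en_comp1[OF f g s(1)] en_comp2[OF f g s(1)] by blast
next
  fix i A B y assume i: "i \<in> K" "i \<in> Hom C A B" and "y \<in> carrier (alg IA B)"
  then obtain s where s: "FM B s" "y = cl B s" by (auto simp: initial_carrier)
  show "exq IA i y \<in> carrier (alg IA A)"
    unfolding s(2) exq_cl[OF i s(1)] by (rule cls_closed[OF fm_Ex[OF i s(1)]])
  fix x assume "x \<in> carrier (alg IA A)"
  then obtain t where t: "FM A t" "x = cl A t" by (auto simp: initial_carrier)
  show "exq IA i y \<sqsubseteq>\<^bsub>alg IA A\<^esub> x \<longleftrightarrow> y \<sqsubseteq>\<^bsub>alg IA B\<^esub> act IA i x"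
    unfolding s(2) t(2) exq_cl[OF i s(1)] act_cl[OF i(2) t(1)] le_cl[OF fm_Ex[OF i s(1)] t(1)]
      le_cl[OF s(1) fm_Sub[OF i(2) t(1)]]
    using en_ExE[OF i t(1)] en_ExI[OF i s(1)] by blast
next
  fix i i' f f' y assume i: "i \<in> K" "i' \<in> K" and p: "pushout C i f f' i'"
    and "y \<in> carrier (alg IA (Cod C i))"
  then obtain s where s: "FM (Cod C i) s" "y = cl (Cod C i) s" by (auto simp: initial_carrier)
  note h = pushout_Hom[OF p]
  have sq: "f' \<cdot>\<^bsub>C\<^esub> i = i' \<cdot>\<^bsub>C\<^esub> f" using p by (auto simp: pushout_def)
  note e = fm_Ex[OF i(1) h(1) s(1)] and u = fm_Sub[OF h(3) s(1)]
  note se = fm_Sub[OF h(2) e] and eu = fm_Ex[OF i(2) h(4) u]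
  have "EN (Cod C i) s (Sub i (Ex i s))" by (rule en_ExI[OF i(1) h(1) s(1) en_refl[OF e]])
  from en_Sub[OF h(3) this]
  have "EN (Cod C i') (Sub f' s) (Sub f' (Sub i (Ex i s)))" .
  from en_trans[OF en_trans[OF this en_comp2[OF h(1,3) e]] en_comp1[OF h(2,4) e, folded sq]]
  have "EN (Cod C i') (Sub f' s) (Sub i' (Sub f (Ex i s)))" .
  then have "EN (Cod C f) (Ex i' (Sub f' s)) (Sub f (Ex i s))"
    by (rule en_ExE[OF i(2) h(4) se])
  moreover have "EN (Cod C f) (Sub f (Ex i s)) (Ex i' (Sub f' s))" by (rule en_BC[OF i p s(1)])
  ultimately show "act IA f (exq IA i y) = exq IA i' (act IA f' y)"
    unfolding s(2) exq_cl[OF i(1) h(1) s(1)] act_cl[OF h(3) s(1)] act_cl[OF h(2) e] exq_cl[OF i(2) h(4) u]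
      cl_eq[OF se eu] by blast
qed

end

primrec fm_eval :: "('o, 'm, 'z) cat_scheme \<Rightarrow> ('o, 'm, 'b) bafun \<Rightarrow> ('m, 'k) fm \<Rightarrow> 'o \<Rightarrow> 'b"
  where
    "fm_eval C P Fls A = \<bottom>\<^bsub>alg P A\<^esub>"
  | "fm_eval C P (Neg s) A = bcompl (alg P A) (fm_eval C P s A)"
  | "fm_eval C P (And s t) A = fm_eval C P s A \<sqinter>\<^bsub>alg P A\<^esub> fm_eval C P t A"
  | "fm_eval C P (Join I s) A = \<Squnion>\<^bsub>alg P A\<^esub> ((\<lambda>k. fm_eval C P (s k) A) ` I)"
  | "fm_eval C P (Sub f s) A = act P f (fm_eval C P s (Dom C f))"
  | "fm_eval C P (Ex i s) A = exq P i (fm_eval C P s (Cod C i))"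

lemma bool_hom_mono:
  assumes "boolean_lattice L" "boolean_lattice L'" "bool_hom L L' h" "x \<in> carrier L" "y \<in> carrier L"
    "x \<sqsubseteq>\<^bsub>L\<^esub> y"
  shows "h x \<sqsubseteq>\<^bsub>L'\<^esub> h y"
proof -
  interpret L: boolean_lattice L by fact
  interpret L': boolean_lattice L' by fact
  have "h x \<in> carrier L'" "h y \<in> carrier L'" using assms by (auto simp: bool_hom_def)
  moreover have "h x = h x \<sqinter>\<^bsub>L'\<^esub> h y"
    using assms L.meet_eq[OF assms(4-6)] unfolding bool_hom_def by metis
  ultimately show ?thesis by (metis L'.meet_right)
qed

context lambda_boolean_over begin

context assumes card: "Card_order r" begin

lemma act_closed: "f \<in> Hom C A B \<Longrightarrow> x \<in> carrier (alg P A) \<Longrightarrow> act P f x \<in> carrier (alg P B)"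
  using act_hom unfolding lambda_hom_def bool_hom_def by blast

lemma ev_closed: "is_fm r C K A s \<Longrightarrow> fm_eval C P s A \<in> carrier (alg P A)"
proof (induction rule: is_fm.induct)
  case (fm_Fls A)
  interpret lambda_boolean r "alg P A" using alg_lambda fm_Fls by auto
  show ?case by simp
next
  case (fm_Neg A s)
  interpret lambda_boolean r "alg P A" using alg_lambda FM_Obj[OF category_axioms card fm_Neg(1)] by auto
  show ?case using fm_Neg compl_facts by simp
next
  case (fm_And A s t)
  interpret lambda_boolean r "alg P A" using alg_lambda FM_Obj[OF category_axioms card fm_And(1)] by auto
  show ?case using fm_And by simp
next
  case (fm_Join A I s)
  interpret lambda_boolean r "alg P A" using alg_lambda fm_Join by auto
  show ?case using fm_Join by (auto intro!: sup_closed small_image)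
next
  case (fm_Sub f A B s)
  then show ?case using act_closed by (auto simp: Hom_def)
next
  case (fm_Ex i A B s)
  then show ?case using exq_closed by (auto simp: Hom_def)
qed

lemma act_mono:
  assumes f: "f \<in> Hom C A B" and "x \<in> carrier (alg P A)" "y \<in> carrier (alg P A)" "x \<sqsubseteq>\<^bsub>alg P A\<^esub> y"
  shows "act P f x \<sqsubseteq>\<^bsub>alg P B\<^esub> act P f y"
proof -
  have "boolean_lattice (alg P A)" "boolean_lattice (alg P B)"
    using alg_lambda Hom_Obj[OF f] unfolding lambda_boolean_def by auto
  then show ?thesis using bool_hom_mono assms act_hom[OF f] unfolding lambda_hom_def by metis
qed

lemma ev_sound: "entails r C K A s t \<Longrightarrow> fm_eval C P s A \<sqsubseteq>\<^bsub>alg P A\<^esub> fm_eval C P t A"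
proof (induction rule: entails.induct)
  case (en_refl A s)
  interpret lambda_boolean r "alg P A" using alg_lambda FM_Obj[OF category_axioms card en_refl(1)] by auto
  show ?case using en_refl ev_closed by auto
next
  case (en_trans A s t u)
  note F = EN_FM[OF category_axioms card en_trans(1)] EN_FM[OF category_axioms card en_trans(2)]
  interpret lambda_boolean r "alg P A" using alg_lambda FM_Obj[OF category_axioms card] F by auto
  show ?case using le_trans[OF en_trans(3,4)] F ev_closed by auto
next
  case (en_Fls A s)
  interpret lambda_boolean r "alg P A" using alg_lambda FM_Obj[OF category_axioms card en_Fls(1)] by auto
  show ?case using ev_closed[OF en_Fls] by simp
next
  case (en_And1 A s t)
  interpret lambda_boolean r "alg P A" using alg_lambda FM_Obj[OF category_axioms card en_And1(1)] by auto
  show ?case using en_And1[THEN ev_closed] by (simp add: meet_left)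
next
  case (en_And2 A s t)
  interpret lambda_boolean r "alg P A" using alg_lambda FM_Obj[OF category_axioms card en_And2(1)] by auto
  show ?case using en_And2[THEN ev_closed] by (simp add: meet_right)
next
  case (en_And A u s t)
  note F = EN_FM[OF category_axioms card en_And(1)] EN_FM[OF category_axioms card en_And(2)]
  interpret lambda_boolean r "alg P A" using alg_lambda FM_Obj[OF category_axioms card] F by auto
  show ?case using en_And F ev_closed by (simp add: meet_iff)
next
  case (en_contr A s)
  interpret lambda_boolean r "alg P A" using alg_lambda FM_Obj[OF category_axioms card en_contr(1)] by auto
  show ?case using ev_closed[OF en_contr] by (simp add: compl_facts)
next
  case (en_cases A s u t)
  interpret lambda_boolean r "alg P A" using alg_lambda FM_Obj[OF category_axioms card en_cases(1)] by auto
  note t = EN_FM[OF category_axioms card en_cases(3), THEN conjunct2]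
  show ?case
    using cases_le[OF ev_closed[OF en_cases(1)] ev_closed[OF en_cases(2)] ev_closed[OF t]] en_cases(5,6)
    by simp
next
  case (en_JoinI A I s k)
  interpret lambda_boolean r "alg P A" using alg_lambda FM_Obj[OF category_axioms card en_JoinI(1)] by auto
  have I: "|I| <o r" "\<And>k. k \<in> I \<Longrightarrow> is_fm r C K A (s k)" using en_JoinI by (auto elim: is_fm.cases)
  have S: "(\<lambda>k. fm_eval C P (s k) A) ` I \<subseteq> carrier (alg P A)" using I ev_closed by auto
  show ?case using sup_iff[OF S small_image[OF I(1)] sup_closed[OF S small_image[OF I(1)]]]
      sup_closed[OF S small_image[OF I(1)]] en_JoinI(2) by simp
next
  case (en_JoinE A I s u t)
  interpret lambda_boolean r "alg P A" using alg_lambda FM_Obj[OF category_axioms card en_JoinE(1)] by auto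
  have I: "|I| <o r" "\<And>k. k \<in> I \<Longrightarrow> is_fm r C K A (s k)" using en_JoinE by (auto elim: is_fm.cases)
  have S: "(\<lambda>k. fm_eval C P (s k) A) ` I \<subseteq> carrier (alg P A)" using I ev_closed by auto
  note u = ev_closed[OF en_JoinE(2)] ev_closed[OF en_JoinE(3)]
  show ?case using en_JoinE(5) u S ev_closed[OF I(2)] compl_facts(1)[OF u(1)]
    by (simp add: residual sup_iff[OF S small_image[OF I(1)]] sup_closed[OF S small_image[OF I(1)]])
next
  case (en_Sub f A B s t)
  then show ?case using act_mono[OF en_Sub(1)] EN_FM[OF category_axioms card en_Sub(2)] ev_closed
    by (auto simp: Hom_def)
next
  case (en_ident1 A s)
  note A = FM_Obj[OF category_axioms card en_ident1(1)]
  interpret lambda_boolean r "alg P A" using alg_lambda A by auto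
  show ?case using act_ident[OF A ev_closed[OF en_ident1]] ident_Hom[OF A] ev_closed[OF en_ident1]
    by (simp add: Hom_def)
next
  case (en_ident2 A s)
  note A = FM_Obj[OF category_axioms card en_ident2(1)]
  interpret lambda_boolean r "alg P A" using alg_lambda A by auto
  show ?case using act_ident[OF A ev_closed[OF en_ident2]] ident_Hom[OF A] ev_closed[OF en_ident2]
    by (simp add: Hom_def)
next
  case (en_comp1 f A B g D s)
  note h = compo_Hom[OF en_comp1(1,2)]
  interpret lambda_boolean r "alg P D" using alg_lambda Hom_Obj[OF h] by auto
  have "Dom C f = A" "Dom C g = B" "Dom C (g \<cdot>\<^bsub>C\<^esub> f) = A" using en_comp1 h by (auto simp: Hom_def)
  then show ?case using act_comp[OF en_comp1(1,2) ev_closed[OF en_comp1(3)]]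
      act_closed[OF h ev_closed[OF en_comp1(3)]] by simp
next
  case (en_comp2 f A B g D s)
  note h = compo_Hom[OF en_comp2(1,2)]
  interpret lambda_boolean r "alg P D" using alg_lambda Hom_Obj[OF h] by auto
  have "Dom C f = A" "Dom C g = B" "Dom C (g \<cdot>\<^bsub>C\<^esub> f) = A" using en_comp2 h by (auto simp: Hom_def)
  then show ?case using act_comp[OF en_comp2(1,2) ev_closed[OF en_comp2(3)]]
      act_closed[OF h ev_closed[OF en_comp2(3)]] by simp
next
  case (en_Sub_Fls f A B)
  interpret lambda_boolean r "alg P B" using alg_lambda Hom_Obj[OF en_Sub_Fls] by auto
  show ?case using en_Sub_Fls act_hom[OF en_Sub_Fls] by (simp add: Hom_def lambda_hom_def bool_hom_def)
next
  case (en_Sub_Neg f A B s)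
  interpret A: lambda_boolean r "alg P A" using alg_lambda Hom_Obj[OF en_Sub_Neg(1)] by auto
  interpret lambda_boolean r "alg P B" using alg_lambda Hom_Obj[OF en_Sub_Neg(1)] by auto
  have D: "Dom C f = A" using en_Sub_Neg by (auto simp: Hom_def)
  have "act P f (bcompl (alg P A) (fm_eval C P s A)) = bcompl (alg P B) (act P f (fm_eval C P s A))"
    by (rule bool_hom_compl)
      (use act_hom[OF en_Sub_Neg(1)] ev_closed[OF en_Sub_Neg(2)] A.boolean_lattice_axioms boolean_lattice_axioms
        in \<open>auto simp: lambda_hom_def\<close>)
  then show ?case using D act_closed[OF en_Sub_Neg(1) ev_closed[OF en_Sub_Neg(2)]] compl_facts(1) by simp
next
  case (en_Sub_And f A B s t)
  interpret A: lambda_boolean r "alg P A" using alg_lambda Hom_Obj[OF en_Sub_And(1)] by auto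
  interpret lambda_boolean r "alg P B" using alg_lambda Hom_Obj[OF en_Sub_And(1)] by auto
  have D: "Dom C f = A" using en_Sub_And by (auto simp: Hom_def)
  note e = ev_closed[OF en_Sub_And(2)] ev_closed[OF en_Sub_And(3)]
  have "act P f (fm_eval C P s A \<sqinter>\<^bsub>alg P A\<^esub> fm_eval C P t A) = act P f (fm_eval C P s A) \<sqinter>\<^bsub>alg P B\<^esub> act P f (fm_eval C P t A)"
    using act_hom[OF en_Sub_And(1)] e by (auto simp: lambda_hom_def bool_hom_def)
  then show ?case using D act_closed[OF en_Sub_And(1) e(1)] act_closed[OF en_Sub_And(1) e(2)] by simp
next
  case (en_Sub_Join f A B I s)
  interpret A: lambda_boolean r "alg P A" using alg_lambda Hom_Obj[OF en_Sub_Join(1)] by auto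
  interpret lambda_boolean r "alg P B" using alg_lambda Hom_Obj[OF en_Sub_Join(1)] by auto
  have D: "Dom C f = A" using en_Sub_Join by (auto simp: Hom_def)
  have I: "|I| <o r" "\<And>k. k \<in> I \<Longrightarrow> is_fm r C K A (s k)" using en_Sub_Join by (auto elim: is_fm.cases)
  have S: "(\<lambda>k. fm_eval C P (s k) A) ` I \<subseteq> carrier (alg P A)" using I ev_closed by auto
  have "act P f (\<Squnion>\<^bsub>alg P A\<^esub> ((\<lambda>k. fm_eval C P (s k) A) ` I)) = \<Squnion>\<^bsub>alg P B\<^esub> (act P f ` (\<lambda>k. fm_eval C P (s k) A) ` I)"
    using act_hom[OF en_Sub_Join(1)] S small_image[OF I(1)] unfolding lambda_hom_def by blast
  moreover have "act P f (\<Squnion>\<^bsub>alg P A\<^esub> ((\<lambda>k. fm_eval C P (s k) A) ` I)) \<in> carrier (alg P B)"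
    by (rule act_closed[OF en_Sub_Join(1) A.sup_closed[OF S small_image[OF I(1)]]])
  ultimately show ?case using D by (simp add: image_image)
next
  case (en_ExE i A B t s)
  note s = EN_FM[OF category_axioms card en_ExE(4)]
  show ?case
    using exq_adjoint[OF en_ExE(1,2) ev_closed[OF en_ExE(3)]] ev_closed s en_ExE
    by (auto simp: Hom_def)
next
  case (en_ExI i A B s t)
  note s = EN_FM[OF category_axioms card en_ExI(4)]
  show ?case
    using exq_adjoint[OF en_ExI(1,2)] ev_closed s en_ExI by (auto simp: Hom_def)
next
  case (en_BC i i' f f' s)
  note h = pushout_Hom[OF en_BC(3)]
  interpret lambda_boolean r "alg P (Cod C f)" using alg_lambda Hom_Obj[OF h(2)] by auto
  note e = ev_closed[OF en_BC(4)]
  have "Dom C f = Dom C i" "Dom C f' = Cod C i" "Cod C f' = Cod C i'" using h by (auto simp: Hom_def)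
  then show ?case using beck_chevalley[OF en_BC(1-3) e] act_closed[OF h(2) exq_closed[OF en_BC(1) h(1) e]]
    by simp
qed

end

end

lemma initial_over_hom:
  fixes r :: "'k rel" and C :: "('o, 'm, 'z) cat_scheme" and P :: "('o, 'm, 'b) bafun"
  assumes P: "lambda_boolean_over r C K P" and card: "Card_order r"
  shows "\<exists>h. bafun_hom r C K (initial_over r C K) P h"
    and "\<lbrakk>bafun_hom r C K (initial_over r C K) P h; bafun_hom r C K (initial_over r C K) P h';
      A \<in> Obj C; x \<in> carrier (alg (initial_over r C K) A)\<rbrakk> \<Longrightarrow> h A x = h' A x"
    and "\<lbrakk>bafun_hom r C K (initial_over r C K) P h; A \<in> Obj C; x \<in> carrier (alg (initial_over r C K) A)\<rbrakk>
      \<Longrightarrow> initial_hom r C K P A x = h A x"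
proof -
  interpret P: lambda_boolean_over r C K P by fact
  note cat = P.category_axioms
  note ctx = cat card
  let ?I = "initial_over r C K"
  interpret I: lambda_boolean_over r C K ?I by (rule initial_over_lambda[OF ctx])
  note initial_carrier = initial_carrier[OF ctx]
  let ?cl = "\<lambda>A s. fm_rel r C K A `` {s}"
  define h where "h A x = fm_eval C P (cls_rep x) A" for A and x :: "('m, 'k) fm set"
  have h_cl: "h A (?cl A s) = fm_eval C P s A" if s: "is_fm r C K A s" for A s
  proof -
    interpret lambda_boolean r "alg P A" using P.alg_lambda FM_Obj[OF ctx s] by auto
    show ?thesis unfolding h_def using rep_cl[OF ctx s] P.ev_sound[OF card] P.ev_closed[OF card] s
      by (intro le_antisym) auto
  qed
  have "bafun_hom r C K ?I P h"
    unfolding bafun_hom_def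
  proof (intro conjI ballI allI)
    fix A assume A: "A \<in> Obj C"
    interpret PA: lambda_boolean r "alg P A" using P.alg_lambda A by auto
    interpret IA: lambda_boolean r "alg ?I A" using I.alg_lambda A by auto
    have F: "is_fm r C K A Fls" "is_fm r C K A (Neg Fls)" using A by (auto intro: is_fm.intros)
    have cb: "bcompl (alg P A) \<bottom>\<^bsub>alg P A\<^esub> = \<top>\<^bsub>alg P A\<^esub>"
    proof -
      note c = PA.compl_facts[OF PA.bottom_closed]
      have "\<top>\<^bsub>alg P A\<^esub> \<sqsubseteq>\<^bsub>alg P A\<^esub> bcompl (alg P A) \<bottom>\<^bsub>alg P A\<^esub>"
        unfolding c(3)[symmetric] using c(1) by (simp add: PA.join_iff del: c(3))
      then show ?thesis using c(1) by (intro PA.le_antisym) auto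
    qed
    have ec: "fm_eval C P s A \<in> carrier (alg P A)" if "is_fm r C K A s" for s using that by (rule P.ev_closed[OF card])
    have j: "fm_eval C P (Disj s t) A = fm_eval C P s A \<squnion>\<^bsub>alg P A\<^esub> fm_eval C P t A"
      if s: "is_fm r C K A s" and t: "is_fm r C K A t" for s t
    proof (rule PA.le_antisym)
      note o = FM_Or[OF ctx s t]
      show "fm_eval C P s A \<squnion>\<^bsub>alg P A\<^esub> fm_eval C P t A \<sqsubseteq>\<^bsub>alg P A\<^esub> fm_eval C P (Disj s t) A"
        using P.ev_sound[OF card, OF en_Or1[OF ctx s t]] P.ev_sound[OF card, OF en_Or2[OF ctx s t]] ec s t o
        by (simp add: PA.join_iff)
      let ?v = "fm_eval C P s A \<squnion>\<^bsub>alg P A\<^esub> fm_eval C P t A"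
      have v: "?v \<in> carrier (alg P A)" using ec s t by simp
      note cf = PA.compl_facts[OF ec[OF s]] PA.compl_facts[OF ec[OF t]]
      let ?m = "bcompl (alg P A) (fm_eval C P s A) \<sqinter>\<^bsub>alg P A\<^esub> bcompl (alg P A) (fm_eval C P t A)"
      have m: "?m \<in> carrier (alg P A)" using cf by simp
      note cm = PA.compl_facts[OF m]
      have cv: "bcompl (alg P A) ?v \<in> carrier (alg P A)" "?v \<sqinter>\<^bsub>alg P A\<^esub> bcompl (alg P A) ?v = \<bottom>\<^bsub>alg P A\<^esub>"
        using PA.compl_facts[OF v] by auto
      have le: "bcompl (alg P A) ?v \<sqsubseteq>\<^bsub>alg P A\<^esub> bcompl (alg P A) u"
        if u: "u \<in> carrier (alg P A)" "u \<sqsubseteq>\<^bsub>alg P A\<^esub> ?v" for u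
      proof -
        have "u \<sqinter>\<^bsub>alg P A\<^esub> bcompl (alg P A) ?v \<sqsubseteq>\<^bsub>alg P A\<^esub> ?v \<sqinter>\<^bsub>alg P A\<^esub> bcompl (alg P A) ?v"
          using PA.le_trans[OF PA.meet_left[OF u(1) cv(1)] u(2)] PA.meet_right[OF u(1) cv(1)] u(1) v cv(1)
          by (simp add: PA.meet_iff)
        then have "bcompl (alg P A) ?v \<sqsubseteq>\<^bsub>alg P A\<^esub> bcompl (alg P A) u \<squnion>\<^bsub>alg P A\<^esub> \<bottom>\<^bsub>alg P A\<^esub>"
          unfolding cv(2) using PA.residual[OF u(1) cv(1)] by simp
        moreover have "bcompl (alg P A) u \<squnion>\<^bsub>alg P A\<^esub> \<bottom>\<^bsub>alg P A\<^esub> \<sqsubseteq>\<^bsub>alg P A\<^esub> bcompl (alg P A) u"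
          using PA.compl_facts(1)[OF u(1)] by (simp add: PA.join_iff)
        ultimately show ?thesis
          using PA.le_trans PA.compl_facts(1)[OF u(1)] cv(1) PA.join_closed PA.bottom_closed by metis
      qed
      have "bcompl (alg P A) ?v \<sqsubseteq>\<^bsub>alg P A\<^esub> ?m"
        using le[OF ec[OF s] PA.join_left] le[OF ec[OF t] PA.join_right] ec s t cf cv
        by (simp add: PA.meet_iff)
      then have "bcompl (alg P A) ?m \<sqinter>\<^bsub>alg P A\<^esub> bcompl (alg P A) ?v \<sqsubseteq>\<^bsub>alg P A\<^esub> ?m \<sqinter>\<^bsub>alg P A\<^esub> bcompl (alg P A) ?m"
        using PA.le_trans[OF PA.meet_right[OF cm(1) cv(1)]] PA.meet_left[OF cm(1) cv(1)] m cm(1) cv(1)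
        by (simp add: PA.meet_iff)
      then have "bcompl (alg P A) ?m \<sqinter>\<^bsub>alg P A\<^esub> bcompl (alg P A) ?v \<sqsubseteq>\<^bsub>alg P A\<^esub> ?v"
        unfolding cm(2) by (rule PA.le_trans[OF _ PA.bottom_lower[OF v]]) (use v cm(1) cv(1) in auto)
      then show "fm_eval C P (Disj s t) A \<sqsubseteq>\<^bsub>alg P A\<^esub> ?v"
        unfolding Disj_def fm_eval.simps
        by (rule PA.cases_le[OF v cm(1) v PA.meet_right[OF cm(1) v]])
    qed (use ec s t FM_Or[OF ctx s t] in auto)
    have "bool_hom (alg ?I A) (alg P A) (h A)"
      unfolding bool_hom_def
    proof (intro conjI ballI funcsetI)
      fix x assume "x \<in> carrier (alg ?I A)"
      then obtain s where s: "is_fm r C K A s" "x = ?cl A s" by (auto simp: initial_carrier)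
      show "h A x \<in> carrier (alg P A)" unfolding s(2) h_cl[OF s(1)] by (rule ec[OF s(1)])
      fix y assume "y \<in> carrier (alg ?I A)"
      then obtain t where t: "is_fm r C K A t" "y = ?cl A t" by (auto simp: initial_carrier)
      show "h A (x \<sqinter>\<^bsub>alg ?I A\<^esub> y) = h A x \<sqinter>\<^bsub>alg P A\<^esub> h A y"
        unfolding s(2) t(2) meet_cl[OF ctx A s(1) t(1)] h_cl[OF s(1)] h_cl[OF t(1)]
          h_cl[OF fm_And[OF s(1) t(1)]] by simp
      show "h A (x \<squnion>\<^bsub>alg ?I A\<^esub> y) = h A x \<squnion>\<^bsub>alg P A\<^esub> h A y"
        unfolding s(2) t(2) join_cl[OF ctx A s(1) t(1)] h_cl[OF s(1)] h_cl[OF t(1)]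
          h_cl[OF FM_Or[OF ctx s(1) t(1)]] by (rule j[OF s(1) t(1)])
    next
      show "h A \<bottom>\<^bsub>alg ?I A\<^esub> = \<bottom>\<^bsub>alg P A\<^esub>" unfolding bot_cl[OF ctx A] h_cl[OF F(1)] by simp
      show "h A \<top>\<^bsub>alg ?I A\<^esub> = \<top>\<^bsub>alg P A\<^esub>" unfolding top_cl[OF ctx A] h_cl[OF F(2)] by (simp add: cb)
    qed
    moreover have "h A (\<Squnion>\<^bsub>alg ?I A\<^esub>S) = \<Squnion>\<^bsub>alg P A\<^esub>(h A ` S)"
      if S: "S \<subseteq> carrier (alg ?I A)" "|S| <o r" for S
    proof -
      obtain I :: "'k set" and s where I: "|I| <o r" "\<And>k. k \<in> I \<Longrightarrow> is_fm r C K A (s k)"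
        "S = (\<lambda>k. ?cl A (s k)) ` I"
        using small_family[OF ctx S] by blast
      have J: "is_fm r C K A (Join I s)" by (rule fm_Join[OF A I(1)]) (rule I(2))
      have S1: "\<Squnion>\<^bsub>alg ?I A\<^esub> S = ?cl A (Join I s)"
        unfolding I(3) by (rule sup_cl(2)[OF ctx A I(1)]) (rule I(2))
      show ?thesis unfolding S1 h_cl[OF J] unfolding I(3) image_image fm_eval.simps
        using I(2) h_cl by (metis (mono_tags, lifting) image_cong)
    qed
    ultimately show "lambda_hom r (alg ?I A) (alg P A) (h A)" unfolding lambda_hom_def by blast
  next
    fix A B f x assume f: "f \<in> Hom C A B" and "x \<in> carrier (alg ?I A)"
    then obtain s where s: "is_fm r C K A s" "x = ?cl A s" by (auto simp: initial_carrier)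
    show "h B (act ?I f x) = act P f (h A x)"
      unfolding s(2) act_cl[OF ctx f s(1)] h_cl[OF s(1)] h_cl[OF fm_Sub[OF f s(1)]]
      using f by (auto simp: Hom_def)
  next
    fix A B i y assume i: "i \<in> K \<inter> Hom C A B" and "y \<in> carrier (alg ?I B)"
    then obtain s where s: "is_fm r C K B s" "y = ?cl B s" by (auto simp: initial_carrier)
    have i: "i \<in> K" "i \<in> Hom C A B" using i by auto
    show "h A (exq ?I i y) = exq P i (h B y)"
      unfolding s(2) exq_cl[OF ctx i s(1)] h_cl[OF s(1)] h_cl[OF fm_Ex[OF i s(1)]]
      using i by (auto simp: Hom_def)
  qed
  then show "\<exists>h. bafun_hom r C K ?I P h" by (rule exI[of "bafun_hom r C K ?I P" h])
  have un: "g A (?cl A s) = fm_eval C P s A"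
    if g: "bafun_hom r C K ?I P g" and "is_fm r C K A s" for g A s
    using that(2)
  proof (induction rule: is_fm.induct)
    case (fm_Fls A)
    then show ?case using g bot_cl[OF ctx fm_Fls]
      by (auto simp: bafun_hom_def lambda_hom_def bool_hom_def)
  next
    case (fm_Neg A s)
    note A = FM_Obj[OF ctx fm_Neg(1)]
    interpret PA: lambda_boolean r "alg P A" using P.alg_lambda A by auto
    interpret IA: lambda_boolean r "alg ?I A" using I.alg_lambda A by auto
    have bh: "bool_hom (alg ?I A) (alg P A) (g A)"
      using g A by (auto simp: bafun_hom_def lambda_hom_def)
    note f = fm_Neg(1) is_fm.fm_Neg[OF fm_Neg(1)]
    have fF: "is_fm r C K A Fls" "is_fm r C K A (Neg Fls)" using A by (auto intro: is_fm.intros)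
    have 1: "?cl A s \<sqinter>\<^bsub>alg ?I A\<^esub> ?cl A (Neg s) = \<bottom>\<^bsub>alg ?I A\<^esub>"
      unfolding meet_cl[OF ctx A f] bot_cl[OF ctx A] cl_eq[OF ctx fm_And[OF f] fF(1)]
      using en_contr[OF f(1)] en_Fls[OF fm_And[OF f]] by blast
    have 2: "?cl A s \<squnion>\<^bsub>alg ?I A\<^esub> ?cl A (Neg s) = \<top>\<^bsub>alg ?I A\<^esub>"
      unfolding join_cl[OF ctx A f] top_cl[OF ctx A] cl_eq[OF ctx FM_Or[OF ctx f] fF(2)]
      using en_lem[OF ctx f(1)] en_top[OF ctx FM_Or[OF ctx f]] by blast
    have in1: "?cl A s \<in> carrier (alg ?I A)" "?cl A (Neg s) \<in> carrier (alg ?I A)"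
      using cls_closed[OF ctx] f by auto
    have "?cl A (Neg s) = bcompl (alg ?I A) (?cl A s)"
      using IA.compl_unique[OF in1(1,2) IA.compl_facts(1)[OF in1(1)] 1 2] IA.compl_facts[OF in1(1)] by metis
    then show ?case
      using bool_hom_compl[OF IA.boolean_lattice_axioms PA.boolean_lattice_axioms bh in1(1)] fm_Neg(2) by simp
  next
    case (fm_And A s t)
    note A = FM_Obj[OF ctx fm_And(1)]
    have bh: "bool_hom (alg ?I A) (alg P A) (g A)" using g A by (auto simp: bafun_hom_def lambda_hom_def)
    show ?case
      using bh meet_cl[OF ctx A fm_And(1,2)] fm_And cls_closed[OF ctx] unfolding bool_hom_def by (metis fm_eval.simps(3))
  next
    case (fm_Join A I s)
    have bh: "lambda_hom r (alg ?I A) (alg P A) (g A)" using g fm_Join(1) by (auto simp: bafun_hom_def)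
    have S: "(\<lambda>k. ?cl A (s k)) ` I \<subseteq> carrier (alg ?I A)" using cls_closed[OF ctx] fm_Join(3) by auto
    have "g A (?cl A (Join I s)) = g A (\<Squnion>\<^bsub>alg ?I A\<^esub> ((\<lambda>k. ?cl A (s k)) ` I))"
      by (rule arg_cong[where f = "g A"], rule sym, rule sup_cl(2)[OF ctx fm_Join(1,2)]) (rule fm_Join(3))
    also have "\<dots> = \<Squnion>\<^bsub>alg P A\<^esub> (g A ` (\<lambda>k. ?cl A (s k)) ` I)"
      using bh S small_image[OF fm_Join(2)] unfolding lambda_hom_def by blast
    also have "g A ` (\<lambda>k. ?cl A (s k)) ` I = (\<lambda>k. fm_eval C P (s k) A) ` I"
      unfolding image_image by (rule image_cong[OF refl fm_Join(4)])
    finally show ?case by simp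
  next
    case (fm_Sub f A B s)
    have "g B (act ?I f (?cl A s)) = act P f (g A (?cl A s))"
      using g fm_Sub(1) cls_closed[OF ctx fm_Sub(2)] unfolding bafun_hom_def by blast
    then show ?case using fm_Sub act_cl[OF ctx fm_Sub(1,2)] by (auto simp: Hom_def)
  next
    case (fm_Ex i A B s)
    have "g A (exq ?I i (?cl B s)) = exq P i (g B (?cl B s))"
      using g fm_Ex(1,2) cls_closed[OF ctx fm_Ex(3)] unfolding bafun_hom_def by blast
    then show ?case using fm_Ex exq_cl[OF ctx fm_Ex(1-3)] by (auto simp: Hom_def)
  qed
  have uq: "g A x = g' A x"
    if g: "bafun_hom r C K ?I P g" "bafun_hom r C K ?I P g'" and x: "x \<in> carrier (alg ?I A)" for g g' A x
  proof -
    obtain s where s: "is_fm r C K A s" "x = ?cl A s" using x by (auto simp: initial_carrier)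
    show ?thesis unfolding s(2) un[OF g(1) s(1)] un[OF g(2) s(1)] ..
  qed
  show "\<lbrakk>bafun_hom r C K ?I P h; bafun_hom r C K ?I P h'; A \<in> Obj C; x \<in> carrier (alg ?I A)\<rbrakk>
      \<Longrightarrow> h A x = h' A x" for h h' by (rule uq)
  show "\<lbrakk>bafun_hom r C K ?I P h; A \<in> Obj C; x \<in> carrier (alg ?I A)\<rbrakk> \<Longrightarrow> initial_hom r C K P A x = h A x"
    for h unfolding initial_hom_def using uq by (intro the_equality) blast+
qed

lemma Hom_full: "f \<in> Hom (full_subcat C S) A B \<longleftrightarrow> f \<in> Hom C A B \<and> A \<in> S \<and> B \<in> S"
  by (auto simp: Hom_def full_subcat_def)

lemma full_sel [simp]: "Dom (full_subcat C S) = Dom C" "Cod (full_subcat C S) = Cod C"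
    "ident (full_subcat C S) = ident C" "compo (full_subcat C S) = compo C"
    "Obj (full_subcat C S) = Obj C \<inter> S"
  by (auto simp: full_subcat_def)

lemma (in category) full_category: "category (full_subcat C S)"
proof
  fix f assume "f \<in> Arr (full_subcat C S)"
  then show "Dom (full_subcat C S) f \<in> Obj (full_subcat C S)" "Cod (full_subcat C S) f \<in> Obj (full_subcat C S)"
    using Dom_Obj Cod_Obj by (auto simp: full_subcat_def)
qed (auto simp: Hom_full intro: ident_Hom compo_Hom ident_left ident_right compo_assoc)

lemma pushout_full:
  assumes "category C" "pushout C i f f' i'" "Dom C i \<in> S" "Cod C i \<in> S" "Cod C f \<in> S" "Cod C i' \<in> S"
  shows "pushout (full_subcat C S) i f f' i'"
proof -
  obtain A B B' D where h: "i \<in> Hom C A B" "f \<in> Hom C A B'" "f' \<in> Hom C B D" "i' \<in> Hom C B' D"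
    "f' \<cdot>\<^bsub>C\<^esub> i = i' \<cdot>\<^bsub>C\<^esub> f"
    and u: "\<And>X u v. \<lbrakk>u \<in> Hom C B X; v \<in> Hom C B' X; u \<cdot>\<^bsub>C\<^esub> i = v \<cdot>\<^bsub>C\<^esub> f\<rbrakk> \<Longrightarrow>
      \<exists>!h. h \<in> Hom C D X \<and> h \<cdot>\<^bsub>C\<^esub> f' = u \<and> h \<cdot>\<^bsub>C\<^esub> i' = v"
    using assms(2) unfolding pushout_def by blast
  have "A \<in> S" "B \<in> S" "B' \<in> S" "D \<in> S" using h assms(3-6) by (auto simp: Hom_def)
  then show ?thesis unfolding pushout_def Hom_full full_sel using h u by blast
qed

context weak_model_category begin

lemma cofibrant_Obj: "cofibrant M X \<Longrightarrow> X \<in> Obj M"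
  using Hom_Obj unfolding cofibrant_def by blast

lemma cofibrant_initial: assumes "initial M Z" shows "cofibrant M Z"
proof -
  obtain Z0 where Z0: "initial M Z0" "ident M Z0 \<in> Cof M" using initial_Cof by blast
  have O: "Z \<in> Obj M" "Z0 \<in> Obj M" using assms Z0 by (auto simp: initial_def)
  obtain u where u: "u \<in> Hom M Z0 Z" using Z0 O unfolding initial_def by blast
  obtain v where v: "v \<in> Hom M Z Z0" using assms O unfolding initial_def by blast
  have vu: "v \<cdot> u = ident M Z0" using Z0 O compo_Hom[OF u v] ident_Hom[OF O(2)] unfolding initial_def by blast
  have uv: "u \<cdot> v = ident M Z" using assms O compo_Hom[OF v u] ident_Hom[OF O(1)] unfolding initial_def by blast
  have iso: "is_iso M u" "is_iso M (ident M Z0)"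
    using u v vu uv ident_Hom[OF O(2)] ident_left[OF ident_Hom[OF O(2)]]
    unfolding is_iso_def Hom_def by auto
  have DC: "Dom M (ident M Z0) = Z0" "Cod M (ident M Z0) = Z0" "Dom M u = Z0" "Cod M u = Z" "u \<in> Arr M"
    using ident_Hom[OF O(2)] u by (auto simp: Hom_def)
  have "u \<in> Cof M"
    using Cof_iso_closed[unfolded iso_closed_def, rule_format, OF Z0(2) DC(5), of "ident M Z0" u]
      iso u ident_Hom[OF O(2)] by (simp add: DC)
  then show ?thesis unfolding cofibrant_def using Z0 u by blast
qed

lemma cofibrant_Cod: assumes "cofibrant M A" "i \<in> Cof M" "i \<in> Hom M A B" shows "cofibrant M B"
proof -
  obtain Z f where f: "initial M Z" "f \<in> Hom M Z A" "f \<in> Cof M" using assms unfolding cofibrant_def by blast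
  have "i \<cdot> f \<in> Cof M" using Cof_comp[OF cofibrant_initial[OF f(1)] f(3,2) assms(2,3)] .
  then show ?thesis unfolding cofibrant_def using f(1) compo_Hom[OF f(2) assms(3)] by blast
qed

lemma cof_cat_category: "category (cof_cat M)"
  unfolding cof_cat_def by (rule full_category)

lemma Hom_cof: "f \<in> Hom (cof_cat M) A B \<longleftrightarrow> f \<in> Hom M A B \<and> cofibrant M A \<and> cofibrant M B"
  unfolding cof_cat_def Hom_full by simp

lemma cof_sel: "Dom (cof_cat M) = Dom M" "Cod (cof_cat M) = Cod M"
    "ident (cof_cat M) = ident M" "compo (cof_cat M) = compo M"
    "A \<in> Obj (cof_cat M) \<longleftrightarrow> cofibrant M A"
  unfolding cof_cat_def using cofibrant_Obj by auto

lemma cof_cofs_iff: "i \<in> cof_cofs M \<and> i \<in> Hom (cof_cat M) A B \<longleftrightarrow>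
    i \<in> Cof M \<and> i \<in> Hom M A B \<and> cofibrant M A \<and> cofibrant M B"
  unfolding cof_cofs_def Hom_cof by (auto simp: Hom_def cof_cat_def full_subcat_def)

lemma pushout_cof_cat:
  assumes i: "i \<in> cof_cofs M" and p: "pushout (cof_cat M) i f f' i'"
  shows "pushout M i f f' i'"
proof -
  obtain A B B' D where h: "i \<in> Hom M A B" "f \<in> Hom M A B'" "f' \<in> Hom M B D" "i' \<in> Hom M B' D"
    "cofibrant M A" "cofibrant M B" "cofibrant M B'" "cofibrant M D"
    and sq: "f' \<cdot> i = i' \<cdot> f"
    and u0: "\<forall>X u v. (u \<in> Hom M B X \<and> cofibrant M B \<and> cofibrant M X) \<and>
      (v \<in> Hom M B' X \<and> cofibrant M B' \<and> cofibrant M X) \<and> u \<cdot> i = v \<cdot> f \<longrightarrow>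
      (\<exists>!h. (h \<in> Hom M D X \<and> cofibrant M D \<and> cofibrant M X) \<and> h \<cdot> f' = u \<and> h \<cdot> i' = v)"
    using p unfolding pushout_def Hom_cof cof_sel(4) by (elim exE conjE) (rule that)
  have u: "\<exists>!h. h \<in> Hom M D X \<and> h \<cdot> f' = u \<and> h \<cdot> i' = v"
    if "cofibrant M X" "u \<in> Hom M B X" "v \<in> Hom M B' X" "u \<cdot> i = v \<cdot> f" for X u v
    using u0[rule_format, of u X v] that h by simp
  have iC: "i \<in> Cof M" using i by (auto simp: cof_cofs_def)
  obtain f'' i'' where po: "pushout M i f f'' i''" "i'' \<in> Cof M"
    using Cof_pushout[OF iC h(1,2,5,7)] by blast
  define E where "E = Cod M i''"
  have DC: "Cod M i = B" "Cod M f = B'" "Dom M i = A" using h by (auto simp: Hom_def)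
  have h': "f'' \<in> Hom M B E" "i'' \<in> Hom M B' E"
    using pushout_Hom[OF po(1)] unfolding E_def DC by auto
  have sq': "f'' \<cdot> i = i'' \<cdot> f" using po(1) by (auto simp: pushout_def)
  have u': "\<exists>!h. h \<in> Hom M E X \<and> h \<cdot> f'' = u \<and> h \<cdot> i'' = v"
    if "u \<in> Hom M B X" "v \<in> Hom M B' X" "u \<cdot> i = v \<cdot> f" for X u v
  proof -
    obtain A1 B1 B1' D1 where a: "i \<in> Hom M A1 B1" "f \<in> Hom M A1 B1'" "i'' \<in> Hom M B1' D1"
      and b: "\<forall>X u v. u \<in> Hom M B1 X \<and> v \<in> Hom M B1' X \<and> u \<cdot> i = v \<cdot> f \<longrightarrow>
        (\<exists>!h. h \<in> Hom M D1 X \<and> h \<cdot> f'' = u \<and> h \<cdot> i'' = v)"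
      using po(1) unfolding pushout_def by (elim exE conjE) (rule that)
    have "B1 = B" "B1' = B'" "D1 = E" using a h h' by (auto simp: Hom_def)
    then show ?thesis using b that by simp
  qed
  have E: "cofibrant M E" by (rule cofibrant_Cod[OF h(7) po(2) h'(2)])
  obtain a where a: "a \<in> Hom M D E" "a \<cdot> f' = f''" "a \<cdot> i' = i''" using u[OF E h' sq'] by blast
  obtain b where b: "b \<in> Hom M E D" "b \<cdot> f'' = f'" "b \<cdot> i'' = i'" using u'[OF h(3,4) sq] by blast
  have ba: "b \<cdot> a = ident M D"
  proof -
    have "b \<cdot> a \<in> Hom M D D \<and> b \<cdot> a \<cdot> f' = f' \<and> b \<cdot> a \<cdot> i' = i'"
      using compo_Hom[OF a(1) b(1)] compo_assoc[OF h(3) a(1) b(1)] compo_assoc[OF h(4) a(1) b(1)] a b by simp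
    moreover have "ident M D \<in> Hom M D D \<and> ident M D \<cdot> f' = f' \<and> ident M D \<cdot> i' = i'"
      using ident_Hom cofibrant_Obj[OF h(8)] ident_left h by blast
    ultimately show ?thesis using u[OF h(8) h(3,4) sq] by blast
  qed
  have "\<exists>!g. g \<in> Hom M D X \<and> g \<cdot> f' = s \<and> g \<cdot> i' = t"
    if st: "s \<in> Hom M B X" "t \<in> Hom M B' X" "s \<cdot> i = t \<cdot> f" for X s t
  proof -
    obtain k where k: "k \<in> Hom M E X" "k \<cdot> f'' = s" "k \<cdot> i'' = t"
      and ku: "\<And>k'. \<lbrakk>k' \<in> Hom M E X; k' \<cdot> f'' = s; k' \<cdot> i'' = t\<rbrakk> \<Longrightarrow> k' = k"
      using u'[OF st] by blast
    show ?thesis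
    proof (rule ex1I[of _ "k \<cdot> a"])
      show "k \<cdot> a \<in> Hom M D X \<and> k \<cdot> a \<cdot> f' = s \<and> k \<cdot> a \<cdot> i' = t"
        using compo_Hom[OF a(1) k(1)] compo_assoc[OF h(3) a(1) k(1)] compo_assoc[OF h(4) a(1) k(1)] a k by simp
      fix g assume g: "g \<in> Hom M D X \<and> g \<cdot> f' = s \<and> g \<cdot> i' = t"
      then have g': "g \<in> Hom M D X" by simp
      have "g \<cdot> b = k"
        using ku[OF compo_Hom[OF b(1) g']] compo_assoc[OF h'(1) b(1) g'] compo_assoc[OF h'(2) b(1) g'] b g by simp
      then show "g = k \<cdot> a" using compo_assoc[OF a(1) b(1) g'] ba ident_right[OF g'] by simp
    qed
  qed
  then show ?thesis unfolding pushout_def using h(1-4) sq by blast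
qed

lemma hom_algebra_lambda:
  fixes r :: "'k rel"
  assumes X: "X \<in> Obj M"
  shows "lambda_boolean_over r (cof_cat M) (cof_cofs M) (hom_algebra M X)"
proof -
  let ?L = "\<lambda>c. \<lparr>carrier = Pow (Hom M c X), eq = (=), le = (\<subseteq>)\<rparr>"
  have po: "partial_order (?L c)" for c by unfold_locales auto
  note B0 = boolI[OF po, where m = "(\<inter>)" and j = "(\<union>)" and b = "{}"]
  have B: "boolean_lattice (?L c)" "\<bottom>\<^bsub>?L c\<^esub> = {}" "\<top>\<^bsub>?L c\<^esub> = Hom M c X" for c
    by (rule B0(1,4,5)[where t = "Hom M c X" and n = "\<lambda>x. Hom M c X - x"]; auto)+
  have B2: "x \<sqinter>\<^bsub>?L c\<^esub> y = x \<inter> y" if "x \<subseteq> Hom M c X" "y \<subseteq> Hom M c X" for c x y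
    by (rule B0(2)[where t = "Hom M c X" and n = "\<lambda>x. Hom M c X - x"]) (use that in auto)
  have B3: "x \<squnion>\<^bsub>?L c\<^esub> y = x \<union> y" if "x \<subseteq> Hom M c X" "y \<subseteq> Hom M c X" for c x y
    by (rule B0(3)[where t = "Hom M c X" and n = "\<lambda>x. Hom M c X - x"]) (use that in auto)
  have sup: "least (?L c) (\<Union>S) (Upper (?L c) S)" "\<Squnion>\<^bsub>?L c\<^esub> S = \<Union>S" if "S \<subseteq> Pow (Hom M c X)" for c S
  proof -
    have 1: "S \<subseteq> carrier (?L c)" "\<Union>S \<in> carrier (?L c)" using that by auto
    have 2: "\<And>t. t \<in> carrier (?L c) \<Longrightarrow> \<Union>S \<sqsubseteq>\<^bsub>?L c\<^esub> t \<longleftrightarrow> (\<forall>y\<in>S. y \<sqsubseteq>\<^bsub>?L c\<^esub> t)" by auto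
    show "least (?L c) (\<Union>S) (Upper (?L c) S)" "\<Squnion>\<^bsub>?L c\<^esub> S = \<Union>S"
      using partial_order.sup_eqI[OF po 1 2] by auto
  qed
  have lam: "lambda_boolean r (?L c)" for c
    unfolding lambda_boolean_def lambda_boolean_axioms_def using B(1) sup(1) by auto
  show ?thesis
  proof (intro lambda_boolean_over.intro lambda_boolean_over_axioms.intro)
    show "category (cof_cat M)" by (rule cof_cat_category)
    show "lambda_boolean r (alg (hom_algebra M X) A)" for A using lam by (simp add: hom_algebra_def)
  next
    fix f A C assume "f \<in> Hom (cof_cat M) A C"
    then have f: "f \<in> Hom M A C" "Cod M f = C" unfolding Hom_cof by (auto simp: Hom_def)
    let ?h = "\<lambda>S. {v \<in> Hom M C X. v \<cdot> f \<in> S}"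
    have h: "act (hom_algebra M X) f = ?h" using f by (simp add: hom_algebra_def)
    have sub: "?h S \<subseteq> Hom M C X" for S by auto
    have j: "?h (\<Squnion>\<^bsub>?L A\<^esub> S) = \<Squnion>\<^bsub>?L C\<^esub> (?h ` S)" if "S \<subseteq> Pow (Hom M A X)" for S
      unfolding sup(2)[OF that] using sup(2)[of "?h ` S" C] by auto
    have b: "bool_hom (?L A) (?L C) ?h"
      unfolding bool_hom_def by (auto simp: B2 B3 B sub intro: compo_Hom[OF f(1)])
    show "lambda_hom r (alg (hom_algebra M X) A) (alg (hom_algebra M X) C) (act (hom_algebra M X) f)"
      unfolding lambda_hom_def h using b j by (auto simp: hom_algebra_def)
  next
    fix A S assume "A \<in> Obj (cof_cat M)" and S: "S \<in> carrier (alg (hom_algebra M X) A)"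
    then have A: "A \<in> Obj M" using cof_sel(5) cofibrant_Obj by blast
    have S: "S \<subseteq> Hom M A X" using S by (auto simp: hom_algebra_def)
    then show "act (hom_algebra M X) (ident (cof_cat M) A) S = S"
      using ident_right ident_Hom[OF A] S unfolding cof_sel hom_algebra_def by (auto simp: Hom_def)
  next
    fix f A C g D S assume f: "f \<in> Hom (cof_cat M) A C" and g: "g \<in> Hom (cof_cat M) C D"
      and "S \<in> carrier (alg (hom_algebra M X) A)"
    have f: "f \<in> Hom M A C" and g: "g \<in> Hom M C D" using f g by (auto simp: Hom_cof)
    have c: "Cod M f = C" "Cod M g = D" "Cod M (g \<cdot> f) = D" using f g compo_Hom[OF f g] by (auto simp: Hom_def)
    show "act (hom_algebra M X) (g \<cdot>\<^bsub>cof_cat M\<^esub> f) S = act (hom_algebra M X) g (act (hom_algebra M X) f S)"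
      unfolding hom_algebra_def cof_sel bafun.simps c using compo_assoc[OF f g] compo_Hom[OF g] by auto
  next
    fix i A C S assume "i \<in> cof_cofs M" "i \<in> Hom (cof_cat M) A C" and S: "S \<in> carrier (alg (hom_algebra M X) C)"
    then have i: "i \<in> Hom M A C" "Cod M i = C" and S: "S \<subseteq> Hom M C X"
      unfolding Hom_cof by (auto simp: Hom_def hom_algebra_def)
    show "exq (hom_algebra M X) i S \<in> carrier (alg (hom_algebra M X) A)"
      using compo_Hom[OF i(1)] S by (auto simp: hom_algebra_def)
    fix T assume T: "T \<in> carrier (alg (hom_algebra M X) A)"
    show "exq (hom_algebra M X) i S \<sqsubseteq>\<^bsub>alg (hom_algebra M X) A\<^esub> T \<longleftrightarrow>
      S \<sqsubseteq>\<^bsub>alg (hom_algebra M X) C\<^esub> act (hom_algebra M X) i T"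
      using S i(2) by (auto simp: hom_algebra_def)
  next
    fix i i' f f' S assume i: "i \<in> cof_cofs M" "pushout (cof_cat M) i f f' i'"
      and S: "S \<in> carrier (alg (hom_algebra M X) (Cod (cof_cat M) i))"
    from pushout_cof_cat[OF this(1,2)] obtain A C C' D where h: "i \<in> Hom M A C" "f \<in> Hom M A C'"
        "f' \<in> Hom M C D" "i' \<in> Hom M C' D"
      and sq: "f' \<cdot> i = i' \<cdot> f"
      and u: "\<And>X u v. \<lbrakk>u \<in> Hom M C X; v \<in> Hom M C' X; u \<cdot> i = v \<cdot> f\<rbrakk> \<Longrightarrow>
        \<exists>!h. h \<in> Hom M D X \<and> h \<cdot> f' = u \<and> h \<cdot> i' = v"
      unfolding pushout_def by blast
    have c: "Cod M i = C" "Cod M f = C'" "Cod M f' = D" using h by (auto simp: Hom_def)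
    have S: "S \<subseteq> Hom M C X" using S c by (auto simp: hom_algebra_def cof_sel)
    show "act (hom_algebra M X) f (exq (hom_algebra M X) i S) =
      exq (hom_algebra M X) i' (act (hom_algebra M X) f' S)" (is "?l = ?r")
    proof
      show "?l \<subseteq> ?r"
      proof
        fix v assume "v \<in> ?l"
        then obtain w where w: "v \<in> Hom M C' X" "w \<in> S" "w \<cdot> i = v \<cdot> f" by (auto simp: hom_algebra_def c)
        then obtain k where "k \<in> Hom M D X" "k \<cdot> f' = w" "k \<cdot> i' = v" using u[of w X v] S by blast
        then show "v \<in> ?r" using w by (auto simp: hom_algebra_def c)
      qed
      show "?r \<subseteq> ?l"
      proof
        fix v assume "v \<in> ?r"
        then obtain k where k: "k \<in> Hom M D X" "k \<cdot> f' \<in> S" "v = k \<cdot> i'" by (auto simp: hom_algebra_def c)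
        have "v \<cdot> f = (k \<cdot> f') \<cdot> i"
          unfolding k(3) compo_assoc[OF h(2,4) k(1)] compo_assoc[OF h(1,3) k(1)] sq ..
        then show "v \<in> ?l" using k compo_Hom[OF h(4) k(1)] by (auto simp: hom_algebra_def c)
      qed
    qed
  qed
qed

end

lemma functor_Hom: "is_functor C D F \<Longrightarrow> f \<in> Hom C A B \<Longrightarrow> farr F f \<in> Hom D (fobj F A) (fobj F B)"
  by (auto simp: is_functor_def)

lemma functor_comp: "is_functor C D F \<Longrightarrow> f \<in> Hom C A B \<Longrightarrow> g \<in> Hom C B E \<Longrightarrow>
    farr F (g \<cdot>\<^bsub>C\<^esub> f) = farr F g \<cdot>\<^bsub>D\<^esub> farr F f"
  unfolding is_functor_def by blast

definition transp where "transp M G \<eta> X h = farr G h \<cdot>\<^bsub>M\<^esub> \<eta> X"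
definition untransp where "untransp N F \<epsilon> Y g = \<epsilon> Y \<cdot>\<^bsub>N\<^esub> farr F g"

context
  fixes M :: "('o, 'm, 'y) cat_scheme" and N :: "('p, 'n, 'z) cat_scheme" and F G \<eta> \<epsilon>
  assumes catM: "category M" and catN: "category N" and adj: "adjunction M N F G \<eta> \<epsilon>"
begin

interpretation M: category M by (rule catM)
interpretation N: category N by (rule catN)

lemma adj_facts:
  shows "is_functor M N F" "is_functor N M G"
    and "X \<in> Obj M \<Longrightarrow> \<eta> X \<in> Hom M X (fobj G (fobj F X))"
    and "Y \<in> Obj N \<Longrightarrow> \<epsilon> Y \<in> Hom N (fobj F (fobj G Y)) Y"
    and "f \<in> Hom M X X' \<Longrightarrow> \<eta> X' \<cdot>\<^bsub>M\<^esub> f = farr G (farr F f) \<cdot>\<^bsub>M\<^esub> \<eta> X"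
    and "g \<in> Hom N Y Y' \<Longrightarrow> \<epsilon> Y' \<cdot>\<^bsub>N\<^esub> farr F (farr G g) = g \<cdot>\<^bsub>N\<^esub> \<epsilon> Y"
    and "X \<in> Obj M \<Longrightarrow> \<epsilon> (fobj F X) \<cdot>\<^bsub>N\<^esub> farr F (\<eta> X) = ident N (fobj F X)"
    and "Y \<in> Obj N \<Longrightarrow> farr G (\<epsilon> Y) \<cdot>\<^bsub>M\<^esub> \<eta> (fobj G Y) = ident M (fobj G Y)"
  using adj by (auto simp: adjunction_def nat_trans_def id_ftor_def comp_ftor_def)


lemma fobj_Obj: "X \<in> Obj M \<Longrightarrow> fobj F X \<in> Obj N" "Y \<in> Obj N \<Longrightarrow> fobj G Y \<in> Obj M"
  using adj_facts(1,2) by (auto simp: is_functor_def)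

lemma transp_Hom:
  assumes "X \<in> Obj M" "h \<in> Hom N (fobj F X) Y" shows "transp M G \<eta> X h \<in> Hom M X (fobj G Y)"
  unfolding transp_def using M.compo_Hom adj_facts(2,3) functor_Hom assms by metis

lemma untransp_Hom:
  assumes "Y \<in> Obj N" "g \<in> Hom M X (fobj G Y)" shows "untransp N F \<epsilon> Y g \<in> Hom N (fobj F X) Y"
  unfolding untransp_def using N.compo_Hom adj_facts(1,4) functor_Hom assms by metis

lemma untransp_transp:
  assumes "X \<in> Obj M" "h \<in> Hom N (fobj F X) Y" shows "untransp N F \<epsilon> Y (transp M G \<eta> X h) = h"
proof -
  have Y: "Y \<in> Obj N" using N.Hom_Obj assms by blast
  note e = adj_facts(3)[OF assms(1)] and Gh = functor_Hom[OF adj_facts(2) assms(2)]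
  have "untransp N F \<epsilon> Y (transp M G \<eta> X h) = \<epsilon> Y \<cdot>\<^bsub>N\<^esub> (farr F (farr G h) \<cdot>\<^bsub>N\<^esub> farr F (\<eta> X))"
    unfolding untransp_def transp_def functor_comp[OF adj_facts(1) e Gh] ..
  also have "\<dots> = \<epsilon> Y \<cdot>\<^bsub>N\<^esub> farr F (farr G h) \<cdot>\<^bsub>N\<^esub> farr F (\<eta> X)"
    using N.compo_assoc[OF functor_Hom[OF adj_facts(1) e] functor_Hom[OF adj_facts(1) Gh] adj_facts(4)[OF Y]] ..
  also have "\<dots> = h \<cdot>\<^bsub>N\<^esub> (\<epsilon> (fobj F X) \<cdot>\<^bsub>N\<^esub> farr F (\<eta> X))"
    unfolding adj_facts(6)[OF assms(2)]
    using N.compo_assoc[OF functor_Hom[OF adj_facts(1) e] adj_facts(4)[OF fobj_Obj(1)[OF assms(1)]] assms(2)] .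
  also have "\<dots> = h" unfolding adj_facts(7)[OF assms(1)] by (rule N.ident_right[OF assms(2)])
  finally show ?thesis .
qed

lemma transp_untransp:
  assumes "Y \<in> Obj N" "g \<in> Hom M X (fobj G Y)" shows "transp M G \<eta> X (untransp N F \<epsilon> Y g) = g"
proof -
  have X: "X \<in> Obj M" using M.Hom_Obj assms by blast
  note e = adj_facts(4)[OF assms(1)] and Fg = functor_Hom[OF adj_facts(1) assms(2)]
  have "transp M G \<eta> X (untransp N F \<epsilon> Y g) = farr G (\<epsilon> Y) \<cdot>\<^bsub>M\<^esub> farr G (farr F g) \<cdot>\<^bsub>M\<^esub> \<eta> X"
    unfolding untransp_def transp_def functor_comp[OF adj_facts(2) Fg e] ..
  also have "\<dots> = farr G (\<epsilon> Y) \<cdot>\<^bsub>M\<^esub> (farr G (farr F g) \<cdot>\<^bsub>M\<^esub> \<eta> X)"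
    by (rule M.compo_assoc[OF adj_facts(3)[OF X] functor_Hom[OF adj_facts(2) Fg] functor_Hom[OF adj_facts(2) e]])
  also have "\<dots> = farr G (\<epsilon> Y) \<cdot>\<^bsub>M\<^esub> \<eta> (fobj G Y) \<cdot>\<^bsub>M\<^esub> g"
    unfolding adj_facts(5)[OF assms(2), symmetric]
    by (rule M.compo_assoc[OF assms(2) adj_facts(3)[OF fobj_Obj(2)[OF assms(1)]]
          functor_Hom[OF adj_facts(2) e], symmetric])
  also have "\<dots> = g" unfolding adj_facts(8)[OF assms(1)] by (rule M.ident_left[OF assms(2)])
  finally show ?thesis .
qed

lemma transp_nat:
  assumes "f \<in> Hom M X' X" "h \<in> Hom N (fobj F X) Y"
  shows "transp M G \<eta> X' (h \<cdot>\<^bsub>N\<^esub> farr F f) = transp M G \<eta> X h \<cdot>\<^bsub>M\<^esub> f"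
proof -
  have X: "X' \<in> Obj M" "X \<in> Obj M" using M.Hom_Obj assms by auto
  note Ff = functor_Hom[OF adj_facts(1) assms(1)]
  have "transp M G \<eta> X' (h \<cdot>\<^bsub>N\<^esub> farr F f) = farr G h \<cdot>\<^bsub>M\<^esub> (farr G (farr F f) \<cdot>\<^bsub>M\<^esub> \<eta> X')"
    unfolding transp_def functor_comp[OF adj_facts(2) Ff assms(2)]
    by (rule M.compo_assoc[OF adj_facts(3)[OF X(1)] functor_Hom[OF adj_facts(2) Ff]
          functor_Hom[OF adj_facts(2) assms(2)]])
  also have "\<dots> = farr G h \<cdot>\<^bsub>M\<^esub> \<eta> X \<cdot>\<^bsub>M\<^esub> f"
    unfolding adj_facts(5)[OF assms(1), symmetric]
    by (rule M.compo_assoc[OF assms(1) adj_facts(3)[OF X(2)] functor_Hom[OF adj_facts(2) assms(2)], symmetric])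
  finally show ?thesis unfolding transp_def .
qed

lemma left_adjoint_pushout:
  assumes "pushout M i f f' i'"
  shows "pushout N (farr F i) (farr F f) (farr F f') (farr F i')"
proof -
  obtain A B B' D where h: "i \<in> Hom M A B" "f \<in> Hom M A B'" "f' \<in> Hom M B D" "i' \<in> Hom M B' D"
    and sq: "f' \<cdot>\<^bsub>M\<^esub> i = i' \<cdot>\<^bsub>M\<^esub> f"
    and u0: "\<forall>X u v. u \<in> Hom M B X \<and> v \<in> Hom M B' X \<and> u \<cdot>\<^bsub>M\<^esub> i = v \<cdot>\<^bsub>M\<^esub> f \<longrightarrow>
        (\<exists>!h. h \<in> Hom M D X \<and> h \<cdot>\<^bsub>M\<^esub> f' = u \<and> h \<cdot>\<^bsub>M\<^esub> i' = v)"
    using assms unfolding pushout_def by (elim exE conjE) (rule that)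
  note F = adj_facts(1)
  have O: "A \<in> Obj M" "B \<in> Obj M" "B' \<in> Obj M" "D \<in> Obj M" using M.Hom_Obj h by auto
  note Fh = h[THEN functor_Hom[OF F]]
  have "\<exists>!h. h \<in> Hom N (fobj F D) Y \<and> h \<cdot>\<^bsub>N\<^esub> farr F f' = u \<and> h \<cdot>\<^bsub>N\<^esub> farr F i' = v"
    if uv: "u \<in> Hom N (fobj F B) Y" "v \<in> Hom N (fobj F B') Y" "u \<cdot>\<^bsub>N\<^esub> farr F i = v \<cdot>\<^bsub>N\<^esub> farr F f" for Y u v
  proof -
    have Y: "Y \<in> Obj N" using N.Hom_Obj uv by blast
    have "transp M G \<eta> B u \<cdot>\<^bsub>M\<^esub> i = transp M G \<eta> B' v \<cdot>\<^bsub>M\<^esub> f"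
      using transp_nat[OF h(1) uv(1)] transp_nat[OF h(2) uv(2)] uv(3) by simp
    then have "\<exists>!g. g \<in> Hom M D (fobj G Y) \<and> g \<cdot>\<^bsub>M\<^esub> f' = transp M G \<eta> B u \<and> g \<cdot>\<^bsub>M\<^esub> i' = transp M G \<eta> B' v"
      using u0 transp_Hom[OF O(2) uv(1)] transp_Hom[OF O(3) uv(2)] by blast
    then obtain g where g: "g \<in> Hom M D (fobj G Y)" "g \<cdot>\<^bsub>M\<^esub> f' = transp M G \<eta> B u" "g \<cdot>\<^bsub>M\<^esub> i' = transp M G \<eta> B' v"
      and gu: "\<And>g'. g' \<in> Hom M D (fobj G Y) \<Longrightarrow> g' \<cdot>\<^bsub>M\<^esub> f' = transp M G \<eta> B u \<Longrightarrow> g' \<cdot>\<^bsub>M\<^esub> i' = transp M G \<eta> B' v \<Longrightarrow> g' = g"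
      by blast
    let ?k = "untransp N F \<epsilon> Y g"
    have k: "?k \<in> Hom N (fobj F D) Y" by (rule untransp_Hom[OF Y g(1)])
    have kt: "transp M G \<eta> D ?k = g" by (rule transp_untransp[OF Y g(1)])
    show ?thesis
    proof (rule ex1I[of _ ?k], intro conjI)
      show "?k \<in> Hom N (fobj F D) Y" by fact
      show "?k \<cdot>\<^bsub>N\<^esub> farr F f' = u"
        using untransp_transp[OF O(2) N.compo_Hom[OF Fh(3) k]] untransp_transp[OF O(2) uv(1)]
        unfolding transp_nat[OF h(3) k] kt g(2) by simp
      show "?k \<cdot>\<^bsub>N\<^esub> farr F i' = v"
        using untransp_transp[OF O(3) N.compo_Hom[OF Fh(4) k]] untransp_transp[OF O(3) uv(2)]
        unfolding transp_nat[OF h(4) k] kt g(3) by simp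
      fix h' assume h': "h' \<in> Hom N (fobj F D) Y \<and> h' \<cdot>\<^bsub>N\<^esub> farr F f' = u \<and> h' \<cdot>\<^bsub>N\<^esub> farr F i' = v"
      then have h1: "h' \<in> Hom N (fobj F D) Y" by simp
      have "transp M G \<eta> D h' = g"
        by (rule gu[OF transp_Hom[OF O(4) h1]])
          (use transp_nat[OF h(3) h1] transp_nat[OF h(4) h1] h' in auto)
      then show "h' = ?k" using untransp_transp[OF O(4) h1] by simp
    qed
  qed
  moreover have "farr F f' \<cdot>\<^bsub>N\<^esub> farr F i = farr F i' \<cdot>\<^bsub>N\<^esub> farr F f"
    using functor_comp[OF F h(1,3)] functor_comp[OF F h(2,4)] sq by simp
  ultimately show ?thesis unfolding pushout_def using Fh by blast
qed

lemma left_adjoint_initial: assumes "initial M Z" shows "initial N (fobj F Z)"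
proof -
  have Z: "Z \<in> Obj M" using assms by (simp add: initial_def)
  have "\<exists>!f. f \<in> Hom N (fobj F Z) Y" if Y: "Y \<in> Obj N" for Y
  proof -
    obtain g where g: "g \<in> Hom M Z (fobj G Y)" "\<And>g'. g' \<in> Hom M Z (fobj G Y) \<Longrightarrow> g' = g"
      using assms fobj_Obj(2)[OF Y] unfolding initial_def by blast
    show ?thesis
    proof (rule ex1I[of _ "untransp N F \<epsilon> Y g"])
      show "untransp N F \<epsilon> Y g \<in> Hom N (fobj F Z) Y" by (rule untransp_Hom[OF Y g(1)])
      fix h assume h: "h \<in> Hom N (fobj F Z) Y"
      show "h = untransp N F \<epsilon> Y g"
        using untransp_transp[OF Z h] g(2)[OF transp_Hom[OF Z h]] by simp
    qed
  qed
  then show ?thesis using fobj_Obj(1)[OF Z] by (simp add: initial_def)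
qed

end

lemma quillen_cofibrant:
  assumes M: "weak_model_category M" and N: "weak_model_category N"
    and Q: "quillen_adjunction M N F G \<eta> \<epsilon>" and A: "cofibrant M A"
  shows "cofibrant N (fobj F A)"
proof -
  have adj: "adjunction M N F G \<eta> \<epsilon>" and F: "is_functor M N F" and C: "farr F ` Cof M \<subseteq> Cof N"
    using Q by (auto simp: quillen_adjunction_def adjunction_def)
  obtain Z f where "initial M Z" "f \<in> Hom M Z A" "f \<in> Cof M" using A unfolding cofibrant_def by blast
  then show ?thesis
    unfolding cofibrant_def
    using left_adjoint_initial[OF _ _ adj] functor_Hom[OF F] C M N
    unfolding weak_model_category_def by blast
qed

lemma pull_bafun_lambda:
  assumes M: "weak_model_category M" and N: "weak_model_category N"
    and Q: "quillen_adjunction M N F G \<eta> \<epsilon>"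
    and P: "lambda_boolean_over r (cof_cat N) (cof_cofs N) P"
  shows "lambda_boolean_over r (cof_cat M) (cof_cofs M) (pull_bafun F P)"
proof -
  interpret M: weak_model_category M by (rule M)
  interpret N: weak_model_category N by (rule N)
  interpret P: lambda_boolean_over r "cof_cat N" "cof_cofs N" P by (rule P)
  have adj: "adjunction M N F G \<eta> \<epsilon>" and F: "is_functor M N F" and C: "farr F ` Cof M \<subseteq> Cof N"
    using Q by (auto simp: quillen_adjunction_def adjunction_def)
  note cof = quillen_cofibrant[OF M N Q]
  have FH: "farr F f \<in> Hom (cof_cat N) (fobj F A) (fobj F B)" if "f \<in> Hom (cof_cat M) A B" for f A B
    using that functor_Hom[OF F] cof unfolding M.Hom_cof N.Hom_cof by blast
  have FC: "farr F i \<in> cof_cofs N" if i: "i \<in> cof_cofs M" for i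
  proof -
    have "i \<in> Hom (cof_cat M) (Dom M i) (Cod M i)"
      using i by (auto simp: cof_cofs_def Hom_def M.cof_sel)
    then have "farr F i \<in> Cof N \<and> farr F i \<in> Hom (cof_cat N) (fobj F (Dom M i)) (fobj F (Cod M i))"
      using FH i C by (auto simp: cof_cofs_def)
    then show ?thesis by (auto simp: cof_cofs_def Hom_def)
  qed
  show ?thesis
  proof (intro lambda_boolean_over.intro lambda_boolean_over_axioms.intro)
    show "category (cof_cat M)" by (rule M.cof_cat_category)
    show "lambda_boolean r (alg (pull_bafun F P) A)" if "A \<in> Obj (cof_cat M)" for A
      using that P.alg_lambda cof unfolding M.cof_sel N.cof_sel pull_bafun_def by simp
    show "lambda_hom r (alg (pull_bafun F P) A) (alg (pull_bafun F P) B) (act (pull_bafun F P) f)"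
      if "f \<in> Hom (cof_cat M) A B" for f A B
      using P.act_hom[OF FH[OF that]] by (simp add: pull_bafun_def)
    show "act (pull_bafun F P) (ident (cof_cat M) A) x = x"
      if "A \<in> Obj (cof_cat M)" "x \<in> carrier (alg (pull_bafun F P) A)" for A x
    proof -
      have A: "cofibrant M A" using that M.cof_sel by simp
      then have "farr F (ident M A) = ident N (fobj F A)"
        using F M.cofibrant_Obj unfolding is_functor_def by blast
      then show ?thesis using P.act_ident[of "fobj F A" x] that(2) cof[OF A]
        unfolding M.cof_sel N.cof_sel pull_bafun_def by simp
    qed
    show "act (pull_bafun F P) (g \<cdot>\<^bsub>cof_cat M\<^esub> f) x = act (pull_bafun F P) g (act (pull_bafun F P) f x)"
      if f: "f \<in> Hom (cof_cat M) A B" "g \<in> Hom (cof_cat M) B D" and x: "x \<in> carrier (alg (pull_bafun F P) A)"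
      for f A B g D x
    proof -
      have "farr F (g \<cdot>\<^bsub>M\<^esub> f) = farr F g \<cdot>\<^bsub>N\<^esub> farr F f"
        using functor_comp[OF F] f unfolding M.Hom_cof by blast
      then show ?thesis using P.act_comp[OF FH[OF f(1)] FH[OF f(2)]] x
        unfolding M.cof_sel N.cof_sel pull_bafun_def by simp
    qed
    show "exq (pull_bafun F P) i y \<in> carrier (alg (pull_bafun F P) A)"
      if "i \<in> cof_cofs M" "i \<in> Hom (cof_cat M) A B" "y \<in> carrier (alg (pull_bafun F P) B)" for i A B y
      using P.exq_closed[OF FC[OF that(1)] FH[OF that(2)]] that(3) by (simp add: pull_bafun_def)
    show "exq (pull_bafun F P) i y \<sqsubseteq>\<^bsub>alg (pull_bafun F P) A\<^esub> x \<longleftrightarrow>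
        y \<sqsubseteq>\<^bsub>alg (pull_bafun F P) B\<^esub> act (pull_bafun F P) i x"
      if "i \<in> cof_cofs M" "i \<in> Hom (cof_cat M) A B" "x \<in> carrier (alg (pull_bafun F P) A)"
        "y \<in> carrier (alg (pull_bafun F P) B)" for i A B x y
      using P.exq_adjoint[OF FC[OF that(1)] FH[OF that(2)]] that(3,4) by (simp add: pull_bafun_def)
    show "act (pull_bafun F P) f (exq (pull_bafun F P) i y) =
        exq (pull_bafun F P) i' (act (pull_bafun F P) f' y)"
      if i: "i \<in> cof_cofs M" "i' \<in> cof_cofs M" and p: "pushout (cof_cat M) i f f' i'"
        and y: "y \<in> carrier (alg (pull_bafun F P) (Cod (cof_cat M) i))" for i i' f f' y
    proof -
      note h = pushout_Hom[OF p, unfolded M.cof_sel]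
      note Fh = h[THEN FH]
      have "pushout N (farr F i) (farr F f) (farr F f') (farr F i')"
        by (rule left_adjoint_pushout[OF M.category_axioms N.category_axioms adj M.pushout_cof_cat[OF i(1) p]])
      then have po: "pushout (cof_cat N) (farr F i) (farr F f) (farr F f') (farr F i')"
        unfolding cof_cat_def
        by (rule pushout_full[OF N.category_axioms])
          (use Fh[unfolded N.Hom_cof] in \<open>auto simp: Hom_def\<close>)
      have c: "Cod N (farr F i) = fobj F (Cod M i)" using Fh(1) unfolding N.Hom_cof by (auto simp: Hom_def)
      show ?thesis
        using P.beck_chevalley[OF FC[OF i(1)] FC[OF i(2)] po, unfolded N.cof_sel c] y
        by (simp add: pull_bafun_def M.cof_sel)
    qed
  qed
qed

lemma zigzag_append: "zigzag C W A B p \<Longrightarrow> zigzag C W B D q \<Longrightarrow> zigzag C W A D (p @ q)"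
  by (induction rule: zigzag.induct) (auto intro: zigzag.intros)

lemma (in category) zigzag_Obj: "zigzag C W A B p \<Longrightarrow> A \<in> Obj C \<and> B \<in> Obj C"
  by (induction rule: zigzag.induct) (auto dest: Hom_Obj)

lemma (in category) zzeq_zigzag: "zzeq C W A B p q \<Longrightarrow> zigzag C W A B p \<and> zigzag C W A B q"
proof (induction rule: zzeq.induct)
  case (zzeq_append A B p p' D q q')
  then show ?case using zigzag_append by metis
next
  case (zzeq_ident A)
  then show ?case using ident_Hom by (auto intro: zigzag.intros)
next
  case (zzeq_comp f A B g D)
  then show ?case using compo_Hom[OF zzeq_comp] Hom_Obj by (auto intro!: zigzag.intros)
next
  case (zzeq_inv1 w A B)
  then show ?case using Hom_Obj by (auto intro!: zigzag.intros)
next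
  case (zzeq_inv2 w A B)
  then show ?case using Hom_Obj by (auto intro!: zigzag.intros)
qed auto

lemma zcls_eq: "zigzag C W A B p \<Longrightarrow> zigzag C W A B q \<Longrightarrow> zcls C W A B p = zcls C W A B q \<longleftrightarrow> zzeq C W A B p q"
  unfolding zcls_def by (auto intro: zzeq_refl zzeq_sym zzeq_trans)

lemma (in category) loc_Hom: "a \<in> Hom (localization C W) A B \<longleftrightarrow> (\<exists>p. zigzag C W A B p \<and> a = zcls C W A B p)"
  by (auto simp: Hom_def localization_def zcls_def)

lemma (in category) loc_comp:
  assumes "zigzag C W A B p" "zigzag C W B D q"
  shows "zcls C W B D q \<cdot>\<^bsub>localization C W\<^esub> zcls C W A B p = zcls C W A D (p @ q)"
  unfolding localization_def zcls_def
  using assms by (auto intro: zzeq_refl zzeq_append zzeq_trans)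

lemma (in category) loc_sel: "Obj (localization C W) = Obj C" "ident (localization C W) A = zcls C W A A []"
  by (auto simp: localization_def)

lemma (in category) loc_category: "category (localization C W)"
proof
  fix f assume "f \<in> Arr (localization C W)"
  then obtain A B p where p: "zigzag C W A B p" "f = zcls C W A B p" by (auto simp: localization_def)
  show "Dom (localization C W) f \<in> Obj (localization C W)" "Cod (localization C W) f \<in> Obj (localization C W)"
    using zigzag_Obj[OF p(1)] p(2) by (auto simp: localization_def zcls_def)
next
  show "ident (localization C W) A \<in> Hom (localization C W) A A" if "A \<in> Obj (localization C W)" for A
    using that unfolding loc_Hom loc_sel by (auto intro: zz_nil)
  fix f A B assume "f \<in> Hom (localization C W) A B"
  then obtain p where p: "zigzag C W A B p" "f = zcls C W A B p" by (auto simp: loc_Hom)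
  have o: "A \<in> Obj C" "B \<in> Obj C" using zigzag_Obj[OF p(1)] by auto
  show "f \<cdot>\<^bsub>localization C W\<^esub> ident (localization C W) A = f"
    unfolding p(2) loc_sel loc_comp[OF zz_nil[OF o(1)] p(1)] by simp
  show "ident (localization C W) B \<cdot>\<^bsub>localization C W\<^esub> f = f"
    unfolding p(2) loc_sel loc_comp[OF p(1) zz_nil[OF o(2)]] by simp
  fix g D assume "g \<in> Hom (localization C W) B D"
  then obtain q where q: "zigzag C W B D q" "g = zcls C W B D q" by (auto simp: loc_Hom)
  note pq = zigzag_append[OF p(1) q(1)]
  show "g \<cdot>\<^bsub>localization C W\<^esub> f \<in> Hom (localization C W) A D"
    unfolding p(2) q(2) loc_comp[OF p(1) q(1)] loc_Hom using pq by blast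
  fix h E assume "h \<in> Hom (localization C W) D E"
  then obtain r where r: "zigzag C W D E r" "h = zcls C W D E r" by (auto simp: loc_Hom)
  show "h \<cdot>\<^bsub>localization C W\<^esub> g \<cdot>\<^bsub>localization C W\<^esub> f = h \<cdot>\<^bsub>localization C W\<^esub> (g \<cdot>\<^bsub>localization C W\<^esub> f)"
    unfolding p(2) q(2) r(2) loc_comp[OF p(1) q(1)] loc_comp[OF q(1) r(1)] loc_comp[OF pq r(1)]
      loc_comp[OF p(1) zigzag_append[OF q(1) r(1)]] by simp
qed

lemma (in category) zz_single:
  "f \<in> Hom C A B \<Longrightarrow> zigzag C W A B [Fwd f]" "w \<in> W \<Longrightarrow> w \<in> Hom C A B \<Longrightarrow> zigzag C W B A [Bwd w]"
  using Hom_Obj by (auto intro!: zigzag.intros)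

lemma (in category) loc_ftor_farr: "f \<in> Hom C A B \<Longrightarrow> farr (loc_ftor C W) f = zcls C W A B [Fwd f]"
  by (auto simp: loc_ftor_def Hom_def)

lemma (in category) loc_functor: "is_functor C (localization C W) (loc_ftor C W)"
proof -
  have 1: "farr (loc_ftor C W) (ident C A) = zcls C W A A []" if "A \<in> Obj C" for A
    unfolding loc_ftor_farr[OF ident_Hom[OF that]]
    using zcls_eq[OF zz_single(1)[OF ident_Hom[OF that]] zz_nil[OF that]] zzeq_ident[OF that] by blast
  have 2: "farr (loc_ftor C W) (g \<cdot> f) = farr (loc_ftor C W) g \<cdot>\<^bsub>localization C W\<^esub> farr (loc_ftor C W) f"
    if f: "f \<in> Hom C A B" "g \<in> Hom C B D" for f g A B D
    unfolding loc_ftor_farr[OF f(1)] loc_ftor_farr[OF f(2)] loc_ftor_farr[OF compo_Hom[OF f]]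
      loc_comp[OF zz_single(1)[OF f(1)] zz_single(1)[OF f(2)]]
    using zcls_eq[OF zz_single(1)[OF compo_Hom[OF f]] zigzag_append[OF zz_single(1)[OF f(1)] zz_single(1)[OF f(2)]]]
      zzeq_comp[OF f] zzeq_sym by fastforce
  show ?thesis unfolding is_functor_def loc_sel loc_Hom
  proof (intro conjI ballI allI)
    fix A B f assume f: "f \<in> Hom C A B"
    show "\<exists>p. zigzag C W (fobj (loc_ftor C W) A) (fobj (loc_ftor C W) B) p \<and>
        farr (loc_ftor C W) f = zcls C W (fobj (loc_ftor C W) A) (fobj (loc_ftor C W) B) p"
      unfolding loc_ftor_farr[OF f] using zz_single(1)[OF f] by (auto simp: loc_ftor_def)
  qed (use 1 2 in \<open>auto simp: loc_ftor_def\<close>)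
qed

lemma (in category) loc_inv:
  assumes w: "w \<in> W" "w \<in> Hom C A B"
  shows "zcls C W B A [Bwd w] \<cdot>\<^bsub>localization C W\<^esub> zcls C W A B [Fwd w] = ident (localization C W) A"
    "zcls C W A B [Fwd w] \<cdot>\<^bsub>localization C W\<^esub> zcls C W B A [Bwd w] = ident (localization C W) B"
proof -
  note z = zz_single(1)[OF w(2)] zz_single(2)[OF w]
  have o: "A \<in> Obj C" "B \<in> Obj C" using Hom_Obj[OF w(2)] by auto
  show "zcls C W B A [Bwd w] \<cdot>\<^bsub>localization C W\<^esub> zcls C W A B [Fwd w] = ident (localization C W) A"
    unfolding loc_comp[OF z] loc_sel zcls_eq[OF zigzag_append[OF z] zz_nil[OF o(1)]]
    using zzeq_inv1[OF w] by simp
  show "zcls C W A B [Fwd w] \<cdot>\<^bsub>localization C W\<^esub> zcls C W B A [Bwd w] = ident (localization C W) B"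
    unfolding loc_comp[OF z(2,1)] loc_sel zcls_eq[OF zigzag_append[OF z(2,1)] zz_nil[OF o(2)]]
    using zzeq_inv2[OF w] by simp
qed

lemma (in category) localization_inverts:
  assumes w: "w \<in> W" "w \<in> Hom C A B" shows "is_iso (localization C W) (farr (loc_ftor C W) w)"
proof -
  have "zcls C W A B [Fwd w] \<in> Hom (localization C W) A B" "zcls C W B A [Bwd w] \<in> Hom (localization C W) B A"
    using zz_single w loc_Hom by blast+
  then show ?thesis
    using loc_inv[OF w] unfolding loc_ftor_farr[OF w(2)] is_iso_def
    by (intro conjI bexI[of _ "zcls C W B A [Bwd w]"]) (simp_all add: Hom_def)
qed


definition inv_arr :: "('o, 'm, 'z) cat_scheme \<Rightarrow> 'm \<Rightarrow> 'm"
  where "inv_arr D f = (SOME g. g \<in> Hom D (Cod D f) (Dom D f) \<and>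
    g \<cdot>\<^bsub>D\<^esub> f = ident D (Dom D f) \<and> f \<cdot>\<^bsub>D\<^esub> g = ident D (Cod D f))"

lemma inv_arr:
  assumes "is_iso D f" "f \<in> Hom D A B"
  shows "inv_arr D f \<in> Hom D B A" "inv_arr D f \<cdot>\<^bsub>D\<^esub> f = ident D A" "f \<cdot>\<^bsub>D\<^esub> inv_arr D f = ident D B"
proof -
  have "\<exists>g. g \<in> Hom D (Cod D f) (Dom D f) \<and>
    g \<cdot>\<^bsub>D\<^esub> f = ident D (Dom D f) \<and> f \<cdot>\<^bsub>D\<^esub> g = ident D (Cod D f)"
    using assms unfolding is_iso_def by blast
  from someI_ex[OF this] show "inv_arr D f \<in> Hom D B A" "inv_arr D f \<cdot>\<^bsub>D\<^esub> f = ident D A"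
    "f \<cdot>\<^bsub>D\<^esub> inv_arr D f = ident D B"
    using assms(2) unfolding inv_arr_def[symmetric] by (auto simp: Hom_def)
qed

primrec zig_eval :: "('o, 'm, 'y) cat_scheme \<Rightarrow> ('p, 'n, 'z) cat_scheme \<Rightarrow> ('o, 'm, 'p, 'n) ftor \<Rightarrow>
    'm step list \<Rightarrow> 'o \<Rightarrow> 'n"
  where
    "zig_eval C D H [] A = ident D (fobj H A)"
  | "zig_eval C D H (s # p) A = (case s of
      Fwd f \<Rightarrow> zig_eval C D H p (Cod C f) \<cdot>\<^bsub>D\<^esub> farr H f
    | Bwd w \<Rightarrow> zig_eval C D H p (Dom C w) \<cdot>\<^bsub>D\<^esub> inv_arr D (farr H w))"

lemma (in category) localization_universal:
  fixes D :: "('p, 'n, 'y) cat_scheme" and H :: "('o, 'm, 'p, 'n) ftor"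
  assumes D: "category D" and H: "is_functor C D H"
    and W: "\<And>w. w \<in> W \<Longrightarrow> w \<in> Arr C \<Longrightarrow> is_iso D (farr H w)"
  shows "\<exists>H'. is_functor (localization C W) D H' \<and> fobj H' = fobj H \<and>
      (\<forall>f\<in>Arr C. farr H' (farr (loc_ftor C W) f) = farr H f)"
    and "\<lbrakk>is_functor (localization C W) D H1; is_functor (localization C W) D H2;
      \<And>A. A \<in> Obj C \<Longrightarrow> fobj H1 A = fobj H2 A;
      \<And>f. f \<in> Arr C \<Longrightarrow> farr H1 (farr (loc_ftor C W) f) = farr H2 (farr (loc_ftor C W) f);
      a \<in> Arr (localization C W)\<rbrakk> \<Longrightarrow> farr H1 a = farr H2 a"
proof -
  interpret D: category D by (rule D)
  let ?L = "localization C W"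
  let ?e = "zig_eval C D H"
  have HO: "fobj H A \<in> Obj D" "farr H (ident C A) = ident D (fobj H A)" if "A \<in> Obj C" for A
    using H that unfolding is_functor_def by auto
  have inv: "inv_arr D (farr H w) \<in> Hom D (fobj H B) (fobj H A)"
      "inv_arr D (farr H w) \<cdot>\<^bsub>D\<^esub> farr H w = ident D (fobj H A)"
      "farr H w \<cdot>\<^bsub>D\<^esub> inv_arr D (farr H w) = ident D (fobj H B)"
    if "w \<in> W" "w \<in> Hom C A B" for w A B
    using inv_arr[OF W functor_Hom[OF H that(2)]] that by (auto simp: Hom_def)
  have eH: "?e p A \<in> Hom D (fobj H A) (fobj H B)" if "zigzag C W A B p" for A B p
    using that
  proof (induction rule: zigzag.induct)
    case (zz_nil A) then show ?case using D.ident_Hom HO by simp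
  next
    case (zz_fwd f A B E p)
    then show ?case using D.compo_Hom[OF functor_Hom[OF H zz_fwd(1)] zz_fwd(3)] by (simp add: Hom_def)
  next
    case (zz_bwd w B A E p)
    then show ?case using D.compo_Hom[OF inv(1)[OF zz_bwd(1,2)] zz_bwd(4)] by (simp add: Hom_def)
  qed
  have eapp: "?e (p @ q) A = ?e q B \<cdot>\<^bsub>D\<^esub> ?e p A" if "zigzag C W A B p" "zigzag C W B E q" for A B E p q
    using that
  proof (induction rule: zigzag.induct)
    case (zz_nil A) then show ?case using D.ident_right[OF eH[OF zz_nil(2)]] by simp
  next
    case (zz_fwd f A B E' p)
    have "Cod C f = B" using zz_fwd by (simp add: Hom_def)
    then show ?case
      using zz_fwd D.compo_assoc[OF functor_Hom[OF H zz_fwd(1)] eH[OF zz_fwd(2)] eH[OF zz_fwd(4)]] by simp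
  next
    case (zz_bwd w B A E' p)
    have "Dom C w = B" using zz_bwd by (simp add: Hom_def)
    then show ?case
      using zz_bwd D.compo_assoc[OF inv(1)[OF zz_bwd(1,2)] eH[OF zz_bwd(3)] eH[OF zz_bwd(5)]] by simp
  qed
  have e1: "?e [Fwd f] A = farr H f" if "f \<in> Hom C A B" for f A B
    using D.ident_left[OF functor_Hom[OF H that]] that by (simp add: Hom_def)
  have e2: "?e [Bwd w] B = inv_arr D (farr H w)" if "w \<in> W" "w \<in> Hom C A B" for w A B
    using D.ident_left[OF inv(1)[OF that]] that by (simp add: Hom_def)
  have esound: "?e p A = ?e q A" if "zzeq C W A B p q" for A B p q
    using that
  proof (induction rule: zzeq.induct)
    case (zzeq_append A B p p' E q q')
    then show ?case
      using eapp zzeq_zigzag[OF zzeq_append(1)] zzeq_zigzag[OF zzeq_append(2)] by metis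
  next
    case (zzeq_ident A)
    then show ?case using e1[OF ident_Hom[OF zzeq_ident]] HO by simp
  next
    case (zzeq_comp f A B g E)
    have "?e [Fwd f, Fwd g] A = farr H g \<cdot>\<^bsub>D\<^esub> farr H f"
      using eapp[OF zz_single(1)[OF zzeq_comp(1)] zz_single(1)[OF zzeq_comp(2)]]
      unfolding e1[OF zzeq_comp(1)] e1[OF zzeq_comp(2)] by simp
    then show ?case unfolding e1[OF compo_Hom[OF zzeq_comp]] using functor_comp[OF H zzeq_comp] by simp
  next
    case (zzeq_inv1 w A B)
    show ?case using eapp[OF zz_single(1)[OF zzeq_inv1(2)] zz_single(2)[OF zzeq_inv1]]
      unfolding e1[OF zzeq_inv1(2)] e2[OF zzeq_inv1] inv(2)[OF zzeq_inv1] by simp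
  next
    case (zzeq_inv2 w A B)
    show ?case using eapp[OF zz_single(2)[OF zzeq_inv2] zz_single(1)[OF zzeq_inv2(2)]]
      unfolding e1[OF zzeq_inv2(2)] e2[OF zzeq_inv2] inv(3)[OF zzeq_inv2] by simp
  qed auto
  define H' where "H' = \<lparr>fobj = fobj H, farr = (\<lambda>a :: ('o, 'm) zarr. ?e (SOME p. p \<in> snd (snd a)) (fst a))\<rparr>"
  have H': "farr H' (zcls C W A B p) = ?e p A" if p: "zigzag C W A B p" for A B p
  proof -
    have "p \<in> snd (snd (zcls C W A B p))" using p by (auto simp: zcls_def intro: zzeq_refl)
    then have "(SOME q. q \<in> snd (snd (zcls C W A B p))) \<in> snd (snd (zcls C W A B p))" by (rule someI)
    then have "zzeq C W A B p (SOME q. q \<in> snd (snd (zcls C W A B p)))" by (simp add: zcls_def)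
    from esound[OF this] show ?thesis by (simp add: H'_def zcls_def)
  qed
  have "is_functor ?L D H'"
    unfolding is_functor_def
  proof (intro conjI ballI allI)
    fix A assume "A \<in> Obj ?L"
    then have A: "A \<in> Obj C" by (simp add: loc_sel)
    show "fobj H' A \<in> Obj D" using HO A by (simp add: H'_def)
    show "farr H' (ident ?L A) = ident D (fobj H' A)"
      unfolding loc_sel H'[OF zz_nil[OF A]] by (simp add: H'_def)
  next
    fix A B f assume "f \<in> Hom ?L A B"
    then obtain p where p: "zigzag C W A B p" "f = zcls C W A B p" by (auto simp: loc_Hom)
    show "farr H' f \<in> Hom D (fobj H' A) (fobj H' B)"
      unfolding p(2) H'[OF p(1)] using eH[OF p(1)] by (simp add: H'_def)
    fix E g assume "g \<in> Hom ?L B E"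
    then obtain q where q: "zigzag C W B E q" "g = zcls C W B E q" by (auto simp: loc_Hom)
    show "farr H' (g \<cdot>\<^bsub>?L\<^esub> f) = farr H' g \<cdot>\<^bsub>D\<^esub> farr H' f"
      unfolding p(2) q(2) loc_comp[OF p(1) q(1)] H'[OF p(1)] H'[OF q(1)] H'[OF zigzag_append[OF p(1) q(1)]]
      by (rule eapp[OF p(1) q(1)])
  qed
  moreover have "farr H' (farr (loc_ftor C W) f) = farr H f" if "f \<in> Arr C" for f
  proof -
    have f: "f \<in> Hom C (Dom C f) (Cod C f)" using that by (simp add: Hom_def)
    show ?thesis unfolding loc_ftor_farr[OF f] H'[OF zz_single(1)[OF f]] by (rule e1[OF f])
  qed
  ultimately show "\<exists>H'. is_functor ?L D H' \<and> fobj H' = fobj H \<and>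
      (\<forall>f\<in>Arr C. farr H' (farr (loc_ftor C W) f) = farr H f)"
    by (intro exI[of _ H']) (simp add: H'_def)
  assume F: "is_functor ?L D H1" "is_functor ?L D H2"
    and O: "\<And>A. A \<in> Obj C \<Longrightarrow> fobj H1 A = fobj H2 A"
    and A: "\<And>f. f \<in> Arr C \<Longrightarrow> farr H1 (farr (loc_ftor C W) f) = farr H2 (farr (loc_ftor C W) f)"
    and a: "a \<in> Arr ?L"
  have fw: "farr H1 (zcls C W A B [Fwd f]) = farr H2 (zcls C W A B [Fwd f])" if "f \<in> Hom C A B" for f A B
    using A[of f] that unfolding loc_ftor_farr[OF that] by (simp add: Hom_def)
  have bw: "farr H1 (zcls C W B A [Bwd w]) = farr H2 (zcls C W B A [Bwd w])"
    if w: "w \<in> W" "w \<in> Hom C A B" for w A B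
  proof -
    have o: "A \<in> Obj C" "B \<in> Obj C" using Hom_Obj[OF w(2)] by auto
    let ?f = "zcls C W A B [Fwd w]" and ?b = "zcls C W B A [Bwd w]"
    have fb: "?f \<in> Hom ?L A B" "?b \<in> Hom ?L B A" using zz_single w loc_Hom by blast+
    have i: "farr G (ident ?L A) = ident D (fobj G A)" if "is_functor ?L D G" "A \<in> Obj C" for G A
      using that unfolding is_functor_def loc_sel by blast
    have 1: "farr H1 ?b \<cdot>\<^bsub>D\<^esub> farr H1 ?f = ident D (fobj H1 A)"
      using functor_comp[OF F(1) fb] i[OF F(1) o(1)] unfolding loc_inv[OF w] by simp
    have 2: "farr H1 ?f \<cdot>\<^bsub>D\<^esub> farr H2 ?b = ident D (fobj H1 B)"
      using functor_comp[OF F(2) fb(2,1)] i[OF F(2) o(2)] O[OF o(2)] unfolding loc_inv[OF w] fw[OF w(2)] by simp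
    note f1 = functor_Hom[OF F(1) fb(1)] and b1 = functor_Hom[OF F(1) fb(2)]
    have b2: "farr H2 ?b \<in> Hom D (fobj H1 B) (fobj H1 A)"
      using functor_Hom[OF F(2) fb(2)] O[OF o(1)] O[OF o(2)] by simp
    show ?thesis
      using D.compo_assoc[OF b2 f1 b1] D.ident_left[OF b2] D.ident_right[OF b1] unfolding 1 2 by simp
  qed
  obtain A0 B0 p where p: "zigzag C W A0 B0 p" "a = zcls C W A0 B0 p" using a by (auto simp: localization_def)
  have "farr H1 (zcls C W A0 B0 p) = farr H2 (zcls C W A0 B0 p)" using p(1)
  proof (induction rule: zigzag.induct)
    case (zz_nil A)
    then show ?case using F O unfolding is_functor_def loc_sel by metis
  next
    case (zz_fwd f A B E p)
    note z = zz_single(1)[OF zz_fwd(1)]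
    have h: "zcls C W A B [Fwd f] \<in> Hom ?L A B" "zcls C W B E p \<in> Hom ?L B E"
      using z zz_fwd(2) loc_Hom by blast+
    show ?case
      using loc_comp[OF z zz_fwd(2)] functor_comp[OF F(1) h] functor_comp[OF F(2) h] fw[OF zz_fwd(1)] zz_fwd(3)
      by simp
  next
    case (zz_bwd w B A E p)
    note z = zz_single(2)[OF zz_bwd(1,2)]
    have h: "zcls C W A B [Bwd w] \<in> Hom ?L A B" "zcls C W B E p \<in> Hom ?L B E"
      using z zz_bwd(3) loc_Hom by blast+
    show ?case
      using loc_comp[OF z zz_bwd(3)] functor_comp[OF F(1) h] functor_comp[OF F(2) h] bw[OF zz_bwd(1,2)] zz_bwd(4)
      by simp
  qed
  then show "farr H1 a = farr H2 a" using p(2) by simp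
qed

lemma boolean_quotient:
  fixes L :: "('a, 'z) gorder_scheme"
  assumes L: "boolean_lattice L" and R: "equiv (carrier L) R"
    and cm: "\<And>x x' y y'. (x, x') \<in> R \<Longrightarrow> (y, y') \<in> R \<Longrightarrow> (x \<sqinter>\<^bsub>L\<^esub> y, x' \<sqinter>\<^bsub>L\<^esub> y') \<in> R"
    and cj: "\<And>x x' y y'. (x, x') \<in> R \<Longrightarrow> (y, y') \<in> R \<Longrightarrow> (x \<squnion>\<^bsub>L\<^esub> y, x' \<squnion>\<^bsub>L\<^esub> y') \<in> R"
  shows "boolean_lattice (quot_order L R)"
    and "bool_hom L (quot_order L R) (\<lambda>x. R `` {x})"
proof -
  interpret L: boolean_lattice L by (rule L)
  let ?Q = "quot_order L R" and ?c = "\<lambda>x. R `` {x}"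
  define \<rho> where "\<rho> X = (SOME x. x \<in> X)" for X :: "'a set"
  have carR: "x \<in> carrier L" "y \<in> carrier L" if "(x, y) \<in> R" for x y
    using that R by (auto simp: equiv_def refl_on_def)
  have sym: "(y, x) \<in> R" if "(x, y) \<in> R" for x y using that R by (meson equivE symE)
  have tr: "(x, z) \<in> R" if "(x, y) \<in> R" "(y, z) \<in> R" for x y z using that R by (meson equivE transE)
  have rf: "(x, x) \<in> R" if "x \<in> carrier L" for x using that R by (meson equivE refl_onD)
  have inQ: "?c x \<in> carrier ?Q" if "x \<in> carrier L" for x
    using that by (simp add: quot_order_def quotientI)
  have ceq: "?c x = ?c y \<longleftrightarrow> (x, y) \<in> R" if "x \<in> carrier L" "y \<in> carrier L" for x y
    using eq_equiv_class_iff[OF R that] .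
  have \<rho>: "\<rho> X \<in> carrier L \<and> ?c (\<rho> X) = X" if "X \<in> carrier ?Q" for X
  proof -
    obtain x where x: "x \<in> carrier L" "X = ?c x"
    proof -
      have "X \<in> carrier L // R" using \<open>X \<in> carrier ?Q\<close> by (simp add: quot_order_def)
      then show thesis by (rule quotientE) (rule that)
    qed
    have "\<rho> X \<in> X" unfolding \<rho>_def using x rf by (metis Image_singleton_iff someI_ex)
    then have "(x, \<rho> X) \<in> R" using x by simp
    then show ?thesis using x ceq[OF x(1) carR(2)] carR(2) by auto
  qed
  have meq: "x \<sqinter>\<^bsub>L\<^esub> y = x" if "x \<in> carrier L" "y \<in> carrier L" "x \<sqsubseteq>\<^bsub>L\<^esub> y" for x y
    using L.meet_eq that by blast
  have leq: "?c x \<sqsubseteq>\<^bsub>?Q\<^esub> ?c y \<longleftrightarrow> (x \<sqinter>\<^bsub>L\<^esub> y, x) \<in> R" if x: "x \<in> carrier L" and y: "y \<in> carrier L" for x y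
  proof
    assume "?c x \<sqsubseteq>\<^bsub>?Q\<^esub> ?c y"
    then obtain x' y' where 1: "(x, x') \<in> R" "(y, y') \<in> R" "x' \<sqsubseteq>\<^bsub>L\<^esub> y'" by (auto simp: quot_order_def)
    have "x' \<sqinter>\<^bsub>L\<^esub> y' = x'" by (rule meq[OF carR(2)[OF 1(1)] carR(2)[OF 1(2)] 1(3)])
    then show "(x \<sqinter>\<^bsub>L\<^esub> y, x) \<in> R" using tr[OF cm[OF 1(1,2)]] sym[OF 1(1)] by simp
  next
    assume "(x \<sqinter>\<^bsub>L\<^esub> y, x) \<in> R"
    from sym[OF this] have "x \<sqinter>\<^bsub>L\<^esub> y \<in> ?c x" by simp
    then show "?c x \<sqsubseteq>\<^bsub>?Q\<^esub> ?c y" using rf[OF y] L.meet_right[OF x y] by (auto simp: quot_order_def)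
  qed
  have mono: "?c x \<sqsubseteq>\<^bsub>?Q\<^esub> ?c y" if "x \<in> carrier L" "y \<in> carrier L" "x \<sqsubseteq>\<^bsub>L\<^esub> y" for x y
    using leq[OF that(1,2)] meq[OF that] rf that by simp
  have qtr: "?c x \<sqsubseteq>\<^bsub>?Q\<^esub> ?c z"
    if c: "x \<in> carrier L" "y \<in> carrier L" "z \<in> carrier L" and le: "?c x \<sqsubseteq>\<^bsub>?Q\<^esub> ?c y" "?c y \<sqsubseteq>\<^bsub>?Q\<^esub> ?c z" for x y z
  proof -
    have 1: "(x \<sqinter>\<^bsub>L\<^esub> y, x) \<in> R" "(y \<sqinter>\<^bsub>L\<^esub> z, y) \<in> R" using le leq c by auto
    have "x \<sqinter>\<^bsub>L\<^esub> (y \<sqinter>\<^bsub>L\<^esub> z) = x \<sqinter>\<^bsub>L\<^esub> y \<sqinter>\<^bsub>L\<^esub> z"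
      using L.weak_meet_assoc[OF c] L.eq_is_equal by metis
    then have a: "(x \<sqinter>\<^bsub>L\<^esub> y \<sqinter>\<^bsub>L\<^esub> z, x \<sqinter>\<^bsub>L\<^esub> y) \<in> R" using cm[OF rf[OF c(1)] 1(2)] by simp
    have b: "(x \<sqinter>\<^bsub>L\<^esub> y \<sqinter>\<^bsub>L\<^esub> z, x \<sqinter>\<^bsub>L\<^esub> z) \<in> R" using cm[OF 1(1) rf[OF c(3)]] .
    have "(x \<sqinter>\<^bsub>L\<^esub> z, x) \<in> R" by (rule tr[OF sym[OF b] tr[OF a 1(1)]])
    then show ?thesis using leq c by blast
  qed
  have qas: "?c x = ?c y" if c: "x \<in> carrier L" "y \<in> carrier L" and le: "?c x \<sqsubseteq>\<^bsub>?Q\<^esub> ?c y" "?c y \<sqsubseteq>\<^bsub>?Q\<^esub> ?c x" for x y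
  proof -
    have a: "(x \<sqinter>\<^bsub>L\<^esub> y, x) \<in> R" "(x \<sqinter>\<^bsub>L\<^esub> y, y) \<in> R" using le leq c meet_comm[of L x y] by auto
    then show ?thesis using ceq[OF c] tr[OF sym[OF a(1)] a(2)] by simp
  qed
  have po: "partial_order ?Q"
  proof -
    have p1: "X \<sqsubseteq>\<^bsub>?Q\<^esub> X" if "X \<in> carrier ?Q" for X using \<rho>[OF that] mono L.le_refl by metis
    have p2: "X = Y" if "X \<in> carrier ?Q" "Y \<in> carrier ?Q" "X \<sqsubseteq>\<^bsub>?Q\<^esub> Y" "Y \<sqsubseteq>\<^bsub>?Q\<^esub> X" for X Y
      using \<rho>[OF that(1)] \<rho>[OF that(2)] qas[of "\<rho> X" "\<rho> Y"] that by simp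
    have p3: "X \<sqsubseteq>\<^bsub>?Q\<^esub> Z"
      if "X \<in> carrier ?Q" "Y \<in> carrier ?Q" "Z \<in> carrier ?Q" "X \<sqsubseteq>\<^bsub>?Q\<^esub> Y" "Y \<sqsubseteq>\<^bsub>?Q\<^esub> Z" for X Y Z
      using \<rho>[OF that(1)] \<rho>[OF that(2)] \<rho>[OF that(3)] qtr[of "\<rho> X" "\<rho> Y" "\<rho> Z"] that by simp
    have p4: "eq ?Q = (=)" by (simp add: quot_order_def)
    show ?thesis 
      by unfold_locales (unfold p4, fast, fast, fast, fact p1, rule p2, assumption+,
        rule p3, assumption+, fast, fast)
  qed
  let ?m = "\<lambda>X Y. ?c (\<rho> X \<sqinter>\<^bsub>L\<^esub> \<rho> Y)" and ?j = "\<lambda>X Y. ?c (\<rho> X \<squnion>\<^bsub>L\<^esub> \<rho> Y)"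
    and ?n = "\<lambda>X. ?c (bcompl L (\<rho> X))"
  have mc: "?m (?c x) (?c y) = ?c (x \<sqinter>\<^bsub>L\<^esub> y)" and jc: "?j (?c x) (?c y) = ?c (x \<squnion>\<^bsub>L\<^esub> y)"
    if "x \<in> carrier L" "y \<in> carrier L" for x y
  proof -
    have "(\<rho> (?c x), x) \<in> R" "(\<rho> (?c y), y) \<in> R" 
      using \<rho>[OF inQ[OF that(1)]] \<rho>[OF inQ[OF that(2)]] ceq that by auto
    from cm[OF this] cj[OF this] show "?m (?c x) (?c y) = ?c (x \<sqinter>\<^bsub>L\<^esub> y)" "?j (?c x) (?c y) = ?c (x \<squnion>\<^bsub>L\<^esub> y)"
      using ceq[OF carR[OF cm[OF \<open>(\<rho> (?c x), x) \<in> R\<close> \<open>(\<rho> (?c y), y) \<in> R\<close>]]]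
        ceq[OF carR[OF cj[OF \<open>(\<rho> (?c x), x) \<in> R\<close> \<open>(\<rho> (?c y), y) \<in> R\<close>]]] by simp_all
  qed
  have el: "P X" if "X \<in> carrier ?Q" "\<And>x. x \<in> carrier L \<Longrightarrow> P (?c x)" for P X
    using that \<rho> by metis
  have 1: "?m X Y \<in> carrier ?Q" "?j X Y \<in> carrier ?Q" if "X \<in> carrier ?Q" "Y \<in> carrier ?Q" for X Y
    using \<rho>[OF that(1)] \<rho>[OF that(2)] inQ by auto
  have 2: "?n X \<in> carrier ?Q" if "X \<in> carrier ?Q" for X
    using \<rho>[OF that] inQ L.compl_facts by auto
  have 3: "Z \<sqsubseteq>\<^bsub>?Q\<^esub> ?m X Y \<longleftrightarrow> Z \<sqsubseteq>\<^bsub>?Q\<^esub> X \<and> Z \<sqsubseteq>\<^bsub>?Q\<^esub> Y"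
    if "X \<in> carrier ?Q" "Y \<in> carrier ?Q" "Z \<in> carrier ?Q" for X Y Z
  proof (rule el[OF that(1)], rule el[OF that(2)], rule el[OF that(3)])
    fix x y z assume c: "x \<in> carrier L" "y \<in> carrier L" "z \<in> carrier L"
    have xy: "x \<sqinter>\<^bsub>L\<^esub> y \<in> carrier L" using c by simp
    have "?c z \<sqsubseteq>\<^bsub>?Q\<^esub> ?c (x \<sqinter>\<^bsub>L\<^esub> y)" if z: "?c z \<sqsubseteq>\<^bsub>?Q\<^esub> ?c x" "?c z \<sqsubseteq>\<^bsub>?Q\<^esub> ?c y"
    proof -
      have r: "(z \<sqinter>\<^bsub>L\<^esub> x, z) \<in> R" "(z \<sqinter>\<^bsub>L\<^esub> y, z) \<in> R" using z leq c by auto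
      have "z \<sqinter>\<^bsub>L\<^esub> (x \<sqinter>\<^bsub>L\<^esub> y) = z \<sqinter>\<^bsub>L\<^esub> x \<sqinter>\<^bsub>L\<^esub> y" using L.weak_meet_assoc[OF c(3,1,2)] L.eq_is_equal by metis
      then show ?thesis using leq[OF c(3) xy] tr[OF cm[OF r(1) rf[OF c(2)]] r(2)] by simp
    qed
    moreover have "?c (x \<sqinter>\<^bsub>L\<^esub> y) \<sqsubseteq>\<^bsub>?Q\<^esub> ?c x" "?c (x \<sqinter>\<^bsub>L\<^esub> y) \<sqsubseteq>\<^bsub>?Q\<^esub> ?c y"
      using mono[OF xy] c L.meet_left L.meet_right by auto
    ultimately show "?c z \<sqsubseteq>\<^bsub>?Q\<^esub> ?m (?c x) (?c y) \<longleftrightarrow> ?c z \<sqsubseteq>\<^bsub>?Q\<^esub> ?c x \<and> ?c z \<sqsubseteq>\<^bsub>?Q\<^esub> ?c y"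
      unfolding mc[OF c(1,2)] using qtr[OF c(3) xy] c by blast
  qed
  have 4: "?j X Y \<sqsubseteq>\<^bsub>?Q\<^esub> Z \<longleftrightarrow> X \<sqsubseteq>\<^bsub>?Q\<^esub> Z \<and> Y \<sqsubseteq>\<^bsub>?Q\<^esub> Z"
    if "X \<in> carrier ?Q" "Y \<in> carrier ?Q" "Z \<in> carrier ?Q" for X Y Z
  proof (rule el[OF that(1)], rule el[OF that(2)], rule el[OF that(3)])
    fix x y z assume c: "x \<in> carrier L" "y \<in> carrier L" "z \<in> carrier L"
    have xy: "x \<squnion>\<^bsub>L\<^esub> y \<in> carrier L" using c by simp
    have "?c (x \<squnion>\<^bsub>L\<^esub> y) \<sqsubseteq>\<^bsub>?Q\<^esub> ?c z" if z: "?c x \<sqsubseteq>\<^bsub>?Q\<^esub> ?c z" "?c y \<sqsubseteq>\<^bsub>?Q\<^esub> ?c z"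
    proof -
      have r: "(x \<sqinter>\<^bsub>L\<^esub> z, x) \<in> R" "(y \<sqinter>\<^bsub>L\<^esub> z, y) \<in> R" using z leq c by auto
      have "(x \<squnion>\<^bsub>L\<^esub> y) \<sqinter>\<^bsub>L\<^esub> z = (x \<sqinter>\<^bsub>L\<^esub> z) \<squnion>\<^bsub>L\<^esub> (y \<sqinter>\<^bsub>L\<^esub> z)"
        using L.meet_distrib[OF c(3,1,2)] by (metis meet_comm[of L])
      then show ?thesis using leq[OF xy c(3)] cj[OF r] by simp
    qed
    moreover have "?c x \<sqsubseteq>\<^bsub>?Q\<^esub> ?c (x \<squnion>\<^bsub>L\<^esub> y)" "?c y \<sqsubseteq>\<^bsub>?Q\<^esub> ?c (x \<squnion>\<^bsub>L\<^esub> y)"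
      using mono xy c L.join_left L.join_right by auto
    ultimately show "?j (?c x) (?c y) \<sqsubseteq>\<^bsub>?Q\<^esub> ?c z \<longleftrightarrow> ?c x \<sqsubseteq>\<^bsub>?Q\<^esub> ?c z \<and> ?c y \<sqsubseteq>\<^bsub>?Q\<^esub> ?c z"
      unfolding jc[OF c(1,2)] using qtr[OF _ xy c(3)] c by blast
  qed
  have 5: "?c \<bottom>\<^bsub>L\<^esub> \<sqsubseteq>\<^bsub>?Q\<^esub> X" "X \<sqsubseteq>\<^bsub>?Q\<^esub> ?c \<top>\<^bsub>L\<^esub>" if "X \<in> carrier ?Q" for X
    by (rule el[OF that], rule mono; simp)+
  have 6: "?m X (?j Y Z) \<sqsubseteq>\<^bsub>?Q\<^esub> ?j (?m X Y) (?m X Z)"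
    if "X \<in> carrier ?Q" "Y \<in> carrier ?Q" "Z \<in> carrier ?Q" for X Y Z
  proof (rule el[OF that(1)], rule el[OF that(2)], rule el[OF that(3)])
    fix x y z assume c: "x \<in> carrier L" "y \<in> carrier L" "z \<in> carrier L"
    then have d: "y \<squnion>\<^bsub>L\<^esub> z \<in> carrier L" "x \<sqinter>\<^bsub>L\<^esub> y \<in> carrier L" "x \<sqinter>\<^bsub>L\<^esub> z \<in> carrier L" by auto
    show "?m (?c x) (?j (?c y) (?c z)) \<sqsubseteq>\<^bsub>?Q\<^esub> ?j (?m (?c x) (?c y)) (?m (?c x) (?c z))"
      unfolding jc[OF c(2,3)] mc[OF c(1) d(1)] mc[OF c(1,2)] mc[OF c(1,3)] jc[OF d(2,3)] L.meet_distrib[OF c]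
      by (rule mono) (use d in auto)
  qed
  have 7: "?m X (?n X) \<sqsubseteq>\<^bsub>?Q\<^esub> ?c \<bottom>\<^bsub>L\<^esub>" "?c \<top>\<^bsub>L\<^esub> \<sqsubseteq>\<^bsub>?Q\<^esub> ?j X (?n X)" if X: "X \<in> carrier ?Q" for X
  proof -
    note f = L.compl_facts[OF \<rho>[OF X, THEN conjunct1]]
    have "?m X (?n X) = ?c (\<rho> X \<sqinter>\<^bsub>L\<^esub> bcompl L (\<rho> X))" "?j X (?n X) = ?c (\<rho> X \<squnion>\<^bsub>L\<^esub> bcompl L (\<rho> X))"
      using mc[OF \<rho>[OF X, THEN conjunct1] f(1)] jc[OF \<rho>[OF X, THEN conjunct1] f(1)] \<rho>[OF X] by auto
    then show "?m X (?n X) \<sqsubseteq>\<^bsub>?Q\<^esub> ?c \<bottom>\<^bsub>L\<^esub>" "?c \<top>\<^bsub>L\<^esub> \<sqsubseteq>\<^bsub>?Q\<^esub> ?j X (?n X)"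
      unfolding f using mono by auto
  qed
  note B = boolI[where L = ?Q and m = ?m and j = ?j and n = ?n and b = "?c \<bottom>\<^bsub>L\<^esub>" and t = "?c \<top>\<^bsub>L\<^esub>"]
  note bt = inQ[OF L.bottom_closed] inQ[OF L.top_closed]
  show "boolean_lattice ?Q" by (rule B(1); fact po 1 2 3 4 5 6 7 bt)
  have b: "\<bottom>\<^bsub>?Q\<^esub> = ?c \<bottom>\<^bsub>L\<^esub>" by (rule B(4); fact po 1 2 3 4 5 6 7 bt)
  have t: "\<top>\<^bsub>?Q\<^esub> = ?c \<top>\<^bsub>L\<^esub>" by (rule B(5); fact po 1 2 3 4 5 6 7 bt)
  have m: "X \<sqinter>\<^bsub>?Q\<^esub> Y = ?m X Y" if "X \<in> carrier ?Q" "Y \<in> carrier ?Q" for X Y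
    by (rule B(2); fact po 1 2 3 4 5 6 7 bt that)
  have j: "X \<squnion>\<^bsub>?Q\<^esub> Y = ?j X Y" if "X \<in> carrier ?Q" "Y \<in> carrier ?Q" for X Y
    by (rule B(3); fact po 1 2 3 4 5 6 7 bt that)
  show "bool_hom L ?Q ?c"
    unfolding bool_hom_def using b t m j mc jc inQ by auto
qed

lemma h_language_boolean:
  fixes r :: "'k rel"
  assumes M: "weak_model_category M" and A: "cofibrant M A" and card: "Card_order r"
  shows "boolean_lattice (h_language r M A)"
proof -
  interpret M: weak_model_category M by (rule M)
  let ?L = "alg (language r M) A"
  have OA: "A \<in> Obj (cof_cat M)" using A M.cof_sel by blast
  have "lambda_boolean r ?L" unfolding language_def
    by (rule lambda_IA[OF M.cof_cat_category card OA])
  then have L: "boolean_lattice ?L" by (simp add: lambda_boolean_def)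
  interpret L: boolean_lattice ?L by (rule L)
  have hom: "bool_hom ?L (alg (hom_algebra M X) A) (interp r M X A)" if X: "X \<in> Obj M" for X
  proof -
    note P = M.hom_algebra_lambda[where r = r, OF X]
    obtain h where h: "bafun_hom r (cof_cat M) (cof_cofs M) (language r M) (hom_algebra M X) h"
      using initial_over_hom(1)[OF P card] unfolding language_def by blast
    have e: "interp r M X A x = h A x" if "x \<in> carrier ?L" for x
      using initial_over_hom(3)[OF P card h[unfolded language_def] OA] that
      unfolding interp_def language_def by simp
    have "bool_hom ?L (alg (hom_algebra M X) A) (h A)"
      using h OA by (auto simp: bafun_hom_def lambda_hom_def)
    then show ?thesis unfolding bool_hom_def by (auto simp: e)
  qed
  show ?thesis unfolding h_language_def
  proof (rule boolean_quotient(1)[OF L])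
    show "equiv (carrier ?L) (sem_equiv r M A)"
      by (intro equivI refl_onI symI transI) (auto simp: sem_equiv_def)
    fix x x' y y' assume R: "(x, x') \<in> sem_equiv r M A" "(y, y') \<in> sem_equiv r M A"
    then have c: "x \<in> carrier ?L" "x' \<in> carrier ?L" "y \<in> carrier ?L" "y' \<in> carrier ?L"
      by (auto simp: sem_equiv_def)
    show "(x \<sqinter>\<^bsub>?L\<^esub> y, x' \<sqinter>\<^bsub>?L\<^esub> y') \<in> sem_equiv r M A" "(x \<squnion>\<^bsub>?L\<^esub> y, x' \<squnion>\<^bsub>?L\<^esub> y') \<in> sem_equiv r M A"
      using R c hom unfolding sem_equiv_def bool_hom_def by auto
  qed
qed

end

theory Submission
  imports Defs
begin

text \<open>A map \<open>v : A \<rightarrow> X\<close> with \<open>A\<close> cofibrant and \<open>X\<close> fibrant satisfies or refutes a formula at \<open>A\<close>,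
  and everything rests on one property of such maps: if \<open>i : A \<rightarrow> B\<close> is a cofibration, every arrow
  \<open>B \<rightarrow> X\<close> of the homotopy category that restricts to the class of \<open>v\<close> is the class of a map
  \<open>B \<rightarrow> X\<close> that restricts strictly to \<open>v\<close>. By induction on formulas, with quantifiers treated by this
  property, truth depends only on the class of \<open>v\<close> up to isomorphism of \<open>X\<close> in the homotopy category.
  This makes substitution along a weak equivalence and the action of a Quillen equivalence injective up to
  semantic equivalence. For surjectivity, an arrow of the homotopy category between cofibrant objects
  is a fraction \<open>j\<inverse> g\<close> with \<open>j\<close> a trivial cofibration, and substitution along it is expressed by
  \<open>\<exists>\<^sub>j g\<^sup>*\<close>; a Quillen equivalence being full and essentially surjective on homotopy categories, each
  formula over \<open>F A\<close> can then be rebuilt, connective by connective, from a formula over \<open>A\<close>.\<close>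

section \<open>Duality\<close>

text \<open>The homotopy category is a localization by zigzags, so neither the equality nor the
  existence of its arrows is directly accessible. Zigzags are therefore made to act on homotopy
  classes of maps from a cofibrant \<open>B\<close> into fibrant replacements; invariance of this
  action under the generating relations yields faithfulness, and following one class along a zigzag
  yields fullness. The obstacle is that only maps from a cofibrant to a fibrant object factor. The
  usual path object, cylinder and gluing of paths are then out of reach. Paths and cylinder
  homotopies are used together instead: one lift concatenates a path with a cylinder homotopy, and
  from this follow transitivity and the independence of all choices. Fractions appear because a
  cofibrant \<open>A\<close> need not be fibrant: an arrow into \<open>A\<close> is the class of a
  map only after passing to \<open>A'\<close> along a trivial cofibration \<open>j\<close>. On the
  logical side, the language is free, so semantic equivalence is decided on raw formulas, and both
  invariance theorems become statements about \<open>sat\<close>.\<close>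

definition opp :: "('o, 'm, 'z) wmcat_scheme \<Rightarrow> ('o, 'm) wmcat"
  where "opp M = \<lparr>Obj = Obj M, Arr = Arr M, Dom = Cod M, Cod = Dom M, ident = ident M,
    compo = (\<lambda>g f. f \<cdot>\<^bsub>M\<^esub> g), Cof = Fib M, Fib = Cof M, Weq = Weq M\<rparr>"

lemma opp_sel [simp]:
  "Obj (opp M) = Obj M" "Arr (opp M) = Arr M" "Dom (opp M) = Cod M" "Cod (opp M) = Dom M"
  "ident (opp M) = ident M" "g \<cdot>\<^bsub>opp M\<^esub> f = f \<cdot>\<^bsub>M\<^esub> g"
  "Cof (opp M) = Fib M" "Fib (opp M) = Cof M" "Weq (opp M) = Weq M"
  by (simp_all add: opp_def)

lemma Hom_opp [simp]: "Hom (opp M) A B = Hom M B A"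
  by (auto simp: Hom_def)

lemma initial_opp [simp]: "initial (opp M) Z \<longleftrightarrow> terminal M Z"
  and terminal_opp [simp]: "terminal (opp M) Z \<longleftrightarrow> initial M Z"
  by (simp_all add: initial_def terminal_def)

lemma cofibrant_opp [simp]: "cofibrant (opp M) X \<longleftrightarrow> fibrant M X"
  and fibrant_opp [simp]: "fibrant (opp M) X \<longleftrightarrow> cofibrant M X"
  by (simp_all add: cofibrant_def fibrant_def)

lemma pushout_opp [simp]: "pushout (opp M) f g p q \<longleftrightarrow> pullback M f g p q"
  and pullback_opp [simp]: "pullback (opp M) f g p q \<longleftrightarrow> pushout M f g p q"
  unfolding pushout_def pullback_def by simp_all

lemma is_iso_opp [simp]: "is_iso (opp M) f \<longleftrightarrow> is_iso M f"
  unfolding is_iso_def by auto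

lemma lifts_opp [simp]: "lifts (opp M) p i \<longleftrightarrow> lifts M i p"
proof -
  have e: "v \<cdot>\<^bsub>M\<^esub> i = p \<cdot>\<^bsub>M\<^esub> u \<longleftrightarrow> p \<cdot>\<^bsub>M\<^esub> u = v \<cdot>\<^bsub>M\<^esub> i" for u v by auto
  show ?thesis unfolding lifts_def opp_sel Hom_opp e by blast
qed

context category begin

lemma comp_Hom: "\<lbrakk>g \<in> Hom C B D; f \<in> Hom C A B\<rbrakk> \<Longrightarrow> g \<cdot> f \<in> Hom C A D"
  by (rule compo_Hom)

lemma iso_inverse:
  assumes "is_iso C f" "f \<in> Hom C A B"
  obtains g where "g \<in> Hom C B A" "g \<cdot> f = ident C A" "f \<cdot> g = ident C B" "is_iso C g"
proof -
  have d: "Dom C f = A" "Cod C f = B" "f \<in> Arr C" using assms(2) by (auto simp: Hom_def)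
  then obtain g where g: "g \<in> Hom C B A" "g \<cdot> f = ident C A" "f \<cdot> g = ident C B"
    using assms(1) unfolding is_iso_def by auto
  then have "is_iso C g" using assms(2) unfolding is_iso_def by (auto simp: Hom_def)
  then show thesis using that g by blast
qed

lemma iso_cancel_left:
  assumes "is_iso C f" "f \<in> Hom C A B" "u \<in> Hom C D A" "v \<in> Hom C D A" "f \<cdot> u = f \<cdot> v"
  shows "u = v"
proof -
  obtain g where g: "g \<in> Hom C B A" "g \<cdot> f = ident C A" using iso_inverse[OF assms(1,2)] by blast
  show ?thesis using compo_assoc[OF assms(3,2) g(1)] compo_assoc[OF assms(4,2) g(1)] g(2) assms
      ident_left by metis
qed

lemma iso_cancel_right:
  assumes "is_iso C f" "f \<in> Hom C A B" "u \<in> Hom C B D" "v \<in> Hom C B D" "u \<cdot> f = v \<cdot> f"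
  shows "u = v"
proof -
  obtain g where g: "g \<in> Hom C B A" "f \<cdot> g = ident C B" using iso_inverse[OF assms(1,2)] by blast
  show ?thesis using compo_assoc[OF g(1) assms(2,3)] compo_assoc[OF g(1) assms(2,4)] g(2) assms
      ident_right by metis
qed

lemma iso_ident: "A \<in> Obj C \<Longrightarrow> is_iso C (ident C A)"
  using ident_Hom[of A] ident_left[OF ident_Hom] unfolding is_iso_def by (auto simp: Hom_def)

lemma iso_comp:
  assumes "is_iso C f" "f \<in> Hom C A B" "is_iso C g" "g \<in> Hom C B D"
  shows "is_iso C (g \<cdot> f)"
proof -
  obtain f' where f': "f' \<in> Hom C B A" "f' \<cdot> f = ident C A" "f \<cdot> f' = ident C B"
    using iso_inverse[OF assms(1,2)] by blast
  obtain g' where g': "g' \<in> Hom C D B" "g' \<cdot> g = ident C B" "g \<cdot> g' = ident C D"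
    using iso_inverse[OF assms(3,4)] by blast
  note gf = comp_Hom[OF assms(4,2)] and h = comp_Hom[OF f'(1) g'(1)]
  have "f' \<cdot> g' \<cdot> (g \<cdot> f) = f' \<cdot> (g' \<cdot> (g \<cdot> f))" by (rule compo_assoc[OF gf g'(1) f'(1)])
  also have "g' \<cdot> (g \<cdot> f) = f"
    using compo_assoc[OF assms(2,4) g'(1)] g'(2) ident_left[OF assms(2)] by simp
  finally have 1: "f' \<cdot> g' \<cdot> (g \<cdot> f) = ident C A" using f'(2) by simp
  have "g \<cdot> f \<cdot> (f' \<cdot> g') = g \<cdot> (f \<cdot> (f' \<cdot> g'))" by (rule compo_assoc[OF h assms(2,4)])
  also have "f \<cdot> (f' \<cdot> g') = g'"
    using compo_assoc[OF g'(1) f'(1) assms(2)] f'(3) ident_left[OF g'(1)] by simp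
  finally have 2: "g \<cdot> f \<cdot> (f' \<cdot> g') = ident C D" using g'(3) by simp
  show ?thesis using gf h 1 2 unfolding is_iso_def by (auto simp: Hom_def)
qed

end

context weak_model_category begin

text \<open>The axioms are exchanged in pairs or are self-dual. Only closure under isomorphism needs
  an argument (\<open>ic\<close>): an isomorphism of arrows in \<open>opp M\<close> points the other
  way, so it is replaced by its inverse.\<close>

lemma dual: "weak_model_category (opp M)"
proof -
  have ic: "iso_closed (opp M) K" if K: "iso_closed M K" "K \<subseteq> Arr M" for K
    unfolding iso_closed_def
  proof (intro ballI allI impI, unfold is_iso_opp opp_sel Hom_opp)
    fix f f' u v assume f: "f \<in> K" "f' \<in> Arr M"
      and a: "is_iso M u \<and> is_iso M v \<and> u \<in> Hom M (Cod M f') (Cod M f) \<and>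
        v \<in> Hom M (Dom M f') (Dom M f) \<and> u \<cdot> f' = f \<cdot> v"
    obtain u' where u': "u' \<in> Hom M (Cod M f) (Cod M f')" "u' \<cdot> u = ident M (Cod M f')" "is_iso M u'"
      using iso_inverse a by metis
    obtain v' where v': "v' \<in> Hom M (Dom M f) (Dom M f')" "v \<cdot> v' = ident M (Dom M f)" "is_iso M v'"
      using iso_inverse a by metis
    have h: "f \<in> Hom M (Dom M f) (Cod M f)" "f' \<in> Hom M (Dom M f') (Cod M f')"
      using f K by (auto simp: Hom_def)
    have vh: "v \<in> Hom M (Dom M f') (Dom M f)" and uh: "u \<in> Hom M (Cod M f') (Cod M f)" using a by auto
    have "f' \<cdot> v' = u' \<cdot> u \<cdot> (f' \<cdot> v')"
      using ident_left[OF compo_Hom[OF v'(1) h(2)]] u' by simp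
    also have "\<dots> = u' \<cdot> (u \<cdot> f' \<cdot> v')"
      using compo_assoc[OF compo_Hom[OF v'(1) h(2)] uh u'(1)] compo_assoc[OF v'(1) h(2) uh] by simp
    also have "\<dots> = u' \<cdot> f"
      using a compo_assoc[OF v'(1) vh h(1)] v'(2) ident_right[OF h(1)] by simp
    finally have sq: "f' \<cdot> v' = u' \<cdot> f" .
    show "f' \<in> K"
      using K(1)[unfolded iso_closed_def, rule_format, OF f, of v' u'] u' v' sq by simp
  qed
  show ?thesis
  proof (unfold_locales, unfold opp_sel Hom_opp initial_opp terminal_opp cofibrant_opp fibrant_opp
      pushout_opp pullback_opp is_iso_opp lifts_opp)
    show "f \<in> Arr M \<Longrightarrow> Cod M f \<in> Obj M" "f \<in> Arr M \<Longrightarrow> Dom M f \<in> Obj M"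
      "A \<in> Obj M \<Longrightarrow> ident M A \<in> Hom M A A" for f A
      by (rule Cod_Obj Dom_Obj ident_Hom; assumption)+
    show "f \<in> Hom M B A \<Longrightarrow> g \<in> Hom M D B \<Longrightarrow> f \<cdot> g \<in> Hom M D A" for A B D f g
      by (rule compo_Hom)
    show "f \<in> Hom M B A \<Longrightarrow> ident M A \<cdot> f = f" "f \<in> Hom M B A \<Longrightarrow> f \<cdot> ident M B = f" for f A B
      by (rule ident_left ident_right; assumption)+
    show "f \<in> Hom M B A \<Longrightarrow> g \<in> Hom M D B \<Longrightarrow> h \<in> Hom M E D \<Longrightarrow> f \<cdot> (g \<cdot> h) = f \<cdot> g \<cdot> h" for f g h A B D E
      by (rule compo_assoc[symmetric])
    show "Fib M \<subseteq> Arr M" "Cof M \<subseteq> Arr M" "Weq M \<subseteq> Arr M" by (fact Fib_Arr Cof_Arr Weq_Arr)+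
    show "\<exists>Z. terminal M Z \<and> ident M Z \<in> Fib M" "\<exists>T. initial M T \<and> ident M T \<in> Cof M"
      by (fact terminal_Fib initial_Cof)+
    show "\<lbrakk>fibrant M A; f \<in> Fib M; f \<in> Hom M B A; g \<in> Fib M; g \<in> Hom M D B\<rbrakk> \<Longrightarrow> f \<cdot> g \<in> Fib M" for A B D f g
      by (rule Fib_comp)
    show "\<lbrakk>cofibrant M D; f \<in> Cof M; f \<in> Hom M B A; g \<in> Cof M; g \<in> Hom M D B\<rbrakk> \<Longrightarrow> f \<cdot> g \<in> Cof M" for A B D f g
      by (rule Cof_comp)
    show "\<lbrakk>f \<in> Hom M B A; g \<in> Hom M D B; fibrant M A \<or> cofibrant M A; fibrant M B \<or> cofibrant M B;
        fibrant M D \<or> cofibrant M D\<rbrakk>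
       \<Longrightarrow> (f \<in> Weq M \<and> g \<in> Weq M \<longrightarrow> f \<cdot> g \<in> Weq M) \<and>
          (f \<in> Weq M \<and> f \<cdot> g \<in> Weq M \<longrightarrow> g \<in> Weq M) \<and> (g \<in> Weq M \<and> f \<cdot> g \<in> Weq M \<longrightarrow> f \<in> Weq M)" for A B D f g
      using two_of_three[of g D B f A] by blast
    show "\<lbrakk>is_iso M f; f \<in> Hom M B A; fibrant M A \<or> cofibrant M A; fibrant M B \<or> cofibrant M B\<rbrakk>
       \<Longrightarrow> f \<in> Weq M" for f A B using iso_Weq by blast
    show "\<lbrakk>i \<in> Fib M; i \<in> Hom M B A; f \<in> Hom M A' A; fibrant M A; fibrant M A'\<rbrakk>
       \<Longrightarrow> \<exists>f' i'. pullback M i f f' i' \<and> i' \<in> Fib M" for i f A B A' by (rule Fib_pullback)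
    show "\<lbrakk>i \<in> Cof M; i \<in> Hom M B A; f \<in> Hom M B A'; cofibrant M B; cofibrant M A'\<rbrakk>
       \<Longrightarrow> \<exists>f' i'. pushout M i f f' i' \<and> i' \<in> Cof M" for i f A B A' by (rule Cof_pushout)
    show "iso_closed (opp M) (Fib M)" "iso_closed (opp M) (Cof M)" "iso_closed (opp M) (Weq M)"
      using ic Fib_iso_closed Cof_iso_closed Weq_iso_closed Fib_Arr Cof_Arr Weq_Arr by auto
    show "\<lbrakk>f \<in> Hom M X A; fibrant M A; cofibrant M X\<rbrakk> \<Longrightarrow>
      \<exists>E. \<exists>i\<in>Hom M E A. \<exists>p\<in>Hom M X E. f = i \<cdot> p \<and> i \<in> Fib M \<and> p \<in> Cof M \<inter> Weq M" for f A X
      using factor_trivial_Cof[of f X A] by blast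
    show "\<lbrakk>f \<in> Hom M X A; fibrant M A; cofibrant M X\<rbrakk> \<Longrightarrow>
      \<exists>E. \<exists>i\<in>Hom M E A. \<exists>p\<in>Hom M X E. f = i \<cdot> p \<and> i \<in> Fib M \<inter> Weq M \<and> p \<in> Cof M" for f A X
      using factor_trivial_Fib[of f X A] by blast
    show "\<lbrakk>i \<in> Fib M; i \<in> Hom M B A; fibrant M A; fibrant M B; p \<in> Cof M; p \<in> Hom M Y X; cofibrant M X;
        cofibrant M Y; i \<in> Weq M \<or> p \<in> Weq M\<rbrakk> \<Longrightarrow> lifts M p i" for i p A B X Y
      using lifting[of p Y X i B A] by blast
  qed
qed

end

section \<open>Homotopy\<close>

text \<open>The last clause replaces the fibration \<open>P \<rightarrow> X \<times> X\<close>. No factorization of the diagonal of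
  \<open>X\<close> is available when \<open>X\<close> is not cofibrant, so the constant paths are given on a cofibrant
  replacement \<open>q\<close>.\<close>

definition path_object :: "('o, 'm, 'z) wmcat_scheme \<Rightarrow> 'o \<Rightarrow> 'o \<Rightarrow> 'm \<Rightarrow> 'm \<Rightarrow> bool"
  where "path_object M X P e0 e1 \<longleftrightarrow> fibrant M X \<and> fibrant M P \<and> e0 \<in> Hom M P X \<and> e1 \<in> Hom M P X \<and>
    e0 \<in> Fib M \<inter> Weq M \<and> e1 \<in> Fib M \<inter> Weq M \<and>
    (\<exists>X' q s. cofibrant M X' \<and> q \<in> Hom M X' X \<and> q \<in> Fib M \<inter> Weq M \<and> s \<in> Hom M X' P \<and>
      e0 \<cdot>\<^bsub>M\<^esub> s = q \<and> e1 \<cdot>\<^bsub>M\<^esub> s = q) \<and>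
    (\<forall>A B i k x y. cofibrant M A \<and> cofibrant M B \<and> i \<in> Hom M A B \<and> i \<in> Cof M \<inter> Weq M \<and>
      k \<in> Hom M A P \<and> x \<in> Hom M B X \<and> y \<in> Hom M B X \<and>
      e0 \<cdot>\<^bsub>M\<^esub> k = x \<cdot>\<^bsub>M\<^esub> i \<and> e1 \<cdot>\<^bsub>M\<^esub> k = y \<cdot>\<^bsub>M\<^esub> i \<longrightarrow>
      (\<exists>h\<in>Hom M B P. h \<cdot>\<^bsub>M\<^esub> i = k \<and> e0 \<cdot>\<^bsub>M\<^esub> h = x \<and> e1 \<cdot>\<^bsub>M\<^esub> h = y))"

text \<open>Read in \<open>M\<close>, the two ends become trivial cofibrations
  \<open>i0, i1 : A -> I\<close>, the constant path becomes a map from \<open>I\<close> to a fibrant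
  replacement of \<open>A\<close> that collapses both ends, and the lifting clause lifts a homotopy
  along a trivial fibration with prescribed ends.\<close>

definition cylinder :: "('o, 'm, 'z) wmcat_scheme \<Rightarrow> 'o \<Rightarrow> 'o \<Rightarrow> 'm \<Rightarrow> 'm \<Rightarrow> bool"
  where "cylinder M = path_object (opp M)"

text \<open>One path object suffices here; that any cylinder or any path object would do is the
  content of \<open>homotopic_left\<close> and \<open>homotopic_right\<close>.\<close>

definition homotopic :: "('o, 'm, 'z) wmcat_scheme \<Rightarrow> 'o \<Rightarrow> 'o \<Rightarrow> 'm \<Rightarrow> 'm \<Rightarrow> bool"
  where "homotopic M A X v v' \<longleftrightarrow> cofibrant M A \<and>
    (\<exists>P e0 e1. \<exists>k\<in>Hom M A P. path_object M X P e0 e1 \<and> e0 \<cdot>\<^bsub>M\<^esub> k = v \<and> e1 \<cdot>\<^bsub>M\<^esub> k = v')"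

lemma path_object_sym: "path_object M X P e0 e1 \<Longrightarrow> path_object M X P e1 e0"
  unfolding path_object_def by (elim conjE, intro conjI) (assumption | blast)+

context weak_model_category begin

section \<open>Lifting, replacement and products of fibrant objects\<close>

lemma fibrant_Dom: "\<lbrakk>fibrant M X; p \<in> Fib M; p \<in> Hom M Y X\<rbrakk> \<Longrightarrow> fibrant M Y"
  using weak_model_category.cofibrant_Cod[OF dual, of X p Y] by simp

lemma fibrant_terminal: "terminal M T \<Longrightarrow> fibrant M T"
  using weak_model_category.cofibrant_initial[OF dual, of T] by simp

lemma fibrant_Obj: "fibrant M X \<Longrightarrow> X \<in> Obj M"
  using weak_model_category.cofibrant_Obj[OF dual, of X] by simp

lemma weq_cancel:
  assumes "f \<in> Hom M A B" "g \<in> Hom M B D" "cofibrant M A \<or> fibrant M A"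
    "cofibrant M B \<or> fibrant M B" "cofibrant M D \<or> fibrant M D"
  shows weq_left: "\<lbrakk>f \<in> Weq M; g \<cdot> f \<in> Weq M\<rbrakk> \<Longrightarrow> g \<in> Weq M"
    and weq_right: "\<lbrakk>g \<in> Weq M; g \<cdot> f \<in> Weq M\<rbrakk> \<Longrightarrow> f \<in> Weq M"
    and weq_comp: "\<lbrakk>f \<in> Weq M; g \<in> Weq M\<rbrakk> \<Longrightarrow> g \<cdot> f \<in> Weq M"
  using two_of_three[OF assms] by auto

lemma lift_square:
  assumes "i \<in> Cof M" "i \<in> Hom M A B" "cofibrant M A"
    "p \<in> Fib M" "p \<in> Hom M X Y" "fibrant M Y" "i \<in> Weq M \<or> p \<in> Weq M"
    "u \<in> Hom M A X" "v \<in> Hom M B Y" "p \<cdot> u = v \<cdot> i"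
  obtains h where "h \<in> Hom M B X" "h \<cdot> i = u" "p \<cdot> h = v"
proof -
  have "lifts M i p"
    using lifting[OF assms(1-3) cofibrant_Cod[OF assms(3,1,2)] assms(4,5) fibrant_Dom[OF assms(6,4,5)] assms(6,7)] .
  moreover have "Dom M i = A" "Cod M i = B" "Dom M p = X" "Cod M p = Y"
    using assms(2,5) by (auto simp: Hom_def)
  ultimately show thesis using that assms(8-10) unfolding lifts_def by blast
qed

lemma extend_trivial_cof:
  assumes "i \<in> Cof M \<inter> Weq M" "i \<in> Hom M A B" "cofibrant M A" "fibrant M X" "f \<in> Hom M A X"
  obtains g where "g \<in> Hom M B X" "g \<cdot> i = f"
proof -
  obtain T t where t: "terminal M T" "t \<in> Hom M X T" "t \<in> Fib M" using assms(4) unfolding fibrant_def by blast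
  have O: "A \<in> Obj M" "B \<in> Obj M" using Hom_Obj assms(2) by auto
  obtain b where b: "b \<in> Hom M B T" using t(1) O unfolding terminal_def by blast
  have "t \<cdot> f = b \<cdot> i"
    using t(1) O comp_Hom[OF t(2) assms(5)] comp_Hom[OF b assms(2)] unfolding terminal_def by blast
  then obtain h where "h \<in> Hom M B X" "h \<cdot> i = f"
    using lift_square[OF _ assms(2,3) t(3,2) fibrant_terminal[OF t(1)] _ assms(5) b] assms(1) by blast
  then show thesis by (rule that)
qed

lemma lift_trivial_fib:
  assumes "p \<in> Fib M \<inter> Weq M" "p \<in> Hom M X Y" "fibrant M Y" "cofibrant M A" "f \<in> Hom M A Y"
  obtains g where "g \<in> Hom M A X" "p \<cdot> g = f"
  using weak_model_category.extend_trivial_cof[OF dual, of p Y X A f] assms by auto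

text \<open>Factorization of the map from an initial object, which is cofibrant, to the fibrant
  \<open>X\<close>; as a fibration over \<open>X\<close>, the result is fibrant as well.\<close>

lemma cofibrant_replacement:
  assumes "fibrant M X"
  obtains X' q where "cofibrant M X'" "fibrant M X'" "q \<in> Hom M X' X" "q \<in> Fib M \<inter> Weq M"
proof -
  obtain Z where Z: "initial M Z" using initial_Cof by blast
  obtain z where z: "z \<in> Hom M Z X" using Z fibrant_Obj[OF assms] unfolding initial_def by blast
  obtain E i p where "i \<in> Hom M Z E" "p \<in> Hom M E X" "i \<in> Cof M" "p \<in> Fib M \<inter> Weq M"
    using factor_trivial_Fib[OF z cofibrant_initial[OF Z] assms] by blast
  then show thesis using that cofibrant_Cod[OF cofibrant_initial[OF Z]] fibrant_Dom[OF assms] by blast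
qed

lemma fibrant_replacement:
  assumes "cofibrant M X"
  obtains X' j where "cofibrant M X'" "fibrant M X'" "j \<in> Hom M X X'" "j \<in> Cof M \<inter> Weq M"
  using weak_model_category.cofibrant_replacement[OF dual, simplified, OF assms] that by blast

text \<open>The product is the pullback over a terminal object, the square there commuting
  automatically.\<close>

lemma binary_product:
  assumes "fibrant M X"
  obtains D a b where "fibrant M D" "a \<in> Hom M D X" "b \<in> Hom M D X" "a \<in> Fib M" "b \<in> Fib M"
    "\<And>W u v. u \<in> Hom M W X \<Longrightarrow> v \<in> Hom M W X \<Longrightarrow> \<exists>!h. h \<in> Hom M W D \<and> a \<cdot> h = u \<and> b \<cdot> h = v"
proof -
  obtain T t where t: "terminal M T" "t \<in> Hom M X T" "t \<in> Fib M" using assms unfolding fibrant_def by blast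
  obtain a b where pb: "pullback M t t a b" and b: "b \<in> Fib M"
    using Fib_pullback[OF t(3,2,2) fibrant_terminal[OF t(1)] assms] by blast
  from pb obtain D where ab: "a \<in> Hom M D X" "b \<in> Hom M D X"
    and u0: "\<And>W u v. u \<in> Hom M W X \<Longrightarrow> v \<in> Hom M W X \<Longrightarrow> t \<cdot> u = t \<cdot> v \<Longrightarrow>
      \<exists>!h. h \<in> Hom M W D \<and> a \<cdot> h = u \<and> b \<cdot> h = v"
    using t(2) unfolding pullback_def Hom_def by blast
  have u: "\<exists>!h. h \<in> Hom M W D \<and> a \<cdot> h = u \<and> b \<cdot> h = v" if "u \<in> Hom M W X" "v \<in> Hom M W X" for W u v
  proof -
    have "t \<cdot> u = t \<cdot> v"
      using t(1) Hom_Obj[OF that(1)] comp_Hom[OF t(2) that(1)] comp_Hom[OF t(2) that(2)]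
      unfolding terminal_def by blast
    then show ?thesis by (rule u0[OF that])
  qed
  have D: "D \<in> Obj M" "X \<in> Obj M" using Hom_Obj[OF ab(1)] by auto
  obtain s where s: "s \<in> Hom M D D" "a \<cdot> s = b" "b \<cdot> s = a" using u[OF ab(2,1)] by blast
  have "a \<cdot> (s \<cdot> s) = a" "b \<cdot> (s \<cdot> s) = b"
    using compo_assoc[OF s(1) s(1) ab(1)] compo_assoc[OF s(1) s(1) ab(2)] s by simp_all
  then have "s \<cdot> s = ident M D"
    using u[OF ab] comp_Hom[OF s(1) s(1)] ident_Hom[OF D(1)] ident_right ab by metis
  then have iso: "is_iso M s" using s(1) unfolding is_iso_def by (auto simp: Hom_def)
  have "a \<cdot> s = ident M X \<cdot> b" using s(2) ident_left[OF ab(2)] by simp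
  then have "a \<in> Fib M"
    using Fib_iso_closed[unfolded iso_closed_def, rule_format, OF b, of a s "ident M X"]
      iso iso_ident[OF D(2)] s(1) ab ident_Hom[OF D(2)] by (auto simp: Hom_def)
  then show thesis using that[OF _ ab _ b u] fibrant_Dom[OF assms b ab(2)] by blast
qed

text \<open>The map \<open>d = (q, q)\<close> from \<open>X'\<close> to the product goes from a
  cofibrant to a fibrant object, hence factors as a trivial cofibration \<open>s\<close> and a
  fibration \<open>c\<close>. Both ends are weak equivalences by 2-out-of-3, since each composes
  with \<open>s\<close> to \<open>q\<close>; the lifting clause is lifting against
  \<open>c\<close>.\<close>

lemma path_object_exists:
  assumes X: "fibrant M X"
  obtains P e0 e1 where "path_object M X P e0 e1"
proof -
  obtain D a b where D: "fibrant M D" and ab: "a \<in> Hom M D X" "b \<in> Hom M D X" "a \<in> Fib M" "b \<in> Fib M"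
    and u: "\<And>W u v. u \<in> Hom M W X \<Longrightarrow> v \<in> Hom M W X \<Longrightarrow> \<exists>!h. h \<in> Hom M W D \<and> a \<cdot> h = u \<and> b \<cdot> h = v"
    using binary_product[OF X] by blast
  obtain X' q where q: "cofibrant M X'" "q \<in> Hom M X' X" "q \<in> Fib M \<inter> Weq M"
    using cofibrant_replacement[OF X] by blast
  obtain d where d: "d \<in> Hom M X' D" "a \<cdot> d = q" "b \<cdot> d = q" using u[OF q(2,2)] by blast
  obtain P s c where s: "s \<in> Hom M X' P" "c \<in> Hom M P D" "d = c \<cdot> s" "s \<in> Cof M \<inter> Weq M" "c \<in> Fib M"
    using factor_trivial_Cof[OF d(1) q(1) D] by blast
  have P: "fibrant M P" using fibrant_Dom[OF D s(5,2)] .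
  have e: "a \<cdot> c \<in> Hom M P X" "b \<cdot> c \<in> Hom M P X" using comp_Hom s(2) ab by auto
  have eF: "a \<cdot> c \<in> Fib M" "b \<cdot> c \<in> Fib M" using Fib_comp[OF X s(5,2)] ab by auto
  have es: "a \<cdot> c \<cdot> s = q" "b \<cdot> c \<cdot> s = q"
    using compo_assoc[OF s(1,2) ab(1)] compo_assoc[OF s(1,2) ab(2)] d s(3) by auto
  have eW: "a \<cdot> c \<in> Weq M" "b \<cdot> c \<in> Weq M"
    using weq_left[OF s(1) e(1)] weq_left[OF s(1) e(2)] q P X s es by auto
  have lift: "\<exists>h\<in>Hom M B P. h \<cdot> i = k \<and> a \<cdot> c \<cdot> h = x \<and> b \<cdot> c \<cdot> h = y"
    if i: "cofibrant M A" "i \<in> Hom M A B" "i \<in> Cof M \<inter> Weq M"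
      and k: "k \<in> Hom M A P" and xy: "x \<in> Hom M B X" "y \<in> Hom M B X"
      and sq: "a \<cdot> c \<cdot> k = x \<cdot> i" "b \<cdot> c \<cdot> k = y \<cdot> i" for A B i k x y
  proof -
    obtain z where z: "z \<in> Hom M B D" "a \<cdot> z = x" "b \<cdot> z = y" using u[OF xy] by blast
    note ck = comp_Hom[OF s(2) k] and zi = comp_Hom[OF z(1) i(2)]
    have "a \<cdot> (c \<cdot> k) = a \<cdot> (z \<cdot> i)" "b \<cdot> (c \<cdot> k) = b \<cdot> (z \<cdot> i)"
      using sq compo_assoc[OF k s(2) ab(1)] compo_assoc[OF k s(2) ab(2)]
        compo_assoc[OF i(2) z(1) ab(1)] compo_assoc[OF i(2) z(1) ab(2)] z by simp_all
    then have "c \<cdot> k = z \<cdot> i" using u[OF comp_Hom[OF ab(1) zi] comp_Hom[OF ab(2) zi]] ck zi by blast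
    then obtain h where h: "h \<in> Hom M B P" "h \<cdot> i = k" "c \<cdot> h = z"
      using lift_square[OF _ i(2,1) s(5,2) D _ k z(1)] i(3) by blast
    have "a \<cdot> c \<cdot> h = x" "b \<cdot> c \<cdot> h = y"
      using compo_assoc[OF h(1) s(2) ab(1)] compo_assoc[OF h(1) s(2) ab(2)] h(3) z by simp_all
    then show ?thesis using h by blast
  qed
  have "path_object M X P (a \<cdot> c) (b \<cdot> c)"
    unfolding path_object_def using X P e eF eW q s(1) es lift by (intro conjI) blast+
  then show thesis by (rule that)
qed

lemma cylinder_exists:
  assumes "cofibrant M A" obtains I i0 i1 where "cylinder M A I i0 i1"
  using weak_model_category.path_object_exists[OF dual, of A] assms unfolding cylinder_def by auto

lemma path_objectD:
  assumes "path_object M X P e0 e1"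
  shows "fibrant M X" "fibrant M P" "e0 \<in> Hom M P X" "e1 \<in> Hom M P X" "e0 \<in> Fib M \<inter> Weq M" "e1 \<in> Fib M \<inter> Weq M"
  using assms unfolding path_object_def by auto

lemma path_object_constant:
  assumes "path_object M X P e0 e1"
  obtains X' q s where "cofibrant M X'" "q \<in> Hom M X' X" "q \<in> Fib M \<inter> Weq M" "s \<in> Hom M X' P"
      "e0 \<cdot> s = q" "e1 \<cdot> s = q"
  using assms unfolding path_object_def by blast

lemma path_object_lift:
  assumes "path_object M X P e0 e1" "cofibrant M A" "cofibrant M B" "i \<in> Hom M A B" "i \<in> Cof M \<inter> Weq M"
    "k \<in> Hom M A P" "x \<in> Hom M B X" "y \<in> Hom M B X" "e0 \<cdot> k = x \<cdot> i" "e1 \<cdot> k = y \<cdot> i"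
  obtains h where "h \<in> Hom M B P" "h \<cdot> i = k" "e0 \<cdot> h = x" "e1 \<cdot> h = y"
proof -
  have "\<forall>A B i k x y. cofibrant M A \<and> cofibrant M B \<and> i \<in> Hom M A B \<and> i \<in> Cof M \<inter> Weq M \<and>
      k \<in> Hom M A P \<and> x \<in> Hom M B X \<and> y \<in> Hom M B X \<and>
      e0 \<cdot> k = x \<cdot> i \<and> e1 \<cdot> k = y \<cdot> i \<longrightarrow>
      (\<exists>h\<in>Hom M B P. h \<cdot> i = k \<and> e0 \<cdot> h = x \<and> e1 \<cdot> h = y)"
    using assms(1) unfolding path_object_def by (elim conjE)
  from this[rule_format, of A B i k x y] show thesis using assms(2-) that by blast
qed

text \<open>Constant paths are given only on \<open>X'\<close>, but \<open>v\<close> lifts through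
  the trivial fibration \<open>q\<close>.\<close>

lemma constant_path:
  assumes "path_object M X P e0 e1" "cofibrant M A" "v \<in> Hom M A X"
  obtains k where "k \<in> Hom M A P" "e0 \<cdot> k = v" "e1 \<cdot> k = v"
proof -
  obtain X' q s where q: "q \<in> Hom M X' X" "q \<in> Fib M \<inter> Weq M" "s \<in> Hom M X' P" "e0 \<cdot> s = q" "e1 \<cdot> s = q"
    using path_object_constant[OF assms(1)] by blast
  note P = path_objectD[OF assms(1)]
  obtain u where u: "u \<in> Hom M A X'" "q \<cdot> u = v"
    using lift_trivial_fib[OF q(2,1) P(1) assms(2,3)] by blast
  show thesis
    by (rule that[OF comp_Hom[OF q(3) u(1)]])
      (use compo_assoc[OF u(1) q(3) P(3)] compo_assoc[OF u(1) q(3) P(4)] u(2) q(4,5) in simp_all)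
qed

lemma cylinderD:
  assumes "cylinder M A I i0 i1"
  shows "cofibrant M A" "cofibrant M I" "i0 \<in> Hom M A I" "i1 \<in> Hom M A I" "i0 \<in> Cof M \<inter> Weq M" "i1 \<in> Cof M \<inter> Weq M"
  using weak_model_category.path_objectD[OF dual assms[unfolded cylinder_def]] by simp_all

text \<open>The path \<open>k\<close> sits over the end \<open>i0\<close> of the cylinder. Lifting
  along \<open>i0\<close> extends it to a family of paths with constant source and with target
  following \<open>H\<close>; its value at \<open>i1\<close> is the concatenation.\<close>

lemma path_concat:
  assumes P: "path_object M X P e0 e1" and k: "k \<in> Hom M A P" and I: "cylinder M A I i0 i1"
    and H: "H \<in> Hom M I X" "H \<cdot> i0 = e1 \<cdot> k"
  obtains k' where "k' \<in> Hom M A P" "e0 \<cdot> k' = e0 \<cdot> k" "e1 \<cdot> k' = H \<cdot> i1"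
proof -
  note PD = path_objectD[OF P] and ID = cylinderD[OF I]
  obtain A' j s where j: "j \<in> Hom M A A'" "j \<in> Cof M \<inter> Weq M" "s \<in> Hom M I A'" "s \<cdot> i0 = j" "s \<cdot> i1 = j"
    using weak_model_category.path_object_constant[OF dual I[unfolded cylinder_def], simplified] by blast
  note v = comp_Hom[OF PD(3) k]
  \<comment> \<open>There is no projection \<open>I -> A\<close>: the cylinder collapses only onto
    \<open>A'\<close>, so the constant homotopy is built from an extension \<open>w\<close> of
    \<open>e0 \<cdot> k\<close> along \<open>j\<close>.\<close>
  obtain w where w: "w \<in> Hom M A' X" "w \<cdot> j = e0 \<cdot> k"
    using extend_trivial_cof[OF j(2,1) ID(1) PD(1) v] by blast
  have ws: "w \<cdot> s \<cdot> i0 = e0 \<cdot> k" "w \<cdot> s \<cdot> i1 = e0 \<cdot> k"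
    using compo_assoc[OF ID(3) j(3) w(1)] compo_assoc[OF ID(4) j(3) w(1)] j w by simp_all
  obtain h where h: "h \<in> Hom M I P" "h \<cdot> i0 = k" "e0 \<cdot> h = w \<cdot> s" "e1 \<cdot> h = H"
    using path_object_lift[OF P ID(1,2,3,5) k comp_Hom[OF w(1) j(3)] H(1)] ws H(2) by metis
  show thesis
    by (rule that[OF comp_Hom[OF h(1) ID(4)]])
      (use compo_assoc[OF ID(4) h(1) PD(3)] compo_assoc[OF ID(4) h(1) PD(4)] h(3,4) ws in simp_all)
qed

section \<open>The homotopy relation\<close>

lemma homotopicD:
  assumes "homotopic M A X v v'"
  shows "cofibrant M A" "fibrant M X" "v \<in> Hom M A X" "v' \<in> Hom M A X"
  using assms path_objectD comp_Hom unfolding homotopic_def by metis+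

text \<open>This is \<open>path_concat\<close> in \<open>opp M\<close>, where cylinder and path
  object exchange roles: the homotopy constant at \<open>v\<close> is concatenated with the path
  \<open>k\<close>.\<close>

lemma homotopic_left:
  assumes "homotopic M A X v v'" "cylinder M A I i0 i1"
  obtains H where "H \<in> Hom M I X" "H \<cdot> i0 = v" "H \<cdot> i1 = v'"
proof -
  obtain P e0 e1 k where k: "k \<in> Hom M A P" "path_object M X P e0 e1" "e0 \<cdot> k = v" "e1 \<cdot> k = v'"
    using assms(1) unfolding homotopic_def by blast
  note h = homotopicD[OF assms(1)]
  obtain H0 where H0: "H0 \<in> Hom M I X" "H0 \<cdot> i0 = v" "H0 \<cdot> i1 = v"
    using weak_model_category.constant_path[OF dual assms(2)[unfolded cylinder_def], of X v] h by auto
  have "cylinder (opp M) X P e0 e1"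
    using k(2) unfolding cylinder_def path_object_def by auto
  then show thesis
    using weak_model_category.path_concat[OF dual assms(2)[unfolded cylinder_def], of H0 X P e0 e1 k] H0 k that
    by auto
qed

text \<open>The homotopy is first moved to a cylinder, which does not depend on the path object it
  came from, and then concatenated with a constant path in the prescribed one.\<close>

lemma homotopic_right:
  assumes "homotopic M A X v v'" "path_object M X P e0 e1"
  obtains k where "k \<in> Hom M A P" "e0 \<cdot> k = v" "e1 \<cdot> k = v'"
proof -
  obtain I i0 i1 where I: "cylinder M A I i0 i1" using cylinder_exists homotopicD(1)[OF assms(1)] by blast
  obtain H where H: "H \<in> Hom M I X" "H \<cdot> i0 = v" "H \<cdot> i1 = v'" using homotopic_left[OF assms(1) I] by blast
  obtain k where k: "k \<in> Hom M A P" "e0 \<cdot> k = v" "e1 \<cdot> k = v"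
    using constant_path[OF assms(2) homotopicD(1,3)[OF assms(1)]] by blast
  show thesis using path_concat[OF assms(2) k(1) I H(1)] H k that by metis
qed

lemma homotopicI_left:
  assumes I: "cylinder M A I i0 i1" and X: "fibrant M X" and H: "H \<in> Hom M I X"
  shows "homotopic M A X (H \<cdot> i0) (H \<cdot> i1)"
proof -
  obtain P e0 e1 where P: "path_object M X P e0 e1" using path_object_exists[OF X] by blast
  note ID = cylinderD[OF I]
  obtain k where k: "k \<in> Hom M A P" "e0 \<cdot> k = H \<cdot> i0" "e1 \<cdot> k = H \<cdot> i0"
    using constant_path[OF P ID(1) comp_Hom[OF H ID(3)]] by blast
  obtain k' where "k' \<in> Hom M A P" "e0 \<cdot> k' = e0 \<cdot> k" "e1 \<cdot> k' = H \<cdot> i1"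
    using path_concat[OF P k(1) I H] k by metis
  then show ?thesis unfolding homotopic_def using ID(1) P k by metis
qed

lemma homotopic_refl:
  assumes "cofibrant M A" "fibrant M X" "v \<in> Hom M A X" shows "homotopic M A X v v"
proof -
  obtain P e0 e1 where P: "path_object M X P e0 e1" using path_object_exists[OF assms(2)] by blast
  then show ?thesis using constant_path[OF P assms(1,3)] assms(1) unfolding homotopic_def by metis
qed

lemma homotopic_sym: "homotopic M A X v v' \<Longrightarrow> homotopic M A X v' v"
  unfolding homotopic_def by (metis path_object_sym)

text \<open>Two paths are never glued: the second one is turned into a cylinder homotopy, to which
  \<open>path_concat\<close> applies.\<close>

lemma homotopic_trans:
  assumes "homotopic M A X u v" "homotopic M A X v w" shows "homotopic M A X u w"
proof -
  obtain P e0 e1 k where k: "k \<in> Hom M A P" "path_object M X P e0 e1" "e0 \<cdot> k = u" "e1 \<cdot> k = v"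
    using assms(1) unfolding homotopic_def by blast
  obtain I i0 i1 where I: "cylinder M A I i0 i1" using cylinder_exists homotopicD(1)[OF assms(1)] by blast
  obtain H where H: "H \<in> Hom M I X" "H \<cdot> i0 = v" "H \<cdot> i1 = w" using homotopic_left[OF assms(2) I] by blast
  obtain k' where "k' \<in> Hom M A P" "e0 \<cdot> k' = e0 \<cdot> k" "e1 \<cdot> k' = H \<cdot> i1"
    using path_concat[OF k(2,1) I H(1)] H k by metis
  then show ?thesis unfolding homotopic_def using k H homotopicD(1)[OF assms(1)] by metis
qed

lemma homotopic_precomp:
  assumes "homotopic M A X u v" "f \<in> Hom M B A" "cofibrant M B"
  shows "homotopic M B X (u \<cdot> f) (v \<cdot> f)"
proof -
  obtain P e0 e1 k where k: "k \<in> Hom M A P" "path_object M X P e0 e1" "e0 \<cdot> k = u" "e1 \<cdot> k = v"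
    using assms(1) unfolding homotopic_def by blast
  have "e0 \<cdot> (k \<cdot> f) = u \<cdot> f" "e1 \<cdot> (k \<cdot> f) = v \<cdot> f"
    using compo_assoc[OF assms(2) k(1)] path_objectD[OF k(2)] k by metis+
  then show ?thesis unfolding homotopic_def using k(2) comp_Hom[OF k(1) assms(2)] assms(3) by blast
qed

text \<open>Path objects are not functorial in \<open>X\<close>, whereas a cylinder depends on
  \<open>A\<close> alone and a homotopy on it can be composed with \<open>g\<close>.\<close>

lemma homotopic_postcomp:
  assumes "homotopic M A X u v" "g \<in> Hom M X Y" "fibrant M Y"
  shows "homotopic M A Y (g \<cdot> u) (g \<cdot> v)"
proof -
  obtain I i0 i1 where I: "cylinder M A I i0 i1" using cylinder_exists homotopicD(1)[OF assms(1)] by blast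
  obtain H where H: "H \<in> Hom M I X" "H \<cdot> i0 = u" "H \<cdot> i1 = v" using homotopic_left[OF assms(1) I] by blast
  show ?thesis
    using homotopicI_left[OF I assms(3) comp_Hom[OF assms(2) H(1)]]
      compo_assoc[OF cylinderD(3)[OF I] H(1) assms(2)] compo_assoc[OF cylinderD(4)[OF I] H(1) assms(2)] H by simp
qed

text \<open>The constant path at the common restriction extends along \<open>j\<close> to a path
  with ends \<open>g\<close> and \<open>g'\<close>.\<close>

lemma homotopic_extension:
  assumes "j \<in> Cof M \<inter> Weq M" "j \<in> Hom M A B" "cofibrant M A" "fibrant M X"
    "g \<in> Hom M B X" "g' \<in> Hom M B X" "g \<cdot> j = g' \<cdot> j"
  shows "homotopic M B X g g'"
proof -
  have B: "cofibrant M B" using cofibrant_Cod assms by blast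
  obtain P e0 e1 where P: "path_object M X P e0 e1" using path_object_exists[OF assms(4)] by blast
  obtain k where k: "k \<in> Hom M A P" "e0 \<cdot> k = g \<cdot> j" "e1 \<cdot> k = g \<cdot> j"
    using constant_path[OF P assms(3) comp_Hom[OF assms(5,2)]] by blast
  obtain h where "h \<in> Hom M B P" "e0 \<cdot> h = g" "e1 \<cdot> h = g'"
    using path_object_lift[OF P assms(3) B assms(2,1) k(1) assms(5,6)] k assms(7) by metis
  then show ?thesis unfolding homotopic_def using B P by blast
qed

text \<open>A cylinder homotopy between \<open>q \<cdot> u\<close> and \<open>q \<cdot> v\<close>
  lifts through \<open>q\<close> with the ends \<open>u\<close> and \<open>v\<close> prescribed, by
  the lifting clause dual to that of path objects.\<close>

lemma homotopic_cancel_trivial_fib: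
  assumes "q \<in> Fib M \<inter> Weq M" "q \<in> Hom M X Y" "fibrant M Y"
    "u \<in> Hom M A X" "v \<in> Hom M A X" "homotopic M A Y (q \<cdot> u) (q \<cdot> v)"
  shows "homotopic M A X u v"
proof -
  have X: "fibrant M X" using fibrant_Dom assms by blast
  note A = homotopicD(1)[OF assms(6)]
  obtain I i0 i1 where I: "cylinder M A I i0 i1" using cylinder_exists[OF A] by blast
  obtain H where H: "H \<in> Hom M I Y" "H \<cdot> i0 = q \<cdot> u" "H \<cdot> i1 = q \<cdot> v" using homotopic_left[OF assms(6) I] by blast
  obtain h where "h \<in> Hom M I X" "h \<cdot> i0 = u" "h \<cdot> i1 = v"
    using weak_model_category.path_object_lift[OF dual I[unfolded cylinder_def], of Y X q H u v] X assms H by auto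
  then show ?thesis using homotopicI_left[OF I X] by metis
qed

text \<open>After the replacement \<open>q : X' -> X\<close>, the map \<open>g \<cdot> q\<close>
  factors as a trivial cofibration \<open>k\<close> and a fibration \<open>p\<close>, which is
  trivial by 2-out-of-3. Classes pass through \<open>p\<close> and \<open>q\<close> by lifting. They
  pass through \<open>k\<close> by a retraction \<open>\<rho>\<close>, where
  \<open>k \<cdot> \<rho>\<close> is homotopic to the identity because both restrict to
  \<open>k\<close> along \<open>k\<close>.\<close>

lemma weq_homotopy_bijection:
  assumes g: "g \<in> Weq M" "g \<in> Hom M X Y" and X: "fibrant M X" and Y: "fibrant M Y" and A: "cofibrant M A"
  shows weq_surj: "v \<in> Hom M A Y \<Longrightarrow> \<exists>u\<in>Hom M A X. homotopic M A Y (g \<cdot> u) v"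
    and weq_inj: "\<lbrakk>u \<in> Hom M A X; u' \<in> Hom M A X; homotopic M A Y (g \<cdot> u) (g \<cdot> u')\<rbrakk> \<Longrightarrow> homotopic M A X u u'"
proof -
  obtain X' q where X': "cofibrant M X'" "fibrant M X'" and q: "q \<in> Hom M X' X" "q \<in> Fib M \<inter> Weq M"
    using cofibrant_replacement[OF X] by blast
  note gq = comp_Hom[OF g(2) q(1)]
  obtain E k p where k: "k \<in> Hom M X' E" "k \<in> Cof M \<inter> Weq M" and p: "p \<in> Hom M E Y" "p \<in> Fib M"
    and e: "g \<cdot> q = p \<cdot> k"
    using factor_trivial_Cof[OF gq X'(1) Y] by blast
  have E: "fibrant M E" "cofibrant M E" using fibrant_Dom[OF Y p(2,1)] cofibrant_Cod[OF X'(1)] k by auto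
  have "g \<cdot> q \<in> Weq M" using weq_comp[OF q(1) g(2)] X' X Y g q by blast
  then have pW: "p \<in> Fib M \<inter> Weq M" using weq_left[OF k(1) p(1)] X' E Y k p e by simp
  note iX = ident_Hom[OF cofibrant_Obj[OF X'(1)]] and iE = ident_Hom[OF cofibrant_Obj[OF E(2)]]
  obtain \<rho> where \<rho>: "\<rho> \<in> Hom M E X'" "\<rho> \<cdot> k = ident M X'"
    using extend_trivial_cof[OF k(2,1) X'(1,2) iX] by blast
  have kr: "homotopic M E E (k \<cdot> \<rho>) (ident M E)"
    using homotopic_extension[OF k(2,1) X'(1) E(1) comp_Hom[OF k(1) \<rho>(1)] iE]
      compo_assoc[OF k(1) \<rho>(1) k(1)] \<rho>(2) ident_right[OF k(1)] ident_left[OF k(1)] by simp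
  show "\<exists>u\<in>Hom M A X. homotopic M A Y (g \<cdot> u) v" if v: "v \<in> Hom M A Y"
  proof -
    obtain w where w: "w \<in> Hom M A E" "p \<cdot> w = v" using lift_trivial_fib[OF pW p(1) Y A v] by blast
    note rw = comp_Hom[OF \<rho>(1) w(1)]
    have "homotopic M A Y (p \<cdot> (k \<cdot> \<rho> \<cdot> w)) (p \<cdot> (ident M E \<cdot> w))"
      by (rule homotopic_postcomp[OF homotopic_precomp[OF kr w(1) A] p(1) Y])
    moreover have "p \<cdot> (k \<cdot> \<rho> \<cdot> w) = g \<cdot> (q \<cdot> (\<rho> \<cdot> w))"
      using compo_assoc[OF w(1) \<rho>(1) k(1)] compo_assoc[OF rw k(1) p(1)] compo_assoc[OF rw q(1) g(2)] e by simp
    ultimately show ?thesis using comp_Hom[OF q(1) rw] w ident_left[OF w(1)] by auto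
  qed
  show "homotopic M A X u u'"
    if u: "u \<in> Hom M A X" "u' \<in> Hom M A X" "homotopic M A Y (g \<cdot> u) (g \<cdot> u')"
  proof -
    obtain a where a: "a \<in> Hom M A X'" "q \<cdot> a = u" using lift_trivial_fib[OF q(2,1) X A u(1)] by blast
    obtain a' where a': "a' \<in> Hom M A X'" "q \<cdot> a' = u'" using lift_trivial_fib[OF q(2,1) X A u(2)] by blast
    have eq: "g \<cdot> (q \<cdot> x) = p \<cdot> (k \<cdot> x)" if "x \<in> Hom M A X'" for x
      using compo_assoc[OF that q(1) g(2)] compo_assoc[OF that k(1) p(1)] e by simp
    have rk: "\<rho> \<cdot> (k \<cdot> x) = x" if "x \<in> Hom M A X'" for x
      using compo_assoc[OF that k(1) \<rho>(1)] \<rho>(2) ident_left[OF that] by simp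
    have "homotopic M A Y (p \<cdot> (k \<cdot> a)) (p \<cdot> (k \<cdot> a'))" using u(3) eq a a' by metis
    from homotopic_cancel_trivial_fib[OF pW p(1) Y comp_Hom[OF k(1) a(1)] comp_Hom[OF k(1) a'(1)] this]
    have "homotopic M A X' (\<rho> \<cdot> (k \<cdot> a)) (\<rho> \<cdot> (k \<cdot> a'))" by (rule homotopic_postcomp[OF _ \<rho>(1) X'(2)])
    then show ?thesis using homotopic_postcomp[OF _ q(1) X] rk a a' by metis
  qed
qed

end

section \<open>Maps in the homotopy category\<close>

abbreviation core :: "('o, 'm, 'z) wmcat_scheme \<Rightarrow> 'o \<Rightarrow> bool"
  where "core M X \<equiv> cofibrant M X \<or> fibrant M X"

text \<open>Non-fibrant objects have to be replaced, and by a trivial cofibration; keeping fibrant objects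
  unchanged is what makes the classes \<open>A \<rightarrow> X\<close> with \<open>X\<close> fibrant visible directly.\<close>

definition frep :: "('o, 'm, 'z) wmcat_scheme \<Rightarrow> 'o \<Rightarrow> 'm"
  where "frep M Y = (if fibrant M Y then ident M Y
    else SOME j. j \<in> Cof M \<inter> Weq M \<and> j \<in> Arr M \<and> Dom M j = Y \<and> fibrant M (Cod M j))"

abbreviation fobj_rep :: "('o, 'm, 'z) wmcat_scheme \<Rightarrow> 'o \<Rightarrow> 'o"
  where "fobj_rep M Y \<equiv> Cod M (frep M Y)"

definition hclass :: "('o, 'm, 'z) wmcat_scheme \<Rightarrow> 'o \<Rightarrow> 'o \<Rightarrow> 'm \<Rightarrow> 'm set"
  where "hclass M B X u = {u'. homotopic M B X u u'}"

text \<open>\<open>step_rel M B f\<close> is the graph, up to homotopy, of the map that \<open>f : Y \<rightarrow> Z\<close> induces from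
  \<open>[B, fobj_rep M Y]\<close> to \<open>[B, fobj_rep M Z]\<close>; a zigzag acts on homotopy classes through these graphs
  and their converses.\<close>

definition step_rel :: "('o, 'm, 'z) wmcat_scheme \<Rightarrow> 'o \<Rightarrow> 'm \<Rightarrow> 'm rel"
  where "step_rel M B f = {(u, u'). u \<in> Hom M B (fobj_rep M (Dom M f)) \<and>
    (\<exists>g\<in>Hom M (fobj_rep M (Dom M f)) (fobj_rep M (Cod M f)).
      g \<cdot>\<^bsub>M\<^esub> frep M (Dom M f) = frep M (Cod M f) \<cdot>\<^bsub>M\<^esub> f \<and>
      homotopic M B (fobj_rep M (Cod M f)) (g \<cdot>\<^bsub>M\<^esub> u) u')}"

primrec step_act :: "('o, 'm, 'z) wmcat_scheme \<Rightarrow> 'o \<Rightarrow> 'm step \<Rightarrow> 'm set \<Rightarrow> 'm set"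
  where
    "step_act M B (Fwd f) c = step_rel M B f `` c"
  | "step_act M B (Bwd w) c = (step_rel M B w)\<inverse> `` c"

context weak_model_category begin

abbreviation \<gamma> where "\<gamma> \<equiv> farr (Ho_ftor M)"

abbreviation hcomp (infixl \<open>\<odot>\<close> 70) where "b \<odot> a \<equiv> b \<cdot>\<^bsub>Ho M\<^esub> a"

lemma Hom_core: "f \<in> Hom (core_cat M) A B \<longleftrightarrow> f \<in> Hom M A B \<and> core M A \<and> core M B"
  unfolding core_cat_def Hom_full by auto

lemma core_sel: "Dom (core_cat M) = Dom M" "Cod (core_cat M) = Cod M"
    "ident (core_cat M) = ident M" "compo (core_cat M) = compo M"
    "A \<in> Obj (core_cat M) \<longleftrightarrow> core M A"
  unfolding core_cat_def using cofibrant_Obj fibrant_Obj by auto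

lemma core_category: "category (core_cat M)"
  unfolding core_cat_def by (rule full_category)

lemma Ho_category: "category (Ho M)"
  unfolding Ho_def by (rule category.loc_category[OF core_category])

lemma Obj_Ho: "A \<in> Obj (Ho M) \<longleftrightarrow> core M A"
  unfolding Ho_def category.loc_sel[OF core_category] core_sel ..

lemma Ho_functor: "is_functor (core_cat M) (Ho M) (Ho_ftor M)"
  unfolding Ho_def Ho_ftor_def by (rule category.loc_functor[OF core_category])

lemma fobj_Ho [simp]: "fobj (Ho_ftor M) A = A"
  by (simp add: Ho_ftor_def loc_ftor_def)

lemma \<gamma>_Hom: "\<lbrakk>f \<in> Hom M A B; core M A; core M B\<rbrakk> \<Longrightarrow> \<gamma> f \<in> Hom (Ho M) A B"
  using functor_Hom[OF Ho_functor, of f A B] Hom_core by auto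

lemma \<gamma>_comp: "\<lbrakk>f \<in> Hom M A B; g \<in> Hom M B D; core M A; core M B; core M D\<rbrakk> \<Longrightarrow> \<gamma> (g \<cdot> f) = \<gamma> g \<odot> \<gamma> f"
  using functor_comp[OF Ho_functor, of f A B g D] Hom_core core_sel by auto

lemma \<gamma>_ident: "core M A \<Longrightarrow> \<gamma> (ident M A) = ident (Ho M) A"
  using Ho_functor core_sel unfolding is_functor_def by (metis fobj_Ho)

lemma \<gamma>_iso: "\<lbrakk>w \<in> Weq M; w \<in> Hom M A B; core M A; core M B\<rbrakk> \<Longrightarrow> is_iso (Ho M) (\<gamma> w)"
  unfolding Ho_def Ho_ftor_def
  using category.localization_inverts[OF core_category, of w "Weq M \<inter> Arr (core_cat M)" A B] Hom_core[of w A B]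
  by (auto simp: Hom_def)

text \<open>The constant-path map \<open>s\<close> is a weak equivalence by 2-out-of-3 and equalizes
  \<open>e0\<close> and \<open>e1\<close>, so \<open>\<gamma>\<close> identifies the two
  ends.\<close>

lemma \<gamma>_homotopic:
  assumes "homotopic M A X v v'" shows "\<gamma> v = \<gamma> v'"
proof -
  interpret H: category "Ho M" by (rule Ho_category)
  obtain P e0 e1 k where k: "k \<in> Hom M A P" "path_object M X P e0 e1" "e0 \<cdot> k = v" "e1 \<cdot> k = v'"
    using assms(1) unfolding homotopic_def by blast
  note P = path_objectD[OF k(2)]
  obtain X' q s where q: "cofibrant M X'" "q \<in> Hom M X' X" "q \<in> Fib M \<inter> Weq M" "s \<in> Hom M X' P"
      "e0 \<cdot> s = q" "e1 \<cdot> s = q"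
    using path_object_constant[OF k(2)] by blast
  have c: "core M A" "core M X" "core M P" "core M X'" using homotopicD(1)[OF assms] P q by auto
  have "s \<in> Weq M" using weq_right[OF q(4) P(3)] c P q by simp
  note i = \<gamma>_iso[OF this q(4) c(4,3)]
  have "\<gamma> e0 \<odot> \<gamma> s = \<gamma> e1 \<odot> \<gamma> s"
    using \<gamma>_comp[OF q(4) P(3) c(4,3,2)] \<gamma>_comp[OF q(4) P(4) c(4,3,2)] q by simp
  then have "\<gamma> e0 = \<gamma> e1"
    using H.iso_cancel_right[OF i \<gamma>_Hom[OF q(4) c(4,3)]] \<gamma>_Hom[OF _ c(3,2)] P(3,4) by blast
  then show ?thesis using \<gamma>_comp[OF k(1) P(3) c(1,3,2)] \<gamma>_comp[OF k(1) P(4) c(1,3,2)] k by simp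
qed

section \<open>Fibrant replacement up to homotopy\<close>

lemma frep_fibrant: "fibrant M Y \<Longrightarrow> frep M Y = ident M Y" "fibrant M Y \<Longrightarrow> fobj_rep M Y = Y"
  using ident_Hom[OF fibrant_Obj] by (auto simp: frep_def Hom_def)

lemma frep_nonfibrant:
  assumes "cofibrant M Y" "\<not> fibrant M Y"
  shows "frep M Y \<in> Cof M \<inter> Weq M \<and> frep M Y \<in> Arr M \<and> Dom M (frep M Y) = Y \<and> fibrant M (fobj_rep M Y)"
proof -
  obtain X' j where "fibrant M X'" "j \<in> Hom M Y X'" "j \<in> Cof M \<inter> Weq M"
    using fibrant_replacement[OF assms(1)] by blast
  then have "\<exists>j. j \<in> Cof M \<inter> Weq M \<and> j \<in> Arr M \<and> Dom M j = Y \<and> fibrant M (Cod M j)"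
    by (auto simp: Hom_def)
  from someI_ex[OF this] show ?thesis using assms(2) by (simp add: frep_def)
qed

lemma frep:
  assumes "core M Y"
  shows "frep M Y \<in> Hom M Y (fobj_rep M Y)" "frep M Y \<in> Weq M" "fibrant M (fobj_rep M Y)"
proof -
  have "frep M Y \<in> Hom M Y (fobj_rep M Y) \<and> frep M Y \<in> Weq M \<and> fibrant M (fobj_rep M Y)"
  proof (cases "fibrant M Y")
    case True
    note i = ident_Hom[OF fibrant_Obj[OF True]]
    show ?thesis using frep_fibrant[OF True] i iso_Weq[OF iso_ident[OF fibrant_Obj[OF True]] i] True by simp
  next
    case False
    then show ?thesis using frep_nonfibrant[of Y] assms by (auto simp: Hom_def)
  qed
  then show "frep M Y \<in> Hom M Y (fobj_rep M Y)" "frep M Y \<in> Weq M" "fibrant M (fobj_rep M Y)" by auto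
qed

lemma frep_extend:
  assumes "core M Y" "fibrant M X" "f \<in> Hom M Y X"
  obtains g where "g \<in> Hom M (fobj_rep M Y) X" "g \<cdot> frep M Y = f"
proof (cases "fibrant M Y")
  case True
  then show thesis using that[of f] frep_fibrant[OF True] assms ident_right by simp
next
  case False
  then have "frep M Y \<in> Cof M \<inter> Weq M" "cofibrant M Y" using frep_nonfibrant assms(1) by auto
  then show thesis using extend_trivial_cof[OF _ frep(1)[OF assms(1)] _ assms(2,3)] that by blast
qed

text \<open>The comparison is made after composing with \<open>u\<close> because
  \<open>fobj_rep M Y\<close> need not be cofibrant, and homotopies are defined on cofibrant sources
  only. When \<open>Y\<close> is fibrant the two maps are equal; otherwise both extend the same map
  along a trivial cofibration.\<close>

lemma frep_extend_unique:
  assumes "core M Y" "fibrant M X" "cofibrant M B" "g \<in> Hom M (fobj_rep M Y) X" "g' \<in> Hom M (fobj_rep M Y) X"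
    "g \<cdot> frep M Y = g' \<cdot> frep M Y" "u \<in> Hom M B (fobj_rep M Y)"
  shows "homotopic M B X (g \<cdot> u) (g' \<cdot> u)"
proof (cases "fibrant M Y")
  case True
  then have "g = g'" using assms(4-6) frep_fibrant[OF True] ident_right by simp
  then show ?thesis using homotopic_refl[OF assms(3,2) comp_Hom[OF assms(4,7)]] by simp
next
  case False
  then have "frep M Y \<in> Cof M \<inter> Weq M" "cofibrant M Y" using frep_nonfibrant assms(1) by auto
  then show ?thesis
    using homotopic_precomp[OF homotopic_extension[OF _ frep(1)[OF assms(1)] _ assms(2,4-6)] assms(7,3)] by blast
qed

lemma hclass_eq: "homotopic M B X u u' \<Longrightarrow> hclass M B X u = hclass M B X u'"
  unfolding hclass_def using homotopic_trans homotopic_sym by blast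

text \<open>The relation \<open>step_rel\<close> allows every extension of \<open>f\<close> to the
  replacements; all of them agree up to homotopy by \<open>frep_extend_unique\<close>, so any single
  \<open>g\<close> computes the action.\<close>

lemma step_act_Fwd:
  assumes c: "core M Y" "core M Z" and B: "cofibrant M B" and f: "f \<in> Hom M Y Z"
    and g: "g \<in> Hom M (fobj_rep M Y) (fobj_rep M Z)" "g \<cdot> frep M Y = frep M Z \<cdot> f"
    and u: "u \<in> Hom M B (fobj_rep M Y)"
  shows "step_act M B (Fwd f) (hclass M B (fobj_rep M Y) u) = hclass M B (fobj_rep M Z) (g \<cdot> u)"
proof -
  have d: "Dom M f = Y" "Cod M f = Z" using f by (auto simp: Hom_def)
  note rY = frep(3)[OF c(1)] and rZ = frep(3)[OF c(2)]
  have "homotopic M B (fobj_rep M Z) (g \<cdot> u) x"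
    if "homotopic M B (fobj_rep M Y) u v" "g' \<in> Hom M (fobj_rep M Y) (fobj_rep M Z)"
      "g' \<cdot> frep M Y = frep M Z \<cdot> f" "homotopic M B (fobj_rep M Z) (g' \<cdot> v) x" for g' v x
  proof -
    have "homotopic M B (fobj_rep M Z) (g \<cdot> u) (g' \<cdot> u)"
      by (rule frep_extend_unique[OF c(1) rZ B g(1) that(2) _ u]) (use g that in simp)
    moreover have "homotopic M B (fobj_rep M Z) (g' \<cdot> u) (g' \<cdot> v)"
      by (rule homotopic_postcomp[OF that(1,2) rZ])
    ultimately show ?thesis using homotopic_trans that(4) by blast
  qed
  moreover have "homotopic M B (fobj_rep M Y) u u" by (rule homotopic_refl[OF B rY u])
  ultimately show ?thesis using g u by (fastforce simp: hclass_def step_rel_def d)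
qed

lemma weq_frep_extend:
  assumes c: "core M Y" "core M Z" and w: "w \<in> Weq M" "w \<in> Hom M Y Z"
    and g: "g \<in> Hom M (fobj_rep M Y) (fobj_rep M Z)" "g \<cdot> frep M Y = frep M Z \<cdot> w"
  shows "g \<in> Weq M"
proof -
  note fY = frep[OF c(1)] and fZ = frep[OF c(2)]
  have "frep M Z \<cdot> w \<in> Weq M" by (rule weq_comp[OF w(2) fZ(1) c _ w(1) fZ(2)]) (use fZ in simp)
  then show ?thesis using weq_left[OF fY(1) g(1) c(1)] fY fZ g by simp
qed

text \<open>The extension \<open>g\<close> of a weak equivalence is itself one, hence injective on
  homotopy classes, and the converse relation undoes it.\<close>

lemma step_act_Bwd:
  assumes c: "core M Y" "core M Z" and B: "cofibrant M B" and w: "w \<in> Weq M" "w \<in> Hom M Y Z"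
    and g: "g \<in> Hom M (fobj_rep M Y) (fobj_rep M Z)" "g \<cdot> frep M Y = frep M Z \<cdot> w"
    and u: "u \<in> Hom M B (fobj_rep M Y)"
  shows "step_act M B (Bwd w) (hclass M B (fobj_rep M Z) (g \<cdot> u)) = hclass M B (fobj_rep M Y) u"
proof -
  have d: "Dom M w = Y" "Cod M w = Z" using w by (auto simp: Hom_def)
  note rY = frep(3)[OF c(1)] and rZ = frep(3)[OF c(2)]
  note gW = weq_frep_extend[OF c w g]
  have "homotopic M B (fobj_rep M Y) u v"
    if v: "v \<in> Hom M B (fobj_rep M Y)" and "homotopic M B (fobj_rep M Z) (g \<cdot> u) x"
      "g' \<in> Hom M (fobj_rep M Y) (fobj_rep M Z)"
      "g' \<cdot> frep M Y = frep M Z \<cdot> w" "homotopic M B (fobj_rep M Z) (g' \<cdot> v) x" for g' v x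
  proof -
    have "homotopic M B (fobj_rep M Z) (g' \<cdot> v) (g \<cdot> v)"
      by (rule frep_extend_unique[OF c(1) rZ B that(3) g(1) _ v]) (use g that in simp)
    then have "homotopic M B (fobj_rep M Z) (g \<cdot> u) (g \<cdot> v)"
      using homotopic_trans homotopic_sym that by blast
    then show ?thesis by (rule weq_inj[OF gW g(1) rY rZ B u v])
  qed
  moreover have "homotopic M B (fobj_rep M Z) (g \<cdot> u) (g \<cdot> v)" if "homotopic M B (fobj_rep M Y) u v" for v
    by (rule homotopic_postcomp[OF that g(1) rZ])
  moreover have "homotopic M B (fobj_rep M Z) (g \<cdot> v) (g \<cdot> v)" if "v \<in> Hom M B (fobj_rep M Y)" for v
    by (rule homotopic_refl[OF B rZ comp_Hom[OF g(1) that]])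
  ultimately show ?thesis
    using g u homotopicD(4)[of B "fobj_rep M Y" u] by (fastforce simp: hclass_def step_rel_def d)
qed

lemma frep_map:
  assumes "core M Y" "core M Z" "f \<in> Hom M Y Z"
  obtains g where "g \<in> Hom M (fobj_rep M Y) (fobj_rep M Z)" "g \<cdot> frep M Y = frep M Z \<cdot> f"
  using frep_extend[OF assms(1) frep(3)[OF assms(2)] comp_Hom[OF frep(1)[OF assms(2)] assms(3)]] by blast

section \<open>The action of zigzags on homotopy classes\<close>

definition hclasses where "hclasses B Y = hclass M B (fobj_rep M Y) ` Hom M B (fobj_rep M Y)"

abbreviation zact where "zact B \<equiv> fold (step_act M B)"

abbreviation Wc where "Wc \<equiv> Weq M \<inter> Arr (core_cat M)"

lemma Bwd_preimage:
  assumes c: "core M Y" "core M Z" and B: "cofibrant M B" and w: "w \<in> Weq M" "w \<in> Hom M Y Z"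
    and g: "g \<in> Hom M (fobj_rep M Y) (fobj_rep M Z)" "g \<cdot> frep M Y = frep M Z \<cdot> w"
    and u: "u \<in> Hom M B (fobj_rep M Z)"
  obtains u1 where "u1 \<in> Hom M B (fobj_rep M Y)" "homotopic M B (fobj_rep M Z) (g \<cdot> u1) u"
  using weq_surj[OF weq_frep_extend[OF c w g] g(1) frep(3)[OF c(1)] frep(3)[OF c(2)] B u] by blast

text \<open>The action is defined on arbitrary sets of maps, but the relations of the localization
  are verified on homotopy classes, so these have to be preserved. For a backward step,
  \<open>Bwd_preimage\<close> first rewrites the class as one in the image of
  \<open>g\<close>.\<close>

lemma zact_closed:
  assumes B: "cofibrant M B" and "zigzag (core_cat M) Wc Y Z p" "c \<in> hclasses B Y"
  shows "zact B p c \<in> hclasses B Z"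
  using assms(2,3)
proof (induction arbitrary: c rule: zigzag.induct)
  case (zz_nil A)
  then show ?case by simp
next
  case (zz_fwd f Y Z D p)
  have f: "f \<in> Hom M Y Z" "core M Y" "core M Z" using zz_fwd(1) Hom_core by auto
  obtain g where g: "g \<in> Hom M (fobj_rep M Y) (fobj_rep M Z)" "g \<cdot> frep M Y = frep M Z \<cdot> f"
    using frep_map[OF f(2,3,1)] by blast
  obtain u where u: "u \<in> Hom M B (fobj_rep M Y)" "c = hclass M B (fobj_rep M Y) u"
    using zz_fwd(4) by (auto simp: hclasses_def)
  have "step_act M B (Fwd f) c \<in> hclasses B Z"
    unfolding u(2) step_act_Fwd[OF f(2,3) B f(1) g u(1)] hclasses_def using comp_Hom[OF g(1) u(1)] by blast
  then show ?case using zz_fwd(3) by simp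
next
  case (zz_bwd w Y Z D p)
  have w: "w \<in> Weq M" "w \<in> Hom M Y Z" "core M Y" "core M Z" using zz_bwd(1,2) Hom_core by auto
  obtain g where g: "g \<in> Hom M (fobj_rep M Y) (fobj_rep M Z)" "g \<cdot> frep M Y = frep M Z \<cdot> w"
    using frep_map[OF w(3,4,2)] by blast
  obtain u where u: "u \<in> Hom M B (fobj_rep M Z)" "c = hclass M B (fobj_rep M Z) u"
    using zz_bwd(5) by (auto simp: hclasses_def)
  obtain u1 where u1: "u1 \<in> Hom M B (fobj_rep M Y)" "homotopic M B (fobj_rep M Z) (g \<cdot> u1) u"
    using Bwd_preimage[OF w(3,4) B w(1,2) g u(1)] by blast
  have "step_act M B (Bwd w) c \<in> hclasses B Y"
    unfolding u(2) hclass_eq[OF u1(2), symmetric] step_act_Bwd[OF w(3,4) B w(1,2) g u1(1)] hclasses_def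
    using u1(1) by blast
  then show ?case using zz_bwd(4) by simp
qed

text \<open>Well-definedness of the action on arrows of the homotopy category. The two inverse laws
  hold because a weak equivalence is injective and surjective on homotopy classes.\<close>

lemma zact_zzeq:
  assumes B: "cofibrant M B" and "zzeq (core_cat M) Wc Y Z p q" "c \<in> hclasses B Y"
  shows "zact B p c = zact B q c"
  using assms(2,3)
proof (induction arbitrary: c rule: zzeq.induct)
  case (zzeq_append Y Z p p' D q q')
  have "zact B p' c \<in> hclasses B Z"
    using zact_closed[OF B] category.zzeq_zigzag[OF core_category zzeq_append(1)] zzeq_append(5) by blast
  then show ?case using zzeq_append by simp
next
  case (zzeq_ident Y)
  then have Y: "core M Y" using core_sel by simp
  note r = frep[OF Y]
  obtain u where u: "u \<in> Hom M B (fobj_rep M Y)" "c = hclass M B (fobj_rep M Y) u"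
    using zzeq_ident(2) by (auto simp: hclasses_def)
  have O: "Y \<in> Obj M" "fobj_rep M Y \<in> Obj M" using Hom_Obj[OF r(1)] by auto
  have "step_act M B (Fwd (ident M Y)) c = c" 
    unfolding u(2)
    using step_act_Fwd[OF Y Y B ident_Hom[OF O(1)] ident_Hom[OF O(2)] _ u(1)]
      ident_left[OF r(1)] ident_right[OF r(1)] ident_left[OF u(1)] by simp
  then show ?case by (simp add: core_sel)
next
  case (zzeq_comp f Y Z f' D)
  have f: "f \<in> Hom M Y Z" "f' \<in> Hom M Z D" "core M Y" "core M Z" "core M D" using zzeq_comp(1,2) Hom_core by auto
  obtain g where g: "g \<in> Hom M (fobj_rep M Y) (fobj_rep M Z)" "g \<cdot> frep M Y = frep M Z \<cdot> f"
    using frep_map[OF f(3,4,1)] by blast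
  obtain g' where g': "g' \<in> Hom M (fobj_rep M Z) (fobj_rep M D)" "g' \<cdot> frep M Z = frep M D \<cdot> f'"
    using frep_map[OF f(4,5,2)] by blast
  obtain u where u: "u \<in> Hom M B (fobj_rep M Y)" "c = hclass M B (fobj_rep M Y) u"
    using zzeq_comp(3) by (auto simp: hclasses_def)
  note r = frep(1)[OF f(3)] frep(1)[OF f(4)] frep(1)[OF f(5)]
  have sq: "g' \<cdot> g \<cdot> frep M Y = frep M D \<cdot> (f' \<cdot> f)"
    using compo_assoc[OF r(1) g(1) g'(1)] compo_assoc[OF f(1) r(2) g'(1)] compo_assoc[OF f(1,2) r(3)] g g' by simp
  show ?case
    unfolding core_sel u(2)
    using step_act_Fwd[OF f(3,4) B f(1) g u(1)] step_act_Fwd[OF f(4,5) B f(2) g' comp_Hom[OF g(1) u(1)]]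
      step_act_Fwd[OF f(3,5) B compo_Hom[OF f(1,2)] comp_Hom[OF g'(1) g(1)] sq u(1)]
      compo_assoc[OF u(1) g(1) g'(1)] by simp
next
  case (zzeq_inv1 w Y Z)
  have w: "w \<in> Weq M" "w \<in> Hom M Y Z" "core M Y" "core M Z" using zzeq_inv1(1,2) Hom_core by auto
  obtain g where g: "g \<in> Hom M (fobj_rep M Y) (fobj_rep M Z)" "g \<cdot> frep M Y = frep M Z \<cdot> w"
    using frep_map[OF w(3,4,2)] by blast
  obtain u where u: "u \<in> Hom M B (fobj_rep M Y)" "c = hclass M B (fobj_rep M Y) u"
    using zzeq_inv1(3) by (auto simp: hclasses_def)
  show ?case
    unfolding u(2) using step_act_Fwd[OF w(3,4) B w(2) g u(1)] step_act_Bwd[OF w(3,4) B w(1,2) g u(1)] by simp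
next
  case (zzeq_inv2 w Y Z)
  have w: "w \<in> Weq M" "w \<in> Hom M Y Z" "core M Y" "core M Z" using zzeq_inv2(1,2) Hom_core by auto
  obtain g where g: "g \<in> Hom M (fobj_rep M Y) (fobj_rep M Z)" "g \<cdot> frep M Y = frep M Z \<cdot> w"
    using frep_map[OF w(3,4,2)] by blast
  obtain u where u: "u \<in> Hom M B (fobj_rep M Z)" "c = hclass M B (fobj_rep M Z) u"
    using zzeq_inv2(3) by (auto simp: hclasses_def)
  obtain u1 where u1: "u1 \<in> Hom M B (fobj_rep M Y)" "homotopic M B (fobj_rep M Z) (g \<cdot> u1) u"
    using Bwd_preimage[OF w(3,4) B w(1,2) g u(1)] by blast
  show ?case
    unfolding u(2) hclass_eq[OF u1(2), symmetric]
    using step_act_Fwd[OF w(3,4) B w(2) g u1(1)] step_act_Bwd[OF w(3,4) B w(1,2) g u1(1)] by simp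
qed auto

text \<open>A Yoneda argument: both one-step zigzags are applied to the class of
  \<open>frep M A\<close>. As the fibrant \<open>X\<close> is its own replacement, the results are
  the classes of \<open>v\<close> and of \<open>v'\<close>.\<close>

lemma \<gamma>_faithful:
  assumes A: "cofibrant M A" and X: "fibrant M X" and v: "v \<in> Hom M A X" "v' \<in> Hom M A X" and e: "\<gamma> v = \<gamma> v'"
  shows "homotopic M A X v v'"
proof -
  have c: "core M A" "core M X" using A X by auto
  have vc: "v \<in> Hom (core_cat M) A X" "v' \<in> Hom (core_cat M) A X" using v c Hom_core by auto
  note single = category.zz_single(1)[OF core_category]
  have "zzeq (core_cat M) Wc A X [Fwd v] [Fwd v']"
    using e zcls_eq[OF single[OF vc(1)] single[OF vc(2)]]
    unfolding Ho_ftor_def category.loc_ftor_farr[OF core_category vc(1)] category.loc_ftor_farr[OF core_category vc(2)]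
    by blast
  note z = zact_zzeq[OF A this, of "hclass M A (fobj_rep M A) (frep M A)"]
  note r = frep(1)[OF c(1)]
  have act: "zact A [Fwd x] (hclass M A (fobj_rep M A) (frep M A)) = hclass M A X x" if x: "x \<in> Hom M A X" for x
  proof -
    obtain g where g: "g \<in> Hom M (fobj_rep M A) (fobj_rep M X)" "g \<cdot> frep M A = frep M X \<cdot> x"
      using frep_map[OF c x] by blast
    show ?thesis using step_act_Fwd[OF c A x g r] g(2) frep_fibrant[OF X] ident_left[OF x] by simp
  qed
  have "hclass M A X v = hclass M A X v'" using z r unfolding act[OF v(1)] act[OF v(2)] hclasses_def by blast
  then show ?thesis using homotopic_refl[OF A X v(2)] unfolding hclass_def by blast
qed

text \<open>Links the action to composition: \<open>u\<close> represents \<open>b\<close> followed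
  by the replacement of its target, and acting by a zigzag on \<open>u\<close> represents the
  composite with the zigzag.\<close>

lemma \<gamma>_zact:
  assumes B: "cofibrant M B" and "zigzag (core_cat M) Wc Y Z p" "b \<in> Hom (Ho M) B Y"
    "u \<in> Hom M B (fobj_rep M Y)" "u' \<in> Hom M B (fobj_rep M Z)" "\<gamma> (frep M Y) \<odot> b = \<gamma> u"
    "zact B p (hclass M B (fobj_rep M Y) u) = hclass M B (fobj_rep M Z) u'"
  shows "\<gamma> (frep M Z) \<odot> (zcls (core_cat M) Wc Y Z p \<odot> b) = \<gamma> u'"
proof -
  interpret H: category "Ho M" by (rule Ho_category)
  note single = category.zz_single[OF core_category]
  note lc = category.loc_comp[OF core_category, of Wc, folded Ho_def]
  note lH = category.loc_Hom[OF core_category, of _ Wc, folded Ho_def]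
  from assms(2-) show ?thesis
  proof (induction arbitrary: b u rule: zigzag.induct)
    case (zz_nil Y)
    then have Y: "core M Y" using core_sel by simp
    have "homotopic M B (fobj_rep M Y) u u'"
      using zz_nil(6) homotopic_refl[OF B frep(3)[OF Y] zz_nil(4)] by (auto simp: hclass_def)
    moreover have "zcls (core_cat M) Wc Y Y [] = ident (Ho M) Y"
      unfolding Ho_def category.loc_sel[OF core_category] ..
    ultimately show ?case using zz_nil \<gamma>_homotopic H.ident_left by metis
  next
    case (zz_fwd f Y Z D p)
    have f: "f \<in> Hom M Y Z" "core M Y" "core M Z" using zz_fwd(1) Hom_core by auto
    obtain g where g: "g \<in> Hom M (fobj_rep M Y) (fobj_rep M Z)" "g \<cdot> frep M Y = frep M Z \<cdot> f"
      using frep_map[OF f(2,3,1)] by blast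
    note rY = frep[OF f(2)] and rZ = frep[OF f(3)]
    have c: "core M B" "core M (fobj_rep M Y)" "core M (fobj_rep M Z)" using B rY rZ by auto
    note h = \<gamma>_Hom[OF f] \<gamma>_Hom[OF rY(1) f(2) c(2)] \<gamma>_Hom[OF rZ(1) f(3) c(3)] \<gamma>_Hom[OF g(1) c(2,3)]
    have "\<gamma> (frep M Z) \<odot> (\<gamma> f \<odot> b) = \<gamma> (frep M Z \<cdot> f) \<odot> b"
      unfolding \<gamma>_comp[OF f(1) rZ(1) f(2,3) c(3)] by (rule H.compo_assoc[OF zz_fwd(4) h(1,3), symmetric])
    also have "\<dots> = \<gamma> g \<odot> (\<gamma> (frep M Y) \<odot> b)"
      unfolding g(2)[symmetric] \<gamma>_comp[OF rY(1) g(1) f(2) c(2,3)] by (rule H.compo_assoc[OF zz_fwd(4) h(2,4)])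
    also have "\<dots> = \<gamma> (g \<cdot> u)" using zz_fwd(7) \<gamma>_comp[OF zz_fwd(5) g(1) c] by simp
    finally have 1: "\<gamma> (frep M Z) \<odot> (\<gamma> f \<odot> b) = \<gamma> (g \<cdot> u)" .
    have 2: "zact B p (hclass M B (fobj_rep M Z) (g \<cdot> u)) = hclass M B (fobj_rep M D) u'"
      using zz_fwd(8) step_act_Fwd[OF f(2,3) B f(1) g zz_fwd(5)] by simp
    note IH = zz_fwd(3)[OF H.compo_Hom[OF zz_fwd(4) h(1)] comp_Hom[OF g(1) zz_fwd(5)] zz_fwd(6) 1 2]
    have z: "zcls (core_cat M) Wc Y Z [Fwd f] = \<gamma> f"
      unfolding Ho_ftor_def category.loc_ftor_farr[OF core_category zz_fwd(1)] ..
    have "zcls (core_cat M) Wc Y D (Fwd f # p) = zcls (core_cat M) Wc Z D p \<odot> \<gamma> f"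
      using lc[OF single(1)[OF zz_fwd(1)] zz_fwd(2)] z by simp
    moreover have "zcls (core_cat M) Wc Z D p \<in> Hom (Ho M) Z D" using lH zz_fwd(2) by blast
    ultimately show ?case using IH H.compo_assoc[OF zz_fwd(4) h(1)] by simp
  next
    case (zz_bwd w Y Z D p)
    have w: "w \<in> Weq M" "w \<in> Hom M Y Z" "core M Y" "core M Z" using zz_bwd(1,2) Hom_core by auto
    obtain g where g: "g \<in> Hom M (fobj_rep M Y) (fobj_rep M Z)" "g \<cdot> frep M Y = frep M Z \<cdot> w"
      using frep_map[OF w(3,4,2)] by blast
    obtain u1 where u1: "u1 \<in> Hom M B (fobj_rep M Y)" "homotopic M B (fobj_rep M Z) (g \<cdot> u1) u"
      using Bwd_preimage[OF w(3,4) B w(1,2) g zz_bwd(6)] by blast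
    note rY = frep[OF w(3)] and rZ = frep[OF w(4)]
    have c: "core M B" "core M (fobj_rep M Y)" "core M (fobj_rep M Z)" using B rY rZ by auto
    note h = \<gamma>_Hom[OF w(2-4)] \<gamma>_Hom[OF rY(1) w(3) c(2)] \<gamma>_Hom[OF rZ(1) w(4) c(3)] \<gamma>_Hom[OF g(1) c(2,3)]
    let ?b = "zcls (core_cat M) Wc Z Y [Bwd w]"
    have z: "zcls (core_cat M) Wc Y Z [Fwd w] = \<gamma> w"
      unfolding Ho_ftor_def category.loc_ftor_farr[OF core_category zz_bwd(2)] ..
    have b: "?b \<in> Hom (Ho M) Z Y" using lH single(2)[OF zz_bwd(1,2)] by blast
    have wb: "\<gamma> w \<odot> ?b = ident (Ho M) Z"
      using category.loc_inv(2)[OF core_category zz_bwd(1,2)] unfolding z Ho_def[symmetric] .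
    note bb = H.compo_Hom[OF zz_bwd(5) b]
    \<comment> \<open>The claim for the backward step is checked after composing with
      \<open>\<gamma> g\<close>, which is invertible and cancelled at the end.\<close>
    have "\<gamma> g \<odot> (\<gamma> (frep M Y) \<odot> (?b \<odot> b)) = \<gamma> (frep M Z \<cdot> w) \<odot> (?b \<odot> b)"
      unfolding g(2)[symmetric] \<gamma>_comp[OF rY(1) g(1) w(3) c(2,3)] by (rule H.compo_assoc[OF bb h(2,4), symmetric])
    also have "\<dots> = \<gamma> (frep M Z) \<odot> (\<gamma> w \<odot> (?b \<odot> b))"
      unfolding \<gamma>_comp[OF w(2) rZ(1) w(3,4) c(3)] by (rule H.compo_assoc[OF bb h(1,3)])
    also have "\<gamma> w \<odot> (?b \<odot> b) = b"
      using H.compo_assoc[OF zz_bwd(5) b h(1)] wb H.ident_left[OF zz_bwd(5)] by simp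
    also have "\<gamma> (frep M Z) \<odot> b = \<gamma> g \<odot> \<gamma> u1"
      using zz_bwd(8) \<gamma>_homotopic[OF u1(2)] \<gamma>_comp[OF u1(1) g(1) c] by simp
    finally have 1: "\<gamma> (frep M Y) \<odot> (?b \<odot> b) = \<gamma> u1"
      by (rule H.iso_cancel_left[OF \<gamma>_iso[OF weq_frep_extend[OF w(3,4,1,2) g] g(1) c(2,3)] h(4)
        H.compo_Hom[OF bb h(2)] \<gamma>_Hom[OF u1(1) c(1,2)]])
    have 2: "zact B p (hclass M B (fobj_rep M Y) u1) = hclass M B (fobj_rep M D) u'"
      using zz_bwd(9) step_act_Bwd[OF w(3,4) B w(1,2) g u1(1)] hclass_eq[OF u1(2)] by simp
    note IH = zz_bwd(4)[OF bb u1(1) zz_bwd(7) 1 2]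
    have "zcls (core_cat M) Wc Z D (Bwd w # p) = zcls (core_cat M) Wc Y D p \<odot> ?b"
      using lc[OF single(2)[OF zz_bwd(1,2)] zz_bwd(3)] by simp
    moreover have "zcls (core_cat M) Wc Y D p \<in> Hom (Ho M) Y D" using lH zz_bwd(3) by blast
    ultimately show ?case using IH H.compo_assoc[OF zz_bwd(5) b] by simp
  qed
qed

text \<open>A zigzag for \<open>b\<close> carries the class of \<open>frep M B\<close> to some class
  of maps \<open>B -> X\<close>. By \<open>\<gamma>_zact\<close>, started at the identity of
  \<open>B\<close>, any member \<open>w\<close> of it represents \<open>b\<close>.\<close>

lemma \<gamma>_full:
  assumes B: "cofibrant M B" and X: "fibrant M X" and b: "b \<in> Hom (Ho M) B X"
  obtains w where "w \<in> Hom M B X" "\<gamma> w = b"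
proof -
  interpret H: category "Ho M" by (rule Ho_category)
  have c: "core M B" "core M X" using B X by auto
  obtain p where p: "zigzag (core_cat M) Wc B X p" "b = zcls (core_cat M) Wc B X p"
    using b unfolding Ho_def category.loc_Hom[OF core_category] by blast
  note r = frep[OF c(1)]
  have rc: "core M (fobj_rep M B)" using r by simp
  note rh = \<gamma>_Hom[OF r(1) c(1) rc]
  have i: "ident (Ho M) B \<in> Hom (Ho M) B B" using H.ident_Hom Obj_Ho c(1) by blast
  have "hclass M B (fobj_rep M B) (frep M B) \<in> hclasses B B" unfolding hclasses_def using r(1) by blast
  from zact_closed[OF B p(1) this] obtain w where w: "w \<in> Hom M B (fobj_rep M X)"
    "zact B p (hclass M B (fobj_rep M B) (frep M B)) = hclass M B (fobj_rep M X) w"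
    unfolding hclasses_def by blast
  have "\<gamma> (frep M X) \<odot> (b \<odot> ident (Ho M) B) = \<gamma> w"
    unfolding p(2) by (rule \<gamma>_zact[OF B p(1) i r(1) w(1) H.ident_right[OF rh] w(2)])
  then have "\<gamma> w = b" 
    unfolding frep_fibrant[OF X] \<gamma>_ident[OF c(2)] H.ident_right[OF b] H.ident_left[OF b] by simp
  then show thesis using that w(1) frep_fibrant(2)[OF X] by simp
qed

text \<open>This is all that the invariance of truth uses about cofibrations and fibrant objects.\<close>

lemma \<gamma>_extension:
  assumes i: "i \<in> Cof M" "i \<in> Hom M A B" and A: "cofibrant M A" and X: "fibrant M X" and v: "v \<in> Hom M A X"
    and b: "b \<in> Hom (Ho M) B X" "b \<odot> \<gamma> i = \<gamma> v"
  obtains w where "w \<in> Hom M B X" "w \<cdot> i = v" "\<gamma> w = b"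
proof -
  have B: "cofibrant M B" by (rule cofibrant_Cod[OF A i])
  have c: "core M A" "core M B" "core M X" using A B X by auto
  obtain w0 where w0: "w0 \<in> Hom M B X" "\<gamma> w0 = b" using \<gamma>_full[OF B X b(1)] by blast
  have "\<gamma> (w0 \<cdot> i) = \<gamma> v" using \<gamma>_comp[OF i(2) w0(1) c] w0 b by simp
  then have ho: "homotopic M A X (w0 \<cdot> i) v" by (rule \<gamma>_faithful[OF A X comp_Hom[OF w0(1) i(2)] v])
  obtain P e0 e1 where P: "path_object M X P e0 e1" using path_object_exists[OF X] by blast
  note PD = path_objectD[OF P]
  obtain k where k: "k \<in> Hom M A P" "e0 \<cdot> k = w0 \<cdot> i" "e1 \<cdot> k = v" using homotopic_right[OF ho P] by blast
  \<comment> \<open>Homotopy extension: \<open>e0\<close> is a trivial fibration, so the path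
    \<open>k\<close> on \<open>A\<close> extends to a path on \<open>B\<close> that starts at
    \<open>w0\<close>. Its other end restricts strictly to \<open>v\<close> and still has class
    \<open>b\<close>.\<close>
  obtain h where h: "h \<in> Hom M B P" "h \<cdot> i = k" "e0 \<cdot> h = w0"
    using lift_square[OF i A _ PD(3,1) _ k(1) w0(1) k(2)] PD(5) by blast
  have "homotopic M B X w0 (e1 \<cdot> h)" unfolding homotopic_def using B P h by blast
  then have "\<gamma> (e1 \<cdot> h) = b" using \<gamma>_homotopic w0(2) by metis
  then show thesis using that[OF comp_Hom[OF PD(4) h(1)]] compo_assoc[OF i(2) h(1) PD(4)] h(2) k(3) by simp
qed

end

section \<open>Truth of formulas\<close>

text \<open>Tarskian truth on raw formulas, which permits induction on syntax;
  \<open>interp_fcls\<close> identifies it with the interpretation of their classes.\<close>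

primrec sat :: "('o, 'm, 'z) cat_scheme \<Rightarrow> 'o \<Rightarrow> ('m, 'k) fm \<Rightarrow> 'm \<Rightarrow> bool"
  where
    "sat M X Fls v \<longleftrightarrow> False"
  | "sat M X (Neg s) v \<longleftrightarrow> \<not> sat M X s v"
  | "sat M X (And s t) v \<longleftrightarrow> sat M X s v \<and> sat M X t v"
  | "sat M X (Join I s) v \<longleftrightarrow> (\<exists>k\<in>I. sat M X (s k) v)"
  | "sat M X (Sub f s) v \<longleftrightarrow> sat M X s (v \<cdot>\<^bsub>M\<^esub> f)"
  | "sat M X (Ex i s) v \<longleftrightarrow> (\<exists>w\<in>Hom M (Cod M i) X. w \<cdot>\<^bsub>M\<^esub> i = v \<and> sat M X s w)"

abbreviation formula :: "'k rel \<Rightarrow> ('o, 'm, 'z) wmcat_scheme \<Rightarrow> 'o \<Rightarrow> ('m, 'k) fm \<Rightarrow> bool"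
  where "formula r M \<equiv> is_fm r (cof_cat M) (cof_cofs M)"

abbreviation fcls :: "'k rel \<Rightarrow> ('o, 'm, 'z) wmcat_scheme \<Rightarrow> 'o \<Rightarrow> ('m, 'k) fm \<Rightarrow> ('m, 'k) fm set"
  where "fcls r M A s \<equiv> fm_rel r (cof_cat M) (cof_cofs M) A `` {s}"

lemma compl_cl:
  assumes cat: "category C" and card: "Card_order r" and s: "is_fm r C K A s"
  shows "bcompl (alg (initial_over r C K) A) (fm_rel r C K A `` {s}) = fm_rel r C K A `` {Neg s}"
proof -
  note ctx = cat card
  let ?L = "alg (initial_over r C K) A" and ?cl = "\<lambda>s. fm_rel r C K A `` {s}"
  note A = FM_Obj[OF ctx s] and n = fm_Neg[OF s]
  interpret L: boolean_lattice ?L by (rule bool_IA[OF ctx A])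
  have F: "is_fm r C K A Fls" "is_fm r C K A (Neg Fls)" using A by (auto intro: is_fm.intros)
  note c = cls_closed[OF ctx s] cls_closed[OF ctx n]
  have "?cl s \<sqinter>\<^bsub>?L\<^esub> ?cl (Neg s) = \<bottom>\<^bsub>?L\<^esub>"
    unfolding meet_cl[OF ctx A s n] bot_cl[OF ctx A] cl_eq[OF ctx fm_And[OF s n] F(1)]
    using en_contr[OF s] en_Fls[OF fm_And[OF s n]] by blast
  moreover have "?cl s \<squnion>\<^bsub>?L\<^esub> ?cl (Neg s) = \<top>\<^bsub>?L\<^esub>"
    unfolding join_cl[OF ctx A s n] top_cl[OF ctx A] cl_eq[OF ctx FM_Or[OF ctx s n] F(2)]
    using en_lem[OF ctx s] en_top[OF ctx FM_Or[OF ctx s n]] by blast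
  ultimately show ?thesis using L.compl_unique[OF c(1)] L.compl_facts[OF c(1)] c(2) by metis
qed

text \<open>A morphism preserves each formula constructor, negation because complements are unique,
  so it can only be evaluation.\<close>

lemma bafun_hom_cl:
  fixes C (structure)
  assumes P: "lambda_boolean_over r C K P" and card: "Card_order r"
    and h: "bafun_hom r C K (initial_over r C K) P h" and s: "is_fm r C K A s"
  shows "h A (fm_rel r C K A `` {s}) = fm_eval C P s A"
proof -
  interpret P: lambda_boolean_over r C K P by (rule P)
  note ctx = P.category_axioms card
  let ?I = "initial_over r C K"
  note closed = cls_closed[OF ctx]
  have lh: "lambda_hom r (alg ?I A) (alg P A) (h A)" and bh: "bool_hom (alg ?I A) (alg P A) (h A)"
    if "A \<in> Obj C" for A using h that by (auto simp: bafun_hom_def lambda_hom_def)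
  show ?thesis using s
  proof (induction rule: is_fm.induct)
    case (fm_Fls A)
    then show ?case using bh[OF fm_Fls] bot_cl[OF ctx fm_Fls] by (simp add: bool_hom_def)
  next
    case (fm_Neg A s)
    note A = FM_Obj[OF ctx fm_Neg(1)]
    have "boolean_lattice (alg P A)" using P.alg_lambda[OF A] by (simp add: lambda_boolean_def)
    from bool_hom_compl[OF bool_IA(1)[OF ctx A] this bh[OF A] closed[OF fm_Neg(1)]]
    show ?case unfolding compl_cl[OF ctx fm_Neg(1)] using fm_Neg(2) by simp
  next
    case (fm_And A s t)
    note A = FM_Obj[OF ctx fm_And(1)]
    show ?case
      using bh[OF A] meet_cl[OF ctx A fm_And(1,2)] fm_And closed unfolding bool_hom_def
      by (metis fm_eval.simps(3))
  next
    case (fm_Join A I s)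
    let ?S = "(\<lambda>k. fm_rel r C K A `` {s k}) ` I"
    have "?S \<subseteq> carrier (alg ?I A)" using closed fm_Join(3) by auto
    then have "h A (\<Squnion>\<^bsub>alg ?I A\<^esub> ?S) = \<Squnion>\<^bsub>alg P A\<^esub> (h A ` ?S)"
      using lh[OF fm_Join(1)] small_image[OF fm_Join(2)] unfolding lambda_hom_def by blast
    moreover have "h A ` ?S = (\<lambda>k. fm_eval C P (s k) A) ` I"
      unfolding image_image by (rule image_cong[OF refl fm_Join(4)])
    ultimately show ?case using sup_cl(2)[OF ctx fm_Join(1-3)] by simp
  next
    case (fm_Sub f A B s)
    have "h B (act ?I f (fm_rel r C K A `` {s})) = act P f (h A (fm_rel r C K A `` {s}))"
      using h fm_Sub(1) closed[OF fm_Sub(2)] unfolding bafun_hom_def by blast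
    then show ?case using fm_Sub act_cl[OF ctx fm_Sub(1,2)] by (auto simp: Hom_def)
  next
    case (fm_Ex i A B s)
    have "h A (exq ?I i (fm_rel r C K B `` {s})) = exq P i (h B (fm_rel r C K B `` {s}))"
      using h fm_Ex(1,2) closed[OF fm_Ex(3)] unfolding bafun_hom_def by blast
    then show ?case using fm_Ex exq_cl[OF ctx fm_Ex(1-3)] by (auto simp: Hom_def)
  qed
qed

lemma initial_hom_cl:
  assumes P: "lambda_boolean_over r C K P" and card: "Card_order r" and s: "is_fm r C K A s"
  shows "initial_hom r C K P A (fm_rel r C K A `` {s}) = fm_eval C P s A"
proof -
  note ctx = lambda_boolean_over.axioms(1)[OF P] card
  obtain h where h: "bafun_hom r C K (initial_over r C K) P h" using initial_over_hom(1)[OF P card] by blast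
  show ?thesis
    using initial_over_hom(3)[OF P card h FM_Obj[OF ctx s] cls_closed[OF ctx s]] bafun_hom_cl[OF P card h s]
    by simp
qed

text \<open>The identity is a morphism from the initial algebra to itself, and morphisms are
  evaluations.\<close>

lemma fm_eval_initial_over:
  assumes cat: "category C" and card: "Card_order r" and s: "is_fm r C K A s"
  shows "fm_eval C (initial_over r C K) s A = fm_rel r C K A `` {s}"
  using bafun_hom_cl[OF initial_over_lambda[OF cat card] card, where h = "\<lambda>A x. x"] s
  by (simp add: bafun_hom_def lambda_hom_def bool_hom_def)

lemma powerset_lattice:
  fixes U :: "'a set"
  defines "L \<equiv> \<lparr>carrier = Pow U, eq = (=), le = (\<subseteq>)\<rparr>"
  shows "\<bottom>\<^bsub>L\<^esub> = {}" and "\<lbrakk>x \<subseteq> U; y \<subseteq> U\<rbrakk> \<Longrightarrow> x \<sqinter>\<^bsub>L\<^esub> y = x \<inter> y"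
    and "x \<subseteq> U \<Longrightarrow> bcompl L x = U - x" and "S \<subseteq> Pow U \<Longrightarrow> \<Squnion>\<^bsub>L\<^esub> S = \<Union>S"
proof -
  have po: "partial_order L" unfolding L_def by unfold_locales auto
  note B0 = boolI[OF po, where m = "(\<inter>)" and j = "(\<union>)" and b = "{}" and t = U and n = "\<lambda>x. U - x"]
  interpret boolean_lattice L by (rule B0(1)) (auto simp: L_def)
  show b: "\<bottom>\<^bsub>L\<^esub> = {}" by (rule B0(4)) (auto simp: L_def)
  have t: "\<top>\<^bsub>L\<^esub> = U" by (rule B0(5)) (auto simp: L_def)
  show m: "x \<sqinter>\<^bsub>L\<^esub> y = x \<inter> y" if "x \<subseteq> U" "y \<subseteq> U" for x y
    by (rule B0(2)) (use that in \<open>auto simp: L_def\<close>)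
  have j: "x \<squnion>\<^bsub>L\<^esub> y = x \<union> y" if "x \<subseteq> U" "y \<subseteq> U" for x y
    by (rule B0(3)) (use that in \<open>auto simp: L_def\<close>)
  show "bcompl L x = U - x" if x: "x \<subseteq> U"
  proof -
    have c: "x \<in> carrier L" "U - x \<in> carrier L" using x by (auto simp: L_def)
    show ?thesis
      by (rule compl_unique[OF c(1) compl_facts(1)[OF c(1)] c(2) compl_facts(2,3)[OF c(1)]])
        (use x in \<open>auto simp: m j b t\<close>)
  qed
  show "\<Squnion>\<^bsub>L\<^esub> S = \<Union>S" if S: "S \<subseteq> Pow U"
    by (rule sup_eqI(2)) (use S in \<open>auto simp: L_def\<close>)
qed

context weak_model_category begin

lemma fm_eval_hom_algebra:
  assumes X: "X \<in> Obj M" and s: "formula r M A s"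
  shows "fm_eval (cof_cat M) (hom_algebra M X) s A = {v \<in> Hom M A X. sat M X s v}"
proof -
  have L: "alg (hom_algebra M X) A = \<lparr>carrier = Pow (Hom M A X), eq = (=), le = (\<subseteq>)\<rparr>" for A
    by (simp add: hom_algebra_def)
  show ?thesis using s
  proof (induction rule: is_fm.induct)
    case (fm_Fls A) then show ?case by (simp add: L powerset_lattice)
  next
    case (fm_Neg A s)
    then show ?case by (auto simp: L powerset_lattice(3))
  next
    case (fm_And A s t)
    then show ?case by (auto simp: L powerset_lattice(2))
  next
    case (fm_Join A I s)
    have "fm_eval (cof_cat M) (hom_algebra M X) (Join I s) A
        = \<Union> ((\<lambda>k. fm_eval (cof_cat M) (hom_algebra M X) (s k) A) ` I)"
      unfolding fm_eval.simps L by (rule powerset_lattice(4)) (use fm_Join(4) in auto)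
    then show ?case using fm_Join(4) by auto
  next
    case (fm_Sub f A B s)
    then have f: "f \<in> Hom M A B" "Dom M f = A" "Cod M f = B" using Hom_cof by (auto simp: Hom_def)
    show ?case using fm_Sub(3) compo_Hom[OF f(1)] by (auto simp: cof_sel f hom_algebra_def)
  next
    case (fm_Ex i A B s)
    then have i: "i \<in> Hom M A B" "Cod M i = B" using Hom_cof by (auto simp: Hom_def)
    show ?case using fm_Ex(4) compo_Hom[OF i(1)] by (auto simp: cof_sel i hom_algebra_def)
  qed
qed

lemma interp_fcls:
  assumes "Card_order r" "X \<in> Obj M" "formula r M A s"
  shows "interp r M X A (fcls r M A s) = {v \<in> Hom M A X. sat M X s v}"
  unfolding interp_def initial_hom_cl[OF hom_algebra_lambda[OF assms(2)] assms(1,3)]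
  by (rule fm_eval_hom_algebra[OF assms(2,3)])

lemma language_carrier:
  assumes "Card_order r"
  shows "carrier (alg (language r M) A) = fcls r M A ` {s. formula r M A s}"
  unfolding language_def by (rule initial_carrier[OF cof_cat_category assms])

lemma sem_equiv_fcls:
  assumes "Card_order r" "formula r M A s" "formula r M A t"
  shows "(fcls r M A s, fcls r M A t) \<in> sem_equiv r M A \<longleftrightarrow>
    (\<forall>X v. fibrant M X \<and> v \<in> Hom M A X \<longrightarrow> sat M X s v = sat M X t v)"
proof -
  have "fcls r M A s \<in> carrier (alg (language r M) A)" "fcls r M A t \<in> carrier (alg (language r M) A)"
    using assms unfolding language_carrier[OF assms(1)] by blast+
  moreover have "interp r M X A (fcls r M A s) = interp r M X A (fcls r M A t) \<longleftrightarrow>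
      (\<forall>v. v \<in> Hom M A X \<longrightarrow> sat M X s v = sat M X t v)" if "X \<in> Obj M" for X
    unfolding interp_fcls[OF assms(1) that assms(2)] interp_fcls[OF assms(1) that assms(3)] by auto
  ultimately show ?thesis unfolding sem_equiv_def using fibrant_Obj by blast
qed

lemma sem_equiv_equiv: "equiv (carrier (alg (language r M) A)) (sem_equiv r M A)"
  by (intro equivI refl_onI symI transI) (auto simp: sem_equiv_def)

lemma sem_equiv_hom:
  assumes card: "Card_order r" and A: "cofibrant M A"
  shows "bool_hom (alg (language r M) A) (h_language r M A) (\<lambda>x. sem_equiv r M A `` {x})"
proof -
  note ctx = cof_cat_category card
  have O: "A \<in> Obj (cof_cat M)" using A cof_sel by blast
  let ?L = "alg (language r M) A"
  note cl = sem_equiv_fcls[OF card] language_carrier[OF card]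
  note ops = meet_cl[OF ctx O, of "cof_cofs M", folded language_def] join_cl[OF ctx O, of "cof_cofs M", folded language_def]
  have rep: "\<exists>s. formula r M A s \<and> x = fcls r M A s" if "x \<in> carrier ?L" for x
    using that cl(2) by auto
  have cong: "(x \<sqinter>\<^bsub>?L\<^esub> y, x' \<sqinter>\<^bsub>?L\<^esub> y') \<in> sem_equiv r M A \<and> (x \<squnion>\<^bsub>?L\<^esub> y, x' \<squnion>\<^bsub>?L\<^esub> y') \<in> sem_equiv r M A"
    if R: "(x, x') \<in> sem_equiv r M A" "(y, y') \<in> sem_equiv r M A" for x x' y y'
  proof -
    have c: "x \<in> carrier ?L" "x' \<in> carrier ?L" "y \<in> carrier ?L" "y' \<in> carrier ?L"
      using R by (auto simp: sem_equiv_def)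
    obtain s s' t t' where f: "formula r M A s" "formula r M A s'" "formula r M A t" "formula r M A t'"
      and e: "x = fcls r M A s" "x' = fcls r M A s'" "y = fcls r M A t" "y' = fcls r M A t'"
      using c[THEN rep] by blast
    note fo = fm_And[OF f(1,3)] fm_And[OF f(2,4)] FM_Or[OF ctx f(1,3)] FM_Or[OF ctx f(2,4)]
    show ?thesis
      using R unfolding e ops(1)[OF f(1,3)] ops(1)[OF f(2,4)] ops(2)[OF f(1,3)] ops(2)[OF f(2,4)]
        cl(1)[OF f(1,2)] cl(1)[OF f(3,4)] cl(1)[OF fo(1,2)] cl(1)[OF fo(3,4)]
      by (auto simp: Disj_def)
  qed
  have "boolean_lattice ?L" unfolding language_def by (rule bool_IA(1)[OF ctx O])
  from boolean_quotient(2)[OF this sem_equiv_equiv] cong show ?thesis unfolding h_language_def by blast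
qed

section \<open>Invariance of truth\<close>

lemma formula_cofibrant: "formula r M A s \<Longrightarrow> Card_order r \<Longrightarrow> cofibrant M A"
  using FM_Obj[OF cof_cat_category] cof_sel by blast

text \<open>\<open>X\<close> is allowed to vary because the comparison across a Quillen equivalence
  replaces \<open>X\<close> by an isomorphic \<open>G Y\<close>. Invertibility of
  \<open>\<theta>\<close> enters at \<open>Ex\<close>: witnesses are composed with it or with its
  inverse, and \<open>\<gamma>_extension\<close> makes the result a strict extension.\<close>

lemma sat_invariant:
  assumes "formula r M A s" "Card_order r" "fibrant M X" "fibrant M X'" "v \<in> Hom M A X" "v' \<in> Hom M A X'"
    "\<theta> \<in> Hom (Ho M) X X'" "is_iso (Ho M) \<theta>" "\<theta> \<odot> \<gamma> v = \<gamma> v'"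
  shows "sat M X s v \<longleftrightarrow> sat M X' s v'"
  using assms
proof (induction arbitrary: X X' v v' \<theta> rule: is_fm.induct)
  case (fm_Join A I s)
  then have "sat M X (s k) v \<longleftrightarrow> sat M X' (s k) v'" if "k \<in> I" for k using that by blast
  then show ?case by simp
next
  case (fm_Sub f A B s)
  interpret H: category "Ho M" by (rule Ho_category)
  have f: "f \<in> Hom M A B" "core M A" "core M B" using fm_Sub(1) Hom_cof by auto
  have c: "core M X" "core M X'" using fm_Sub by auto
  have "\<theta> \<odot> \<gamma> (v \<cdot> f) = \<gamma> (v' \<cdot> f)"
    using \<gamma>_comp[OF f(1) fm_Sub(7) f(2,3) c(1)] \<gamma>_comp[OF f(1) fm_Sub(8) f(2,3) c(2)]
      H.compo_assoc[OF \<gamma>_Hom[OF f] \<gamma>_Hom[OF fm_Sub(7) f(3) c(1)] fm_Sub(9)] fm_Sub(11) by simp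
  from fm_Sub(3)[OF fm_Sub(4-6) comp_Hom[OF fm_Sub(7) f(1)] comp_Hom[OF fm_Sub(8) f(1)] fm_Sub(9,10) this]
  show ?case by simp
next
  case (fm_Ex i A B s)
  interpret H: category "Ho M" by (rule Ho_category)
  have i: "i \<in> Cof M" "i \<in> Hom M A B" "cofibrant M A" "cofibrant M B"
    using fm_Ex(1,2) cof_cofs_iff by auto
  then have ci: "Cod M i = B" "core M A" "core M B" by (auto simp: Hom_def)
  have transfer: "\<exists>w'\<in>Hom M B Y'. w' \<cdot> i = y' \<and> sat M Y' s w'"
    if a: "fibrant M Y" "fibrant M Y'" "y \<in> Hom M A Y" "y' \<in> Hom M A Y'" "\<zeta> \<in> Hom (Ho M) Y Y'"
      "is_iso (Ho M) \<zeta>" "\<zeta> \<odot> \<gamma> y = \<gamma> y'" and w: "w \<in> Hom M B Y" "w \<cdot> i = y" "sat M Y s w" for Y Y' y y' \<zeta> w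
  proof -
    have c: "core M Y" using a by simp
    note gw = \<gamma>_Hom[OF w(1) ci(3) c]
    have "\<zeta> \<odot> \<gamma> w \<odot> \<gamma> i = \<gamma> y'"
      using H.compo_assoc[OF \<gamma>_Hom[OF i(2) ci(2,3)] gw a(5)] \<gamma>_comp[OF i(2) w(1) ci(2,3) c] w(2) a(7) by simp
    then obtain w' where w': "w' \<in> Hom M B Y'" "w' \<cdot> i = y'" "\<gamma> w' = \<zeta> \<odot> \<gamma> w"
      using \<gamma>_extension[OF i(1-3) a(2,4) H.comp_Hom[OF a(5) gw]] by blast
    have "sat M Y s w \<longleftrightarrow> sat M Y' s w'" by (rule fm_Ex(4)[OF fm_Ex(5) a(1,2) w(1) w'(1) a(5,6) w'(3)[symmetric]])
    then show ?thesis using w' w(3) by blast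
  qed
  obtain \<theta>' where \<theta>': "\<theta>' \<in> Hom (Ho M) X' X" "\<theta>' \<odot> \<theta> = ident (Ho M) X" "is_iso (Ho M) \<theta>'"
    using H.iso_inverse[OF fm_Ex(11,10)] by blast
  have gv: "\<gamma> v \<in> Hom (Ho M) A X" using \<gamma>_Hom[OF fm_Ex(8)] ci fm_Ex(6) by blast
  have "\<theta>' \<odot> \<gamma> v' = \<gamma> v"
    using H.compo_assoc[OF gv fm_Ex(10) \<theta>'(1)] \<theta>'(2) H.ident_left[OF gv] fm_Ex(12) by simp
  then show ?case
    unfolding sat.simps ci
    using transfer[OF fm_Ex(6-12)] transfer[OF fm_Ex(7,6,9,8) \<theta>'(1,3)] by blast
qed auto

text \<open>\<open>Ex j (Sub g s)\<close> transports \<open>s\<close> along the arrow \<open>(\<gamma> j)\<inverse> \<odot> \<gamma> g\<close> of the homotopy category.\<close>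

lemma sat_Ex_Sub:
  assumes s: "formula r M A1 s" and card: "Card_order r" and A: "cofibrant M A" "cofibrant M A'"
    and j: "j \<in> Cof M" "j \<in> Hom M A A'" and g: "g \<in> Hom M A1 A'" and Y: "fibrant M Y"
    and w: "w \<in> Hom M A Y" and x: "x \<in> Hom M A1 Y" and t: "t \<in> Hom (Ho M) A' Y"
    and iso: "is_iso (Ho M) (\<gamma> j)" and tj: "t \<odot> \<gamma> j = \<gamma> w" and tg: "t \<odot> \<gamma> g = \<gamma> x"
  shows "sat M Y (Ex j (Sub g s)) w \<longleftrightarrow> sat M Y s x"
proof -
  interpret H: category "Ho M" by (rule Ho_category)
  have A1: "cofibrant M A1" using formula_cofibrant s card by blast
  have c: "core M A" "core M A'" "core M A1" "core M Y" using A A1 Y by auto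
  have i: "ident (Ho M) Y \<in> Hom (Ho M) Y Y" "is_iso (Ho M) (ident (Ho M) Y)"
    using H.ident_Hom H.iso_ident Obj_Ho c by blast+
  have eq: "sat M Y s (u \<cdot> g) \<longleftrightarrow> sat M Y s x" if u: "u \<in> Hom M A' Y" "\<gamma> u = t" for u
  proof -
    note ug = comp_Hom[OF u(1) g]
    have "ident (Ho M) Y \<odot> \<gamma> (u \<cdot> g) = \<gamma> x"
      using H.ident_left[OF \<gamma>_Hom[OF ug c(3,4)]] \<gamma>_comp[OF g u(1) c(3,2,4)] u(2) tg by simp
    then show ?thesis by (rule sat_invariant[OF s card Y Y ug x i])
  qed
  have jc: "Cod M j = A'" using j by (simp add: Hom_def)
  \<comment> \<open>As \<open>\<gamma> j\<close> is invertible, all extensions of \<open>w\<close>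
    along \<open>j\<close> have the same class \<open>t\<close>; the existential thus quantifies
    over one class of witnesses, on which truth of \<open>s\<close> is constant.\<close>
  have "\<gamma> u = t" if "u \<in> Hom M A' Y" "u \<cdot> j = w" for u
    using H.iso_cancel_right[OF iso \<gamma>_Hom[OF j(2) c(1,2)] \<gamma>_Hom[OF that(1) c(2,4)] t]
      \<gamma>_comp[OF j(2) that(1) c(1,2,4)] that(2) tj by simp
  moreover obtain u where "u \<in> Hom M A' Y" "u \<cdot> j = w" "\<gamma> u = t"
    using \<gamma>_extension[OF j A(1) Y w t tj] by blast
  ultimately show ?thesis using eq by (auto simp: jc)
qed

end

section \<open>Maps between quotients\<close>

lemma quot_map_class:
  assumes "equiv S R" "equiv S' R'" "\<And>x y. (x, y) \<in> R \<Longrightarrow> (h x, h y) \<in> R'" "x \<in> S"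
  shows "quot_map R' h (R `` {x}) = R' `` {h x}"
proof -
  have "R' `` {h y} = R' `` {h x}" if "(x, y) \<in> R" for y
    using equiv_class_eq[OF assms(2) assms(3)[OF that]] by simp
  moreover have "(x, x) \<in> R" using assms(1,4) by (meson equivE refl_onD)
  ultimately show ?thesis unfolding quot_map_def by blast
qed

text \<open>The equivalence \<open>iff\<close> serves twice: from right to left it makes the map
  well defined, from left to right injective.\<close>

lemma quot_map_bij:
  assumes R: "equiv S R" and R': "equiv S' R'" and h: "\<And>x. x \<in> S \<Longrightarrow> h x \<in> S'"
    and iff: "\<And>x y. \<lbrakk>x \<in> S; y \<in> S\<rbrakk> \<Longrightarrow> (h x, h y) \<in> R' \<longleftrightarrow> (x, y) \<in> R"
    and surj: "\<And>y. y \<in> S' \<Longrightarrow> \<exists>x\<in>S. (h x, y) \<in> R'"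
  shows "(\<lambda>x. R' `` {h x}) respects R" and "bij_betw (quot_map R' h) (S // R) (S' // R')"
proof -
  have RS: "x \<in> S \<and> y \<in> S" if "(x, y) \<in> R" for x y using that R by (auto simp: equiv_def refl_on_def)
  then have resp: "(h x, h y) \<in> R'" if "(x, y) \<in> R" for x y using iff that by blast
  then show "(\<lambda>x. R' `` {h x}) respects R" by (intro congruentI equiv_class_eq[OF R']) 
  have cls: "quot_map R' h (R `` {x}) = R' `` {h x}" if "x \<in> S" for x
    by (rule quot_map_class[OF R R' _ that]) (rule resp)
  show "bij_betw (quot_map R' h) (S // R) (S' // R')"
  proof (rule bij_betw_imageI)
    show "inj_on (quot_map R' h) (S // R)"
    proof (rule inj_onI)
      fix X Y assume "X \<in> S // R" "Y \<in> S // R" and e: "quot_map R' h X = quot_map R' h Y"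
      then obtain x y where xy: "x \<in> S" "X = R `` {x}" "y \<in> S" "Y = R `` {y}" by (auto elim!: quotientE)
      then have "R' `` {h x} = R' `` {h y}" using e cls by simp
      then have "(h x, h y) \<in> R'" using eq_equiv_class_iff[OF R' h[OF xy(1)] h[OF xy(3)]] by blast
      then show "X = Y" using iff[OF xy(1,3)] equiv_class_eq[OF R] xy by simp
    qed
    show "quot_map R' h ` (S // R) = S' // R'"
    proof
      show "quot_map R' h ` (S // R) \<subseteq> S' // R'"
        by (auto elim!: quotientE simp: cls simp del: Image_singleton_iff intro!: quotientI h)
      show "S' // R' \<subseteq> quot_map R' h ` (S // R)"
      proof
        fix Y assume "Y \<in> S' // R'"
        then obtain y where y: "y \<in> S'" "Y = R' `` {y}" by (auto elim!: quotientE)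
        then obtain x where x: "x \<in> S" "(h x, y) \<in> R'" using surj by blast
        have "Y = quot_map R' h (R `` {x})" using cls[OF x(1)] equiv_class_eq[OF R' x(2)] y by simp
        then show "Y \<in> quot_map R' h ` (S // R)" by (rule image_eqI) (rule quotientI[OF x(1)])
      qed
    qed
  qed
qed

lemma quot_map_bool_hom:
  assumes R: "equiv (carrier L) R" and R': "equiv (carrier L') R'"
    and L: "boolean_lattice L"
    and h: "bool_hom L L' h" and resp: "\<And>x y. (x, y) \<in> R \<Longrightarrow> (h x, h y) \<in> R'"
    and q: "bool_hom L (quot_order L R) (\<lambda>x. R `` {x})"
    and q': "bool_hom L' (quot_order L' R') (\<lambda>x. R' `` {x})"
  shows "bool_hom (quot_order L R) (quot_order L' R') (quot_map R' h)"
proof -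
  interpret L: boolean_lattice L by (rule L)
  let ?Q = "quot_order L R" and ?Q' = "quot_order L' R'" and ?h = "quot_map R' h"
  have hc: "h x \<in> carrier L'" if "x \<in> carrier L" for x using h that by (auto simp: bool_hom_def)
  have cls: "?h (R `` {x}) = R' `` {h x}" if "x \<in> carrier L" for x
    by (rule quot_map_class[OF R R' _ that]) (rule resp)
  have rep: "\<exists>x\<in>carrier L. X = R `` {x}" if "X \<in> carrier ?Q" for X
    using that unfolding quot_order_def by (auto elim: quotientE)
  have "?h (X \<sqinter>\<^bsub>?Q\<^esub> Y) = ?h X \<sqinter>\<^bsub>?Q'\<^esub> ?h Y \<and> ?h (X \<squnion>\<^bsub>?Q\<^esub> Y) = ?h X \<squnion>\<^bsub>?Q'\<^esub> ?h Y"
    if XY: "X \<in> carrier ?Q" "Y \<in> carrier ?Q" for X Y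
  proof -
    obtain x y where x: "x \<in> carrier L" "X = R `` {x}" and y: "y \<in> carrier L" "Y = R `` {y}"
      using rep XY by blast
    have "X \<sqinter>\<^bsub>?Q\<^esub> Y = R `` {x \<sqinter>\<^bsub>L\<^esub> y}" "X \<squnion>\<^bsub>?Q\<^esub> Y = R `` {x \<squnion>\<^bsub>L\<^esub> y}"
      using q x y unfolding bool_hom_def by auto
    moreover have "R' `` {h x \<sqinter>\<^bsub>L'\<^esub> h y} = R' `` {h x} \<sqinter>\<^bsub>?Q'\<^esub> R' `` {h y}"
      "R' `` {h x \<squnion>\<^bsub>L'\<^esub> h y} = R' `` {h x} \<squnion>\<^bsub>?Q'\<^esub> R' `` {h y}"
      using q' hc[OF x(1)] hc[OF y(1)] unfolding bool_hom_def by auto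
    moreover have "h (x \<sqinter>\<^bsub>L\<^esub> y) = h x \<sqinter>\<^bsub>L'\<^esub> h y" "h (x \<squnion>\<^bsub>L\<^esub> y) = h x \<squnion>\<^bsub>L'\<^esub> h y"
      using h x y unfolding bool_hom_def by auto
    ultimately show ?thesis using x y cls by simp
  qed
  moreover have "?h \<bottom>\<^bsub>?Q\<^esub> = \<bottom>\<^bsub>?Q'\<^esub>" "?h \<top>\<^bsub>?Q\<^esub> = \<top>\<^bsub>?Q'\<^esub>"
    using q q' h cls[OF L.bottom_closed] cls[OF L.top_closed] unfolding bool_hom_def by auto
  moreover have "?h \<in> carrier ?Q \<rightarrow> carrier ?Q'"
  proof (rule funcsetI)
    fix X assume "X \<in> carrier ?Q"
    then obtain x where x: "x \<in> carrier L" "X = R `` {x}" using rep by blast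
    then show "?h X \<in> carrier ?Q'" using q' hc[OF x(1)] unfolding x(2) cls[OF x(1)] bool_hom_def by blast
  qed
  ultimately show ?thesis unfolding bool_hom_def by blast
qed

section \<open>Weak equivalences\<close>

context weak_model_category begin

lemma sat_\<gamma>_eq:
  assumes "formula r M A s" "Card_order r" "fibrant M X" "v \<in> Hom M A X" "v' \<in> Hom M A X" "\<gamma> v = \<gamma> v'"
  shows "sat M X s v \<longleftrightarrow> sat M X s v'"
proof -
  interpret H: category "Ho M" by (rule Ho_category)
  have c: "core M A" "core M X" using formula_cofibrant[OF assms(1,2)] assms(3) by auto
  then have "ident (Ho M) X \<in> Hom (Ho M) X X" "is_iso (Ho M) (ident (Ho M) X)"
    using H.ident_Hom H.iso_ident Obj_Ho by blast+
  then show ?thesis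
    by (rule sat_invariant[OF assms(1,2,3,3,4,5)]) (use H.ident_left[OF \<gamma>_Hom[OF assms(4) c]] assms(6) in simp)
qed

lemma carrier_h_language:
  "carrier (h_language r M A) = carrier (alg (language r M) A) // sem_equiv r M A"
  by (simp add: h_language_def quot_order_def)

lemma language_invariance:
  assumes card: "Card_order r" and A: "cofibrant M A" and B: "cofibrant M B" and f: "f \<in> Hom M A B" "f \<in> Weq M"
  shows "(\<lambda>\<phi>. sem_equiv r M B `` {act (language r M) f \<phi>}) respects sem_equiv r M A"
    and "bij_betw (quot_map (sem_equiv r M B) (act (language r M) f))
      (carrier (h_language r M A)) (carrier (h_language r M B))"
proof -
  interpret H: category "Ho M" by (rule Ho_category)
  note ctx = cof_cat_category card
  let ?S = "carrier (alg (language r M) A)" and ?S' = "carrier (alg (language r M) B)"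
  have fc: "f \<in> Hom (cof_cat M) A B" using f A B Hom_cof by blast
  have c: "core M A" "core M B" using A B by auto
  note gf = \<gamma>_Hom[OF f(1) c] and fi = \<gamma>_iso[OF f(2,1) c]
  obtain k where k: "k \<in> Hom (Ho M) B A" "k \<odot> \<gamma> f = ident (Ho M) A" "\<gamma> f \<odot> k = ident (Ho M) B"
    using H.iso_inverse[OF fi gf] by blast
  have act: "act (language r M) f (fcls r M A s) = fcls r M B (Sub f s)" if "formula r M A s" for s
    unfolding language_def by (rule act_cl[OF ctx fc that])
  note lang = language_carrier[OF card] and sub = fm_Sub[OF fc]
  have 1: "act (language r M) f x \<in> ?S'" if x: "x \<in> ?S" for x
  proof -
    obtain s where s: "formula r M A s" "x = fcls r M A s" using x unfolding lang by blast
    show ?thesis unfolding s(2) act[OF s(1)] lang using sub[OF s(1)] by blast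
  qed
  have 2: "(act (language r M) f x, act (language r M) f y) \<in> sem_equiv r M B \<longleftrightarrow> (x, y) \<in> sem_equiv r M A"
    if xy: "x \<in> ?S" "y \<in> ?S" for x y
  proof -
    obtain s t where s: "formula r M A s" "x = fcls r M A s" and t: "formula r M A t" "y = fcls r M A t"
      using xy unfolding lang by blast
    have "sat M X s w = sat M X t w"
      if e: "\<And>X v. fibrant M X \<Longrightarrow> v \<in> Hom M B X \<Longrightarrow> sat M X s (v \<cdot> f) = sat M X t (v \<cdot> f)"
        and X: "fibrant M X" and w: "w \<in> Hom M A X" for X w
    proof -
      have cX: "core M X" using X by simp
      note gw = \<gamma>_Hom[OF w c(1) cX]
      \<comment> \<open>\<open>v\<close> realizes \<open>w\<close> composed with the inverse
        \<open>k\<close> of \<open>f\<close>, so \<open>v \<cdot> f\<close> and \<open>w\<close>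
        have the same class and satisfy the same formulas.\<close>
      obtain v where v: "v \<in> Hom M B X" "\<gamma> v = \<gamma> w \<odot> k" using \<gamma>_full[OF B X H.comp_Hom[OF gw k(1)]] by blast
      have "\<gamma> w = \<gamma> (v \<cdot> f)"
        using \<gamma>_comp[OF f(1) v(1) c cX] v(2) H.compo_assoc[OF gf k(1) gw] k(2) H.ident_right[OF gw] by simp
      note eq = sat_\<gamma>_eq[OF _ card X w comp_Hom[OF v(1) f(1)] this]
      show ?thesis unfolding eq[OF s(1)] eq[OF t(1)] by (rule e[OF X v(1)])
    qed
    then show ?thesis
      unfolding s(2) t(2) act[OF s(1)] act[OF t(1)] sem_equiv_fcls[OF card s(1) t(1)]
        sem_equiv_fcls[OF card sub[OF s(1)] sub[OF t(1)]]
      using comp_Hom[OF _ f(1)] by auto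
  qed
  have 3: "\<exists>x\<in>?S. (act (language r M) f x, y) \<in> sem_equiv r M B" if y: "y \<in> ?S'" for y
  proof -
    obtain t where t: "formula r M B t" "y = fcls r M B t" using y unfolding lang by blast
    \<comment> \<open>The required formula is \<open>t\<close> transported along
      \<open>k : B -> A\<close>. This arrow need not be the class of a map, as \<open>A\<close> need
      not be fibrant, but \<open>\<gamma> j \<odot> k\<close> is the class of some
      \<open>g\<close>.\<close>
    obtain A' j where A': "cofibrant M A'" "fibrant M A'" and j: "j \<in> Hom M A A'" "j \<in> Cof M \<inter> Weq M"
      using fibrant_replacement[OF A] by blast
    have cA': "core M A'" using A' by simp
    note gj = \<gamma>_Hom[OF j(1) c(1) cA']
    have ji: "is_iso (Ho M) (\<gamma> j)" using \<gamma>_iso[OF _ j(1) c(1) cA'] j(2) by blast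
    obtain l where l: "l \<in> Hom (Ho M) A' A" "l \<odot> \<gamma> j = ident (Ho M) A"
      using H.iso_inverse[OF ji gj] by blast
    obtain g where g: "g \<in> Hom M B A'" "\<gamma> g = \<gamma> j \<odot> k" using \<gamma>_full[OF B A'(2) H.comp_Hom[OF gj k(1)]] by blast
    let ?s = "Ex j (Sub g t)"
    have jc: "j \<in> cof_cofs M" "j \<in> Hom (cof_cat M) A A'" using cof_cofs_iff[of j A A'] j A A' by auto
    have gc: "g \<in> Hom (cof_cat M) B A'" using Hom_cof g B A' by blast
    have s: "formula r M A ?s" by (rule fm_Ex[OF jc fm_Sub[OF gc t(1)]])
    have "sat M X ?s (v \<cdot> f) = sat M X t v" if X: "fibrant M X" and v: "v \<in> Hom M B X" for X v
    proof -
      have cX: "core M X" using X by simp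
      note vf = comp_Hom[OF v f(1)]
      note gv = \<gamma>_Hom[OF v c(2) cX] and gvf = \<gamma>_Hom[OF vf c(1) cX]
      \<comment> \<open>The arrow \<open>A' -> X\<close> to use is
        \<open>\<gamma> (v \<cdot> f) \<odot> l\<close>: along \<open>j\<close> it restricts to the
        class of \<open>v \<cdot> f\<close>, and along \<open>g\<close> to
        \<open>\<gamma> (v \<cdot> f) \<odot> k\<close>, the class of \<open>v\<close>.\<close>
      show ?thesis
      proof (rule sat_Ex_Sub[OF t(1) card A A'(1) _ j(1) g(1) X vf v H.comp_Hom[OF gvf l(1)] ji])
        show "j \<in> Cof M" using j by blast
        show "\<gamma> (v \<cdot> f) \<odot> l \<odot> \<gamma> j = \<gamma> (v \<cdot> f)"
          using H.compo_assoc[OF gj l(1) gvf] l(2) H.ident_right[OF gvf] by simp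
        have "\<gamma> (v \<cdot> f) \<odot> l \<odot> (\<gamma> j \<odot> k) = \<gamma> (v \<cdot> f) \<odot> (l \<odot> \<gamma> j \<odot> k)"
          using H.compo_assoc[OF H.comp_Hom[OF gj k(1)] l(1) gvf] H.compo_assoc[OF k(1) gj l(1)] by simp
        also have "\<dots> = \<gamma> v \<odot> (\<gamma> f \<odot> k)"
          using l(2) H.ident_left[OF k(1)] \<gamma>_comp[OF f(1) v c cX] H.compo_assoc[OF k(1) gf gv] by simp
        finally show "\<gamma> (v \<cdot> f) \<odot> l \<odot> \<gamma> g = \<gamma> v" using g(2) k(3) H.ident_right[OF gv] by simp
      qed
    qed
    then have "(fcls r M B (Sub f ?s), y) \<in> sem_equiv r M B"
      unfolding t(2) sem_equiv_fcls[OF card sub[OF s] t(1)] by simp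
    moreover have "fcls r M A ?s \<in> ?S" unfolding lang using s by blast
    ultimately show ?thesis using act[OF s] by metis
  qed
  show "(\<lambda>\<phi>. sem_equiv r M B `` {act (language r M) f \<phi>}) respects sem_equiv r M A"
    by (rule quot_map_bij(1)[OF sem_equiv_equiv sem_equiv_equiv]) (use 1 2 3 in auto)
  show "bij_betw (quot_map (sem_equiv r M B) (act (language r M) f))
      (carrier (h_language r M A)) (carrier (h_language r M B))"
    unfolding carrier_h_language
    by (rule quot_map_bij(2)[OF sem_equiv_equiv sem_equiv_equiv]) (use 1 2 3 in auto)
qed

text \<open>Needed because the derived right adjoint may take a value that is only fibrant, while
  \<open>F\<close> is compared with \<open>LF\<close> on cofibrant objects.\<close>

lemma core_cofibrant_replacement:
  assumes "core M X"
  obtains A k where "cofibrant M A" "k \<in> Hom (Ho M) A X" "is_iso (Ho M) k"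
proof (cases "cofibrant M X")
  case True
  then show thesis
    using that[of X "ident (Ho M) X"] category.ident_Hom[OF Ho_category] category.iso_ident[OF Ho_category] Obj_Ho
    by blast
next
  case False
  then have X: "fibrant M X" using assms by simp
  obtain A q where q: "cofibrant M A" "q \<in> Hom M A X" "q \<in> Fib M \<inter> Weq M"
    using cofibrant_replacement[OF X] by blast
  then show thesis using that[OF q(1) \<gamma>_Hom[OF q(2)] \<gamma>_iso[OF _ q(2)]] assms by blast
qed

end

lemma functor_iso:
  assumes F: "is_functor C D F" and f: "is_iso C f" "f \<in> Hom C A B" and C: "category C"
  shows "is_iso D (farr F f)"
proof -
  interpret C: category C by (rule C)
  obtain g where g: "g \<in> Hom C B A" "g \<cdot>\<^bsub>C\<^esub> f = ident C A" "f \<cdot>\<^bsub>C\<^esub> g = ident C B"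
    using C.iso_inverse[OF f] by blast
  have O: "A \<in> Obj C" "B \<in> Obj C" using C.Hom_Obj f by auto
  have "farr F (ident C X) = ident D (fobj F X)" if "X \<in> Obj C" for X using F that unfolding is_functor_def by blast
  then have "farr F g \<cdot>\<^bsub>D\<^esub> farr F f = ident D (fobj F A)" "farr F f \<cdot>\<^bsub>D\<^esub> farr F g = ident D (fobj F B)"
    using functor_comp[OF F f(2) g(1)] functor_comp[OF F g(1) f(2)] g O by auto
  then show ?thesis using functor_Hom[OF F f(2)] functor_Hom[OF F g(1)] unfolding is_iso_def by (auto simp: Hom_def)
qed

section \<open>Quillen equivalences\<close>

text \<open>\<open>LF\<close> and \<open>RG\<close> are tied to \<open>F\<close> and
  \<open>G\<close> by \<open>\<alpha>\<close> on cofibrant and by \<open>\<beta>\<close> on fibrant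
  objects, so every argument has to be moved to such representatives first.\<close>

locale derived_equivalence = M: weak_model_category M + N: weak_model_category N
  for M :: "('o, 'm, 'y) wmcat_scheme" and N :: "('p, 'n, 'z) wmcat_scheme" +
  fixes F G \<eta> \<epsilon> LF RG \<eta>h \<epsilon>h \<alpha> \<beta>
  assumes quillen: "quillen_adjunction M N F G \<eta> \<epsilon>"
    and equivalence: "adjoint_equivalence (Ho M) (Ho N) LF RG \<eta>h \<epsilon>h"
    and \<alpha>: "nat_iso (cof_cat M) (Ho N) (LF \<circ>\<^sub>F Ho_ftor M) (Ho_ftor N \<circ>\<^sub>F F) \<alpha>"
    and \<beta>: "nat_iso (fib_cat N) (Ho M) (RG \<circ>\<^sub>F Ho_ftor N) (Ho_ftor M \<circ>\<^sub>F G) \<beta>"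
begin

sublocale HM: category "Ho M" by (rule M.Ho_category)
sublocale HN: category "Ho N" by (rule N.Ho_category)

lemma adj: "adjunction M N F G \<eta> \<epsilon>" and F_functor: "is_functor M N F" and G_functor: "is_functor N M G"
  and F_Cof: "i \<in> Cof M \<Longrightarrow> farr F i \<in> Cof N" and G_Fib: "p \<in> Fib N \<Longrightarrow> farr G p \<in> Fib M"
  using quillen by (auto simp: quillen_adjunction_def adjunction_def)

lemmas F_Hom = functor_Hom[OF F_functor]
lemmas F_cofibrant = quillen_cofibrant[OF M.weak_model_category_axioms N.weak_model_category_axioms quillen]
lemmas adjM = M.category_axioms N.category_axioms adj

lemma Hadj: "adjunction (Ho M) (Ho N) LF RG \<eta>h \<epsilon>h"
  and \<eta>h_iso: "X \<in> Obj (Ho M) \<Longrightarrow> is_iso (Ho M) (\<eta>h X)"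
  and \<epsilon>h_iso: "Y \<in> Obj (Ho N) \<Longrightarrow> is_iso (Ho N) (\<epsilon>h Y)"
  using equivalence by (auto simp: adjoint_equivalence_def)

lemmas Hadj_facts = adj_facts[OF HM.category_axioms HN.category_axioms Hadj]

lemma \<alpha>_Hom: "cofibrant M X \<Longrightarrow> \<alpha> X \<in> Hom (Ho N) (fobj LF X) (fobj F X)"
  and \<alpha>_iso: "cofibrant M X \<Longrightarrow> is_iso (Ho N) (\<alpha> X)"
  and \<alpha>_nat: "\<lbrakk>f \<in> Hom M A B; cofibrant M A; cofibrant M B\<rbrakk>
    \<Longrightarrow> \<alpha> B \<cdot>\<^bsub>Ho N\<^esub> farr LF (M.\<gamma> f) = N.\<gamma> (farr F f) \<cdot>\<^bsub>Ho N\<^esub> \<alpha> A"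
  using \<alpha> M.Hom_cof[of f A B] M.cof_sel(5)[of X]
  by (auto simp: nat_iso_def nat_trans_def comp_ftor_def)

lemma \<beta>_Hom: "fibrant N Y \<Longrightarrow> \<beta> Y \<in> Hom (Ho M) (fobj RG Y) (fobj G Y)"
  and \<beta>_iso: "fibrant N Y \<Longrightarrow> is_iso (Ho M) (\<beta> Y)"
  using \<beta> N.fibrant_Obj[of Y] by (auto simp: nat_iso_def nat_trans_def comp_ftor_def fib_cat_def)

text \<open>As a right adjoint, \<open>G\<close> preserves terminal objects, shown here by
  transposing maps; it preserves fibrations by hypothesis.\<close>

lemma G_fibrant:
  assumes "fibrant N Y" shows "fibrant M (fobj G Y)"
proof -
  obtain T t where t: "terminal N T" "t \<in> Hom N Y T" "t \<in> Fib N" using assms unfolding fibrant_def by blast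
  have T: "T \<in> Obj N" using t(1) by (simp add: terminal_def)
  have "\<exists>!f. f \<in> Hom M X (fobj G T)" if X: "X \<in> Obj M" for X
  proof -
    obtain h where h: "h \<in> Hom N (fobj F X) T" "\<And>h'. h' \<in> Hom N (fobj F X) T \<Longrightarrow> h' = h"
      using t(1) fobj_Obj(1)[OF adjM X] unfolding terminal_def by blast
    show ?thesis
    proof (rule ex1I[of _ "transp M G \<eta> X h"])
      show "transp M G \<eta> X h \<in> Hom M X (fobj G T)" by (rule transp_Hom[OF adjM X h(1)])
      fix g assume g: "g \<in> Hom M X (fobj G T)"
      show "g = transp M G \<eta> X h"
        using transp_untransp[OF adjM T g] h(2)[OF untransp_Hom[OF adjM T g]] by simp
    qed
  qed
  then have "terminal M (fobj G T)" unfolding terminal_def using fobj_Obj(2)[OF adjM T] by blast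
  then show ?thesis unfolding fibrant_def using functor_Hom[OF G_functor t(2)] G_Fib[OF t(3)] by blast
qed

lemma F_Hom_cof: "f \<in> Hom (cof_cat M) A B \<Longrightarrow> farr F f \<in> Hom (cof_cat N) (fobj F A) (fobj F B)"
  using F_Hom F_cofibrant unfolding M.Hom_cof N.Hom_cof by blast

lemma F_cof_cofs:
  assumes "i \<in> cof_cofs M" "i \<in> Hom (cof_cat M) A B"
  shows "farr F i \<in> cof_cofs N" "farr F i \<in> Hom (cof_cat N) (fobj F A) (fobj F B)"
  using assms M.cof_cofs_iff[of i A B] N.cof_cofs_iff[of "farr F i" "fobj F A" "fobj F B"]
    F_Cof F_Hom F_cofibrant by blast+

lemma formula_map: "formula r M A s \<Longrightarrow> formula r N (fobj F A) (map_fm (farr F) s)"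
proof (induction rule: is_fm.induct)
  case (fm_Fls A)
  then show ?case using F_cofibrant by (auto intro: is_fm.fm_Fls simp: M.cof_sel N.cof_sel)
next
  case (fm_Join A I s)
  then show ?case using F_cofibrant by (auto intro!: is_fm.fm_Join simp: M.cof_sel N.cof_sel)
next
  case (fm_Sub f A B s)
  then show ?case using is_fm.fm_Sub[OF F_Hom_cof[OF fm_Sub(1)]] by simp
next
  case (fm_Ex i A B s)
  then show ?case using is_fm.fm_Ex[OF F_cof_cofs[OF fm_Ex(1,2)]] by simp
qed (auto intro: is_fm.intros)

lemma fm_eval_pull:
  "formula r M A s \<Longrightarrow> fm_eval (cof_cat M) (pull_bafun F P) s A = fm_eval (cof_cat N) P (map_fm (farr F) s) (fobj F A)"
proof (induction rule: is_fm.induct)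
  case (fm_Join A I s)
  then have "(\<lambda>k. fm_eval (cof_cat M) (pull_bafun F P) (s k) A) ` I
      = (\<lambda>k. fm_eval (cof_cat N) P (map_fm (farr F) (s k)) (fobj F A)) ` I"
    by (intro image_cong) auto
  then show ?case by (simp add: pull_bafun_def)
next
  case (fm_Sub f A B s)
  then have "Dom M f = A" "Dom N (farr F f) = fobj F A"
    using F_Hom_cof[OF fm_Sub(1)] unfolding M.Hom_cof N.Hom_cof by (auto simp: Hom_def)
  then show ?case using fm_Sub by (simp add: pull_bafun_def M.cof_sel N.cof_sel)
next
  case (fm_Ex i A B s)
  then have "Cod M i = B" "Cod N (farr F i) = fobj F B"
    using F_Hom_cof[OF fm_Ex(2)] unfolding M.Hom_cof N.Hom_cof by (auto simp: Hom_def)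
  then show ?case using fm_Ex by (simp add: pull_bafun_def M.cof_sel N.cof_sel)
qed (auto simp: pull_bafun_def)

lemma pull_language:
  "Card_order r \<Longrightarrow> lambda_boolean_over r (cof_cat M) (cof_cofs M) (pull_bafun F (language r N))"
  unfolding language_def
  by (rule pull_bafun_lambda[OF M.weak_model_category_axioms N.weak_model_category_axioms quillen
    initial_over_lambda[OF N.cof_cat_category]])

text \<open>By initiality the morphism is evaluation in the pulled-back algebra, and this amounts to
  relabelling every arrow of the formula by \<open>F\<close>.\<close>

lemma language_map_fcls:
  assumes "Card_order r" "formula r M A s"
  shows "language_map r M N F A (fcls r M A s) = fcls r N (fobj F A) (map_fm (farr F) s)"
  unfolding language_map_def initial_hom_cl[OF pull_language[OF assms(1)] assms] fm_eval_pull[OF assms(2)]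
  unfolding language_def by (rule fm_eval_initial_over[OF N.cof_cat_category assms(1) formula_map[OF assms(2)]])

lemma language_map_hom:
  assumes "Card_order r" "cofibrant M A"
  shows "bool_hom (alg (language r M) A) (alg (language r N) (fobj F A)) (language_map r M N F A)"
proof -
  obtain h where h: "bafun_hom r (cof_cat M) (cof_cofs M) (language r M) (pull_bafun F (language r N)) h"
    using initial_over_hom(1)[OF pull_language[OF assms(1)] assms(1)] unfolding language_def by blast
  have A: "A \<in> Obj (cof_cat M)" using assms(2) M.cof_sel by blast
  have e: "language_map r M N F A x = h A x" if "x \<in> carrier (alg (language r M) A)" for x
    unfolding language_map_def
    using initial_over_hom(3)[OF pull_language[OF assms(1)] assms(1) h[unfolded language_def[of r M]] A] that
    unfolding language_def[of r M] by blast
  have b: "bool_hom (alg (language r M) A) (alg (language r N) (fobj F A)) (h A)"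
    using h A by (auto simp: bafun_hom_def lambda_hom_def pull_bafun_def)
  interpret L: boolean_lattice "alg (language r M) A"
    unfolding language_def by (rule bool_IA(1)[OF M.cof_cat_category assms(1) A])
  show ?thesis using b unfolding bool_hom_def by (auto simp: e)
qed

text \<open>An exact correspondence, without homotopy: by naturality, transposition is a bijection
  between extensions of \<open>w\<close> along \<open>F i\<close> and extensions of the transpose of
  \<open>w\<close> along \<open>i\<close>.\<close>

lemma sat_map:
  assumes "formula r M A s" "Y \<in> Obj N" "w \<in> Hom N (fobj F A) Y"
  shows "sat N Y (map_fm (farr F) s) w \<longleftrightarrow> sat M (fobj G Y) s (transp M G \<eta> A w)"
  using assms
proof (induction arbitrary: w rule: is_fm.induct)
  case (fm_Sub f A B s)
  then have f: "f \<in> Hom M A B" using M.Hom_cof by blast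
  have "w \<cdot>\<^bsub>N\<^esub> farr F f \<in> Hom N (fobj F A) Y" using N.compo_Hom[OF F_Hom[OF f] fm_Sub(5)] .
  then show ?case using fm_Sub(3)[OF fm_Sub(4)] transp_nat[OF adjM f fm_Sub(5)] by simp
next
  case (fm_Ex i A B s)
  then have i: "i \<in> Hom M A B" using M.Hom_cof by blast
  have O: "A \<in> Obj M" "B \<in> Obj M" using M.Hom_Obj[OF i] by auto
  have c: "Cod M i = B" "Cod N (farr F i) = fobj F B" using i F_Hom[OF i] by (auto simp: Hom_def)
  show ?case
  proof
    assume "sat N Y (map_fm (farr F) (Ex i s)) w"
    then obtain u where u: "u \<in> Hom N (fobj F B) Y" "u \<cdot>\<^bsub>N\<^esub> farr F i = w" "sat N Y (map_fm (farr F) s) u"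
      by (auto simp: c)
    then show "sat M (fobj G Y) (Ex i s) (transp M G \<eta> A w)"
      using fm_Ex(4)[OF fm_Ex(5) u(1)] transp_nat[OF adjM i u(1)] transp_Hom[OF adjM O(2) u(1)] by (auto simp: c)
  next
    assume "sat M (fobj G Y) (Ex i s) (transp M G \<eta> A w)"
    then obtain v where v: "v \<in> Hom M B (fobj G Y)" "v \<cdot>\<^bsub>M\<^esub> i = transp M G \<eta> A w" "sat M (fobj G Y) s v"
      by (auto simp: c)
    let ?u = "untransp N F \<epsilon> Y v"
    have u: "?u \<in> Hom N (fobj F B) Y" "transp M G \<eta> B ?u = v"
      using untransp_Hom[OF adjM fm_Ex(5) v(1)] transp_untransp[OF adjM fm_Ex(5) v(1)] by auto
    have ui: "?u \<cdot>\<^bsub>N\<^esub> farr F i \<in> Hom N (fobj F A) Y" using N.compo_Hom[OF F_Hom[OF i] u(1)] .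
    have "transp M G \<eta> A (?u \<cdot>\<^bsub>N\<^esub> farr F i) = transp M G \<eta> A w"
      using transp_nat[OF adjM i u(1)] u(2) v(2) by simp
    then have "?u \<cdot>\<^bsub>N\<^esub> farr F i = w"
      using untransp_transp[OF adjM O(1) ui] untransp_transp[OF adjM O(1) fm_Ex(6)] by metis
    then show "sat N Y (map_fm (farr F) (Ex i s)) w"
      using fm_Ex(4)[OF fm_Ex(5) u(1)] u v(3) by (auto simp: c)
  qed
qed auto

text \<open>\<open>LF\<close> preserves isomorphisms, and \<open>\<alpha>\<close> conjugates its
  action into that of \<open>F\<close>. Invertibility of the class is all that
  \<open>sat_Ex_Sub\<close> asks of the image of a trivial cofibration.\<close>

lemma F_\<gamma>_iso:
  assumes "w \<in> Weq M" "w \<in> Hom M A B" "cofibrant M A" "cofibrant M B"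
  shows "is_iso (Ho N) (N.\<gamma> (farr F w))"
proof -
  have c: "core M A" "core M B" "core N (fobj F A)" "core N (fobj F B)" using assms(3,4) F_cofibrant by auto
  note gw = M.\<gamma>_Hom[OF assms(2) c(1,2)] and gF = N.\<gamma>_Hom[OF F_Hom[OF assms(2)] c(3,4)]
  have "is_iso (Ho N) (farr LF (M.\<gamma> w))"
    by (rule functor_iso[OF Hadj_facts(1) M.\<gamma>_iso[OF assms(1,2) c(1,2)] gw HM.category_axioms])
  then have i: "is_iso (Ho N) (N.\<gamma> (farr F w) \<cdot>\<^bsub>Ho N\<^esub> \<alpha> A)"
    using HN.iso_comp[OF _ functor_Hom[OF Hadj_facts(1) gw] \<alpha>_iso[OF assms(4)] \<alpha>_Hom[OF assms(4)]]
    unfolding \<alpha>_nat[OF assms(2-4)] by blast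
  note a = \<alpha>_Hom[OF assms(3)]
  obtain e where e: "e \<in> Hom (Ho N) (fobj F A) (fobj LF A)" "\<alpha> A \<cdot>\<^bsub>Ho N\<^esub> e = ident (Ho N) (fobj F A)" "is_iso (Ho N) e"
    using HN.iso_inverse[OF \<alpha>_iso[OF assms(3)] a] by blast
  have "N.\<gamma> (farr F w) = N.\<gamma> (farr F w) \<cdot>\<^bsub>Ho N\<^esub> \<alpha> A \<cdot>\<^bsub>Ho N\<^esub> e"
    using HN.compo_assoc[OF e(1) a gF] e(2) HN.ident_right[OF gF] by simp
  then show ?thesis using HN.iso_comp[OF e(3,1) i HN.comp_Hom[OF gF a]] by simp
qed

text \<open>By \<open>sat_map\<close>, truth in a fibrant \<open>Y\<close> of \<open>N\<close> is
  truth in \<open>G Y\<close>. Conversely, every fibrant \<open>X\<close> of \<open>M\<close> is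
  isomorphic in the homotopy category to some \<open>G Y\<close> with \<open>Y\<close> fibrant, and
  \<open>sat_invariant\<close> applies.\<close>

lemma sem_equiv_map:
  assumes card: "Card_order r" and s: "formula r M A s" and t: "formula r M A t"
  shows "(fcls r N (fobj F A) (map_fm (farr F) s), fcls r N (fobj F A) (map_fm (farr F) t)) \<in> sem_equiv r N (fobj F A)
    \<longleftrightarrow> (fcls r M A s, fcls r M A t) \<in> sem_equiv r M A"
  unfolding N.sem_equiv_fcls[OF card formula_map[OF s] formula_map[OF t]] M.sem_equiv_fcls[OF card s t]
proof (rule iffI; intro allI impI; elim conjE)
  have A: "cofibrant M A" by (rule M.formula_cofibrant[OF s card])
  fix X v
  assume e: "\<forall>X v. fibrant N X \<and> v \<in> Hom N (fobj F A) X \<longrightarrow>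
      sat N X (map_fm (farr F) s) v = sat N X (map_fm (farr F) t) v"
    and X: "fibrant M X" and v: "v \<in> Hom M A X"
  have c: "core M A" "core M X" using A X by auto
  then have OX: "X \<in> Obj (Ho M)" using M.Obj_Ho by blast
  let ?Z = "fobj LF X"
  have "?Z \<in> Obj (Ho N)" by (rule fobj_Obj(1)[OF HM.category_axioms HN.category_axioms Hadj OX])
  then have Y0: "core N ?Z" using N.Obj_Ho by blast
  let ?Y = "fobj_rep N ?Z"
  note j = N.frep[OF Y0]
  have cY: "core N ?Y" using j by simp
  note gj = N.\<gamma>_Hom[OF j(1) Y0 cY]
  have Rj: "farr RG (N.\<gamma> (frep N ?Z)) \<in> Hom (Ho M) (fobj RG ?Z) (fobj RG ?Y)"
      "is_iso (Ho M) (farr RG (N.\<gamma> (frep N ?Z)))"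
    using functor_Hom[OF Hadj_facts(2) gj]
      functor_iso[OF Hadj_facts(2) N.\<gamma>_iso[OF j(2,1) Y0 cY] gj HN.category_axioms] by auto
  \<comment> \<open>With \<open>?Y\<close> a fibrant replacement of \<open>LF X\<close>, the arrows
    \<open>?r\<close> and \<open>?th\<close> are \<open>X -> RG (LF X) -> RG ?Y\<close> and its
    continuation to \<open>G ?Y\<close>; the derived unit is invertible, hence so are both.\<close>
  let ?r = "farr RG (N.\<gamma> (frep N ?Z)) \<cdot>\<^bsub>Ho M\<^esub> \<eta>h X"
  let ?th = "\<beta> ?Y \<cdot>\<^bsub>Ho M\<^esub> ?r"
  have r: "?r \<in> Hom (Ho M) X (fobj RG ?Y)" "is_iso (Ho M) ?r"
    using HM.comp_Hom[OF Rj(1) Hadj_facts(3)[OF OX]] HM.iso_comp[OF \<eta>h_iso[OF OX] Hadj_facts(3)[OF OX] Rj(2,1)] by auto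
  have th: "?th \<in> Hom (Ho M) X (fobj G ?Y)" "is_iso (Ho M) ?th"
    using HM.comp_Hom[OF \<beta>_Hom[OF j(3)] r(1)] HM.iso_comp[OF r(2,1) \<beta>_iso[OF j(3)] \<beta>_Hom[OF j(3)]] by auto
  have GY: "fibrant M (fobj G ?Y)" by (rule G_fibrant[OF j(3)])
  note OY = N.fibrant_Obj[OF j(3)]
  obtain u where u: "u \<in> Hom M A (fobj G ?Y)" "M.\<gamma> u = ?th \<cdot>\<^bsub>Ho M\<^esub> M.\<gamma> v"
    using M.\<gamma>_full[OF A GY HM.comp_Hom[OF th(1) M.\<gamma>_Hom[OF v c]]] by blast
  let ?w = "untransp N F \<epsilon> ?Y u"
  have w: "?w \<in> Hom N (fobj F A) ?Y" "transp M G \<eta> A ?w = u"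
    using untransp_Hom[OF adjM OY u(1)] transp_untransp[OF adjM OY u(1)] by auto
  have "sat M X x v \<longleftrightarrow> sat N ?Y (map_fm (farr F) x) ?w" if x: "formula r M A x" for x
    using M.sat_invariant[OF x card X GY v u(1) th u(2)[symmetric]] sat_map[OF x OY w(1)] w(2) by simp
  then show "sat M X s v = sat M X t v" using e j(3) w(1) s t by blast
next
  fix Y w
  assume e: "\<forall>X v. fibrant M X \<and> v \<in> Hom M A X \<longrightarrow> sat M X s v = sat M X t v"
    and Y: "fibrant N Y" and w: "w \<in> Hom N (fobj F A) Y"
  have O: "A \<in> Obj M" "Y \<in> Obj N"
    using M.cofibrant_Obj[OF M.formula_cofibrant[OF s card]] N.fibrant_Obj[OF Y] by auto
  show "sat N Y (map_fm (farr F) s) w = sat N Y (map_fm (farr F) t) w"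
    unfolding sat_map[OF s O(2) w] sat_map[OF t O(2) w] using e G_fibrant[OF Y] transp_Hom[OF adjM O(1) w] by blast
qed

lemma LF_full:
  assumes O: "X \<in> Obj (Ho M)" "X' \<in> Obj (Ho M)" and c: "c \<in> Hom (Ho N) (fobj LF X) (fobj LF X')"
  obtains a where "a \<in> Hom (Ho M) X X'" "farr LF a = c"
proof -
  note L = Hadj_facts(1) and e = Hadj_facts(3)[OF O(1)] Hadj_facts(3)[OF O(2)]
  note Rc = functor_Hom[OF Hadj_facts(2) c]
  note r = HM.comp_Hom[OF Rc e(1)]
  obtain k where k: "k \<in> Hom (Ho M) (fobj RG (fobj LF X')) X'" "\<eta>h X' \<cdot>\<^bsub>Ho M\<^esub> k = ident (Ho M) (fobj RG (fobj LF X'))"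
    using HM.iso_inverse[OF \<eta>h_iso[OF O(2)] e(2)] by blast
  \<comment> \<open>Naturality of the unit dictates this choice: a preimage of \<open>c\<close> must
    satisfy \<open>\<eta>h X' \<cdot> a = RG c \<cdot> \<eta>h X\<close>. The triangle identity then
    gives \<open>LF a = c\<close>.\<close>
  let ?a = "k \<cdot>\<^bsub>Ho M\<^esub> (farr RG c \<cdot>\<^bsub>Ho M\<^esub> \<eta>h X)"
  have a: "?a \<in> Hom (Ho M) X X'" by (rule HM.comp_Hom[OF k(1) r])
  have sq: "\<eta>h X' \<cdot>\<^bsub>Ho M\<^esub> ?a = farr RG c \<cdot>\<^bsub>Ho M\<^esub> \<eta>h X"
    using HM.compo_assoc[OF r k(1) e(2)] k(2) HM.ident_left[OF r] by simp
  note La = functor_Hom[OF L a] and Le = functor_Hom[OF L e(1)] functor_Hom[OF L e(2)] and LR = functor_Hom[OF L Rc]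
  have OL: "fobj LF X \<in> Obj (Ho N)" "fobj LF X' \<in> Obj (Ho N)" using HN.Hom_Obj[OF c] by auto
  note ep = Hadj_facts(4)[OF OL(1)] Hadj_facts(4)[OF OL(2)]
  have "farr LF ?a = \<epsilon>h (fobj LF X') \<cdot>\<^bsub>Ho N\<^esub> farr LF (\<eta>h X') \<cdot>\<^bsub>Ho N\<^esub> farr LF ?a"
    using Hadj_facts(7)[OF O(2)] HN.ident_left[OF La] by simp
  also have "\<dots> = \<epsilon>h (fobj LF X') \<cdot>\<^bsub>Ho N\<^esub> (farr LF (farr RG c) \<cdot>\<^bsub>Ho N\<^esub> farr LF (\<eta>h X))"
    using HN.compo_assoc[OF La Le(2) ep(2)] functor_comp[OF L a e(2)] functor_comp[OF L e(1) Rc] sq by simp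
  also have "\<dots> = c \<cdot>\<^bsub>Ho N\<^esub> (\<epsilon>h (fobj LF X) \<cdot>\<^bsub>Ho N\<^esub> farr LF (\<eta>h X))"
    using HN.compo_assoc[OF Le(1) LR ep(2)] HN.compo_assoc[OF Le(1) ep(1) c] Hadj_facts(6)[OF c] by simp
  also have "\<dots> = c" using Hadj_facts(7)[OF O(1)] HN.ident_right[OF c] by simp
  finally show thesis using that a by blast
qed

text \<open>With \<open>A\<close> a cofibrant replacement of \<open>RG B\<close>, the isomorphism is
  \<open>F A -> LF A -> LF (RG B) -> B\<close>, ending with the derived counit.\<close>

lemma F_essentially_surjective:
  assumes B: "cofibrant N B"
  obtains A a where "cofibrant M A" "a \<in> Hom (Ho N) (fobj F A) B" "is_iso (Ho N) a"
proof -
  have OB: "B \<in> Obj (Ho N)" using B N.Obj_Ho by blast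
  have OX: "fobj RG B \<in> Obj (Ho M)" by (rule fobj_Obj(2)[OF HM.category_axioms HN.category_axioms Hadj OB])
  obtain A k where A: "cofibrant M A" and k: "k \<in> Hom (Ho M) A (fobj RG B)" "is_iso (Ho M) k"
    using M.core_cofibrant_replacement OX M.Obj_Ho by metis
  note Lk = functor_Hom[OF Hadj_facts(1) k(1)] functor_iso[OF Hadj_facts(1) k(2,1) HM.category_axioms]
  obtain e where e: "e \<in> Hom (Ho N) (fobj F A) (fobj LF A)" "is_iso (Ho N) e"
    using HN.iso_inverse[OF \<alpha>_iso[OF A] \<alpha>_Hom[OF A]] by blast
  note m = HN.comp_Hom[OF Lk(1) e(1)] HN.iso_comp[OF e(2,1) Lk(2,1)]
  note n = HN.comp_Hom[OF Hadj_facts(4)[OF OB] m(1)] HN.iso_comp[OF m(2,1) \<epsilon>h_iso[OF OB] Hadj_facts(4)[OF OB]]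
  show thesis by (rule that[OF A n])
qed

text \<open>Fullness of \<open>LF\<close> gives an arrow \<open>x : A1 -> A\<close> of the homotopy
  category of \<open>M\<close>; replacing \<open>A\<close> by the fibrant \<open>A'\<close> makes
  \<open>\<gamma> j\<close> after \<open>x\<close> the class of a map \<open>g\<close>.\<close>

lemma F_full_fraction:
  assumes A1: "cofibrant M A1" and A: "cofibrant M A" and b: "b \<in> Hom (Ho N) (fobj F A1) (fobj F A)"
  obtains A' j g where "cofibrant M A'" "fibrant M A'" "j \<in> Hom M A A'" "j \<in> Cof M \<inter> Weq M" "g \<in> Hom M A1 A'"
    "N.\<gamma> (farr F j) \<cdot>\<^bsub>Ho N\<^esub> b = N.\<gamma> (farr F g)"
proof -
  have O: "A1 \<in> Obj (Ho M)" "A \<in> Obj (Ho M)" using M.Obj_Ho A A1 by auto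
  note a = \<alpha>_Hom[OF A] and a1 = \<alpha>_Hom[OF A1]
  obtain e where e: "e \<in> Hom (Ho N) (fobj F A) (fobj LF A)" "\<alpha> A \<cdot>\<^bsub>Ho N\<^esub> e = ident (Ho N) (fobj F A)"
    using HN.iso_inverse[OF \<alpha>_iso[OF A] a] by blast
  note ba = HN.comp_Hom[OF b a1]
  obtain x where x: "x \<in> Hom (Ho M) A1 A" "farr LF x = e \<cdot>\<^bsub>Ho N\<^esub> (b \<cdot>\<^bsub>Ho N\<^esub> \<alpha> A1)"
    using LF_full[OF O HN.comp_Hom[OF e(1) ba]] by blast
  have ax: "\<alpha> A \<cdot>\<^bsub>Ho N\<^esub> farr LF x = b \<cdot>\<^bsub>Ho N\<^esub> \<alpha> A1"
    using x(2) HN.compo_assoc[OF ba e(1) a] e(2) HN.ident_left[OF ba] by simp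
  obtain A' j where A': "cofibrant M A'" "fibrant M A'" and j: "j \<in> Hom M A A'" "j \<in> Cof M \<inter> Weq M"
    using M.fibrant_replacement[OF A] by blast
  have c: "core M A" "core M A1" "core M A'" "core N (fobj F A)" "core N (fobj F A1)" "core N (fobj F A')"
    using A A1 A' F_cofibrant by auto
  note gj = M.\<gamma>_Hom[OF j(1) c(1,3)]
  obtain g where g: "g \<in> Hom M A1 A'" "M.\<gamma> g = M.\<gamma> j \<cdot>\<^bsub>Ho M\<^esub> x"
    using M.\<gamma>_full[OF A1 A'(2) HM.comp_Hom[OF gj x(1)]] by blast
  note Fj = N.\<gamma>_Hom[OF F_Hom[OF j(1)] c(4,6)] and Fg = N.\<gamma>_Hom[OF F_Hom[OF g(1)] c(5,6)]
  note Lx = functor_Hom[OF Hadj_facts(1) x(1)] and Lj = functor_Hom[OF Hadj_facts(1) gj]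
  have "N.\<gamma> (farr F j) \<cdot>\<^bsub>Ho N\<^esub> b \<cdot>\<^bsub>Ho N\<^esub> \<alpha> A1 = N.\<gamma> (farr F j) \<cdot>\<^bsub>Ho N\<^esub> \<alpha> A \<cdot>\<^bsub>Ho N\<^esub> farr LF x"
    using HN.compo_assoc[OF a1 b Fj] HN.compo_assoc[OF Lx a Fj] ax by simp
  also have "\<dots> = \<alpha> A' \<cdot>\<^bsub>Ho N\<^esub> farr LF (M.\<gamma> g)"
    using \<alpha>_nat[OF j(1) A A'(1)] HN.compo_assoc[OF Lx Lj \<alpha>_Hom[OF A'(1)]] functor_comp[OF Hadj_facts(1) x(1) gj] g(2)
    by simp
  also have "\<dots> = N.\<gamma> (farr F g) \<cdot>\<^bsub>Ho N\<^esub> \<alpha> A1" by (rule \<alpha>_nat[OF g(1) A1 A'(1)])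
  finally have "N.\<gamma> (farr F j) \<cdot>\<^bsub>Ho N\<^esub> b = N.\<gamma> (farr F g)"
    by (rule HN.iso_cancel_right[OF \<alpha>_iso[OF A1] a1 HN.comp_Hom[OF Fj b] Fg])
  then show thesis using that[OF A' j g(1)] by blast
qed

text \<open>An arbitrary isomorphism \<open>a : F A -> B\<close> is needed even when only
  \<open>B = F A\<close> is wanted, since the subformulas of \<open>t\<close> live at objects
  outside the image of \<open>F\<close>. Valuations are matched through \<open>a\<close> at the
  level of homotopy classes.\<close>

lemma formula_transport:
  assumes "formula r N B t" "Card_order r" "cofibrant M A" "a \<in> Hom (Ho N) (fobj F A) B" "is_iso (Ho N) a"
  shows "\<exists>s. formula r M A s \<and> (\<forall>Y v w. fibrant N Y \<and> v \<in> Hom N B Y \<and> w \<in> Hom N (fobj F A) Y \<and>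
    N.\<gamma> w = N.\<gamma> v \<cdot>\<^bsub>Ho N\<^esub> a \<longrightarrow> sat N Y (map_fm (farr F) s) w = sat N Y t v)"
  using assms
proof (induction arbitrary: A a rule: is_fm.induct)
  case (fm_Fls B)
  then have "formula r M A Fls" by (auto intro: is_fm.fm_Fls simp: M.cof_sel)
  then show ?case by (intro exI[of _ Fls]) simp
next
  case (fm_Neg B t)
  from fm_Neg(2)[OF fm_Neg(3-6)] obtain s where s: "formula r M A s"
    "\<forall>Y v w. fibrant N Y \<and> v \<in> Hom N B Y \<and> w \<in> Hom N (fobj F A) Y \<and>
      N.\<gamma> w = N.\<gamma> v \<cdot>\<^bsub>Ho N\<^esub> a \<longrightarrow> sat N Y (map_fm (farr F) s) w = sat N Y t v" by blast
  then show ?case using is_fm.fm_Neg[OF s(1)] by (intro exI[of _ "Neg s"]) simp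
next
  case (fm_And B t u)
  from fm_And(3)[OF fm_And(5-8)] obtain s where s: "formula r M A s"
    "\<forall>Y v w. fibrant N Y \<and> v \<in> Hom N B Y \<and> w \<in> Hom N (fobj F A) Y \<and>
      N.\<gamma> w = N.\<gamma> v \<cdot>\<^bsub>Ho N\<^esub> a \<longrightarrow> sat N Y (map_fm (farr F) s) w = sat N Y t v" by blast
  from fm_And(4)[OF fm_And(5-8)] obtain s' where s': "formula r M A s'"
    "\<forall>Y v w. fibrant N Y \<and> v \<in> Hom N B Y \<and> w \<in> Hom N (fobj F A) Y \<and>
      N.\<gamma> w = N.\<gamma> v \<cdot>\<^bsub>Ho N\<^esub> a \<longrightarrow> sat N Y (map_fm (farr F) s') w = sat N Y u v" by blast
  show ?case using is_fm.fm_And[OF s(1) s'(1)] s(2) s'(2) by (intro exI[of _ "And s s'"]) (simp, blast)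
next
  case (fm_Join B I t)
  have "\<forall>k\<in>I. \<exists>s. formula r M A s \<and> (\<forall>Y v w. fibrant N Y \<and> v \<in> Hom N B Y \<and> w \<in> Hom N (fobj F A) Y \<and>
      N.\<gamma> w = N.\<gamma> v \<cdot>\<^bsub>Ho N\<^esub> a \<longrightarrow> sat N Y (map_fm (farr F) s) w = sat N Y (t k) v)"
    using fm_Join(4)[OF _ fm_Join(5-8)] by blast
  from bchoice[OF this] obtain s where s: "\<And>k. k \<in> I \<Longrightarrow> formula r M A (s k)"
    "\<And>k Y v w. k \<in> I \<Longrightarrow> fibrant N Y \<and> v \<in> Hom N B Y \<and> w \<in> Hom N (fobj F A) Y \<and>
      N.\<gamma> w = N.\<gamma> v \<cdot>\<^bsub>Ho N\<^esub> a \<Longrightarrow> sat N Y (map_fm (farr F) (s k)) w = sat N Y (t k) v" by blast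
  have "A \<in> Obj (cof_cat M)" using fm_Join(6) M.cof_sel by blast
  then have "formula r M A (Join I s)" by (rule is_fm.fm_Join[OF _ fm_Join(2) s(1)])
  moreover have "sat N Y (map_fm (farr F) (Join I s)) w = sat N Y (Join I t) v"
    if "fibrant N Y \<and> v \<in> Hom N B Y \<and> w \<in> Hom N (fobj F A) Y \<and> N.\<gamma> w = N.\<gamma> v \<cdot>\<^bsub>Ho N\<^esub> a" for Y v w
    using s(2)[OF _ that] by simp
  ultimately show ?case by blast
next
  case (fm_Sub f B1 B t)
  note card = fm_Sub(4) and A = fm_Sub(5) and a = fm_Sub(6,7)
  have f: "f \<in> Hom N B1 B" and B: "cofibrant N B1" "cofibrant N B" using fm_Sub(1) N.Hom_cof by auto
  obtain A1 a1 where A1: "cofibrant M A1" and a1: "a1 \<in> Hom (Ho N) (fobj F A1) B1" "is_iso (Ho N) a1"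
    using F_essentially_surjective[OF B(1)] by blast
  obtain e where e: "e \<in> Hom (Ho N) B (fobj F A)" "a \<cdot>\<^bsub>Ho N\<^esub> e = ident (Ho N) B"
    using HN.iso_inverse[OF a(2,1)] by blast
  have cB: "core N B1" "core N B" using B by auto
  note gf = N.\<gamma>_Hom[OF f cB]
  note fa = HN.comp_Hom[OF gf a1(1)]
  \<comment> \<open>This is \<open>f\<close> seen between objects in the image of \<open>F\<close>.
    It comes from a fraction rather than from a map of \<open>M\<close>, so the formula is
    \<open>Ex j (Sub g s)\<close> instead of a substitution.\<close>
  let ?b = "e \<cdot>\<^bsub>Ho N\<^esub> (N.\<gamma> f \<cdot>\<^bsub>Ho N\<^esub> a1)"
  have b: "?b \<in> Hom (Ho N) (fobj F A1) (fobj F A)" by (rule HN.comp_Hom[OF e(1) fa])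
  have ab: "a \<cdot>\<^bsub>Ho N\<^esub> ?b = N.\<gamma> f \<cdot>\<^bsub>Ho N\<^esub> a1"
    using HN.compo_assoc[OF fa e(1) a(1)] e(2) HN.ident_left[OF fa] by simp
  obtain A' j g where A': "cofibrant M A'" "fibrant M A'" and j: "j \<in> Hom M A A'" "j \<in> Cof M \<inter> Weq M"
    and g: "g \<in> Hom M A1 A'" and jg: "N.\<gamma> (farr F j) \<cdot>\<^bsub>Ho N\<^esub> ?b = N.\<gamma> (farr F g)"
    using F_full_fraction[OF A1 A b] by blast
  have c: "core M A" "core M A1" "core M A'" "core N (fobj F A)" "core N (fobj F A1)" "core N (fobj F A')"
    using A A1 A' F_cofibrant by auto
  note Fj = N.\<gamma>_Hom[OF F_Hom[OF j(1)] c(4,6)]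
  have ji: "is_iso (Ho N) (N.\<gamma> (farr F j))" using F_\<gamma>_iso[OF _ j(1) A A'(1)] j(2) by blast
  obtain l where l: "l \<in> Hom (Ho N) (fobj F A') (fobj F A)" "l \<cdot>\<^bsub>Ho N\<^esub> N.\<gamma> (farr F j) = ident (Ho N) (fobj F A)"
    using HN.iso_inverse[OF ji Fj] by blast
  from fm_Sub(3)[OF card A1 a1] obtain s where s: "formula r M A1 s"
    and s_sat: "\<forall>Y v w. fibrant N Y \<and> v \<in> Hom N B1 Y \<and> w \<in> Hom N (fobj F A1) Y \<and>
      N.\<gamma> w = N.\<gamma> v \<cdot>\<^bsub>Ho N\<^esub> a1 \<longrightarrow> sat N Y (map_fm (farr F) s) w = sat N Y t v" by blast
  have jc: "j \<in> cof_cofs M" "j \<in> Hom (cof_cat M) A A'" using M.cof_cofs_iff[of j A A'] j A A' by auto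
  have gc: "g \<in> Hom (cof_cat M) A1 A'" using M.Hom_cof g A1 A' by blast
  have "sat N Y (Ex (farr F j) (Sub (farr F g) (map_fm (farr F) s))) w = sat N Y t (v \<cdot>\<^bsub>N\<^esub> f)"
    if Y: "fibrant N Y" and v: "v \<in> Hom N B Y" and w: "w \<in> Hom N (fobj F A) Y"
      and wv: "N.\<gamma> w = N.\<gamma> v \<cdot>\<^bsub>Ho N\<^esub> a" for Y v w
  proof -
    have cY: "core N Y" using Y by simp
    note gv = N.\<gamma>_Hom[OF v cB(2) cY] and gw = N.\<gamma>_Hom[OF w c(4) cY]
    note vf = N.comp_Hom[OF v f]
    note gvf = N.\<gamma>_Hom[OF vf cB(1) cY]
    obtain x where x: "x \<in> Hom N (fobj F A1) Y" "N.\<gamma> x = N.\<gamma> (v \<cdot>\<^bsub>N\<^esub> f) \<cdot>\<^bsub>Ho N\<^esub> a1"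
      using N.\<gamma>_full[OF F_cofibrant[OF A1] Y HN.comp_Hom[OF gvf a1(1)]] by blast
    have "sat N Y (Ex (farr F j) (Sub (farr F g) (map_fm (farr F) s))) w = sat N Y (map_fm (farr F) s) x"
    proof (rule N.sat_Ex_Sub[OF formula_map[OF s] card F_cofibrant[OF A] F_cofibrant[OF A'(1)] _ F_Hom[OF j(1)]
          F_Hom[OF g] Y w x(1) HN.comp_Hom[OF gw l(1)] ji])
      show "farr F j \<in> Cof N" using F_Cof j by blast
      show "N.\<gamma> w \<cdot>\<^bsub>Ho N\<^esub> l \<cdot>\<^bsub>Ho N\<^esub> N.\<gamma> (farr F j) = N.\<gamma> w"
        using HN.compo_assoc[OF Fj l(1) gw] l(2) HN.ident_right[OF gw] by simp
      have "N.\<gamma> w \<cdot>\<^bsub>Ho N\<^esub> l \<cdot>\<^bsub>Ho N\<^esub> N.\<gamma> (farr F g) = N.\<gamma> w \<cdot>\<^bsub>Ho N\<^esub> (l \<cdot>\<^bsub>Ho N\<^esub> N.\<gamma> (farr F j) \<cdot>\<^bsub>Ho N\<^esub> ?b)"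
        unfolding jg[symmetric]
        using HN.compo_assoc[OF HN.comp_Hom[OF Fj b] l(1) gw] HN.compo_assoc[OF b Fj l(1)] by simp
      also have "\<dots> = N.\<gamma> v \<cdot>\<^bsub>Ho N\<^esub> (a \<cdot>\<^bsub>Ho N\<^esub> ?b)"
        unfolding l(2) HN.ident_left[OF b] wv by (rule HN.compo_assoc[OF b a(1) gv])
      also have "\<dots> = N.\<gamma> x"
        unfolding ab x(2) N.\<gamma>_comp[OF f v cB cY] by (rule HN.compo_assoc[OF a1(1) gf gv, symmetric])
      finally show "N.\<gamma> w \<cdot>\<^bsub>Ho N\<^esub> l \<cdot>\<^bsub>Ho N\<^esub> N.\<gamma> (farr F g) = N.\<gamma> x" .
    qed
    then show ?thesis using s_sat Y vf x by blast
  qed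
  then show ?case using is_fm.fm_Ex[OF jc is_fm.fm_Sub[OF gc s]] by (intro exI[of _ "Ex j (Sub g s)"]) auto
next
  case (fm_Ex i B B' t)
  note card = fm_Ex(5) and A = fm_Ex(6) and a = fm_Ex(7,8)
  have i: "i \<in> Cof N" "i \<in> Hom N B B'" and B: "cofibrant N B" "cofibrant N B'"
    using fm_Ex(1,2) N.cof_cofs_iff by auto
  obtain A2 a2 where A2: "cofibrant M A2" and a2: "a2 \<in> Hom (Ho N) (fobj F A2) B'" "is_iso (Ho N) a2"
    using F_essentially_surjective[OF B(2)] by blast
  obtain e where e: "e \<in> Hom (Ho N) B' (fobj F A2)" "a2 \<cdot>\<^bsub>Ho N\<^esub> e = ident (Ho N) B'"
    using HN.iso_inverse[OF a2(2,1)] by blast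
  have cB: "core N B" "core N B'" using B by auto
  note gi = N.\<gamma>_Hom[OF i(2) cB]
  note ia = HN.comp_Hom[OF gi a(1)]
  let ?b = "e \<cdot>\<^bsub>Ho N\<^esub> (N.\<gamma> i \<cdot>\<^bsub>Ho N\<^esub> a)"
  have b: "?b \<in> Hom (Ho N) (fobj F A) (fobj F A2)" by (rule HN.comp_Hom[OF e(1) ia])
  have ab: "a2 \<cdot>\<^bsub>Ho N\<^esub> ?b = N.\<gamma> i \<cdot>\<^bsub>Ho N\<^esub> a"
    using HN.compo_assoc[OF ia e(1) a2(1)] e(2) HN.ident_left[OF ia] by simp
  obtain A' j g where A': "cofibrant M A'" "fibrant M A'" and j: "j \<in> Hom M A2 A'" "j \<in> Cof M \<inter> Weq M"
    and g: "g \<in> Hom M A A'" and jg: "N.\<gamma> (farr F j) \<cdot>\<^bsub>Ho N\<^esub> ?b = N.\<gamma> (farr F g)"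
    using F_full_fraction[OF A A2 b] by blast
  \<comment> \<open>To quantify along \<open>i\<close>, a cofibration of \<open>M\<close> has to
    correspond to it. The map \<open>g\<close> is not one, but its factor \<open>k\<close> is; the
    trivial fibration \<open>p\<close> is absorbed into the isomorphism
    \<open>?z : F A3 -> B'\<close>, under which \<open>F k\<close> corresponds to
    \<open>i\<close>.\<close>
  obtain A3 k p where k: "k \<in> Hom M A A3" "k \<in> Cof M" and p: "p \<in> Hom M A3 A'" "p \<in> Fib M \<inter> Weq M" and gpk: "g = p \<cdot>\<^bsub>M\<^esub> k"
    using M.factor_trivial_Fib[OF g A A'(2)] by blast
  have A3: "cofibrant M A3" by (rule M.cofibrant_Cod[OF A k(2,1)])
  have c: "core N (fobj F A)" "core N (fobj F A2)" "core N (fobj F A3)" "core N (fobj F A')"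
    using A A2 A3 A' F_cofibrant by auto
  note Fj = N.\<gamma>_Hom[OF F_Hom[OF j(1)] c(2,4)] and Fk = N.\<gamma>_Hom[OF F_Hom[OF k(1)] c(1,3)]
    and Fp = N.\<gamma>_Hom[OF F_Hom[OF p(1)] c(3,4)]
  have iso: "is_iso (Ho N) (N.\<gamma> (farr F j))" "is_iso (Ho N) (N.\<gamma> (farr F p))"
    using F_\<gamma>_iso[OF _ j(1) A2 A'(1)] F_\<gamma>_iso[OF _ p(1) A3 A'(1)] j(2) p(2) by auto
  obtain l where l: "l \<in> Hom (Ho N) (fobj F A') (fobj F A2)"
    "l \<cdot>\<^bsub>Ho N\<^esub> N.\<gamma> (farr F j) = ident (Ho N) (fobj F A2)" "is_iso (Ho N) l"
    using HN.iso_inverse[OF iso(1) Fj] by blast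
  let ?lp = "l \<cdot>\<^bsub>Ho N\<^esub> N.\<gamma> (farr F p)"
  note lp = HN.comp_Hom[OF l(1) Fp] HN.iso_comp[OF iso(2) Fp l(3,1)]
  let ?z = "a2 \<cdot>\<^bsub>Ho N\<^esub> ?lp"
  note a3 = HN.comp_Hom[OF a2(1) lp(1)] HN.iso_comp[OF lp(2,1) a2(2,1)]
  have pk: "N.\<gamma> (farr F g) = N.\<gamma> (farr F p) \<cdot>\<^bsub>Ho N\<^esub> N.\<gamma> (farr F k)"
    unfolding gpk functor_comp[OF F_functor k(1) p(1)] by (rule N.\<gamma>_comp[OF F_Hom[OF k(1)] F_Hom[OF p(1)] c(1,3,4)])
  have "?lp \<cdot>\<^bsub>Ho N\<^esub> N.\<gamma> (farr F k) = ?b"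
    using HN.compo_assoc[OF Fk Fp l(1)] HN.compo_assoc[OF b Fj l(1)] pk jg l(2) HN.ident_left[OF b] by simp
  then have a3k: "?z \<cdot>\<^bsub>Ho N\<^esub> N.\<gamma> (farr F k) = N.\<gamma> i \<cdot>\<^bsub>Ho N\<^esub> a"
    using HN.compo_assoc[OF Fk lp(1) a2(1)] ab by simp
  obtain d where d: "d \<in> Hom (Ho N) B' (fobj F A3)" "d \<cdot>\<^bsub>Ho N\<^esub> ?z = ident (Ho N) (fobj F A3)"
    using HN.iso_inverse[OF a3(2,1)] by blast
  from fm_Ex(4)[OF card A3 a3] obtain s where s: "formula r M A3 s"
    and s_sat: "\<forall>Y v w. fibrant N Y \<and> v \<in> Hom N B' Y \<and> w \<in> Hom N (fobj F A3) Y \<and>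
      N.\<gamma> w = N.\<gamma> v \<cdot>\<^bsub>Ho N\<^esub> ?z \<longrightarrow> sat N Y (map_fm (farr F) s) w = sat N Y t v" by blast
  have kc: "k \<in> cof_cofs M" "k \<in> Hom (cof_cat M) A A3" using M.cof_cofs_iff[of k A A3] k A A3 by auto
  have cods: "Cod N i = B'" "Cod N (farr F k) = fobj F A3" using i F_Hom[OF k(1)] by (auto simp: Hom_def)
  have "(\<exists>w3\<in>Hom N (fobj F A3) Y. w3 \<cdot>\<^bsub>N\<^esub> farr F k = w \<and> sat N Y (map_fm (farr F) s) w3) \<longleftrightarrow>
      (\<exists>v'\<in>Hom N B' Y. v' \<cdot>\<^bsub>N\<^esub> i = v \<and> sat N Y t v')"
    if Y: "fibrant N Y" and v: "v \<in> Hom N B Y" and w: "w \<in> Hom N (fobj F A) Y"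
      and wv: "N.\<gamma> w = N.\<gamma> v \<cdot>\<^bsub>Ho N\<^esub> a" for Y v w
  proof
    have cY: "core N Y" using Y by simp
    note gv = N.\<gamma>_Hom[OF v cB(1) cY] and gw = N.\<gamma>_Hom[OF w c(1) cY]
    {
      assume "\<exists>w3\<in>Hom N (fobj F A3) Y. w3 \<cdot>\<^bsub>N\<^esub> farr F k = w \<and> sat N Y (map_fm (farr F) s) w3"
      then obtain w3 where w3: "w3 \<in> Hom N (fobj F A3) Y" "w3 \<cdot>\<^bsub>N\<^esub> farr F k = w" "sat N Y (map_fm (farr F) s) w3"
        by blast
      note gw3 = N.\<gamma>_Hom[OF w3(1) c(3) cY]
      \<comment> \<open>The candidate class of a witness over \<open>B'\<close> is that of
        \<open>w3\<close> carried along the inverse \<open>d\<close> of \<open>?z\<close>. It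
        restricts along \<open>i\<close> to the class of \<open>v\<close>, so
        \<open>\<gamma>_extension\<close> turns it into a strict witness.\<close>
      let ?v = "N.\<gamma> w3 \<cdot>\<^bsub>Ho N\<^esub> d"
      have vh: "?v \<in> Hom (Ho N) B' Y" by (rule HN.comp_Hom[OF gw3 d(1)])
      have va3: "?v \<cdot>\<^bsub>Ho N\<^esub> ?z = N.\<gamma> w3"
        using HN.compo_assoc[OF a3(1) d(1) gw3] d(2) HN.ident_right[OF gw3] by simp
      have "?v \<cdot>\<^bsub>Ho N\<^esub> N.\<gamma> i \<cdot>\<^bsub>Ho N\<^esub> a = N.\<gamma> w3 \<cdot>\<^bsub>Ho N\<^esub> N.\<gamma> (farr F k)"
        using HN.compo_assoc[OF a(1) gi vh] HN.compo_assoc[OF Fk a3(1) vh] va3 a3k by simp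
      also have "\<dots> = N.\<gamma> v \<cdot>\<^bsub>Ho N\<^esub> a" using N.\<gamma>_comp[OF F_Hom[OF k(1)] w3(1) c(1,3) cY] w3(2) wv by simp
      finally have "?v \<cdot>\<^bsub>Ho N\<^esub> N.\<gamma> i = N.\<gamma> v"
        by (rule HN.iso_cancel_right[OF a(2,1) HN.comp_Hom[OF vh gi] gv])
      then obtain v' where "v' \<in> Hom N B' Y" "v' \<cdot>\<^bsub>N\<^esub> i = v" "N.\<gamma> v' = ?v"
        using N.\<gamma>_extension[OF i B(1) Y v vh] by blast
      then show "\<exists>v'\<in>Hom N B' Y. v' \<cdot>\<^bsub>N\<^esub> i = v \<and> sat N Y t v'" using s_sat Y w3 va3 by metis
    }
    {
      assume "\<exists>v'\<in>Hom N B' Y. v' \<cdot>\<^bsub>N\<^esub> i = v \<and> sat N Y t v'"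
      then obtain v' where v': "v' \<in> Hom N B' Y" "v' \<cdot>\<^bsub>N\<^esub> i = v" "sat N Y t v'" by blast
      note gv' = N.\<gamma>_Hom[OF v'(1) cB(2) cY]
      have "N.\<gamma> v' \<cdot>\<^bsub>Ho N\<^esub> ?z \<cdot>\<^bsub>Ho N\<^esub> N.\<gamma> (farr F k) = N.\<gamma> w"
        using HN.compo_assoc[OF Fk a3(1) gv'] HN.compo_assoc[OF a(1) gi gv'] a3k
          N.\<gamma>_comp[OF i(2) v'(1) cB cY] v'(2) wv by simp
      then obtain w3 where "w3 \<in> Hom N (fobj F A3) Y" "w3 \<cdot>\<^bsub>N\<^esub> farr F k = w" "N.\<gamma> w3 = N.\<gamma> v' \<cdot>\<^bsub>Ho N\<^esub> ?z"
        using N.\<gamma>_extension[OF F_Cof[OF k(2)] F_Hom[OF k(1)] F_cofibrant[OF A] Y w HN.comp_Hom[OF gv' a3(1)]] by blast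
      then show "\<exists>w3\<in>Hom N (fobj F A3) Y. w3 \<cdot>\<^bsub>N\<^esub> farr F k = w \<and> sat N Y (map_fm (farr F) s) w3"
        using s_sat Y v' by metis
    }
  qed
  then show ?case using is_fm.fm_Ex[OF kc s] by (intro exI[of _ "Ex k s"]) (auto simp: cods)
qed

lemma language_equivalence:
  assumes card: "Card_order r" and A: "cofibrant M A"
  shows "(\<lambda>\<phi>. sem_equiv r N (fobj F A) `` {language_map r M N F A \<phi>}) respects sem_equiv r M A"
    and "bool_iso (h_language r M A) (h_language r N (fobj F A))
      (quot_map (sem_equiv r N (fobj F A)) (language_map r M N F A))"
proof -
  let ?S = "carrier (alg (language r M) A)" and ?S' = "carrier (alg (language r N) (fobj F A))"
  let ?h = "language_map r M N F A"
  note FA = F_cofibrant[OF A]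
  note lang = M.language_carrier[OF card] N.language_carrier[OF card]
  have rep: "\<exists>s. formula r M A s \<and> x = fcls r M A s" if "x \<in> ?S" for x using that lang(1) by auto
  note hom = language_map_hom[OF card A]
  then have 1: "?h x \<in> ?S'" if "x \<in> ?S" for x using that by (auto simp: bool_hom_def)
  have 2: "(?h x, ?h y) \<in> sem_equiv r N (fobj F A) \<longleftrightarrow> (x, y) \<in> sem_equiv r M A" if "x \<in> ?S" "y \<in> ?S" for x y
    using rep[OF that(1)] rep[OF that(2)] language_map_fcls[OF card] sem_equiv_map[OF card] by metis
  have 3: "\<exists>x\<in>?S. (?h x, y) \<in> sem_equiv r N (fobj F A)" if y: "y \<in> ?S'" for y
  proof -
    obtain t where t: "formula r N (fobj F A) t" "y = fcls r N (fobj F A) t" using y unfolding lang by blast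
    have O: "fobj F A \<in> Obj (Ho N)" using FA N.Obj_Ho by blast
    \<comment> \<open>Transport along the identity of \<open>F A\<close> produces a preimage up to
      semantic equivalence.\<close>
    from formula_transport[OF t(1) card A HN.ident_Hom[OF O] HN.iso_ident[OF O]] obtain s where s: "formula r M A s"
      and s_sat: "\<forall>Y v w. fibrant N Y \<and> v \<in> Hom N (fobj F A) Y \<and> w \<in> Hom N (fobj F A) Y \<and>
        N.\<gamma> w = N.\<gamma> v \<cdot>\<^bsub>Ho N\<^esub> ident (Ho N) (fobj F A) \<longrightarrow> sat N Y (map_fm (farr F) s) w = sat N Y t v"
      by blast
    have "sat N Y (map_fm (farr F) s) v = sat N Y t v" if Y: "fibrant N Y" and v: "v \<in> Hom N (fobj F A) Y" for Y v
      using s_sat Y v HN.ident_right[OF N.\<gamma>_Hom[OF v]] FA by metis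
    then have "(?h (fcls r M A s), y) \<in> sem_equiv r N (fobj F A)"
      unfolding language_map_fcls[OF card s] t(2) N.sem_equiv_fcls[OF card formula_map[OF s] t(1)] by blast
    moreover have "fcls r M A s \<in> ?S" unfolding lang using s by blast
    ultimately show ?thesis by blast
  qed
  show "(\<lambda>\<phi>. sem_equiv r N (fobj F A) `` {?h \<phi>}) respects sem_equiv r M A"
    by (rule quot_map_bij(1)[OF M.sem_equiv_equiv N.sem_equiv_equiv]) (use 1 2 3 in auto)
  have "bij_betw (quot_map (sem_equiv r N (fobj F A)) ?h)
      (carrier (h_language r M A)) (carrier (h_language r N (fobj F A)))"
    unfolding M.carrier_h_language N.carrier_h_language
    by (rule quot_map_bij(2)[OF M.sem_equiv_equiv N.sem_equiv_equiv]) (use 1 2 3 in auto)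
  moreover have "bool_hom (h_language r M A) (h_language r N (fobj F A)) (quot_map (sem_equiv r N (fobj F A)) ?h)"
    unfolding h_language_def
  proof (rule quot_map_bool_hom[OF M.sem_equiv_equiv N.sem_equiv_equiv _ hom])
    have "A \<in> Obj (cof_cat M)" using A M.cof_sel by blast
    then show "boolean_lattice (alg (language r M) A)"
      unfolding language_def by (rule bool_IA(1)[OF M.cof_cat_category card])
    show "(?h x, ?h y) \<in> sem_equiv r N (fobj F A)" if xy: "(x, y) \<in> sem_equiv r M A" for x y
      using 2[of x y] xy by (auto simp: sem_equiv_def)
  qed (use M.sem_equiv_hom[OF card A] N.sem_equiv_hom[OF card FA] in \<open>simp_all add: h_language_def\<close>)
  ultimately show "bool_iso (h_language r M A) (h_language r N (fobj F A)) (quot_map (sem_equiv r N (fobj F A)) ?h)"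
    unfolding bool_iso_def by blast
qed

end

theorem theorem4p2:
  fixes r :: "'k rel" and M :: "('o, 'm) wmcat"
  assumes "Cinfinite r" and "regularCard r" and "weak_model_category M"
  shows "(\<forall>A B f. cofibrant M A \<and> cofibrant M B \<and> f \<in> Hom M A B \<and> f \<in> Weq M \<longrightarrow>
      (\<lambda>\<phi>. sem_equiv r M B `` {act (language r M) f \<phi>}) respects sem_equiv r M A \<and>
      bij_betw (quot_map (sem_equiv r M B) (act (language r M) f))
        (carrier (h_language r M A)) (carrier (h_language r M B))) \<and>
    (\<forall>(N :: ('p, 'n) wmcat) F. weak_model_category N \<and> left_quillen_equivalence M N F \<longrightarrow>
      (\<forall>A. cofibrant M A \<longrightarrow>
        (\<lambda>\<phi>. sem_equiv r N (fobj F A) `` {language_map r M N F A \<phi>}) respects sem_equiv r M A \<and>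
        bool_iso (h_language r M A) (h_language r N (fobj F A))
          (quot_map (sem_equiv r N (fobj F A)) (language_map r M N F A))))"
proof (intro conjI[where P = "\<forall>A B f. _ A B f"] allI impI; elim conjE)
  have card: "Card_order r" using assms(1) by simp
  interpret M: weak_model_category M by (rule assms(3))
  show "(\<lambda>\<phi>. sem_equiv r M B `` {act (language r M) f \<phi>}) respects sem_equiv r M A \<and>
      bij_betw (quot_map (sem_equiv r M B) (act (language r M) f))
        (carrier (h_language r M A)) (carrier (h_language r M B))"
    if "cofibrant M A" "cofibrant M B" "f \<in> Hom M A B" "f \<in> Weq M" for A B f
    using M.language_invariance[OF card that] by blast
  fix N :: "('p, 'n) wmcat" and F A
  assume N: "weak_model_category N" and Q: "left_quillen_equivalence M N F" and A: "cofibrant M A"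
  from Q obtain G \<eta> \<epsilon> LF RG \<eta>h \<epsilon>h where q: "quillen_adjunction M N F G \<eta> \<epsilon>"
      "induced_adjunction M N F G \<eta> LF RG \<eta>h \<epsilon>h" "adjoint_equivalence (Ho M) (Ho N) LF RG \<eta>h \<epsilon>h"
    unfolding left_quillen_equivalence_def by blast
  from q(2) obtain \<alpha> \<beta> where ab: "nat_iso (cof_cat M) (Ho N) (LF \<circ>\<^sub>F Ho_ftor M) (Ho_ftor N \<circ>\<^sub>F F) \<alpha>"
      "nat_iso (fib_cat N) (Ho M) (RG \<circ>\<^sub>F Ho_ftor N) (Ho_ftor M \<circ>\<^sub>F G) \<beta>"
    unfolding induced_adjunction_def by blast
  interpret derived_equivalence M N F G \<eta> \<epsilon> LF RG \<eta>h \<epsilon>h \<alpha> \<beta>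
    using assms(3) N q(1,3) ab by (intro derived_equivalence.intro derived_equivalence_axioms.intro)
  show "(\<lambda>\<phi>. sem_equiv r N (fobj F A) `` {language_map r M N F A \<phi>}) respects sem_equiv r M A \<and>
      bool_iso (h_language r M A) (h_language r N (fobj F A))
        (quot_map (sem_equiv r N (fobj F A)) (language_map r M N F A))"
    using language_equivalence[OF card A] by blast
qed

end
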